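(* Consider the partial differential equation for $\mathbf y=\mathbf y(x,\theta)\in\mathbb C^n$ $$x^2\,\mathbf y'_x\,\bigl(1+xF_0+x^2F_1(x,\mathbf y,\theta)\bigr)+\mathbf y'_\theta+x\,\mathbf A\,\mathbf y=x^2\,\mathbf G_1(x,\mathbf y,\theta),\qquad(\ast)$$ where $F_0\in\mathbb C$, $\mathbf A=\operatorname{diag}(\lambda^1,\dots,\lambda^n)\in\mathbb R^{n\times n}$ with $\lambda^j>0$ for all $j$, and $F_1:B_\kappa\times B_\kappa^n\times\mathbb T_\zeta\to\mathbb C$, $\mathbf G_1:B_\kappa\times B_\kappa^n\times\mathbb T_\zeta\to\mathbb C^n$ are analytic ($\kappa,\zeta>0$). Fix any $\chi\in(0,\pi)$. Then for $\delta>0$ and $\xi>0$ both small enough there exist two analytic solutions $$\mathbf y^{\pm}:S^{\pm}(\delta,\chi)\times\mathbb T_\xi\to\mathbb C^n$$ of $(\ast)$. Upon writing $\mathbf y^\pm(x,\theta)=\sum_{\alpha\in\mathbb Z}\mathbf y^\pm_\alpha(x)e^{i\alpha\theta}$, the Fourier coefficients satisfy $\mathbf y^\pm_\alpha(x)=\mathcal O(x\,e^{-|\alpha|\xi})$ uniformly for $\alpha\in\mathbb Z$, $x\in S^\pm(\delta,\chi)$; and for each $\alpha\in\mathbb Z$ there is a Gevrey-$1$ formal series $\sum_{\beta=1}^\infty\mathbf y_{\alpha,\beta}x^\beta$, $\mathbf y_{\alpha,\beta}\in\mathbb C^n$ (the same for $+$ and $-$), such that $\mathbf y_\alpha^{+}$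 and $\mathbf y_\alpha^-$ are the $1$-sums of this series on $S^+(\delta,\chi)$ and $S^-(\delta,\chi)$ in the directions $0$ and $\pi$, respectively.
   Context: $()'_z=\partial/\partial z$. $B_\kappa^n\subset\mathbb C^n$ is the open ball of radius $\kappa$ centered at $0$, $B_\kappa:=B_\kappa^1$. $\mathbb T_\zeta:=\{\theta\in\mathbb C/(2\pi\mathbb Z):|\operatorname{Im}\theta|<\zeta\}$. $$S^\pm(\delta,\chi)=\{x\in\mathbb C: 0<|x|<\delta,\ |\operatorname{Arg}(\pm x)|<\tfrac{\pi+\chi}{2}\}.$$ A formal series $\widetilde W=\sum_{\beta\ge1}W_\beta x^\beta$ is Gevrey-$1$ if $|W_\beta|\le A\tau^\beta(\beta-1)!$ for some $A,\tau>0$; its Borel transform is $\widehat W(w)=\sum_{\beta\ge1}W_\beta\frac{w^{\beta-1}}{(\beta-1)!}$, convergent near $w=0$. $\widetilde W$ is $1$-summable in the direction $\varphi$ if $\widehat W$ can be analytically continued to a function $\widehat W^\varphi$ along (a sectorial neighborhood of) the ray $w=re^{i\varphi}$, $r\ge0$, with $e^{-\eta|w|}|\widehat W^\varphi(w)|=\mathcal O(1)$ as $w\to\infty e^{i\varphi}$ for some $\eta>0$. Its $1$-sum is (the analytic continuation, by rotating the ray, of) the Laplace transform $W^\varphi(x)=\int_0^{\infty e^{i\varphi}}\widehat W^\varphi(w)e^{-w/x}dw$, on a local sector centered along $\varphi$ of opening greater than $\pi$. These notions are applied componentwise to $\mathbb C^n$-valued series. *)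

theory Defs
  imports "HOL-Complex_Analysis.Complex_Analysis"
begin

section \<open>Domains\<close>

text \<open>A function on the complex torus \<open>{\<theta> \<in> \<complex>/(2\<pi>\<int>). \<bar>Im \<theta>\<bar> < \<zeta>}\<close> is represented by a function on the
  strip below that is \<open>2\<pi>\<close>-periodic there.\<close>

definition strip :: "real \<Rightarrow> complex set" where
  "strip \<zeta> = {\<theta>. \<bar>Im \<theta>\<bar> < \<zeta>}"

definition sector_plus :: "real \<Rightarrow> real \<Rightarrow> complex set" where
  "sector_plus \<delta> chi = {x. 0 < norm x \<and> norm x < \<delta> \<and> \<bar>Arg x\<bar> < (pi + chi) / 2}"

definition sector_minus :: "real \<Rightarrow> real \<Rightarrow> complex set" where
  "sector_minus \<delta> chi = {x. 0 < norm x \<and> norm x < \<delta> \<and> \<bar>Arg (- x)\<bar> < (pi + chi) / 2}"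


section \<open>Analytic functions of several complex variables\<close>

text \<open>As for \<^const>\<open>holomorphic_on\<close>, analyticity on an open set is complex differentiability at every
  point: there is a Frechet derivative that is complex linear. The numbers \<open>a\<close>, \<open>b $ j\<close>, \<open>c\<close> are
  the complex partial derivatives. The domains used are open, so \<open>at\<close> is unrestricted.\<close>

definition analytic_x_theta ::
  "(complex \<Rightarrow> complex \<Rightarrow> complex) \<Rightarrow> (complex \<times> complex) set \<Rightarrow> bool" where
  "analytic_x_theta f D \<longleftrightarrow>
     (\<forall>p\<in>D. \<exists>a c. ((\<lambda>(x, \<theta>). f x \<theta>) has_derivative (\<lambda>(u, w). a * u + c * w)) (at p))"

definition analytic_x_y_theta ::
  "(complex \<Rightarrow> complex ^ 'n \<Rightarrow> complex \<Rightarrow> complex) \<Rightarrow> (complex \<times> (complex ^ 'n) \<times> complex) set \<Rightarrow> bool"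
  where
  "analytic_x_y_theta f D \<longleftrightarrow>
     (\<forall>p\<in>D. \<exists>a b c. ((\<lambda>(x, y, \<theta>). f x y \<theta>) has_derivative
        (\<lambda>(u, v, w). a * u + (\<Sum>j\<in>UNIV. b $ j * v $ j) + c * w)) (at p))"

definition pde_domain :: "real \<Rightarrow> real \<Rightarrow> (complex \<times> (complex ^ 'n) \<times> complex) set" where
  "pde_domain \<kappa> \<zeta> = ball 0 \<kappa> \<times> ball 0 \<kappa> \<times> strip \<zeta>"

definition analytic_coefficient ::
  "real \<Rightarrow> real \<Rightarrow> (complex \<Rightarrow> complex ^ 'n \<Rightarrow> complex \<Rightarrow> complex) \<Rightarrow> bool" where
  "analytic_coefficient \<kappa> \<zeta> f \<longleftrightarrow>
     analytic_x_y_theta f (pde_domain \<kappa> \<zeta>) \<and>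
     (\<forall>(x, y, \<theta>)\<in>pde_domain \<kappa> \<zeta>. f x y (\<theta> + 2 * of_real pi) = f x y \<theta>)"


section \<open>Solutions of the partial differential equation\<close>

text \<open>\<open>lam\<close> is the diagonal of \<open>A\<close>; the equation is written in components. Since \<open>F1\<close> and \<open>G1\<close>
  are total functions in the logic, a solution is required to stay in their domain.\<close>

definition analytic_solution ::
  "real \<Rightarrow> real \<Rightarrow> complex \<Rightarrow> (complex \<Rightarrow> complex ^ 'n \<Rightarrow> complex \<Rightarrow> complex) \<Rightarrow> real ^ 'n \<Rightarrow>
   (complex \<Rightarrow> complex ^ 'n \<Rightarrow> complex \<Rightarrow> complex ^ 'n) \<Rightarrow>
   complex set \<Rightarrow> real \<Rightarrow> (complex \<Rightarrow> complex \<Rightarrow> complex ^ 'n) \<Rightarrow> bool" where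
  "analytic_solution \<kappa> \<zeta> F0 F1 lam G1 S \<xi> y \<longleftrightarrow>
     (\<forall>j. analytic_x_theta (\<lambda>x \<theta>. y x \<theta> $ j) (S \<times> strip \<xi>)) \<and>
     (\<forall>x\<in>S. \<forall>\<theta>\<in>strip \<xi>.
        y x (\<theta> + 2 * of_real pi) = y x \<theta> \<and>
        (x, y x \<theta>, \<theta>) \<in> pde_domain \<kappa> \<zeta> \<and>
        (\<forall>j. x\<^sup>2 * deriv (\<lambda>x. y x \<theta> $ j) x * (1 + x * F0 + x\<^sup>2 * F1 x (y x \<theta>) \<theta>)
             + deriv (\<lambda>\<theta>. y x \<theta> $ j) \<theta>
             + x * (of_real (lam $ j) * y x \<theta> $ j)
             = x\<^sup>2 * G1 x (y x \<theta>) \<theta> $ j))"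

definition fourier_coeff ::
  "(complex \<Rightarrow> complex \<Rightarrow> complex ^ 'n) \<Rightarrow> int \<Rightarrow> complex \<Rightarrow> complex ^ 'n" where
  "fourier_coeff y \<alpha> x =
     (\<chi> j. integral {0..2 * pi} (\<lambda>t. y x (of_real t) $ j * exp (- \<i> * of_int \<alpha> * of_real t))
            / (2 * of_real pi))"


section \<open>Gevrey-1 series and 1-summability\<close>

definition gevrey1 :: "complex fps \<Rightarrow> bool" where
  "gevrey1 W \<longleftrightarrow> fps_nth W 0 = 0 \<and>
     (\<exists>A>0. \<exists>\<tau>>0. \<forall>\<beta>\<ge>1. norm (fps_nth W \<beta>) \<le> A * \<tau> ^ \<beta> * fact (\<beta> - 1))"

definition borel_transform :: "complex fps \<Rightarrow> complex fps" where
  "borel_transform W = Abs_fps (\<lambda>k. fps_nth W (Suc k) / fact k)"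

definition ray_sector :: "real \<Rightarrow> real \<Rightarrow> complex set" where
  "ray_sector \<phi> \<epsilon> = {w. w \<noteq> 0 \<and> \<bar>Arg (w * cis (- \<phi>))\<bar> < \<epsilon>}"

text \<open>\<open>H\<close> continues the Borel transform of \<open>W\<close> to a sectorial neighbourhood (of half-opening \<open>\<epsilon>\<close>,
  including a disc around the origin) of the ray in direction \<open>\<phi>\<close>, with at most exponential growth
  of order one and type \<open>\<eta>\<close> at infinity in that neighbourhood.\<close>

definition borel_continuation ::
  "complex fps \<Rightarrow> real \<Rightarrow> real \<Rightarrow> real \<Rightarrow> (complex \<Rightarrow> complex) \<Rightarrow> bool" where
  "borel_continuation W \<phi> \<epsilon> \<eta> H \<longleftrightarrow>
     H has_fps_expansion borel_transform W \<and>
     (\<exists>\<rho>>0. H holomorphic_on (ball 0 \<rho> \<union> ray_sector \<phi> \<epsilon>)) \<and>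
     (\<exists>C R. \<forall>w\<in>ray_sector \<phi> \<epsilon>. norm w \<ge> R \<longrightarrow> exp (- \<eta> * norm w) * norm (H w) \<le> C)"

text \<open>Laplace transform along the ray in direction \<open>\<psi>\<close>, parametrized by \<open>w = r * cis \<psi>\<close>.\<close>

definition has_laplace ::
  "(complex \<Rightarrow> complex) \<Rightarrow> real \<Rightarrow> complex \<Rightarrow> complex \<Rightarrow> bool" where
  "has_laplace H \<psi> x I \<longleftrightarrow>
     ((\<lambda>r. H (of_real r * cis \<psi>) * exp (- (of_real r * cis \<psi>) / x) * cis \<psi>) has_integral I) {0..}"

text \<open>\<open>f\<close> is, on \<open>S\<close>, the 1-sum of \<open>W\<close> in direction \<open>\<phi>\<close>: \<open>W\<close> is 1-summable in direction \<open>\<phi>\<close>, and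
  \<open>f\<close> is the Laplace transform continued by rotating the ray within the sectorial neighbourhood.
  The condition \<open>Re (cis \<psi> / x) > \<eta>\<close> describes the half-plane in \<open>1 / x\<close> where the growth bound
  makes the integral along direction \<open>\<psi>\<close> converge; every point of \<open>S\<close> must be reached by some
  admissible direction, and all admissible directions must give the value \<open>f x\<close>.\<close>

definition is_one_sum ::
  "complex fps \<Rightarrow> real \<Rightarrow> complex set \<Rightarrow> (complex \<Rightarrow> complex) \<Rightarrow> bool" where
  "is_one_sum W \<phi> S f \<longleftrightarrow>
     (\<exists>\<epsilon>>0. \<exists>\<eta>>0. \<exists>H. borel_continuation W \<phi> \<epsilon> \<eta> H \<and>
        (\<forall>x\<in>S. (\<exists>\<psi>. \<bar>\<psi> - \<phi>\<bar> < \<epsilon> \<and> Re (cis \<psi> / x) > \<eta>) \<and>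
               (\<forall>\<psi>. \<bar>\<psi> - \<phi>\<bar> < \<epsilon> \<and> Re (cis \<psi> / x) > \<eta> \<longrightarrow> has_laplace H \<psi> x (f x))))"

end

theory Submission
  imports Defs
begin

text \<open>The equation is solved in the Borel plane, where \<open>x\<^sup>2 d/dx\<close> becomes multiplication by \<open>w\<close> and
  products become convolutions along the segment from \<open>0\<close> to \<open>w\<close>. Expanding the solution by its degree
  in \<open>x\<close> and by positive and negative frequency in \<open>\<theta>\<close> turns the system into a recursion on the degree,
  whose terms are holomorphic on a star-shaped domain avoiding the resonances \<open>w = - \<i> \<alpha>\<close> with
  \<open>\<alpha> \<noteq> 0\<close>; the resonant mode \<open>\<alpha> = 0\<close> is solved by averaging along rays, which converges because
  \<open>\<lambda>\<^sup>j > 0\<close>. Majorants \<open>\<bar>w\<bar>\<^bsup>m - 1\<^esup> / (m - 1)!\<close> are reproduced by convolution and make the series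
  converge with exponential growth in \<open>w\<close>. The Laplace transforms in directions near \<open>0\<close> and near \<open>\<pi>\<close> of
  the same Borel transform are the two solutions.\<close>

section \<open>Convolution on a star-shaped domain\<close>

text \<open>Multiplication by \<open>w\<close> is unbounded, so the term with \<open>F1 * y'\<close>
  is no perturbation when written in \<open>y\<close>. The unknowns are therefore \<open>Y\<close>
  and an auxiliary \<open>Q\<close>, and the derivative enters as \<open>Z = x^2 y'\<close>,
  computed from \<open>D\<close>: its multiplier is \<open>w / (w + \<i> \<alpha>)\<close> for
  \<open>\<alpha> \<noteq> 0\<close>, bounded on the domain, and 1 for \<open>\<alpha> = 0\<close>.
  In the zero mode \<open>Y\<close> itself needs a division by \<open>w\<close>; this costs one
  degree, and \<open>Q\<close> is defined with one factor \<open>x\<close> less than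
  \<open>D\<close> so that this degree is available. Smallness comes from the factors
  \<open>x\<close>. Degree \<open>m\<close> carries the weight \<open>\<tau>^m\<close>, so
  \<open>x\<close> has norm \<open>4 / \<tau>\<close>, and \<open>\<tau>\<close> is chosen after all
  other constants. The price is exponential type \<open>\<tau>\<close> in the Borel plane, hence a
  small radius of the sectors. Both half axes lie in one star-shaped domain carrying a single Borel
  transform for each mode; this is why the series is the same for both signs.\<close>

definition star0 :: "complex set \<Rightarrow> bool" where
  "star0 S \<longleftrightarrow> open S \<and> (\<forall>w\<in>S. \<forall>t\<in>{0..1}. of_real t * w \<in> S)"

lemma star0D: "star0 S \<Longrightarrow> w \<in> S \<Longrightarrow> 0 \<le> t \<Longrightarrow> t \<le> 1 \<Longrightarrow> of_real t * w \<in> S"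
  and star0_open: "star0 S \<Longrightarrow> open S"
  by (auto simp: star0_def)

lemma star0D': "star0 S \<Longrightarrow> w \<in> S \<Longrightarrow> 0 \<le> t \<Longrightarrow> t \<le> 1 \<Longrightarrow> of_real (1 - t) * w \<in> S"
  by (rule star0D) auto

lemma star0_zero: "star0 S \<Longrightarrow> w \<in> S \<Longrightarrow> 0 \<in> S"
  using star0D[of S w 0] by simp

text \<open>Differentiation under the integral sign, stated once for two uses: \<open>k = 1\<close>
  gives the convolution, \<open>k t = t powr \<mu>\<close> with \<open>g = 1\<close> gives the
  averages along rays. Star-shapedness keeps both arguments \<open>of_real t * w\<close> and
  \<open>of_real (1 - t) * w\<close> in the domain.\<close>

lemma DERIV_dilation_integral:
  fixes k :: "real \<Rightarrow> complex"
  assumes S: "star0 S" and f: "f holomorphic_on S" and g: "g holomorphic_on S"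
    and k: "continuous_on {0..1} k" and w: "w \<in> S"
  shows "((\<lambda>w. integral {0..1} (\<lambda>t. k t * (f (of_real t * w) * g (of_real (1 - t) * w))))
    has_field_derivative integral {0..1} (\<lambda>t. k t * (of_real t * deriv f (of_real t * w) * g (of_real (1 - t) * w)
      + of_real (1 - t) * f (of_real t * w) * deriv g (of_real (1 - t) * w)))) (at w)"
proof -
  have oS: "open S" using S by (rule star0_open)
  obtain r where r: "r > 0" "ball w r \<subseteq> S" using oS w open_contains_ball by blast
  have cf: "continuous_on S f" "continuous_on S g" "continuous_on S (deriv f)" "continuous_on S (deriv g)"
    using f g oS by (auto intro!: holomorphic_on_imp_continuous_on holomorphic_deriv)
  have wi: "x \<in> ball w r \<Longrightarrow> t \<in> {0..1} \<Longrightarrow> of_real t * x \<in> S" 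
    "x \<in> ball w r \<Longrightarrow> t \<in> {0..1} \<Longrightarrow> of_real (1 - t) * x \<in> S" for x t
    using r star0D[OF S] star0D'[OF S] by auto
  have df: "(f has_field_derivative deriv f z) (at z)" "(g has_field_derivative deriv g z) (at z)" if "z \<in> S" for z
    using f g oS that by (auto intro: holomorphic_derivI)
  have "((\<lambda>w. integral (cbox 0 1) (\<lambda>t. k t * (f (of_real t * w) * g (of_real (1 - t) * w))))
    has_field_derivative integral (cbox 0 1) (\<lambda>t. k t * (of_real t * deriv f (of_real t * w) * g (of_real (1 - t) * w)
      + of_real (1 - t) * f (of_real t * w) * deriv g (of_real (1 - t) * w)))) (at w within ball w r)"
  proof (rule leibniz_rule_field_derivative)
    fix x t assume x: "x \<in> ball w r" and t: "t \<in> cbox (0::real) 1"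
    have a: "((\<lambda>x. f (of_real t * x)) has_field_derivative deriv f (of_real t * x) * of_real t) (at x)"
      using df(1)[OF wi(1)[OF x]] t by (intro DERIV_chain2[where g = "\<lambda>x. of_real t * x"]) (auto intro!: derivative_eq_intros)
    have b: "((\<lambda>x. g (of_real (1-t) * x)) has_field_derivative deriv g (of_real (1-t) * x) * of_real (1-t)) (at x)"
      using df(2)[OF wi(2)[OF x]] t by (intro DERIV_chain2[where g = "\<lambda>x. of_real (1-t) * x"]) (auto intro!: derivative_eq_intros)
    show "((\<lambda>w. k t * (f (of_real t * w) * g (of_real (1 - t) * w))) has_field_derivative
       k t * (of_real t * deriv f (of_real t * x) * g (of_real (1 - t) * x)
      + of_real (1 - t) * f (of_real t * x) * deriv g (of_real (1 - t) * x))) (at x within ball w r)"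
      by (rule DERIV_subset[OF _ subset_UNIV], rule DERIV_cong[OF DERIV_cmult[OF DERIV_mult[OF a b]]])
         (simp add: algebra_simps)
  next
    fix x assume x: "x \<in> ball w r"
    show "(\<lambda>t. k t * (f (of_real t * x) * g (of_real (1 - t) * x))) integrable_on cbox 0 1"
      unfolding cbox_interval using k wi x
      by (intro integrable_continuous_real continuous_intros continuous_on_compose2[OF cf(1)] continuous_on_compose2[OF cf(2)]) auto
  next
    have kk: "continuous_on (ball w r \<times> {0..1}) (\<lambda>p. k (snd p))"
      by (rule continuous_on_compose2[OF k]) (auto intro!: continuous_intros)
    have "continuous_on (ball w r \<times> {0..1})
     (\<lambda>p. k (snd p) * (of_real (snd p) * deriv f (of_real (snd p) * fst p) * g (of_real (1 - snd p) * fst p)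
      + of_real (1 - snd p) * f (of_real (snd p) * fst p) * deriv g (of_real (1 - snd p) * fst p)))"
      by (intro continuous_intros kk continuous_on_compose2[OF cf(1)] continuous_on_compose2[OF cf(2)]
         continuous_on_compose2[OF cf(3)] continuous_on_compose2[OF cf(4)]) (use wi in \<open>auto simp: mem_Times_iff\<close>)
    then show "continuous_on (ball w r \<times> cbox 0 1)
     (\<lambda>(w,t). k t * (of_real t * deriv f (of_real t * w) * g (of_real (1 - t) * w)
      + of_real (1 - t) * f (of_real t * w) * deriv g (of_real (1 - t) * w)))"
      by (simp add: case_prod_unfold)
  qed (use r in auto)
  moreover have "at w within ball w r = at w" using r by (intro at_within_open) auto
  ultimately show ?thesis by simp
qed

text \<open>The convolution \<open>\<integral>_0^w f(u) g(w - u) du\<close> along the segment, after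
  the substitution \<open>u = t w\<close>.\<close>

definition conv :: "(complex \<Rightarrow> complex) \<Rightarrow> (complex \<Rightarrow> complex) \<Rightarrow> complex \<Rightarrow> complex" where
  "conv f g w = w * integral {0..1} (\<lambda>t. f (of_real t * w) * g (of_real (1 - t) * w))"

text \<open>This is \<open>w^(-1-\<mu>) * \<integral>_0^w u^\<mu> f(u) du\<close>; after the
  substitution \<open>u = t w\<close> the powers of \<open>w\<close> cancel and no branch point is
  left at \<open>0\<close>.\<close>

definition ray_avg :: "real \<Rightarrow> (complex \<Rightarrow> complex) \<Rightarrow> complex \<Rightarrow> complex" where
  "ray_avg \<mu> f w = integral {0..1} (\<lambda>t. of_real (t powr \<mu>) * f (of_real t * w))"

lemma conv_zero_right [simp]: "conv f (\<lambda>_. 0) = (\<lambda>_. 0)"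
  by (auto simp: conv_def)

lemma holomorphic_conv:
  assumes S: "star0 S" and f: "f holomorphic_on S" and g: "g holomorphic_on S"
  shows "conv f g holomorphic_on S"
proof -
  have "(\<lambda>w. integral {0..1} (\<lambda>t. 1 * (f (of_real t * w) * g (of_real (1 - t) * w)))) holomorphic_on S"
    using DERIV_dilation_integral[OF S f g, of "\<lambda>_. 1"] star0_open[OF S]
    by (auto simp: holomorphic_on_open)
  then show ?thesis unfolding conv_def by (auto intro!: holomorphic_intros)
qed

lemma powr_continuous_on_unit: "\<mu> > 0 \<Longrightarrow> continuous_on {0..1} (\<lambda>t. complex_of_real (t powr \<mu>))"
  by (intro continuous_intros continuous_on_powr') auto

lemma DERIV_ray_avg:
  assumes S: "star0 S" and f: "f holomorphic_on S" and l: "\<mu> > 0" and w: "w \<in> S"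
  shows "(ray_avg \<mu> f has_field_derivative
    integral {0..1} (\<lambda>t. of_real (t powr \<mu>) * (of_real t * deriv f (of_real t * w)))) (at w)"
  using DERIV_dilation_integral[OF S f _ powr_continuous_on_unit[OF l] w, of "\<lambda>_. 1"]
  unfolding ray_avg_def[abs_def] by simp

lemma holomorphic_ray_avg:
  assumes S: "star0 S" and f: "f holomorphic_on S" and l: "\<mu> > 0"
  shows "ray_avg \<mu> f holomorphic_on S"
  using DERIV_ray_avg[OF assms] star0_open[OF S] by (auto simp: holomorphic_on_open)

lemma DERIV_along_line:
  assumes "(f has_field_derivative d) (at (a + of_real t * w))"
  shows "((\<lambda>t. f (a + of_real t * w)) has_vector_derivative w * d) (at t within T)"
proof -
  have "((\<lambda>t. a + of_real t * w) has_vector_derivative w) (at t)"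
    by (auto intro!: derivative_eq_intros)
  from field_vector_diff_chain_at[where f = "\<lambda>t. a + of_real t * w" and g = f, OF this assms]
  show ?thesis by (simp add: o_def has_vector_derivative_at_within)
qed

text \<open>Convolution with 1 is integration from \<open>0\<close>, the Borel counterpart of
  multiplication by \<open>x\<close>; a primitive exists because the domain is starlike.\<close>

lemma DERIV_conv_one:
  assumes S: "star0 S" and f: "f holomorphic_on S" and w: "w \<in> S"
  shows "(conv (\<lambda>_. 1) f has_field_derivative f w) (at w)"
proof -
  have z: "0 \<in> S" using star0_zero[OF S w] .
  have "starlike S" unfolding starlike_def
    apply (rule bexI[OF _ z]) using star0D[OF S] by (auto simp: in_segment scaleR_conv_of_real)
  then obtain P where P: "\<And>x. x \<in> S \<Longrightarrow> (P has_field_derivative f x) (at x)"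
    using holomorphic_starlike_primitive[of S f "{}"] f star0_open[OF S]
    by (auto simp: holomorphic_on_imp_continuous_on holomorphic_on_imp_differentiable_at)
  have eq: "conv (\<lambda>_. 1) f x = P x - P 0" if x: "x \<in> S" for x
  proof -
    have "((\<lambda>t. - x * f (of_real (1-t) * x)) has_integral (P (of_real (1-1) * x) - P (of_real (1-0) * x))) {0..1::real}"
    proof (rule fundamental_theorem_of_calculus)
      fix t :: real assume t: "t \<in> {0..1}"
      have "(P has_field_derivative f (x + of_real t * (-x))) (at (x + of_real t * (-x)))"
        using P[of "x + of_real t * (-x)"] star0D'[OF S x, of t] t by (simp add: algebra_simps)
      from DERIV_along_line[OF this]
      show "((\<lambda>t. P (of_real (1-t) * x)) has_vector_derivative - x * f (of_real (1-t) * x)) (at t within {0..1})"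
        by (simp add: algebra_simps)
    qed auto
    from has_integral_neg[OF this] have "((\<lambda>t. x * f (of_real (1-t) * x)) has_integral (P x - P 0)) {0..1::real}"
      by simp
    then have "integral {0..1} (\<lambda>t. x * f (of_real (1-t) * x)) = P x - P 0" by (rule integral_unique)
    then show ?thesis by (simp add: conv_def)
  qed
  have "((\<lambda>x. P x - P 0) has_field_derivative f w) (at w)"
    using P[OF w] by (auto intro!: derivative_eq_intros)
  moreover have "\<forall>\<^sub>F x in nhds w. conv (\<lambda>_. 1) f x = P x - P 0"
    using eq star0_open[OF S] w by (auto simp: eventually_nhds)
  ultimately show ?thesis by (subst DERIV_cong_ev[OF refl _ refl]) auto
qed

text \<open>Integration by parts along the ray, in the form of the fundamental theorem for
  \<open>t powr (\<mu> + 1) * f (t w)\<close>, whose boundary term at \<open>t = 0\<close>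
  vanishes.\<close>

lemma ray_avg_ode:
  assumes S: "star0 S" and f: "f holomorphic_on S" and l: "\<mu> > 0" and w: "w \<in> S"
  shows "w * deriv (ray_avg \<mu> f) w = f w - (1 + \<mu>) * ray_avg \<mu> f w"
proof -
  have cf: "continuous_on S f" "continuous_on S (deriv f)"
    using f star0_open[OF S] by (auto intro!: holomorphic_on_imp_continuous_on holomorphic_deriv)
  have tS: "of_real t * w \<in> S" if "t \<in> {0..1}" for t using star0D[OF S w] that by auto
  have ca: "continuous_on {0..1} (\<lambda>t. f (of_real t * w))" "continuous_on {0..1} (\<lambda>t. deriv f (of_real t * w))"
    using tS by (auto intro!: continuous_intros continuous_on_compose2[OF cf(1)] continuous_on_compose2[OF cf(2)])
  define A where "A = (\<lambda>t. complex_of_real (t powr \<mu>) * f (of_real t * w))"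
  define B where "B = (\<lambda>t. complex_of_real (t powr \<mu>) * (of_real t * deriv f (of_real t * w)))"
  have iA: "A integrable_on {0..1}" and iB: "B integrable_on {0..1}"
    unfolding A_def B_def using powr_continuous_on_unit[OF l] ca
    by (auto intro!: integrable_continuous_real continuous_intros)
  have "((\<lambda>t. (1 + \<mu>) * A t + w * B t) has_integral (of_real (1 powr (\<mu>+1)) * f (of_real 1 * w) - of_real (0 powr (\<mu>+1)) * f (of_real 0 * w))) {0..1}"
  \<comment> \<open>The derivative of \<open>t powr (\<mu> + 1)\<close> is taken only for
    \<open>t > 0\<close>; at the endpoints continuity is enough.\<close>
  proof (rule fundamental_theorem_of_calculus_interior)
    show "continuous_on {0..1} (\<lambda>t. complex_of_real (t powr (\<mu>+1)) * f (of_real t * w))"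
      using ca powr_continuous_on_unit[of "\<mu>+1"] l by (auto intro!: continuous_intros)
    fix t :: real assume t: "t \<in> {0<..<1}"
    have "(f has_field_derivative deriv f (0 + of_real t * w)) (at (0 + of_real t * w))"
      using tS[of t] t f star0_open[OF S] by (auto intro: holomorphic_derivI)
    from DERIV_along_line[OF this, of UNIV]
    have d1: "((\<lambda>t. f (of_real t * w)) has_vector_derivative w * deriv f (of_real t * w)) (at t)"
      by simp
    have "((\<lambda>t. t powr (\<mu>+1)) has_real_derivative (\<mu>+1) * t powr \<mu>) (at t)"
      using has_real_derivative_powr[of t "\<mu>+1"] t by simp
    then have d2: "((\<lambda>t. complex_of_real (t powr (\<mu>+1))) has_vector_derivative of_real ((\<mu>+1) * t powr \<mu>)) (at t)"
      by (intro has_vector_derivative_of_real) (auto simp: has_real_derivative_iff_has_vector_derivative)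
    show "((\<lambda>t. complex_of_real (t powr (\<mu>+1)) * f (of_real t * w)) has_vector_derivative
        (1 + \<mu>) * A t + w * B t) (at t)"
      using has_vector_derivative_mult[OF d2 d1] t
      by (simp add: A_def B_def powr_add algebra_simps)
  qed (use l in auto)
  then have "integral {0..1} (\<lambda>t. (1 + \<mu>) * A t + w * B t) = f w"
    using l by (auto dest!: integral_unique)
  moreover have "integral {0..1} (\<lambda>t. (1 + \<mu>) * A t + w * B t) = (1+\<mu>) * integral {0..1} A + w * integral {0..1} B"
    using iA iB by (subst integral_add) (auto intro: integrable_on_mult_right)
  moreover have "deriv (ray_avg \<mu> f) w = integral {0..1} B"
    unfolding B_def by (rule DERIV_imp_deriv[OF DERIV_ray_avg[OF S f l w]])
  ultimately show ?thesis by (simp add: ray_avg_def A_def algebra_simps)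
qed

text \<open>Both sides vanish at \<open>0\<close>, and by \<open>ray_avg_ode\<close> their
  derivatives agree. This is the zero-mode equation \<open>(w Y)' = f - \<mu> Y\<close> in
  integrated form.\<close>

lemma ray_avg_eq_conv:
  assumes S: "star0 S" and f: "f holomorphic_on S" and l: "\<mu> > 0" and w: "w \<in> S"
  shows "w * ray_avg \<mu> f w = conv (\<lambda>_. 1) (\<lambda>z. f z - \<mu> * ray_avg \<mu> f z) w"
proof -
  let ?Y = "ray_avg \<mu> f"
  have hY: "?Y holomorphic_on S" by (rule holomorphic_ray_avg[OF S f l])
  have hg: "(\<lambda>z. f z - \<mu> * ?Y z) holomorphic_on S" using f hY by (auto intro!: holomorphic_intros)
  define D where "D = (\<lambda>z. z * ?Y z - conv (\<lambda>_. 1) (\<lambda>z. f z - \<mu> * ?Y z) z)"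
  have dD: "(D has_field_derivative 0) (at z within closed_segment 0 w)" if "z \<in> S" for z
  proof -
    have "(?Y has_field_derivative deriv ?Y z) (at z)" using hY star0_open[OF S] that by (auto intro: holomorphic_derivI)
    then have "(D has_field_derivative (z * deriv ?Y z + 1 * ?Y z) - (f z - \<mu> * ?Y z)) (at z)"
      unfolding D_def using DERIV_conv_one[OF S hg that] by (auto intro!: derivative_eq_intros)
    then show ?thesis using ray_avg_ode[OF S f l that] by (auto simp: algebra_simps intro: has_field_derivative_at_within)
  qed
  have "closed_segment 0 w \<subseteq> S" using star0D[OF S w] by (auto simp: in_segment scaleR_conv_of_real)
  then obtain c where c: "\<And>z. z \<in> closed_segment 0 w \<Longrightarrow> D z = c"
    using has_field_derivative_zero_constant[of "closed_segment 0 w" D] dD by blast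
  have "D w = D 0" using c[of w] c[of 0] by simp
  also have "\<dots> = 0" by (simp add: D_def conv_def)
  finally show ?thesis by (simp add: D_def)
qed

text \<open>\<open>pw m\<close> is the Borel transform of \<open>x^m\<close>. A constant has no such
  transform (it would be a point mass), and the value 0 at \<open>m = 0\<close> forces every family
  dominated by \<open>pw\<close> to vanish in degree 0.\<close>

definition pw :: "nat \<Rightarrow> real \<Rightarrow> real" where
  "pw m r = (if m = 0 then 0 else r ^ (m - 1) / fact (m - 1))"

lemma pw_nonneg: "r \<ge> 0 \<Longrightarrow> pw m r \<ge> 0" by (simp add: pw_def)

lemma pw_mono: "0 \<le> r \<Longrightarrow> r \<le> s \<Longrightarrow> pw m r \<le> pw m s"
  by (auto simp: pw_def intro!: divide_right_mono power_mono)

text \<open>The Borel form of \<open>x^m * x^n = x^(m+n)\<close>, which amounts to Euler's Beta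
  integral.\<close>

lemma has_integral_pw:
  assumes "m > 0" "n > 0"
  shows "((\<lambda>t. pw m (t * r) * pw n ((1-t) * r) * r) has_integral pw (m + n) r) {0..1}"
proof -
  obtain a b where ab: "m = Suc a" "n = Suc b" using assms by (metis gr0_implies_Suc)
  have "Beta (real (Suc a)) (real (Suc b)) = fact a * fact b / fact (a + b + 1)"
    using Gamma_fact[of a, where 'a = real] Gamma_fact[of b, where 'a = real] Gamma_fact[of "a+b+1", where 'a = real]
    by (simp add: Beta_def add_ac)
  then have "((\<lambda>t. t powr (real (Suc a) - 1) * (1 - t) powr (real (Suc b) - 1)) has_integral fact a * fact b / fact (a + b + 1)) {0..1}"
    using has_integral_Beta_real[of "real (Suc a)" "real (Suc b)"] by simp
  \<comment> \<open>With exponent 0, \<open>powr\<close> and \<open>^\<close> differ at base 0, so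
    the change from real to natural exponents is made on the open interval.\<close>
  then have "((\<lambda>t. t powr (real (Suc a) - 1) * (1 - t) powr (real (Suc b) - 1)) has_integral fact a * fact b / fact (a + b + 1)) {0<..<1}"
    by (simp add: has_integral_Icc_iff_Ioo)
  then have "((\<lambda>t. t ^ a * (1 - t) ^ b) has_integral fact a * fact b / fact (a + b + 1)) {0<..<1::real}"
    by (rule has_integral_eq[rotated]) (auto simp: powr_realpow)
  then have "((\<lambda>t. t ^ a * (1 - t) ^ b) has_integral fact a * fact b / fact (a + b + 1)) {0..1::real}"
    by (simp add: has_integral_Icc_iff_Ioo)
  from has_integral_mult_right[OF this, of "r ^ (a+b+1) / (fact a * fact b)"]
  have "((\<lambda>t. pw m (t * r) * pw n ((1-t) * r) * r) has_integral r ^ (a+b+1) / (fact a * fact b) * (fact a * fact b / fact (a + b + 1))) {0..1}"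
    by (rule has_integral_eq[rotated]) (simp add: ab pw_def power_mult_distrib power_add)
  then show ?thesis by (simp add: ab pw_def)
qed

text \<open>The Beta integral reproduces the majorants without loss. Only values on the segment from
  \<open>0\<close> to \<open>w\<close> enter, so the bounds are asked for there; if one degree is 0,
  that factor vanishes on the whole segment.\<close>

lemma conv_bound:
  assumes S: "star0 S" and f: "f holomorphic_on S" and g: "g holomorphic_on S" and w: "w \<in> S"
    and F: "\<And>t. t \<in> {0..1} \<Longrightarrow> norm (f (of_real t * w)) \<le> a * pw m (norm (of_real t * w))"
    and G: "\<And>t. t \<in> {0..1} \<Longrightarrow> norm (g (of_real t * w)) \<le> b * pw n (norm (of_real t * w))"
    and ab: "a \<ge> 0" "b \<ge> 0"
  shows "norm (conv f g w) \<le> a * b * (if m = 0 \<or> n = 0 then 0 else pw (m + n) (norm w))"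
proof (cases "m = 0 \<or> n = 0")
  case True
  then have "f (of_real t * w) * g (of_real (1 - t) * w) = 0" if "t \<in> {0..1}" for t
    using F[of t] G[of "1-t"] that by (auto simp: pw_def)
  then have "integral {0..1} (\<lambda>t. f (of_real t * w) * g (of_real (1 - t) * w)) = integral {0..1} (\<lambda>t::real. 0)"
    by (intro integral_cong) blast
  then show ?thesis using True by (auto simp: conv_def)
next
  case False
  have cf: "continuous_on S f" "continuous_on S g" using f g by (auto intro: holomorphic_on_imp_continuous_on)
  let ?h = "\<lambda>t. f (of_real t * w) * g (of_real (1 - t) * w)"
  have int: "?h integrable_on {0..1}"
    using star0D[OF S w] star0D'[OF S w]
    by (intro integrable_continuous_real continuous_intros continuous_on_compose2[OF cf(1)] continuous_on_compose2[OF cf(2)]) auto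
  have hi: "((\<lambda>t. (a * b) * (pw m (t * norm w) * pw n ((1-t) * norm w) * norm w)) has_integral (a * b) * pw (m + n) (norm w)) {0..1}"
    using has_integral_pw[of m n "norm w"] False by (intro has_integral_mult_right) auto
  have "norm (integral {0..1} (\<lambda>t. w * ?h t)) \<le> integral {0..1} (\<lambda>t. (a * b) * (pw m (t * norm w) * pw n ((1-t) * norm w) * norm w))"
  proof (rule integral_norm_bound_integral)
    show "(\<lambda>t. w * ?h t) integrable_on {0..1}" using int by (rule integrable_on_mult_right)
    fix t :: real assume t: "t \<in> {0..1}"
    have "norm (f (of_real t * w)) \<le> a * pw m (t * norm w)" using F[OF t] t by (simp add: norm_mult)
    moreover have "norm (g (of_real (1-t) * w)) \<le> b * pw n ((1-t) * norm w)"
    proof -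
      have "norm (complex_of_real (1-t) * w) = (1-t) * norm w" using t by (simp only: norm_mult norm_of_real) auto
      then show ?thesis using G[of "1-t"] t by simp
    qed
    ultimately have "norm (f (of_real t * w)) * norm (g (of_real (1-t) * w)) \<le> (a * pw m (t * norm w)) * (b * pw n ((1-t) * norm w))"
      using ab t by (intro mult_mono) (auto intro!: mult_nonneg_nonneg pw_nonneg)
    then have "norm w * (norm (f (of_real t * w)) * norm (g (of_real (1-t) * w))) \<le> norm w * ((a * pw m (t * norm w)) * (b * pw n ((1-t) * norm w)))"
      by (rule mult_left_mono) simp
    then show "norm (w * ?h t) \<le> (a * b) * (pw m (t * norm w) * pw n ((1-t) * norm w) * norm w)"
      by (simp only: norm_mult mult_ac)
  qed (use hi in auto)
  also have "\<dots> = a * b * pw (m + n) (norm w)" using hi by (rule integral_unique)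
  finally show ?thesis using False by (simp add: conv_def)
qed

text \<open>Since \<open>t powr \<mu> \<le> 1\<close>, averaging costs no constant, which is what
  makes the zero mode as good as the others.\<close>

lemma ray_avg_bound:
  assumes S: "star0 S" and f: "f holomorphic_on S" and w: "w \<in> S" and l: "\<mu> > 0"
    and F: "\<And>t. t \<in> {0..1} \<Longrightarrow> norm (f (of_real t * w)) \<le> b"
  shows "norm (ray_avg \<mu> f w) \<le> b"
proof -
  have cf: "continuous_on S f" using f by (auto intro: holomorphic_on_imp_continuous_on)
  have b: "b \<ge> 0" by (rule order_trans[OF norm_ge_zero F[of 0]]) simp
  have "norm (ray_avg \<mu> f w) \<le> b * (1 - 0)" unfolding ray_avg_def
  proof (rule integral_bound)
    show "continuous_on {0..1} (\<lambda>t. complex_of_real (t powr \<mu>) * f (of_real t * w))"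
      using powr_continuous_on_unit[OF l] star0D[OF S w]
      by (intro continuous_on_mult continuous_on_compose2[OF cf]) (auto intro!: continuous_intros)
    fix t :: real assume t: "t \<in> {0..1}"
    have "t powr \<mu> \<le> 1" using t l by (intro powr_le1) auto
    then have "t powr \<mu> * norm (f (of_real t * w)) \<le> 1 * b" using F[OF t] by (intro mult_mono) auto
    then show "norm (complex_of_real (t powr \<mu>) * f (of_real t * w)) \<le> b" by (simp add: norm_mult)
  qed auto
  then show ?thesis by simp
qed

text \<open>Fubini and translation invariance on the whole line; functions on a half-line will enter
  extended by zero.\<close>

lemma integral_convolution:
  fixes a b :: "real \<Rightarrow> complex"
  assumes a: "integrable lborel a" and b: "integrable lborel b"
  shows "(LINT r|lborel. LINT s|lborel. a s * b (r - s)) = (LINT s|lborel. a s) * (LINT s|lborel. b s)"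
proof -
  have [measurable]: "a \<in> borel_measurable borel" "b \<in> borel_measurable borel"
    using a b by (auto dest: borel_measurable_integrable)
  have shift: "integrable lborel (\<lambda>r. b (r - s))" "(LINT r|lborel. b (r - s)) = (LINT r|lborel. b r)" for s
    using lborel_integrable_real_affine[OF b, of 1 "-s"] lborel_integral_real_affine[of 1 b "-s"]
    by (simp_all add: algebra_simps)
  have shiftn: "(LINT r|lborel. norm (b (r - s))) = (LINT r|lborel. norm (b r))" for s
    using lborel_integral_real_affine[of 1 "\<lambda>r. norm (b r)" "-s"] by (simp add: algebra_simps)
  have "integrable (lborel \<Otimes>\<^sub>M lborel) (\<lambda>(s, r). a s * b (r - s))"
  proof (rule lborel_pair.Fubini_integrable)
    show "(\<lambda>(s, r). a s * b (r - s)) \<in> borel_measurable (lborel \<Otimes>\<^sub>M lborel)" by measurable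
    show "integrable lborel (\<lambda>x. LINT y|lborel. norm (case (x, y) of (s, r) \<Rightarrow> a s * b (r - s)))"
      using a by (simp add: norm_mult shiftn)
    show "AE x in lborel. integrable lborel (\<lambda>y. case (x, y) of (s, r) \<Rightarrow> a s * b (r - s))"
      using shift by simp
  qed
  from lborel_pair.Fubini_integral[OF this]
  have "(LINT r|lborel. LINT s|lborel. a s * b (r - s)) = (LINT s|lborel. LINT r|lborel. a s * b (r - s))" .
  also have "\<dots> = (LINT s|lborel. a s) * (LINT s|lborel. b s)" using a by (simp add: shift)
  finally show ?thesis .
qed

section \<open>Laplace transforms along rays\<close>

text \<open>Here \<open>z\<close> stands for \<open>1 / x\<close> and \<open>e\<close> is meant to
  be the unit vector of the ray.\<close>

definition lap :: "complex \<Rightarrow> complex \<Rightarrow> (complex \<Rightarrow> complex) \<Rightarrow> complex" where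
  "lap e z f = (LINT r:{0..}|lborel. f (of_real r * e) * exp (- (of_real r * e * z)) * e)"

definition ray_bounded :: "complex \<Rightarrow> real \<Rightarrow> real \<Rightarrow> (complex \<Rightarrow> complex) \<Rightarrow> bool" where
  "ray_bounded e \<tau> C f \<longleftrightarrow> continuous_on {0..} (\<lambda>r. f (of_real r * e)) \<and>
     (\<forall>r\<ge>0. norm (f (of_real r * e)) \<le> C * exp (\<tau> * r))"

lemma exp_decay_integrable:
  assumes "c > (0::real)"
  shows "set_integrable lborel {0..} (\<lambda>r. exp (- (c * r)))" "(LINT r:{0..}|lborel. exp (- (c * r))) = 1 / c"
proof -
  have h: "((\<lambda>r. exp (- c * r)) has_integral exp (- c * 0) / c) {0..}"
    using has_integral_exp_minus_to_infinity[OF assms, of 0] by simp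
  have "(\<lambda>r. exp (- c * r)) absolutely_integrable_on {0..}"
    using h by (intro nonnegative_absolutely_integrable_1) (auto simp: integrable_on_def)
  then show 1: "set_integrable lborel {0..} (\<lambda>r. exp (- (c * r)))"
    unfolding set_integrable_def by (subst (asm) integrable_completion) auto
  show "(LINT r:{0..}|lborel. exp (- (c * r))) = 1 / c"
    using set_borel_integral_eq_integral(2)[OF 1] integral_unique[OF h] by simp
qed

lemma lap_integrable:
  assumes f: "ray_bounded e \<tau> C f" and c: "Re (e * z) > \<tau>" and e: "norm e = 1"
  shows "set_integrable lborel {0..} (\<lambda>r. f (of_real r * e) * exp (- (of_real r * e * z)) * e)"
    "norm (lap e z f) \<le> C / (Re (e * z) - \<tau>)"
proof -
  let ?h = "\<lambda>r. f (of_real r * e) * exp (- (of_real r * e * z)) * e"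
  let ?b = "\<lambda>r. C * exp (- ((Re (e * z) - \<tau>) * r))"
  have C: "norm (f (of_real r * e)) \<le> C * exp (\<tau> * r)" if "r \<ge> 0" for r
    using f that by (auto simp: ray_bounded_def)
  have ib: "set_integrable lborel {0..} ?b" using exp_decay_integrable(1) c by auto
  have b: "norm (?h r) \<le> ?b r" if "r \<ge> 0" for r
  proof -
    have "Re (of_real r * e * z) = r * Re (e * z)" by (simp add: algebra_simps)
    then have "norm (?h r) = norm (f (of_real r * e)) * exp (- (r * Re (e * z)))"
      using e by (simp add: norm_mult del: times_complex.sel)
    also have "\<dots> \<le> (C * exp (\<tau> * r)) * exp (- (r * Re (e * z)))" using C[OF that] by (rule mult_right_mono) simp
    also have "\<dots> = ?b r" by (simp add: exp_add[symmetric] algebra_simps)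
    finally show ?thesis .
  qed
  have "continuous_on {0..} ?h" using f unfolding ray_bounded_def by (auto intro!: continuous_intros)
  then have meas: "set_borel_measurable lborel {0..} ?h"
    by (auto simp: set_borel_measurable_def intro!: borel_measurable_continuous_on_indicator)
  show ih: "set_integrable lborel {0..} ?h"
    by (rule set_integrable_bound[OF ib meas]) (use b in force)
  have "norm (lap e z f) \<le> (LINT r:{0..}|lborel. norm (?h r))"
    unfolding lap_def by (rule set_integral_norm_bound[OF ih])
  also have "\<dots> \<le> (LINT r:{0..}|lborel. ?b r)"
    by (rule set_integral_mono[OF set_integrable_norm[OF ih] ib]) (use b in auto)
  also have "\<dots> = C / (Re (e * z) - \<tau>)" using exp_decay_integrable(2)[of "Re (e * z) - \<tau>"] c
    by simp
  finally show "norm (lap e z f) \<le> C / (Re (e * z) - \<tau>)" .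
qed

lemma ray_bounded_add:
  assumes "ray_bounded e \<tau> C f" "ray_bounded e \<tau> D g"
  shows "ray_bounded e \<tau> (C + D) (\<lambda>w. f w + g w)"
  using assms by (auto simp: ray_bounded_def distrib_right intro!: continuous_intros norm_triangle_mono)

lemma ray_bounded_cmult:
  assumes "ray_bounded e \<tau> C f"
  shows "ray_bounded e \<tau> (norm c * C) (\<lambda>w. c * f w)"
  using assms by (auto simp: ray_bounded_def norm_mult mult.assoc intro!: continuous_intros mult_left_mono)

lemma lap_add:
  assumes "ray_bounded e \<tau> C f" "ray_bounded e \<tau> D g" "Re (e * z) > \<tau>" "norm e = 1"
  shows "lap e z (\<lambda>w. f w + g w) = lap e z f + lap e z g"
  unfolding lap_def distrib_right
  by (intro set_integral_add lap_integrable(1)[where \<tau> = \<tau>]) (use assms in auto)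

lemma lap_cmult: "lap e z (\<lambda>w. c * f w) = c * lap e z f"
  unfolding lap_def mult.assoc by (simp add: set_integral_mult_right)

lemma lap_diff:
  assumes "ray_bounded e \<tau> C f" "ray_bounded e \<tau> D g" "Re (e * z) > \<tau>" "norm e = 1"
  shows "lap e z (\<lambda>w. f w - g w) = lap e z f - lap e z g"
  using lap_add[OF assms(1) ray_bounded_cmult[OF assms(2), of "-1"] assms(3,4)] lap_cmult[of e z "-1" g] by simp

lemma lap_cong:
  assumes "\<And>r. r \<ge> 0 \<Longrightarrow> f (of_real r * e) = g (of_real r * e)"
  shows "lap e z f = lap e z g"
  unfolding lap_def by (rule set_lebesgue_integral_cong) (auto simp: assms)

lemma ray_bounded_zero: "ray_bounded e \<tau> 0 (\<lambda>_. 0)" by (simp add: ray_bounded_def)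

lemma ray_bounded_sum:
  assumes "finite F" "\<And>i. i \<in> F \<Longrightarrow> ray_bounded e \<tau> (C i) (f i)"
  shows "ray_bounded e \<tau> (\<Sum>i\<in>F. C i) (\<lambda>w. \<Sum>i\<in>F. f i w)"
  using assms by (induction F rule: finite_induct) (auto intro!: ray_bounded_zero ray_bounded_add)

lemma lap_zero: "lap e z (\<lambda>_. 0) = 0" by (simp add: lap_def)

lemma lap_sum:
  assumes "finite F" "\<And>i. i \<in> F \<Longrightarrow> ray_bounded e \<tau> (C i) (f i)" "Re (e * z) > \<tau>" "norm e = 1"
  shows "lap e z (\<lambda>w. \<Sum>i\<in>F. f i w) = (\<Sum>i\<in>F. lap e z (f i))"
  using assms
proof (induction F rule: finite_induct)
  case (insert i F)
  have "lap e z (\<lambda>w. f i w + (\<Sum>i\<in>F. f i w)) = lap e z (f i) + lap e z (\<lambda>w. \<Sum>i\<in>F. f i w)"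
    using insert by (intro lap_add[where \<tau> = \<tau>, OF _ ray_bounded_sum[where C = C]]) auto
  then show ?case using insert by simp
qed (simp add: lap_zero)

lemma lap_tendsto:
  assumes f: "ray_bounded e \<tau> C f" and c: "Re (e * z) > \<tau>" and e: "norm e = 1"
  shows "((\<lambda>R. integral {0..R} (\<lambda>r. f (of_real r * e) * exp (- (of_real r * e * z)) * e)) \<longlongrightarrow> lap e z f) at_top"
proof -
  let ?h = "\<lambda>r. f (of_real r * e) * exp (- (of_real r * e * z)) * e"
  have "((\<lambda>R. LINT r:{0..R}|lborel. ?h r) \<longlongrightarrow> lap e z f) at_top"
    unfolding lap_def by (rule tendsto_set_lebesgue_integral_at_top[OF _ lap_integrable(1)[OF f c e]]) auto
  moreover have "(\<lambda>R. LINT r:{0..R}|lborel. ?h r) = (\<lambda>R. integral {0..R} ?h)"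
    by (rule ext, rule set_borel_integral_eq_integral(2)[OF set_integrable_subset[OF lap_integrable(1)[OF f c e]]]) auto
  ultimately show ?thesis by (simp only:)
qed

text \<open>Expresses the Laplace integral through boundary values of a primitive, so that two rays
  can be compared through their points at distance \<open>R\<close>.\<close>

lemma lap_primitive:
  assumes f: "ray_bounded e \<tau> C f" and c: "Re (e * z) > \<tau>" and e: "norm e = 1"
    and P: "\<And>r. r \<ge> 0 \<Longrightarrow> (P has_field_derivative f (of_real r * e) * exp (- (of_real r * e * z))) (at (of_real r * e))"
  shows "((\<lambda>R. P (of_real R * e) - P 0) \<longlongrightarrow> lap e z f) at_top"
proof (rule Lim_transform_eventually[OF lap_tendsto[OF f c e]])
  have "((\<lambda>r. f (of_real r * e) * exp (- (of_real r * e * z)) * e) has_integral P (0 + of_real R * e) - P (0 + of_real 0 * e)) {0..R}"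
    if "R \<ge> 0" for R
  proof (rule fundamental_theorem_of_calculus[OF that])
    fix t assume "t \<in> {0..R}"
    then show "((\<lambda>r. P (0 + of_real r * e)) has_vector_derivative f (of_real t * e) * exp (- (of_real t * e * z)) * e) (at t within {0..R})"
      using DERIV_along_line[of P "f (of_real t * e) * exp (- (of_real t * e * z))" 0 t e] P[of t] by (simp add: mult.commute)
  qed
  then show "\<forall>\<^sub>F R in at_top. integral {0..R} (\<lambda>r. f (of_real r * e) * exp (- (of_real r * e * z)) * e) = P (of_real R * e) - P 0"
    by (intro eventually_mono[OF eventually_ge_at_top[of 0]] integral_unique) simp
qed

lemma exp_decay_tendsto: "c > (0::real) \<Longrightarrow> ((\<lambda>R. exp (- (c * R))) \<longlongrightarrow> 0) at_top"
  by real_asymp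

lemma lap_one:
  assumes e: "norm e = 1" and c: "Re (e * z) > 0"
  shows "lap e z (\<lambda>_. 1) = 1 / z"
proof -
  have z: "z \<noteq> 0" "e \<noteq> 0" using c e by auto
  have rb: "ray_bounded e 0 1 (\<lambda>_. 1)" by (auto simp: ray_bounded_def)
  let ?P = "\<lambda>w. - exp (- (w * z)) / z"
  have "(?P has_field_derivative 1 * exp (- (w * z))) (at w)" for w
    using z by (auto intro!: derivative_eq_intros)
  from lap_primitive[OF rb c e this]
  have 1: "((\<lambda>R. ?P (of_real R * e) - ?P 0) \<longlongrightarrow> lap e z (\<lambda>_. 1)) at_top" .
  have "norm (exp (- (of_real R * e * z))) = exp (- (Re (e * z) * R))" for R by (simp add: algebra_simps)
  then have "((\<lambda>R. norm (exp (- (of_real R * e * z)))) \<longlongrightarrow> 0) at_top" using exp_decay_tendsto[OF c] by simp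
  then have "((\<lambda>R. exp (- (of_real R * e * z))) \<longlongrightarrow> 0) at_top" by (rule tendsto_norm_zero_cancel)
  then have "((\<lambda>R. ?P (of_real R * e) - ?P 0) \<longlongrightarrow> - 0 / z - ?P 0) at_top" by (intro tendsto_intros) (use z in auto)
  from tendsto_unique[OF _ 1 this] show ?thesis by simp
qed

text \<open>After extension by zero the claim is \<open>integral_convolution\<close>: for
  \<open>r > 0\<close> the inner integral turns into \<open>conv\<close> under
  \<open>s = r t\<close>, and the exponential factors combine to one that depends on
  \<open>r\<close> only.\<close>

lemma lap_conv:
  assumes f: "ray_bounded e \<tau> C f" and g: "ray_bounded e \<tau> D g"
    and c: "Re (e * z) > \<tau>" and e: "norm e = 1"
  shows "lap e z (conv f g) = lap e z f * lap e z g"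
proof -
  define a where "a = (\<lambda>r::real. indicator {0..} r *\<^sub>R (f (of_real r * e) * exp (- (of_real r * e * z)) * e))"
  define b where "b = (\<lambda>r::real. indicator {0..} r *\<^sub>R (g (of_real r * e) * exp (- (of_real r * e * z)) * e))"
  have ia: "integrable lborel a" "integrable lborel b"
    using lap_integrable(1)[OF f c e] lap_integrable(1)[OF g c e] by (simp_all add: a_def b_def set_integrable_def)
  have inner: "(LINT s|lborel. a s * b (r - s)) =
    indicator {0..} r *\<^sub>R (conv f g (of_real r * e) * exp (- (of_real r * e * z)) * e)" for r
  proof -
    consider "r < 0" | "r = 0" | "r > 0" by linarith
    then show ?thesis
    proof cases
      case 1
      then have "(\<lambda>s. a s * b (r - s)) = (\<lambda>s. 0)" by (auto simp: a_def b_def indicator_def fun_eq_iff)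
      then show ?thesis using 1 by (simp only: indicator_def) simp
    next
      case 2
      have "(\<lambda>s. a s * b (r - s)) = (\<lambda>s. indicator {0} s *\<^sub>R (f 0 * g 0 * e * e))"
        by (auto simp: a_def b_def indicator_def 2 fun_eq_iff)
      then show ?thesis using 2 by (simp only:) (simp add: conv_def)
    next
      case 3
      have "a (0 + r * t) * b (r - (0 + r * t)) = indicator {0..1} t *\<^sub>R
         ((f (of_real t * (of_real r * e)) * g (of_real (1 - t) * (of_real r * e))) * (exp (- (of_real r * e * z)) * e * e))" for t
      proof (cases "t \<in> {0..1}")
        case True
        have x: "exp (- (of_real (r * t) * e * z)) * exp (- (of_real (r - r * t) * e * z)) = exp (- (of_real r * e * z))"
          by (simp add: exp_add[symmetric] algebra_simps)
        have "r * t \<ge> 0" "r - r * t \<ge> 0" using True 3 by (auto simp: mult_le_cancel_left1)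
        then have "a (0 + r * t) * b (r - (0 + r * t)) = (f (of_real (r * t) * e) * g (of_real (r - r * t) * e)) *
            ((exp (- (of_real (r * t) * e * z)) * exp (- (of_real (r - r * t) * e * z))) * e * e)"
          by (simp add: a_def b_def)
        then show ?thesis unfolding x using True by (simp add: algebra_simps)
      next
        case False
        then have "r * t < 0 \<or> r - r * t < 0" using 3 by (auto simp: mult_less_0_iff)
        then show ?thesis using False by (auto simp: a_def b_def)
      qed
      then have "(LINT s|lborel. a s * b (r - s)) = r *\<^sub>R (LINT t:{0..1}|lborel.
         ((f (of_real t * (of_real r * e)) * g (of_real (1 - t) * (of_real r * e))) * (exp (- (of_real r * e * z)) * e * e)))"
        using lborel_integral_real_affine[of r "\<lambda>s. a s * b (r - s)" 0] 3
        unfolding set_lebesgue_integral_def by simp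
      also have "\<dots> = r *\<^sub>R ((LINT t:{0..1}|lborel.
         (f (of_real t * (of_real r * e)) * g (of_real (1 - t) * (of_real r * e)))) * (exp (- (of_real r * e * z)) * e * e))"
        by (subst set_integral_mult_left) auto
      also have "(LINT t:{0..1}|lborel. (f (of_real t * (of_real r * e)) * g (of_real (1 - t) * (of_real r * e)))) =
         integral {0..1} (\<lambda>t. f (of_real t * (of_real r * e)) * g (of_real (1 - t) * (of_real r * e)))"
      proof (rule set_borel_integral_eq_integral(2))
        have cc: "continuous_on {0..} (\<lambda>r. f (of_real r * e))" "continuous_on {0..} (\<lambda>r. g (of_real r * e))"
          using f g by (auto simp: ray_bounded_def)
        have "continuous_on {0..1} (\<lambda>t. f (of_real (t * r) * e) * g (of_real ((1 - t) * r) * e))"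
          using 3 by (intro continuous_on_mult continuous_on_compose2[OF cc(1)] continuous_on_compose2[OF cc(2)])
             (auto intro!: continuous_intros)
        then have "continuous_on {0..1} (\<lambda>t. f (of_real t * (of_real r * e)) * g (of_real (1 - t) * (of_real r * e)))"
          by (simp add: mult.assoc)
        then show "set_integrable lborel {0..1} (\<lambda>t. f (of_real t * (of_real r * e)) * g (of_real (1 - t) * (of_real r * e)))"
          by (rule borel_integrable_atLeastAtMost'[of 0 1])
      qed
      finally show ?thesis using 3 by (simp add: conv_def scaleR_conv_of_real)
    qed
  qed
  have "lap e z (conv f g) = (LINT r|lborel. LINT s|lborel. a s * b (r - s))"
    unfolding inner lap_def set_lebesgue_integral_def ..
  also have "\<dots> = lap e z f * lap e z g"
    unfolding integral_convolution[OF ia] by (simp only: a_def b_def lap_def set_lebesgue_integral_def)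
  finally show ?thesis .
qed

text \<open>The chord from \<open>R e\<close> to \<open>R e'\<close> stays in the convex cone. On it
  \<open>norm w \<le> R\<close> and \<open>Re (w z) \<ge> R m\<close>, with \<open>m\<close> the
  worse of the two rates, so the integral over the chord is at most a multiple of
  \<open>R exp (- (m - \<tau>) R)\<close> and tends to 0. This is Cauchy's theorem for the rotation
  of the ray.\<close>

lemma lap_direction:
  assumes W: "convex W" "\<And>w r. w \<in> W \<Longrightarrow> r > 0 \<Longrightarrow> of_real r * w \<in> W"
    and S: "star0 S" "W \<subseteq> S" "f holomorphic_on S"
    and bd: "\<And>w. w \<in> insert 0 W \<Longrightarrow> norm (f w) \<le> C * exp (\<tau> * norm w)" and \<tau>: "\<tau> \<ge> 0"
    and e: "e \<in> W" "norm e = 1" "Re (e * z) > \<tau>" and e': "e' \<in> W" "norm e' = 1" "Re (e' * z) > \<tau>"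
  shows "lap e z f = lap e' z f"
proof -
  have z0: "0 \<in> S" using star0_zero[OF S(1)] e(1) S(2) by blast
  have C: "C \<ge> 0" using order_trans[OF norm_ge_zero bd[of 0]] by simp
  have ray: "of_real r * d \<in> insert 0 W" if "d \<in> W" "r \<ge> 0" for d r
    using W(2)[OF that(1), of r] that by (cases "r = 0") auto
  have rayS: "of_real r * d \<in> S" if "d \<in> W" "r \<ge> 0" for d r
    using ray[OF that] z0 S(2) by auto
  have cf: "continuous_on S f" using S(3) by (rule holomorphic_on_imp_continuous_on)
  have rb: "ray_bounded d \<tau> C f" if d: "d \<in> W" "norm d = 1" for d
    unfolding ray_bounded_def
  proof safe
    show "continuous_on {0..} (\<lambda>r. f (of_real r * d))"
      using rayS[OF d(1)] by (intro continuous_on_compose2[OF cf]) (auto intro!: continuous_intros)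
    show "norm (f (of_real r * d)) \<le> C * exp (\<tau> * r)" if "0 \<le> r" for r
      using bd[OF ray[OF d(1) that]] d(2) that by (simp add: norm_mult)
  qed
  have "starlike S" unfolding starlike_def
    apply (rule bexI[OF _ z0]) using star0D[OF S(1)] by (auto simp: in_segment scaleR_conv_of_real)
  moreover have "(\<lambda>w. f w * exp (- (w * z))) holomorphic_on S" using S(3) by (auto intro!: holomorphic_intros)
  ultimately obtain P where P: "\<And>x. x \<in> S \<Longrightarrow> (P has_field_derivative f x * exp (- (x * z))) (at x)"
    using holomorphic_starlike_primitive[of S "\<lambda>w. f w * exp (- (w * z))" "{}"] star0_open[OF S(1)]
    by (auto simp: holomorphic_on_imp_continuous_on holomorphic_on_imp_differentiable_at)
  have lim: "((\<lambda>R. P (of_real R * d) - P 0) \<longlongrightarrow> lap d z f) at_top" if "d \<in> W" "norm d = 1" "Re (d * z) > \<tau>" for d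
    using lap_primitive[OF rb[OF that(1,2)] that(3,2)] P[OF rayS[OF that(1)]] by blast
  define m where "m = min (Re (e * z)) (Re (e' * z))"
  have m: "m > \<tau>" using e e' by (simp add: m_def)
  have bound: "norm (P (of_real R * e) - P (of_real R * e')) \<le> C * exp (- ((m - \<tau>) * R)) * (2 * R)" if R: "R > 0" for R
  proof -
    let ?x = "of_real R * e" and ?y = "of_real R * e'"
    have seg: "w \<in> W \<and> norm (f w * exp (- (w * z))) \<le> C * exp (- ((m - \<tau>) * R))" if w: "w \<in> closed_segment ?x ?y" for w
    proof -
      have wW: "w \<in> W" using closed_segment_subset[OF W(2)[OF e(1) R] W(2)[OF e'(1) R] W(1)] w by blast
      obtain u where u: "0 \<le> u" "u \<le> 1" "w = (1 - u) *\<^sub>R ?x + u *\<^sub>R ?y" using w by (auto simp: in_segment)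
      have "norm w \<le> (1 - u) * norm ?x + u * norm ?y" unfolding u(3)
        by (rule norm_triangle_le) (use u in simp)
      also have "\<dots> = R" using e e' R by (simp add: norm_mult algebra_simps)
      finally have nw: "norm w \<le> R" .
      have "w * z = of_real (R * (1 - u)) * (e * z) + of_real (R * u) * (e' * z)"
        unfolding u(3) by (simp add: scaleR_conv_of_real algebra_simps)
      moreover have "Re (of_real k * x) = k * Re x" for k x by simp
      ultimately have "Re (w * z) = R * ((1 - u) * Re (e * z) + u * Re (e' * z))"
        by (simp only: plus_complex.sel distrib_left mult.assoc)
      moreover have "(1 - u) * Re (e * z) + u * Re (e' * z) \<ge> (1 - u) * m + u * m"
        using u by (intro add_mono mult_left_mono) (auto simp: m_def)
      ultimately have rw: "Re (w * z) \<ge> R * m" using R mult_left_mono[of m "(1 - u) * Re (e * z) + u * Re (e' * z)" R]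
        by (simp only: left_diff_distrib)
      have "norm (f w * exp (- (w * z))) = norm (f w) * exp (- Re (w * z))" by (simp add: norm_mult)
      also have "\<dots> \<le> (C * exp (\<tau> * norm w)) * exp (- (R * m))"
        using bd[of w] wW rw C by (intro mult_mono) auto
      also have "\<dots> \<le> (C * exp (\<tau> * R)) * exp (- (R * m))"
        using nw \<tau> C by (intro mult_mono mult_left_mono) (auto intro!: mult_left_mono)
      also have "\<dots> = C * exp (- ((m - \<tau>) * R))" by (simp add: exp_add[symmetric] algebra_simps)
      finally show ?thesis using wW by blast
    qed
    have "norm (P ?x - P ?y) \<le> C * exp (- ((m - \<tau>) * R)) * norm (?x - ?y)"
    proof (rule field_differentiable_bound[of "closed_segment ?x ?y" P "\<lambda>w. f w * exp (- (w * z))"])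
      fix w assume "w \<in> closed_segment ?x ?y"
      then have "w \<in> S" "norm (f w * exp (- (w * z))) \<le> C * exp (- ((m - \<tau>) * R))"
        using seg S(2) by blast+
      then show "(P has_field_derivative f w * exp (- (w * z))) (at w within closed_segment ?x ?y)"
        "norm (f w * exp (- (w * z))) \<le> C * exp (- ((m - \<tau>) * R))"
        using P has_field_derivative_at_within by blast+
    qed auto
    also have "C * exp (- ((m - \<tau>) * R)) * norm (?x - ?y) \<le> C * exp (- ((m - \<tau>) * R)) * (2 * R)"
      using norm_triangle_ineq4[of ?x ?y] e e' R C by (intro mult_left_mono) (auto simp: norm_mult)
    finally show ?thesis .
  qed
  have "((\<lambda>R. P (of_real R * e) - P (of_real R * e')) \<longlongrightarrow> 0) at_top"
  proof (rule Lim_null_comparison)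
    show "\<forall>\<^sub>F R in at_top. norm (P (of_real R * e) - P (of_real R * e')) \<le> C * exp (- ((m - \<tau>) * R)) * (2 * R)"
      using bound by (intro eventually_mono[OF eventually_gt_at_top[of 0]])
    have "((\<lambda>R. exp (- ((m - \<tau>) * R)) * (2 * R)) \<longlongrightarrow> 0) at_top" using m by real_asymp
    from tendsto_mult_left[OF this, of C] show "((\<lambda>R. C * exp (- ((m - \<tau>) * R)) * (2 * R)) \<longlongrightarrow> 0) at_top"
      by (simp add: mult.assoc)
  qed
  moreover have "((\<lambda>R. (P (of_real R * e) - P 0) - (P (of_real R * e') - P 0)) \<longlongrightarrow> lap e z f - lap e' z f) at_top"
    by (intro tendsto_diff lim e e')
  then have "((\<lambda>R. P (of_real R * e) - P (of_real R * e')) \<longlongrightarrow> lap e z f - lap e' z f) at_top" by simp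
  ultimately have "lap e z f - lap e' z f = 0" using tendsto_unique[OF trivial_limit_at_top_linorder] by metis
  then show ?thesis by simp
qed

text \<open>The remainder after a finite subsum is itself \<open>ray_bounded\<close>, with the
  remainder of the constants as its constant, so the Laplace bound applies to it directly.\<close>

lemma lap_has_sum:
  assumes f: "\<And>i. ray_bounded e \<tau> (C i) (f i)" and g: "\<And>w. w \<in> (\<lambda>r. of_real r * e) ` {0..} \<Longrightarrow> ((\<lambda>i. f i w) has_sum g w) A"
    and C: "C summable_on A" and c: "Re (e * z) > \<tau>" and e: "norm e = 1"
    and gc: "continuous_on {0..} (\<lambda>r. g (of_real r * e))"
  shows "((\<lambda>i. lap e z (f i)) has_sum lap e z g) A"
proof -
  have tail: "norm (lap e z g - (\<Sum>i\<in>F. lap e z (f i))) \<le> (infsum C A - sum C F) / (Re (e * z) - \<tau>)" if F: "finite F" "F \<subseteq> A" for F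
  proof -
    have fs: "ray_bounded e \<tau> (sum C F) (\<lambda>w. \<Sum>i\<in>F. f i w)" using f F by (intro ray_bounded_sum) auto
    have sCF: "((\<lambda>i. C i) has_sum (infsum C A - sum C F)) (A - F)"
      using has_sum_Diff[OF has_sum_infsum[OF C] has_sum_finite[OF F(1)] F(2)] .
    have gb: "ray_bounded e \<tau> (infsum C A - sum C F) (\<lambda>w. g w - (\<Sum>i\<in>F. f i w))"
      unfolding ray_bounded_def
    proof safe
      show "continuous_on {0..} (\<lambda>r. g (of_real r * e) - (\<Sum>i\<in>F. f i (of_real r * e)))"
        using gc fs by (auto simp: ray_bounded_def intro!: continuous_intros)
      fix r :: real assume r: "0 \<le> r"
      have h: "((\<lambda>i. f i (of_real r * e)) has_sum (g (of_real r * e) - (\<Sum>i\<in>F. f i (of_real r * e)))) (A - F)"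
        using has_sum_Diff[OF g[of "of_real r * e"] has_sum_finite[OF F(1)] F(2)] r by auto
      show "norm (g (of_real r * e) - (\<Sum>i\<in>F. f i (of_real r * e))) \<le> (infsum C A - sum C F) * exp (\<tau> * r)"
        by (rule norm_infsum_le[OF h has_sum_cmult_left[OF sCF]]) (use f r in \<open>auto simp: ray_bounded_def\<close>)
    qed
    have "ray_bounded e \<tau> ((infsum C A - sum C F) + sum C F) (\<lambda>w. (g w - (\<Sum>i\<in>F. f i w)) + (\<Sum>i\<in>F. f i w))"
      by (rule ray_bounded_add[OF gb fs])
    then have gg: "ray_bounded e \<tau> (infsum C A) g" by simp
    have "lap e z (\<lambda>w. g w - (\<Sum>i\<in>F. f i w)) = lap e z g - (\<Sum>i\<in>F. lap e z (f i))"
      using lap_diff[OF gg fs c e] lap_sum[of F e \<tau> C f z] F f c e by simp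
    then show ?thesis using lap_integrable(2)[OF gb c e] by simp
  qed
  have nz: "Re (e * z) - \<tau> \<noteq> 0" using c by (metis less_irrefl right_minus_eq)
  have "((\<lambda>F. infsum C A - sum C F) \<longlongrightarrow> infsum C A - infsum C A) (finite_subsets_at_top A)"
    using has_sum_infsum[OF C] unfolding has_sum_def by (intro tendsto_diff tendsto_const)
  then have "((\<lambda>F. (infsum C A - sum C F) / (Re (e * z) - \<tau>)) \<longlongrightarrow> (infsum C A - infsum C A) / (Re (e * z) - \<tau>)) (finite_subsets_at_top A)"
    by (rule tendsto_divide[OF _ tendsto_const nz])
  then have lim: "((\<lambda>F. (infsum C A - sum C F) / (Re (e * z) - \<tau>)) \<longlongrightarrow> 0) (finite_subsets_at_top A)" by (simp only: diff_self div_0)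
  have "((\<lambda>F. lap e z g - (\<Sum>i\<in>F. lap e z (f i))) \<longlongrightarrow> 0) (finite_subsets_at_top A)"
    by (rule Lim_null_comparison[OF eventually_finite_subsets_at_top_weakI lim]) (use tail in auto)
  from tendsto_diff[OF tendsto_const[of "lap e z g"] this] show ?thesis by (simp add: has_sum_def)
qed

lemma norm_exp_minus_one_minus: "norm (exp u - 1 - u) \<le> (norm u)\<^sup>2 * exp (norm (u::complex))"
  using Taylor_exp_field[of u 1] by (simp add: algebra_simps power2_eq_square)

text \<open>Comes from the second-order remainder of the exponential. The powers of \<open>r\<close>
  produced by differentiation are absorbed by giving up part of the gap \<open>d\<close> between the
  rate and the growth type.\<close>

lemma DERIV_lap:
  assumes f: "ray_bounded e \<tau> C f" and c: "Re (e * z) > \<tau>" and e: "norm e = 1"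
  shows "((\<lambda>z. lap e z f) has_field_derivative - lap e z (\<lambda>w. w * f w)) (at z)"
proof -
  define d where "d = Re (e * z) - \<tau>"
  have d: "d > 0" using c by (simp add: d_def)
  have cont: "continuous_on {0..} (\<lambda>r. f (of_real r * e))" and bd: "\<And>r. r \<ge> 0 \<Longrightarrow> norm (f (of_real r * e)) \<le> C * exp (\<tau> * r)"
    using f by (auto simp: ray_bounded_def)
  have C: "C \<ge> 0" using bd[of 0] order_trans[OF norm_ge_zero] by force
  have r1: "r \<le> 4 / d * exp (d / 4 * r)" if "r \<ge> 0" for r
  proof -
    have "d / 4 * r \<le> exp (d / 4 * r)" using exp_ge_add_one_self[of "d / 4 * r"] by linarith
    then show ?thesis using d by (simp add: field_simps)
  qed
  have r2: "r\<^sup>2 \<le> 2 * (4 / d)\<^sup>2 * exp (d / 4 * r)" if "r \<ge> 0" for r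
  proof -
    have "(d / 4 * r)\<^sup>2 / 2 \<le> exp (d / 4 * r)" using exp_lower_Taylor_quadratic[of "d / 4 * r"] mult_nonneg_nonneg[of "d/4" r] that d by linarith
    then show ?thesis using d by (simp add: field_simps power2_eq_square)
  qed
  have wf: "ray_bounded e (\<tau> + d/4) (C * (4/d)) (\<lambda>w. w * f w)"
    unfolding ray_bounded_def
  proof safe
    show "continuous_on {0..} (\<lambda>r. of_real r * e * f (of_real r * e))" using cont by (auto intro!: continuous_intros)
    fix r :: real assume r: "0 \<le> r"
    have "norm (of_real r * e * f (of_real r * e)) = r * norm (f (of_real r * e))" using r e by (simp add: norm_mult)
    also have "\<dots> \<le> (4 / d * exp (d / 4 * r)) * (C * exp (\<tau> * r))" using r1[OF r] bd[OF r] r d C by (intro mult_mono) auto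
    also have "\<dots> = C * (4/d) * exp ((\<tau> + d/4) * r)" by (simp add: exp_add[symmetric] algebra_simps)
    finally show "norm (of_real r * e * f (of_real r * e)) \<le> C * (4/d) * exp ((\<tau> + d/4) * r)" .
  qed
  define K where "K = C * (2 * (4 / d)\<^sup>2)"
  have est: "norm ((lap e (z + h) f - lap e z f) / h - (- lap e z (\<lambda>w. w * f w))) \<le> K * norm h / (d / 2)"
    if h: "h \<noteq> 0" "norm h < d / 4" for h
  proof -
    define q where "q = (\<lambda>w. f w * (exp (- (w * h)) - 1 - (- (w * h))))"
    \<comment> \<open>One \<open>d/4\<close> pays for \<open>r^2\<close> through \<open>r2\<close>,
      the other for \<open>exp (r * norm h)\<close>; this leaves the growth type
      \<open>\<tau> + d/2\<close>.\<close>
    have qb: "ray_bounded e (\<tau> + d/2) (K * (norm h)\<^sup>2) q" unfolding ray_bounded_def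
    proof safe
      show "continuous_on {0..} (\<lambda>r. q (of_real r * e))" using cont unfolding q_def by (auto intro!: continuous_intros)
      fix r :: real assume r: "0 \<le> r"
      have "norm (exp (- (of_real r * e * h)) - 1 - (- (of_real r * e * h))) \<le> (r * norm h)\<^sup>2 * exp (r * norm h)"
        using norm_exp_minus_one_minus[of "- (of_real r * e * h)"] r e by (simp add: norm_mult)
      also have "\<dots> \<le> (r * norm h)\<^sup>2 * exp (d / 4 * r)" using mult_right_mono[of "norm h" "d/4" r] h r by (intro mult_left_mono) (simp_all add: mult.commute)
      also have "\<dots> \<le> (2 * (4 / d)\<^sup>2 * exp (d / 4 * r)) * (norm h)\<^sup>2 * exp (d / 4 * r)"
        unfolding power_mult_distrib using r2[OF r] by (intro mult_right_mono) auto
      finally have "norm (q (of_real r * e)) \<le> (C * exp (\<tau> * r)) * ((2 * (4 / d)\<^sup>2 * exp (d / 4 * r)) * (norm h)\<^sup>2 * exp (d / 4 * r))"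
        unfolding q_def norm_mult using bd[OF r] C by (intro mult_mono) auto
      also have "\<dots> = K * (norm h)\<^sup>2 * (exp (\<tau> * r) * exp (d / 4 * r) * exp (d / 4 * r))" by (simp add: K_def)
      also have "exp (\<tau> * r) * exp (d / 4 * r) * exp (d / 4 * r) = exp ((\<tau> + d/2) * r)"
        by (simp add: exp_add[symmetric] algebra_simps)
      finally show "norm (q (of_real r * e)) \<le> K * (norm h)\<^sup>2 * exp ((\<tau> + d/2) * r)" .
    qed
    have re: "Re (e * z) > \<tau> + d/2" "Re (e * z) > \<tau> + d/4" 
    proof -
      have "\<tau> < a \<Longrightarrow> \<tau> + (a - \<tau>) / 2 < a" "\<tau> < a \<Longrightarrow> \<tau> + (a - \<tau>) / 4 < a" for a by (simp_all add: field_simps)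
      from this[OF c] show "Re (e * z) > \<tau> + d/2" "Re (e * z) > \<tau> + d/4" unfolding d_def by blast+
    qed
    have fb: "ray_bounded e (\<tau> + d/2) C f" unfolding ray_bounded_def
    proof safe
      fix r :: real assume r: "0 \<le> r"
      have "C * exp (\<tau> * r) \<le> C * exp ((\<tau> + d / 2) * r)" using C d r mult_right_mono[of \<tau> "\<tau> + d/2" r] by (intro mult_left_mono) simp_all
      then show "norm (f (of_real r * e)) \<le> C * exp ((\<tau> + d / 2) * r)" using bd[OF r] by linarith
    qed (rule cont)
    have sp: "lap e (z + h) f = lap e z (\<lambda>w. q w + (f w + (- h) * (w * f w)))"
    proof -
      have "f w * exp (- (w * (z + h))) = (q w + (f w + (- h) * (w * f w))) * exp (- (w * z))" for w
        by (simp add: q_def algebra_simps exp_add exp_diff exp_minus field_simps)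
      then show ?thesis unfolding lap_def by (simp only: )
    qed
    have wf': "ray_bounded e (\<tau> + d/2) (norm (- h) * (C * (4/d))) (\<lambda>w. (- h) * (w * f w))"
    proof -
      have "ray_bounded e (\<tau> + d/2) (C * (4/d)) (\<lambda>w. w * f w)" unfolding ray_bounded_def
      proof safe
        show "continuous_on {0..} (\<lambda>r. of_real r * e * f (of_real r * e))" using cont by (auto intro!: continuous_intros)
        fix r :: real assume r: "0 \<le> r"
        have "C * (4/d) * exp ((\<tau> + d / 4) * r) \<le> C * (4/d) * exp ((\<tau> + d / 2) * r)"
          using C d r mult_right_mono[of "\<tau> + d/4" "\<tau> + d/2" r] by (intro mult_left_mono) simp_all
        then show "norm (of_real r * e * f (of_real r * e)) \<le> C * (4/d) * exp ((\<tau> + d / 2) * r)"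
          using wf r unfolding ray_bounded_def by (meson order_trans)
      qed
      then show ?thesis by (rule ray_bounded_cmult)
    qed
    have "lap e (z + h) f = lap e z q + (lap e z f + (- h) * lap e z (\<lambda>w. w * f w))"
      unfolding sp lap_add[OF qb ray_bounded_add[OF fb wf'] re(1) e] lap_add[OF fb wf' re(1) e] lap_cmult ..
    then have "(lap e (z + h) f - lap e z f) / h - (- lap e z (\<lambda>w. w * f w)) = lap e z q / h"
      using h by (simp add: field_simps)
    moreover have "norm (lap e z q) \<le> K * (norm h)\<^sup>2 / (d / 2)"
    proof -
      have "a - (\<tau> + (a - \<tau>) / 2) = (a - \<tau>) / 2" for a :: real by (simp add: field_simps)
      from this[of "Re (e * z)"] have "Re (e * z) - (\<tau> + d/2) = d/2" unfolding d_def .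
      then show ?thesis using lap_integrable(2)[OF qb re(1) e] by (simp only:)
    qed
    ultimately show ?thesis using h by (simp add: norm_divide power2_eq_square divide_right_mono pos_divide_le_eq algebra_simps)
  qed
  have "((\<lambda>h. (lap e (z + h) f - lap e z f) / h - (- lap e z (\<lambda>w. w * f w))) \<longlongrightarrow> 0) (at 0)"
  proof (rule Lim_null_comparison)
    show "\<forall>\<^sub>F h in at 0. norm ((lap e (z + h) f - lap e z f) / h - (- lap e z (\<lambda>w. w * f w))) \<le> K * norm h / (d / 2)"
      using est d by (auto simp: eventually_at intro!: exI[of _ "d/4"])
    show "((\<lambda>h::complex. K * norm h / (d / 2)) \<longlongrightarrow> 0) (at 0)"
      using d by (auto intro!: tendsto_eq_intros)
  qed
  then show ?thesis unfolding DERIV_def by (subst (asm) LIM_zero_iff)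
qed

section \<open>Taylor series over words\<close>

lemma norm_summable_on:
  fixes f :: "'a \<Rightarrow> 'b :: banach"
  assumes "g summable_on A" "\<And>x. x \<in> A \<Longrightarrow> norm (f x) \<le> g x"
  shows "f summable_on A"
  by (rule abs_summable_summable, rule summable_on_comparison_test[OF assms(1)]) (use assms(2) in auto)

lemma summable_on_times:
  fixes f :: "'a \<Rightarrow> real" and g :: "'b \<Rightarrow> real"
  assumes f: "f summable_on A" and g: "g summable_on B"
    and f0: "\<And>x. x \<in> A \<Longrightarrow> f x \<ge> 0" and g0: "\<And>x. x \<in> B \<Longrightarrow> g x \<ge> 0"
  shows "(\<lambda>(x, y). f x * g y) summable_on A \<times> B"
proof (rule summable_on_SigmaI[where g = "\<lambda>x. f x * infsum g B"])
  show "((\<lambda>y. case (x, y) of (x, y) \<Rightarrow> f x * g y) has_sum f x * infsum g B) B" if "x \<in> A" for x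
    using has_sum_cmult_right[OF has_sum_infsum[OF g], of "f x"] by simp
  show "(\<lambda>x. f x * infsum g B) summable_on A" using f by (rule summable_on_cmult_left)
qed (use f0 g0 in auto)

lemma taylor_remainder_bound:
  assumes f: "f holomorphic_on ball 0 R" and r: "0 < r" "r < R" and M: "\<And>u. u \<in> ball 0 R \<Longrightarrow> norm (f u) \<le> M"
  shows "norm ((deriv ^^ k) f 0 / fact k) \<le> M / r ^ k"
    and "norm h \<le> r / 2 \<Longrightarrow> norm (f h - (\<Sum>k\<le>m. (deriv ^^ k) f 0 / fact k * h ^ k)) \<le> 2 * M * (norm h / r) ^ Suc m"
proof -
  define a where "a = (\<lambda>k. (deriv ^^ k) f 0 / fact k)"
  have sub: "cball 0 r \<subseteq> ball 0 R" using r by auto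
  have M0: "M \<ge> 0" using M[of 0] r order_trans[OF norm_ge_zero] by force
  have ak: "norm (a k) \<le> M / r ^ k" for k
  proof -
    have "norm ((deriv ^^ k) f 0) \<le> fact k * M / r ^ k"
    proof (rule Cauchy_inequality)
      show "f holomorphic_on ball 0 r" "continuous_on (cball 0 r) f"
        using sub r by (auto intro!: holomorphic_on_subset[OF f] continuous_on_subset[OF holomorphic_on_imp_continuous_on[OF f]])
      show "norm (f x) \<le> M" if "norm (0 - x) = r" for x using that M r by simp
    qed (use r in auto)
    then show ?thesis by (simp add: a_def norm_divide field_simps)
  qed
  then show "norm ((deriv ^^ k) f 0 / fact k) \<le> M / r ^ k" by (simp add: a_def)
  assume h: "norm h \<le> r / 2"
  define q where "q = norm h / r"
  have q: "0 \<le> q" "q \<le> 1/2" using h r by (auto simp: q_def field_simps)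
  have "(\<lambda>n. a n * (h - 0) ^ n) sums f h" unfolding a_def
    by (rule holomorphic_power_series[OF f]) (use h r in auto)
  then have "(\<lambda>n. a (n + Suc m) * h ^ (n + Suc m)) sums (f h - (\<Sum>k<Suc m. a k * h ^ k))"
    by (intro sums_split_initial_segment) simp
  then have s: "(\<lambda>n. a (n + Suc m) * h ^ (n + Suc m)) sums (f h - (\<Sum>k\<le>m. a k * h ^ k))"
    by (simp only: lessThan_Suc_atMost)
  have t: "norm (a (n + Suc m) * h ^ (n + Suc m)) \<le> M * q ^ Suc m * q ^ n" for n
  proof -
    have "norm (a (n + Suc m) * h ^ (n + Suc m)) \<le> (M / r ^ (n + Suc m)) * norm h ^ (n + Suc m)"
      unfolding norm_mult norm_power by (rule mult_right_mono[OF ak]) simp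
    also have "\<dots> = M * q ^ (n + Suc m)" by (simp add: q_def power_divide)
    finally show ?thesis by (simp only: power_add mult_ac)
  qed
  have gs: "(\<lambda>n. M * q ^ Suc m * q ^ n) sums (M * q ^ Suc m * (1 / (1 - q)))"
    using geometric_sums[of q] q by (intro sums_mult) auto
  have "norm (f h - (\<Sum>k\<le>m. a k * h ^ k)) \<le> M * q ^ Suc m * (1 / (1 - q))"
    using norm_suminf_le[OF t sums_summable[OF gs]] by (simp only: sums_unique[OF s, symmetric] sums_unique[OF gs, symmetric])
  also have "\<dots> \<le> M * q ^ Suc m * 2" using q M0 by (intro mult_left_mono) (auto simp: field_simps)
  finally show "norm (f h - (\<Sum>k\<le>m. (deriv ^^ k) f 0 / fact k * h ^ k)) \<le> 2 * M * (norm h / r) ^ Suc m"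
    by (simp add: a_def q_def mult_ac)
qed

text \<open>By induction on \<open>m\<close>: the coefficient is the limit of the Taylor remainder
  of order \<open>m\<close> divided by \<open>h^m\<close> as \<open>h\<close> tends to 0, uniformly
  in \<open>s\<close> thanks to the common bound \<open>M\<close>. Separate holomorphy together with
  that bound carries the argument.\<close>

lemma taylor_coeff_holomorphic:
  assumes S: "open S" and R: "R > 0"
    and hs: "\<And>u. u \<in> ball 0 R \<Longrightarrow> (\<lambda>s. F s u) holomorphic_on S"
    and hu: "\<And>s. s \<in> S \<Longrightarrow> F s holomorphic_on ball 0 R"
    and M: "\<And>s u. s \<in> S \<Longrightarrow> u \<in> ball 0 R \<Longrightarrow> norm (F s u) \<le> M"
  shows "(\<lambda>s. (deriv ^^ m) (F s) 0 / fact m) holomorphic_on S"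
proof (induction m rule: less_induct)
  case (less m)
  define a where "a = (\<lambda>k s. (deriv ^^ k) (F s) 0 / fact k)"
  define r where "r = R / 2"
  define h where "h = (\<lambda>n. r / (2 * (real n + 1)))"
  have r: "0 < r" "r < R" using R by (auto simp: r_def)
  have h: "0 < h n" "h n \<le> r / 2" for n using r by (auto simp: h_def field_simps)
  define g where "g = (\<lambda>n s. (F s (of_real (h n)) - (\<Sum>k<m. a k s * of_real (h n) ^ k)) / of_real (h n) ^ m)"
  have est: "norm (g n s - a m s) \<le> (2 * M / r ^ Suc m) * h n" if s: "s \<in> S" for n s
  proof -
    have "F s (of_real (h n)) - (\<Sum>k\<le>m. a k s * of_real (h n) ^ k) = (g n s - a m s) * of_real (h n) ^ m"
      using h(1)[of n] by (simp add: g_def field_simps flip: lessThan_Suc_atMost)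
    then have "norm (g n s - a m s) * h n ^ m = norm (F s (of_real (h n)) - (\<Sum>k\<le>m. a k s * of_real (h n) ^ k))"
      using h(1)[of n] by (simp add: norm_mult norm_power)
    also have "\<dots> \<le> 2 * M * (norm (complex_of_real (h n)) / r) ^ Suc m"
      unfolding a_def using hu[OF s] r M[OF s] h[of n] by (intro taylor_remainder_bound(2)) auto
    also have "\<dots> = ((2 * M / r ^ Suc m) * h n) * h n ^ m" using h(1)[of n] by (simp add: power_divide)
    finally show ?thesis by (rule mult_right_le_imp_le) (use h(1)[of n] in simp)
  qed
  have lim: "uniform_limit S g (a m) sequentially"
  proof (rule uniform_limitI)
    fix e :: real assume e: "e > 0"
    have "(\<lambda>n. (2 * M / r ^ Suc m) * h n) \<longlonglongrightarrow> 0" unfolding h_def by real_asymp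
    then have "\<forall>\<^sub>F n in sequentially. (2 * M / r ^ Suc m) * h n < e" using e by (rule order_tendstoD(2))
    then show "\<forall>\<^sub>F n in sequentially. \<forall>s\<in>S. dist (g n s) (a m s) < e"
    proof eventually_elim
      case (elim n)
      show ?case unfolding dist_norm using est[of _ n] elim by (meson le_less_trans)
    qed
  qed
  have "a m holomorphic_on S"
  proof (rule holomorphic_uniform_sequence[OF S])
    show "g n holomorphic_on S" for n unfolding g_def
    proof (intro holomorphic_on_divide holomorphic_on_diff holomorphic_on_sum holomorphic_on_mult holomorphic_on_const hs)
      show "a k holomorphic_on S" if "k \<in> {..<m}" for k using less.IH that by (simp add: a_def)
    qed (use h(1)[of n] h(2)[of n] r in auto)
    show "\<exists>d>0. cball x d \<subseteq> S \<and> uniform_limit (cball x d) g (a m) sequentially" if x: "x \<in> S" for x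
    proof -
      obtain d where "d > 0" "cball x d \<subseteq> S" using S x open_contains_cball[of S] by blast
      then show ?thesis using uniform_limit_on_subset[OF lim] by auto
    qed
  qed
  then show ?case by (simp add: a_def)
qed

text \<open>There are \<open>card A ^ k\<close> words of length \<open>k\<close>, so the sum is
  dominated by the geometric series of ratio 1/2.\<close>

lemma sum_lists_geometric:
  fixes q :: real
  assumes A: "finite A" and q: "q \<ge> 0" "card A * q \<le> 1 / 2"
  shows "(\<Sum>l\<in>{l\<in>lists A. length l < n}. q ^ length l) \<le> 2"
proof -
  let ?S = "{l\<in>lists A. length l < n}"
  have fin: "finite ?S"
    by (rule finite_subset[OF _ finite_lists_length_le[OF A, of n]]) auto
  have "(\<Sum>l\<in>?S. q ^ length l) = (\<Sum>k<n. \<Sum>l\<in>{l\<in>?S. length l = k}. q ^ length l)"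
    by (rule sum.group[symmetric]) (use fin in auto)
  also have "\<dots> = (\<Sum>k<n. (card A * q) ^ k)"
  proof (rule sum.cong[OF refl])
    fix k assume "k \<in> {..<n}"
    then have "{l\<in>?S. length l = k} = {l. set l \<subseteq> A \<and> length l = k}" by auto
    moreover have "(\<Sum>l\<in>{l. set l \<subseteq> A \<and> length l = k}. q ^ length l) = (card A * q) ^ k"
      by (simp add: card_lists_length_eq[OF A] power_mult_distrib)
    ultimately show "(\<Sum>l\<in>{l\<in>?S. length l = k}. q ^ length l) = (card A * q) ^ k" by simp
  qed
  also have "\<dots> \<le> (\<Sum>k<n. (1/2) ^ k)" using q by (intro sum_mono power_mono) auto
  also have "\<dots> \<le> 2" by (simp add: sum_gp_strict)
  finally show ?thesis .
qed

lemma summable_on_lists_geometric: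
  fixes q :: real
  assumes A: "finite A" and q: "q \<ge> 0" "card A * q \<le> 1 / 2"
  shows "(\<lambda>l. q ^ length l) summable_on lists A"
proof (rule nonneg_bdd_above_summable_on)
  show "bdd_above (sum (\<lambda>l. q ^ length l) ` {F. F \<subseteq> lists A \<and> finite F})"
  proof (rule bdd_aboveI2[where M = 2])
    fix F assume F: "F \<in> {F. F \<subseteq> lists A \<and> finite F}"
    define n where "n = Suc (Max (insert 0 (length ` F)))"
    have "length l < n" if "l \<in> F" for l using F that by (auto simp: n_def less_Suc_eq_le intro!: Max_ge)
    then have "sum (\<lambda>l. q ^ length l) F \<le> (\<Sum>l\<in>{l\<in>lists A. length l < n}. q ^ length l)"
      using F q by (intro sum_mono2 finite_subset[OF _ finite_lists_length_le[OF A, of n]]) auto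
    then show "sum (\<lambda>l. q ^ length l) F \<le> 2" using sum_lists_geometric[OF assms, of n] by linarith
  qed
qed (use q in auto)

text \<open>Words take the place of multi-indices because a monomial will become an iterated
  convolution, one letter at a time. Each monomial is represented by the single word whose letters
  are grouped in the order of \<open>vs\<close>; every other word has coefficient 0. The induction
  splits off one variable. The clause comparing \<open>\<theta>\<close> and \<open>\<theta>'\<close>
  later transfers periodicity to the coefficients.\<close>

lemma taylor_lists:
  fixes F :: "complex \<Rightarrow> ('v \<Rightarrow> complex) \<Rightarrow> complex" and q :: real
  assumes T: "open T" and r: "0 < r" "r < R" and q: "0 \<le> q" "length vs * q \<le> 1 / 2" "q \<le> 1"
    and vs: "distinct vs"
    and ht: "\<And>z. (\<And>v. z v \<in> ball 0 R) \<Longrightarrow> (\<lambda>\<theta>. F \<theta> z) holomorphic_on T"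
    and hz: "\<And>z \<theta> v. \<theta> \<in> T \<Longrightarrow> v \<in> set vs \<Longrightarrow> (\<And>v. z v \<in> ball 0 R) \<Longrightarrow> (\<lambda>s. F \<theta> (z(v := s))) holomorphic_on ball 0 R"
    and M: "\<And>z \<theta>. \<theta> \<in> T \<Longrightarrow> (\<And>v. z v \<in> ball 0 R) \<Longrightarrow> norm (F \<theta> z) \<le> M" and M0: "M \<ge> 0"
  shows "\<exists>c. (\<forall>l. c l holomorphic_on T) \<and> (\<forall>l. \<forall>\<theta>\<in>T. norm (c l \<theta>) \<le> M / r ^ length l) \<and>
     (\<forall>\<theta> \<theta>'. F \<theta> = F \<theta>' \<longrightarrow> (\<forall>l. c l \<theta> = c l \<theta>')) \<and>
     (\<forall>\<theta>\<in>T. \<forall>z. (\<forall>v. norm (z v) \<le> q * r) \<and> (\<forall>v. v \<notin> set vs \<longrightarrow> z v = 0) \<longrightarrow>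
        ((\<lambda>l. c l \<theta> * prod_list (map z l)) has_sum F \<theta> z) (lists (set vs)))"
  using assms(5,7-)
proof (induction vs arbitrary: F M)
  case Nil
  have "((\<lambda>l. F \<theta> (\<lambda>_. 0) * prod_list (map z l)) has_sum F \<theta> z) (lists (set []))" if "\<forall>v. z v = 0" for z \<theta>
  proof -
    have "z = (\<lambda>_. 0)" using that by auto
    then show ?thesis by (simp add: has_sum_finite_iff)
  qed
  note sum = this
  let ?c = "\<lambda>l \<theta>. if l = [] then F \<theta> (\<lambda>_. 0) else 0"
  have R: "\<And>v::'v. (\<lambda>_. 0::complex) v \<in> ball 0 R" using r by simp
  show ?case
  proof (intro exI[of _ ?c] conjI allI ballI impI)
    show "?c l holomorphic_on T" for l
      using Nil.prems(3)[OF R] by (cases "l = []") auto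
    show "norm (?c l \<theta>) \<le> M / r ^ length l" if "\<theta> \<in> T" for l \<theta>
      using Nil.prems(5)[OF that R] Nil.prems(6) r by (cases "l = []") auto
    show "((\<lambda>l. ?c l \<theta> * prod_list (map z l)) has_sum F \<theta> z) (lists (set []))"
      if "(\<forall>v. norm (z v) \<le> q * r) \<and> (\<forall>v. v \<notin> set [] \<longrightarrow> z v = 0)" for \<theta> z
      using that by (intro has_sum_cong[THEN iffD1, OF _ sum[of z \<theta>]]) auto
  qed simp
next
  case (Cons v vs)
  define a where "a = (\<lambda>m \<theta> z. (deriv ^^ m) (\<lambda>s. F \<theta> (z(v := s))) 0 / fact m)"
  have R: "R > 0" using r by simp
  have v: "v \<notin> set vs" "distinct vs" using Cons.prems(2) by auto
  have upd: "(z(v := u)) w \<in> ball 0 R" if "\<And>v. z v \<in> ball 0 R" "u \<in> ball 0 R" for z :: "'v \<Rightarrow> complex" and u v w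
    using that by auto
  have len: "length vs * q \<le> 1 / 2" using Cons.prems(1) q by (simp add: distrib_right)
  have a_ht: "(\<lambda>\<theta>. a m \<theta> z) holomorphic_on T" if z: "\<And>v. z v \<in> ball 0 R" for m z
    unfolding a_def
  proof (rule taylor_coeff_holomorphic[OF T R, where F = "\<lambda>\<theta> u. F \<theta> (z(v := u))" and M = M])
    show "(\<lambda>s. F s (z(v := u))) holomorphic_on T" if "u \<in> ball 0 R" for u
      by (rule Cons.prems(3)) (rule upd[OF z that])
    show "(\<lambda>u. F s (z(v := u))) holomorphic_on ball 0 R" if "s \<in> T" for s
      by (rule Cons.prems(4)[OF that _ z]) simp
    show "norm (F s (z(v := u))) \<le> M" if "s \<in> T" "u \<in> ball 0 R" for s u
      by (rule Cons.prems(5)[OF that(1)]) (rule upd[OF z that(2)])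
  qed
  have a_hz: "(\<lambda>s. a m \<theta> (z(w := s))) holomorphic_on ball 0 R"
    if \<theta>: "\<theta> \<in> T" and w: "w \<in> set vs" and z: "\<And>v. z v \<in> ball 0 R" for m z \<theta> w
  proof -
    have wv: "w \<noteq> v" using w v by auto
    show ?thesis unfolding a_def
    proof (rule taylor_coeff_holomorphic[OF open_ball R, where F = "\<lambda>s u. F \<theta> (z(w := s, v := u))" and M = M])
      show "(\<lambda>s. F \<theta> (z(w := s, v := u))) holomorphic_on ball 0 R" if "u \<in> ball 0 R" for u
        unfolding fun_upd_twist[OF wv] using w by (intro Cons.prems(4)[OF \<theta>] upd z that) auto
      show "(\<lambda>u. F \<theta> (z(w := s, v := u))) holomorphic_on ball 0 R" if "s \<in> ball 0 R" for s
        by (intro Cons.prems(4)[OF \<theta>] upd z that) auto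
      show "norm (F \<theta> (z(w := s, v := u))) \<le> M" if "s \<in> ball 0 R" "u \<in> ball 0 R" for s u
        by (intro Cons.prems(5)[OF \<theta>] upd z that)
    qed
  qed
  have a_M: "norm (a m \<theta> z) \<le> M / r ^ m" if \<theta>: "\<theta> \<in> T" and z: "\<And>v. z v \<in> ball 0 R" for m z \<theta>
    unfolding a_def
  proof (rule taylor_remainder_bound(1)[OF _ r])
    show "(\<lambda>u. F \<theta> (z(v := u))) holomorphic_on ball 0 R"
      by (rule Cons.prems(4)[OF \<theta> _ z]) simp
    show "norm (F \<theta> (z(v := u))) \<le> M" if "u \<in> ball 0 R" for u
      by (rule Cons.prems(5)[OF \<theta>]) (rule upd[OF z that])
  qed
  have "\<forall>m. \<exists>c. (\<forall>l. c l holomorphic_on T) \<and> (\<forall>l. \<forall>\<theta>\<in>T. norm (c l \<theta>) \<le> (M / r ^ m) / r ^ length l) \<and>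
     (\<forall>\<theta> \<theta>'. a m \<theta> = a m \<theta>' \<longrightarrow> (\<forall>l. c l \<theta> = c l \<theta>')) \<and>
     (\<forall>\<theta>\<in>T. \<forall>z. (\<forall>v. norm (z v) \<le> q * r) \<and> (\<forall>v. v \<notin> set vs \<longrightarrow> z v = 0) \<longrightarrow>
        ((\<lambda>l. c l \<theta> * prod_list (map z l)) has_sum a m \<theta> z) (lists (set vs)))"
    by (intro allI Cons.IH[OF len v(2)] a_ht a_hz a_M) (use Cons.prems(6) r in auto)
  from choice[OF this] obtain c where cc: "\<forall>m. (\<forall>l. c m l holomorphic_on T) \<and> (\<forall>l. \<forall>\<theta>\<in>T. norm (c m l \<theta>) \<le> (M / r ^ m) / r ^ length l) \<and>
     (\<forall>\<theta> \<theta>'. a m \<theta> = a m \<theta>' \<longrightarrow> (\<forall>l. c m l \<theta> = c m l \<theta>')) \<and>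
     (\<forall>\<theta>\<in>T. \<forall>z. (\<forall>v. norm (z v) \<le> q * r) \<and> (\<forall>v. v \<notin> set vs \<longrightarrow> z v = 0) \<longrightarrow>
        ((\<lambda>l. c m l \<theta> * prod_list (map z l)) has_sum a m \<theta> z) (lists (set vs)))" ..
  have c: "\<And>m l. c m l holomorphic_on T"
     "\<And>m l \<theta>. \<theta> \<in> T \<Longrightarrow> norm (c m l \<theta>) \<le> (M / r ^ m) / r ^ length l"
     "\<And>m l \<theta> \<theta>'. a m \<theta> = a m \<theta>' \<Longrightarrow> c m l \<theta> = c m l \<theta>'"
     "\<And>m \<theta> z. \<theta> \<in> T \<Longrightarrow> (\<forall>v. norm (z v) \<le> q * r) \<Longrightarrow> (\<forall>v. v \<notin> set vs \<longrightarrow> z v = 0) \<Longrightarrow>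
        ((\<lambda>l. c m l \<theta> * prod_list (map z l)) has_sum a m \<theta> z) (lists (set vs))"
    using cc by blast+
  define pre where "pre = (\<lambda>l. length (takeWhile ((=) v) l))"
  define suf where "suf = (\<lambda>l. dropWhile ((=) v) l)"
  \<comment> \<open>A word can carry a coefficient only if all its letters \<open>v\<close> come
    first: then \<open>pre\<close> is the exponent of \<open>v\<close> and \<open>suf\<close> the
    word in the remaining variables.\<close>
  define d where "d = (\<lambda>l \<theta>. if v \<in> set (suf l) then 0 else c (pre l) (suf l) \<theta>)"
  have len_l: "pre l + length (suf l) = length l" for l
    unfolding pre_def suf_def by (metis length_append takeWhile_dropWhile_id)
  let ?h = "\<lambda>(m, l). replicate m v @ l"
  have ps: "pre (replicate m v @ l) = m" "suf (replicate m v @ l) = l" if "v \<notin> set l" for m l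
  proof -
    have t: "takeWhile ((=) v) l = []" "dropWhile ((=) v) l = l" using that by (cases l; auto)+
    show "pre (replicate m v @ l) = m" "suf (replicate m v @ l) = l"
      unfolding pre_def suf_def by (induction m) (auto simp: t)
  qed
  have vl: "v \<notin> set l" if "l \<in> lists (set vs)" for l using that v by auto
  have inj: "inj_on ?h (UNIV \<times> lists (set vs))"
    by (rule inj_on_inverseI[where g = "\<lambda>l. (pre l, suf l)"]) (use v in \<open>auto intro!: ps\<close>)
  have img: "?h ` (UNIV \<times> lists (set vs)) \<subseteq> lists (set (v # vs))" by auto
  have rest: "d l = (\<lambda>_. 0)" if l: "l \<in> lists (set (v # vs)) - ?h ` (UNIV \<times> lists (set vs))" for l
  proof (rule ccontr)
    assume "d l \<noteq> (\<lambda>_. 0)"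
    then have n: "v \<notin> set (suf l)" by (auto simp: d_def)
    have "set (suf l) \<subseteq> set l" unfolding suf_def by (meson set_dropWhileD subsetI)
    then have sl: "suf l \<in> lists (set vs)" using n l by auto
    have "l = takeWhile ((=) v) l @ suf l" by (simp add: suf_def)
    moreover have "takeWhile ((=) v) l = replicate (pre l) v"
      unfolding pre_def by (metis (mono_tags, lifting) replicate_eqI set_takeWhileD)
    ultimately have "l = ?h (pre l, suf l)" by simp
    then show False using l sl by blast
  qed
  show ?case
  proof (intro exI[of _ d] conjI allI ballI impI)
    show "d l holomorphic_on T" for l using c(1)[of "pre l" "suf l"] unfolding d_def by (cases "v \<in> set (suf l)") simp_all
  next
    fix l \<theta> assume "\<theta> \<in> T"
    then have "norm (c (pre l) (suf l) \<theta>) \<le> (M / r ^ pre l) / r ^ length (suf l)" by (rule c(2))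
    also have "\<dots> = M / r ^ length l" by (simp add: len_l[of l, symmetric] power_add)
    finally show "norm (d l \<theta>) \<le> M / r ^ length l" using Cons.prems(6) r by (auto simp: d_def)
  next
    fix \<theta> \<theta>' l assume "F \<theta> = F \<theta>'"
    then have "a m \<theta> = a m \<theta>'" for m unfolding a_def by simp
    from c(3)[OF this] show "d l \<theta> = d l \<theta>'" unfolding d_def by (simp only:)
  next
    fix \<theta> and z :: "'v \<Rightarrow> complex" assume \<theta>: "\<theta> \<in> T" and z: "(\<forall>v. norm (z v) \<le> q * r) \<and> (\<forall>w. w \<notin> set (v # vs) \<longrightarrow> z w = 0)"
    have qr: "q * r \<le> r" "0 \<le> q * r" using q r by (auto simp: mult_left_le_one_le)
    have zb: "z w \<in> ball 0 R" for w
    proof -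
      have "norm (z w) \<le> q * r" using z by blast
      then have "norm (z w) < R" using qr r by linarith
      then show ?thesis by simp
    qed
    define z' where "z' = z(v := 0)"
    have z': "\<forall>v. norm (z' v) \<le> q * r" "\<forall>w. w \<notin> set vs \<longrightarrow> z' w = 0"
      using z qr by (auto simp: z'_def)
    have hv: "(\<lambda>s. F \<theta> (z(v := s))) holomorphic_on ball 0 R"
      by (rule Cons.prems(4)[where z = z, OF \<theta>]) (use zb in auto)
    have "(\<lambda>m. a m \<theta> z' * (z v - 0) ^ m) sums F \<theta> (z(v := z v))"
      unfolding a_def z'_def fun_upd_upd
      by (rule holomorphic_power_series[OF hv]) (use zb in auto)
    then have sums: "(\<lambda>m. a m \<theta> z' * z v ^ m) sums F \<theta> z" by simp
    have nt: "norm (d l \<theta> * prod_list (map z l)) \<le> M * q ^ length l" for l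
    proof -
      have "norm (prod_list (map z l)) \<le> (q * r) ^ length l"
        using z qr by (induction l) (auto simp: norm_mult intro!: mult_mono)
      moreover have "norm (d l \<theta>) \<le> M / r ^ length l"
        using c(2)[OF \<theta>, of "pre l" "suf l"] Cons.prems(6) r by (auto simp: d_def power_add len_l[of l, symmetric])
      ultimately have "norm (d l \<theta> * prod_list (map z l)) \<le> (M / r ^ length l) * (q * r) ^ length l"
        unfolding norm_mult using Cons.prems(6) r by (intro mult_mono) auto
      then show ?thesis using r by (simp add: power_mult_distrib)
    qed
    have card: "card (set (v # vs)) * q \<le> 1 / 2" using Cons.prems(1,2) by (simp add: distinct_card)
    have summ: "(\<lambda>l. d l \<theta> * prod_list (map z l)) summable_on lists (set (v # vs))"
      by (rule norm_summable_on[OF summable_on_cmult_right[OF summable_on_lists_geometric[OF _ q(1) card]] nt]) simp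
    have dl: "d (?h (m, l)) \<theta> * prod_list (map z (?h (m, l))) = z v ^ m * (c m l \<theta> * prod_list (map z' l))"
      if "l \<in> lists (set vs)" for m l
    proof -
      have "map z' l = map z l" using vl[OF that] by (auto simp: z'_def)
      then have "prod_list (map z' l) = prod_list (map z l)" by (rule arg_cong)
      then show ?thesis using ps[OF vl[OF that], of m] vl[OF that] by (simp add: d_def prod_list_replicate)
    qed
    have "((\<lambda>p. d (?h p) \<theta> * prod_list (map z (?h p))) has_sum F \<theta> z) (UNIV \<times> lists (set vs))"
    proof (rule has_sum_SigmaI[where g = "\<lambda>m. z v ^ m * a m \<theta> z'"])
      fix m :: nat
      have "((\<lambda>l. z v ^ m * (c m l \<theta> * prod_list (map z' l))) has_sum z v ^ m * a m \<theta> z') (lists (set vs))"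
        by (intro has_sum_cmult_right c(4)[OF \<theta>] z')
      then show "((\<lambda>y. d (?h (m, y)) \<theta> * prod_list (map z (?h (m, y)))) has_sum z v ^ m * a m \<theta> z') (lists (set vs))"
        by (rule has_sum_cong[THEN iffD2, rotated]) (rule dl)
    next
      have "norm (z v ^ m * a m \<theta> z') \<le> M * (1/2) ^ m" for m
      proof -
        have "q * 1 \<le> q * real (length (v # vs))" using q by (intro mult_left_mono) auto
        then have "q \<le> 1 / 2" using Cons.prems(1) by (simp only: mult.commute mult_1_right)
        then have "q * r \<le> 1 / 2 * r" using r by (intro mult_right_mono) auto
        moreover have "norm (z v) \<le> q * r" using z by blast
        ultimately have "norm (z v) \<le> r / 2" by linarith
        moreover have "norm (a m \<theta> z') \<le> M / r ^ m" unfolding z'_def by (rule a_M[OF \<theta>]) (use zb R in auto)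
        ultimately have "norm (z v) ^ m * norm (a m \<theta> z') \<le> (r / 2) ^ m * (M / r ^ m)"
          using r by (intro mult_mono power_mono) auto
        also have "\<dots> = M * (1/2) ^ m" using r by (simp add: power_divide)
        finally show ?thesis by (simp add: norm_mult norm_power)
      qed
      note nb = this
      have "summable (\<lambda>m. M * (1/2) ^ m)" by (rule summable_mult[OF summable_geometric]) simp
      then have "summable (\<lambda>m. norm (z v ^ m * a m \<theta> z'))"
        by (rule summable_comparison_test') (use nb in simp)
      then show "((\<lambda>m. z v ^ m * a m \<theta> z') has_sum F \<theta> z) UNIV"
        by (rule norm_summable_imp_has_sum) (use sums in \<open>simp add: mult.commute\<close>)
    next
      have "(\<lambda>l. d l \<theta> * prod_list (map z l)) summable_on ?h ` (UNIV \<times> lists (set vs))"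
        using summ img by (rule summable_on_subset_banach)
      then show "(\<lambda>p. d (?h p) \<theta> * prod_list (map z (?h p))) summable_on UNIV \<times> lists (set vs)"
        by (subst (asm) summable_on_reindex[OF inj]) (simp add: o_def)
    qed
    then have "((\<lambda>l. d l \<theta> * prod_list (map z l)) has_sum F \<theta> z) (?h ` (UNIV \<times> lists (set vs)))"
      by (subst has_sum_reindex[OF inj]) (simp add: o_def)
    then show "((\<lambda>l. d l \<theta> * prod_list (map z l)) has_sum F \<theta> z) (lists (set (v # vs)))"
    proof (rule has_sum_cong_neutral[THEN iffD1, rotated -1])
      show "d l \<theta> * prod_list (map z l) = 0" if "l \<in> lists (set (v # vs)) - ?h ` (UNIV \<times> lists (set vs))" for l
        using rest[OF that] by simp
      show "d l \<theta> * prod_list (map z l) = 0" if "l \<in> ?h ` (UNIV \<times> lists (set vs)) - lists (set (v # vs))" for l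
        using img that by blast
    qed simp
  qed
qed

section \<open>Fourier series on a strip\<close>

definition fcoef :: "(complex \<Rightarrow> complex) \<Rightarrow> int \<Rightarrow> complex" where
  "fcoef g \<alpha> = integral {0..2 * pi} (\<lambda>t. g (of_real t) * exp (- \<i> * of_int \<alpha> * of_real t)) / (2 * of_real pi)"

definition strip_periodic :: "real \<Rightarrow> (complex \<Rightarrow> complex) \<Rightarrow> bool" where
  "strip_periodic \<zeta> g \<longleftrightarrow> g holomorphic_on strip \<zeta> \<and> (\<forall>\<theta>\<in>strip \<zeta>. g (\<theta> + 2 * of_real pi) = g \<theta>)"

lemma open_strip: "open (strip \<zeta>)" and convex_strip: "convex (strip \<zeta>)"
proof -
  have e: "strip \<zeta> = Im -` {-\<zeta><..<\<zeta>}" by (auto simp: strip_def)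
  show "open (strip \<zeta>)" unfolding e by (intro continuous_open_vimage) (auto intro!: continuous_intros)
  show "convex (strip \<zeta>)" unfolding e by (intro convex_linear_vimage) (auto simp: bounded_linear.linear bounded_linear_Im)
qed

lemma exp_ii_periodic: "exp (\<i> * of_int \<alpha> * (\<theta> + 2 * of_real pi)) = exp (\<i> * of_int \<alpha> * \<theta>)"
proof -
  have "exp (\<i> * of_int \<alpha> * (\<theta> + 2 * of_real pi)) = exp (\<i> * of_int \<alpha> * \<theta> + 2 * of_int \<alpha> * of_real pi * \<i>)"
    by (simp add: algebra_simps)
  then show ?thesis using exp_integer_2pi[of "of_int \<alpha>"] by (simp add: exp_add)
qed

lemma strip_periodic_mult_exp:
  assumes "strip_periodic \<zeta> g"
  shows "strip_periodic \<zeta> (\<lambda>\<theta>. g \<theta> * exp (\<i> * of_int \<alpha> * \<theta>))"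
  using assms exp_ii_periodic[of \<alpha>] by (auto simp: strip_periodic_def intro!: holomorphic_intros)

lemma strip_continuous:
  assumes "strip_periodic \<zeta> g" "\<bar>Im a\<bar> < \<zeta>"
  shows "continuous_on S (\<lambda>t. g (of_real t + a))"
proof -
  have "continuous_on (strip \<zeta>) g" using assms by (auto simp: strip_periodic_def intro: holomorphic_on_imp_continuous_on)
  then show ?thesis by (rule continuous_on_compose2) (use assms in \<open>auto simp: strip_def intro!: continuous_intros\<close>)
qed

text \<open>With a primitive \<open>G\<close> of \<open>g\<close>, the integral over a period
  starting at \<open>z\<close> is \<open>G (z + 2 pi) - G z\<close>, which has derivative 0 by
  periodicity.\<close>

lemma periodic_integral_shift:
  assumes g: "strip_periodic \<zeta> g" and a: "\<bar>Im a\<bar> < \<zeta>"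
  shows "integral {0..2 * pi} (\<lambda>t. g (of_real t + a)) = integral {0..2 * pi} (\<lambda>t. g (of_real t))"
proof -
  have hol: "g holomorphic_on strip \<zeta>" and per: "\<And>\<theta>. \<theta> \<in> strip \<zeta> \<Longrightarrow> g (\<theta> + 2 * of_real pi) = g \<theta>"
    using g by (auto simp: strip_periodic_def)
  obtain G where G: "\<And>x. x \<in> strip \<zeta> \<Longrightarrow> (G has_field_derivative g x) (at x)"
    using holomorphic_convex_primitive'[OF convex_strip open_strip hol] by (metis at_within_open open_strip)
  have int: "integral {0..2 * pi} (\<lambda>t. g (of_real t + z)) = G (z + 2 * of_real pi) - G z" if z: "z \<in> strip \<zeta>" for z
  proof -
    have "((\<lambda>t. 1 * g (z + of_real t * 1)) has_integral G (z + of_real (2 * pi) * 1) - G (z + of_real 0 * 1)) {0..2 * pi}"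
    proof (rule fundamental_theorem_of_calculus)
      fix t :: real
      have "z + of_real t * 1 \<in> strip \<zeta>" using z by (simp add: strip_def)
      from DERIV_along_line[OF G[OF this]]
      show "((\<lambda>t. G (z + of_real t * 1)) has_vector_derivative 1 * g (z + of_real t * 1)) (at t within {0..2 * pi})" .
    qed simp
    from integral_unique[OF this] show ?thesis by (simp add: add.commute)
  qed
  have "((\<lambda>z. G (z + 2 * of_real pi) - G z) has_field_derivative 0) (at z within strip \<zeta>)" if z: "z \<in> strip \<zeta>" for z
  proof -
    have z2: "z + 2 * of_real pi \<in> strip \<zeta>" using z by (simp add: strip_def)
    have "((\<lambda>z. G (z + 2 * of_real pi)) has_field_derivative g (z + 2 * of_real pi) * 1) (at z)"
      by (rule DERIV_chain2[where f = G and g = "\<lambda>z. z + 2 * of_real pi", OF G[OF z2]]) (auto intro!: derivative_eq_intros)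
    from DERIV_diff[OF this G[OF z]] show ?thesis using per[OF z] by (auto intro: has_field_derivative_at_within)
  qed
  from has_field_derivative_zero_constant[OF convex_strip this]
  obtain k where k: "z \<in> strip \<zeta> \<Longrightarrow> G (z + 2 * of_real pi) - G z = k" for z by auto
  have s: "a \<in> strip \<zeta>" "0 \<in> strip \<zeta>" using a by (auto simp: strip_def)
  show ?thesis using int[OF s(1)] int[OF s(2)] k[OF s(1)] k[OF s(2)] by simp
qed

lemma fcoef_shift:
  assumes g: "strip_periodic \<zeta> g" and a: "\<bar>Im a\<bar> < \<zeta>"
  shows "fcoef (\<lambda>t. g (t + a)) \<alpha> = fcoef g \<alpha> * exp (\<i> * of_int \<alpha> * a)"
proof -
  have "integral {0..2 * pi} (\<lambda>t. g (of_real t + a) * exp (\<i> * of_int (- \<alpha>) * (of_real t + a))) =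
     integral {0..2 * pi} (\<lambda>t. g (of_real t) * exp (\<i> * of_int (- \<alpha>) * of_real t))"
    using periodic_integral_shift[OF strip_periodic_mult_exp[OF g, of "- \<alpha>"] a] .
  moreover have "(\<lambda>t. g (of_real t + a) * exp (- \<i> * of_int \<alpha> * of_real t)) =
     (\<lambda>t. (g (of_real t + a) * exp (\<i> * of_int (- \<alpha>) * (of_real t + a))) * exp (\<i> * of_int \<alpha> * a))"
  proof
    fix t
    have "exp (- \<i> * of_int \<alpha> * of_real t) = exp (\<i> * of_int (- \<alpha>) * (of_real t + a)) * exp (\<i> * of_int \<alpha> * a)"
      by (simp add: exp_add[symmetric] algebra_simps)
    then show "g (of_real t + a) * exp (- \<i> * of_int \<alpha> * of_real t) =
       (g (of_real t + a) * exp (\<i> * of_int (- \<alpha>) * (of_real t + a))) * exp (\<i> * of_int \<alpha> * a)" by simp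
  qed
  ultimately show ?thesis by (simp add: fcoef_def)
qed

lemma fcoef_norm_le:
  assumes "continuous_on {0..2 * pi} (\<lambda>t. g (of_real t))" "\<And>t. t \<in> {0..2 * pi} \<Longrightarrow> norm (g (of_real t)) \<le> M"
  shows "norm (fcoef g \<alpha>) \<le> M"
proof -
  have "norm (integral {0..2 * pi} (\<lambda>t. g (of_real t) * exp (- \<i> * of_int \<alpha> * of_real t))) \<le> M * (2 * pi - 0)"
    by (rule integral_bound) (use assms in \<open>auto simp: norm_mult intro!: continuous_intros\<close>)
  then show ?thesis by (simp add: fcoef_def norm_divide field_simps)
qed

lemma fcoef_decay:
  assumes g: "strip_periodic \<zeta> g" and z: "0 \<le> \<zeta>'" "\<zeta>' < \<zeta>"
    and M: "\<And>t. t \<in> {0..2 * pi} \<Longrightarrow> norm (g (of_real t + \<i> * of_real \<zeta>')) \<le> M"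
      "\<And>t. t \<in> {0..2 * pi} \<Longrightarrow> norm (g (of_real t - \<i> * of_real \<zeta>')) \<le> M"
  shows "norm (fcoef g \<alpha>) \<le> M * exp (- \<zeta>' * \<bar>real_of_int \<alpha>\<bar>)"
proof -
  \<comment> \<open>The line of integration moves to the side on which
    \<open>exp (\<i> \<alpha> a)\<close> has modulus
    \<open>exp (\<zeta>' \<bar>\<alpha>\<bar>)\<close>.\<close>
  define a where "a = (if \<alpha> \<ge> 0 then - (\<i> * complex_of_real \<zeta>') else \<i> * of_real \<zeta>')"
  have a: "\<bar>Im a\<bar> < \<zeta>" using z by (simp add: a_def)
  have "norm (fcoef (\<lambda>t. g (t + a)) \<alpha>) \<le> M"
    by (rule fcoef_norm_le[OF strip_continuous[OF g a]]) (use M in \<open>auto simp: a_def\<close>)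
  then have "norm (fcoef g \<alpha>) * exp (Re (\<i> * of_int \<alpha> * a)) \<le> M"
    unfolding fcoef_shift[OF g a] norm_mult norm_exp_eq_Re .
  moreover have "Re (\<i> * of_int \<alpha> * a) = \<zeta>' * \<bar>real_of_int \<alpha>\<bar>" by (auto simp: a_def)
  ultimately have "norm (fcoef g \<alpha>) * exp (\<zeta>' * \<bar>real_of_int \<alpha>\<bar>) \<le> M" by simp
  then show ?thesis by (simp add: exp_minus field_simps)
qed

lemma fcoef_const: "fcoef (\<lambda>_. c) \<alpha> = (if \<alpha> = 0 then c else 0)"
proof (cases "\<alpha> = 0")
  case False
  have "((\<lambda>t. 1 * (c * exp (- \<i> * of_int \<alpha> * (0 + of_real t * 1)))) has_integral
    (\<lambda>t. c * exp (- \<i> * of_int \<alpha> * t) / (- \<i> * of_int \<alpha>)) (0 + of_real (2 * pi) * 1) -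
    (\<lambda>t. c * exp (- \<i> * of_int \<alpha> * t) / (- \<i> * of_int \<alpha>)) (0 + of_real 0 * 1)) {0..2 * pi}"
    by (rule fundamental_theorem_of_calculus, simp, rule DERIV_along_line)
       (use False in \<open>auto intro!: derivative_eq_intros\<close>)
  moreover have "exp (- \<i> * of_int \<alpha> * (2 * of_real pi)) = 1"
    using exp_ii_periodic[of "-\<alpha>" 0] by simp
  ultimately show ?thesis using False by (auto simp: fcoef_def dest!: integral_unique)
qed (simp add: fcoef_def scaleR_conv_of_real)

lemma int_symmetric_geometric:
  assumes "0 \<le> q" "(q::real) < 1"
  shows "(\<lambda>\<alpha>::int. q ^ nat \<bar>\<alpha>\<bar>) summable_on UNIV"
proof -
  have n: "(\<lambda>n::nat. q ^ n) summable_on UNIV"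
    using assms by (intro norm_summable_imp_summable_on) (simp add: summable_geometric)
  have 1: "(\<lambda>\<alpha>::int. q ^ nat \<bar>\<alpha>\<bar>) summable_on range int"
    by (subst summable_on_reindex) (use n in \<open>auto simp: o_def\<close>)
  have 2: "(\<lambda>\<alpha>::int. q ^ nat \<bar>\<alpha>\<bar>) summable_on range (\<lambda>n. - int n)"
    by (subst summable_on_reindex) (use n in \<open>auto simp: o_def inj_on_def\<close>)
  have "UNIV = range int \<union> range (\<lambda>n. - int n)"
    by (auto simp: image_iff) (metis int_cases2)
  then show ?thesis using summable_on_union[OF 1 2] by simp
qed

lemma int_symmetric_exp_summable:
  assumes "c > 0"
  shows "(\<lambda>\<alpha>::int. exp (- c * \<bar>real_of_int \<alpha>\<bar>)) summable_on UNIV"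
proof -
  have "exp (- c * \<bar>real_of_int \<alpha>\<bar>) = exp (- c) ^ nat \<bar>\<alpha>\<bar>" for \<alpha>
    by (simp add: exp_of_nat_mult[symmetric] mult.commute)
  then show ?thesis using int_symmetric_geometric[of "exp (- c)"] assms by simp
qed

lemma symmetric_intervals_cofinal: "filterlim (\<lambda>N. {- int N..int N}) (finite_subsets_at_top UNIV) sequentially"
  unfolding filterlim_finite_subsets_at_top
proof safe
  fix X :: "int set" assume X: "finite X"
  show "\<forall>\<^sub>F N in sequentially. finite {- int N..int N} \<and> X \<subseteq> {- int N..int N} \<and> {- int N..int N} \<subseteq> UNIV"
  proof (rule eventually_mono[OF eventually_ge_at_top[of "Max (insert 0 ((\<lambda>x. nat \<bar>x\<bar>) ` X))"]], safe)
    fix N x assume N: "Max (insert 0 ((\<lambda>x. nat \<bar>x\<bar>) ` X)) \<le> N" and x: "x \<in> X"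
    have "nat \<bar>x\<bar> \<le> N" by (rule order_trans[OF Max_ge N]) (use X x in auto)
    then show "x \<in> {- int N..int N}" by auto
  qed auto
qed

lemma strip_periodic_int:
  assumes g: "\<And>\<theta>. \<theta> \<in> strip \<zeta> \<Longrightarrow> g (\<theta> + 2 * of_real pi) = g \<theta>" and t: "\<theta> \<in> strip \<zeta>"
  shows "g (\<theta> + 2 * of_int k * of_real pi) = g \<theta>"
proof (induction k rule: int_induct[of _ 0])
  case (step1 i)
  have "\<theta> + 2 * of_int i * of_real pi \<in> strip \<zeta>" using t by (simp add: strip_def)
  from g[OF this] step1 show ?case by (simp add: algebra_simps)
next
  case (step2 i)
  have "\<theta> + 2 * of_int (i - 1) * of_real pi \<in> strip \<zeta>" using t by (simp add: strip_def)
  from g[OF this] step2 show ?case by (simp add: algebra_simps)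
qed simp

text \<open>The difference quotient of a periodic function is again holomorphic and periodic, which
  reduces the convergence of its Fourier series to a telescoping sum.\<close>

lemma periodic_quotient:
  assumes g: "strip_periodic \<zeta> g" and z: "\<zeta> > 0"
  obtains h where "strip_periodic \<zeta> h" "\<And>t. t \<in> strip \<zeta> \<Longrightarrow> (exp (\<i> * t) - 1) * h t = g t - g 0"
proof
  define h where "h = (\<lambda>t. if exp (\<i> * t) = 1 then deriv g 0 / \<i> else (g t - g 0) / (exp (\<i> * t) - 1))"
  have hol: "g holomorphic_on strip \<zeta>" and per: "\<And>\<theta>. \<theta> \<in> strip \<zeta> \<Longrightarrow> g (\<theta> + 2 * of_real pi) = g \<theta>"
    using g by (auto simp: strip_periodic_def)
  have e1: "exp (\<i> * t) = 1 \<longleftrightarrow> (\<exists>k::int. t = 2 * of_int k * of_real pi)" for t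
  proof
    assume "exp (\<i> * t) = 1"
    then obtain n :: int where "Re (\<i> * t) = 0" "Im (\<i> * t) = of_int (2 * n) * pi" unfolding exp_eq_1 by blast
    then have "t = 2 * of_int n * of_real pi" by (simp add: complex_eq_iff)
    then show "\<exists>k::int. t = 2 * of_int k * of_real pi" ..
  next
    assume "\<exists>k::int. t = 2 * of_int k * of_real pi"
    then obtain k :: int where "t = 2 * of_int k * of_real pi" ..
    then show "exp (\<i> * t) = 1" unfolding exp_eq_1 by (auto intro!: exI[of _ k])
  qed
  have g0: "g (2 * of_int k * of_real pi) = g 0" for k :: int
    using strip_periodic_int[of \<zeta> g 0 k, OF per] z by (simp add: strip_def)
  have hper: "h (t + 2 * of_real pi) = h t" if "t \<in> strip \<zeta>" for t
    using per[OF that] exp_ii_periodic[of 1 t] by (simp add: h_def)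
  \<comment> \<open>Near \<open>0\<close> the function is the quotient of two difference quotients
    with their singularities filled in. The radius 1 keeps out the other zeros of
    \<open>exp (\<i> t) - 1\<close>; periodicity then transports the result to them.\<close>
  have h0: "h holomorphic_on ball 0 (min \<zeta> 1)"
  proof -
    let ?B = "ball 0 (min \<zeta> 1) :: complex set"
    have sub: "?B \<subseteq> strip \<zeta>"
      by (auto simp: strip_def) (meson abs_Im_le_cmod le_less_trans)
    define q1 where "q1 = (\<lambda>t. if t = 0 then deriv g 0 else (g t - g 0) / (t - 0))"
    define q2 where "q2 = (\<lambda>t. if t = 0 then deriv (\<lambda>t. exp (\<i> * t)) 0 else (exp (\<i> * t) - exp (\<i> * 0)) / (t - 0))"
    have "q1 holomorphic_on ?B" unfolding q1_def by (rule pole_lemma_open[OF holomorphic_on_subset[OF hol sub] open_ball])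
    moreover have "q2 holomorphic_on ?B" unfolding q2_def by (rule pole_lemma_open) (auto intro!: holomorphic_intros)
    moreover have d2: "deriv (\<lambda>t. exp (\<i> * t)) 0 = \<i>" by (rule DERIV_imp_deriv) (auto intro!: derivative_eq_intros)
    have ne: "exp (\<i> * t) \<noteq> 1" if t: "t \<in> ?B" "t \<noteq> 0" for t
    proof
      assume "exp (\<i> * t) = 1"
      then obtain k :: int where k: "t = 2 * of_int k * of_real pi" unfolding e1 ..
      then have "k \<noteq> 0" using t by auto
      then have "1 \<le> \<bar>real_of_int k\<bar>" by linarith
      moreover have "norm t = 2 * \<bar>real_of_int k\<bar> * pi" using k by (simp add: norm_mult)
      moreover have "norm t < 1" using t by simp
      moreover have "2 * 1 * 2 \<le> 2 * \<bar>real_of_int k\<bar> * pi" if "1 \<le> \<bar>real_of_int k\<bar>"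
        using that pi_ge_two by (intro mult_mono) auto
      ultimately show False by linarith
    qed
    have "q2 t \<noteq> 0" if "t \<in> ?B" for t using ne[OF that] by (auto simp: q2_def d2)
    ultimately have "(\<lambda>t. q1 t / q2 t) holomorphic_on ?B" by (intro holomorphic_on_divide)
    moreover have "q1 t / q2 t = h t" if "t \<in> ?B" for t
      using ne[OF that] by (auto simp: q1_def q2_def h_def d2)
    ultimately show ?thesis by (rule holomorphic_transform)
  qed
  have "h field_differentiable at t" if t: "t \<in> strip \<zeta>" for t
  proof (cases "exp (\<i> * t) = 1")
    case True
    then obtain k :: int where k: "t = 2 * of_int k * of_real pi" unfolding e1 ..
    have "(h has_field_derivative deriv h 0) (at (t + 2 * of_int (- k) * of_real pi))"
      using h0 z k by (auto intro!: holomorphic_derivI)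
    then have "((\<lambda>s. h (s + 2 * of_int (- k) * of_real pi)) has_field_derivative deriv h 0) (at t)"
      by (simp only: DERIV_shift)
    moreover have "\<forall>\<^sub>F s in nhds t. h (s + 2 * of_int (- k) * of_real pi) = h s"
      using open_strip[of \<zeta>] t strip_periodic_int[of \<zeta> h, OF hper] unfolding eventually_nhds by blast
    ultimately have "(h has_field_derivative deriv h 0) (at t)"
      by (subst (asm) DERIV_cong_ev[OF refl _ refl]) auto
    then show ?thesis by (auto simp: field_differentiable_def)
  next
    case False
    have oS: "open {t. exp (\<i> * t) \<noteq> 1}" by (intro open_Collect_neq continuous_intros)
    have "(\<lambda>t. (g t - g 0) / (exp (\<i> * t) - 1)) holomorphic_on (strip \<zeta> \<inter> {t. exp (\<i> * t) \<noteq> 1})"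
      by (intro holomorphic_intros holomorphic_on_subset[OF hol]) auto
    then have "h holomorphic_on (strip \<zeta> \<inter> {t. exp (\<i> * t) \<noteq> 1})"
      by (rule holomorphic_transform) (auto simp: h_def)
    then show ?thesis using t False open_strip[of \<zeta>] oS
      by (auto intro: holomorphic_on_imp_differentiable_at)
  qed
  then have "h holomorphic_on strip \<zeta>" by (auto simp: holomorphic_on_def intro: field_differentiable_at_within)
  then show "strip_periodic \<zeta> h" using hper by (auto simp: strip_periodic_def)
  fix t assume t: "t \<in> strip \<zeta>"
  show "(exp (\<i> * t) - 1) * h t = g t - g 0"
  proof (cases "exp (\<i> * t) = 1")
    case True
    then have "g t = g 0" unfolding e1 using g0 by auto
    then show ?thesis using True by simp
  qed (simp add: h_def)
qed

lemma fcoef_add: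
  assumes "continuous_on {0..2 * pi} (\<lambda>t. f (of_real t))" "continuous_on {0..2 * pi} (\<lambda>t. g (of_real t))"
  shows "fcoef (\<lambda>t. f t + g t) \<alpha> = fcoef f \<alpha> + fcoef g \<alpha>"
proof -
  have "integral {0..2 * pi} (\<lambda>t. f (of_real t) * exp (- \<i> * of_int \<alpha> * of_real t) + g (of_real t) * exp (- \<i> * of_int \<alpha> * of_real t)) =
    integral {0..2 * pi} (\<lambda>t. f (of_real t) * exp (- \<i> * of_int \<alpha> * of_real t)) + integral {0..2 * pi} (\<lambda>t. g (of_real t) * exp (- \<i> * of_int \<alpha> * of_real t))"
    by (intro integral_add integrable_continuous_real continuous_intros assms)
  then show ?thesis by (simp add: fcoef_def distrib_right add_divide_distrib)
qed

lemma fcoef_mult_exp: "fcoef (\<lambda>t. exp (\<i> * t) * h t) \<alpha> = fcoef h (\<alpha> - 1)"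
proof -
  have "exp (\<i> * of_real t) * h (of_real t) * exp (- \<i> * of_int \<alpha> * of_real t) = h (of_real t) * exp (- \<i> * of_int (\<alpha> - 1) * of_real t)" for t
  proof -
    have "exp (\<i> * of_real t) * exp (- \<i> * of_int \<alpha> * of_real t) = exp (- \<i> * of_int (\<alpha> - 1) * of_real t)"
      by (simp add: exp_add[symmetric] algebra_simps)
    then show ?thesis by (metis mult.assoc mult.commute)
  qed
  then show ?thesis unfolding fcoef_def by (simp only:)
qed

text \<open>With the quotient \<open>h\<close>, the coefficient of \<open>g - g 0\<close> at
  \<open>\<alpha>\<close> is \<open>fcoef h (\<alpha> - 1) - fcoef h \<alpha>\<close>. A symmetric
  sum thus reduces to two outer coefficients of \<open>h\<close>, which decay exponentially.\<close>

lemma fcoef_partial_sums: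
  assumes g: "strip_periodic \<zeta> g" and z: "\<zeta> > 0"
  shows "(\<lambda>N. \<Sum>\<alpha>\<in>{- int N..int N}. fcoef g \<alpha>) \<longlonglongrightarrow> g 0"
proof -
  obtain h where h: "strip_periodic \<zeta> h" "\<And>t. t \<in> strip \<zeta> \<Longrightarrow> (exp (\<i> * t) - 1) * h t = g t - g 0"
    using periodic_quotient[OF assms] by blast
  have cont: "continuous_on {0..2 * pi} (\<lambda>t. f (of_real t))" if "strip_periodic \<zeta> f" for f
    using strip_continuous[OF that, of 0] z by simp
  have ph: "strip_periodic \<zeta> (\<lambda>t. exp (\<i> * t) * h t)"
    using strip_periodic_mult_exp[OF h(1), of 1] by (simp add: mult.commute)
  have pc: "strip_periodic \<zeta> (\<lambda>t. (-1) * h t)" using h(1) by (auto simp: strip_periodic_def intro!: holomorphic_intros)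
  have hm: "fcoef (\<lambda>t. (-1) * h t) \<alpha> = - fcoef h \<alpha>" for \<alpha> by (simp add: fcoef_def)
  have tele: "fcoef g \<alpha> = fcoef (\<lambda>_. g 0) \<alpha> + (fcoef h (\<alpha> - 1) - fcoef h \<alpha>)" for \<alpha>
  proof -
    have "fcoef g \<alpha> = fcoef (\<lambda>t. g 0 + (exp (\<i> * t) * h t + (-1) * h t)) \<alpha>"
      unfolding fcoef_def using h(2)[of "of_real t" for t] z
      by (intro arg_cong2[where f = "(/)"] integral_cong) (auto simp: strip_def algebra_simps)
    also have "\<dots> = fcoef (\<lambda>_. g 0) \<alpha> + fcoef (\<lambda>t. exp (\<i> * t) * h t + (-1) * h t) \<alpha>"
      by (rule fcoef_add) (intro continuous_intros cont h(1))+
    also have "fcoef (\<lambda>t. exp (\<i> * t) * h t + (-1) * h t) \<alpha> = fcoef (\<lambda>t. exp (\<i> * t) * h t) \<alpha> + fcoef (\<lambda>t. (-1) * h t) \<alpha>"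
      by (rule fcoef_add[OF cont[OF ph] cont[OF pc]])
    finally show ?thesis by (simp only: fcoef_mult_exp hm) simp
  qed
  have sumh: "(\<Sum>\<alpha>\<in>{- int N..int N}. fcoef h (\<alpha> - 1) - fcoef h \<alpha>) = fcoef h (- int N - 1) - fcoef h (int N)" for N
  proof (induction N)
    case (Suc N)
    have "{- int (Suc N)..int (Suc N)} = insert (- int (Suc N)) (insert (int (Suc N)) {- int N..int N})" by auto
    then have "(\<Sum>\<alpha>\<in>{- int (Suc N)..int (Suc N)}. fcoef h (\<alpha> - 1) - fcoef h \<alpha>) =
      (fcoef h (- int (Suc N) - 1) - fcoef h (- int (Suc N))) + ((fcoef h (int (Suc N) - 1) - fcoef h (int (Suc N))) +
       (\<Sum>\<alpha>\<in>{- int N..int N}. fcoef h (\<alpha> - 1) - fcoef h \<alpha>))"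
      by (simp only:) (subst sum.insert; auto)+
    also have "\<dots> = (fcoef h (- int (Suc N) - 1) - fcoef h (- int N - 1)) + ((fcoef h (int N) - fcoef h (int (Suc N))) +
       (fcoef h (- int N - 1) - fcoef h (int N)))"
    proof -
      have "- int (Suc N) = - int N - 1" "int (Suc N) - 1 = int N" by auto
      then show ?thesis unfolding Suc.IH by (simp only:)
    qed
    finally show ?case by simp
  qed simp
  have sumc: "(\<Sum>\<alpha>\<in>{- int N..int N}. fcoef (\<lambda>_. g 0) \<alpha>) = g 0" for N by (simp add: fcoef_const)
  define z' where "z' = \<zeta> / 2"
  have z': "0 < z'" "z' < \<zeta>" using z by (auto simp: z'_def)
  have bd: "\<exists>M. \<forall>t\<in>{0..2 * pi}. norm (h (of_real t + a)) \<le> M" if "\<bar>Im a\<bar> < \<zeta>" for a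
    using compact_imp_bounded[OF compact_continuous_image[OF strip_continuous[OF h(1) that, of "{0..2 * pi}"]]]
    by (auto simp: bounded_iff)
  obtain M1 where M1: "\<forall>t\<in>{0..2 * pi}. norm (h (of_real t + \<i> * of_real z')) \<le> M1"
    using bd[of "\<i> * of_real z'"] z' by auto
  obtain M2 where M2: "\<forall>t\<in>{0..2 * pi}. norm (h (of_real t - \<i> * of_real z')) \<le> M2"
    using bd[of "- (\<i> * of_real z')"] z' by auto
  note M = M1 M2
  have dec: "norm (fcoef h \<alpha>) \<le> max M1 M2 * exp (- z' * \<bar>real_of_int \<alpha>\<bar>)" for \<alpha>
    by (rule fcoef_decay[OF h(1)]) (use M z' in \<open>force simp: le_max_iff_disj\<close>)+
  have l: "(\<lambda>N. max M1 M2 * exp (- z' * \<bar>real_of_int (int N)\<bar>)) \<longlonglongrightarrow> 0"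
    "(\<lambda>N. max M1 M2 * exp (- z' * \<bar>real_of_int (- int N - 1)\<bar>)) \<longlonglongrightarrow> 0"
    using z' by real_asymp+
  have l1: "(\<lambda>N. fcoef h (int N)) \<longlonglongrightarrow> 0" by (rule Lim_null_comparison[OF always_eventually l(1)]) (use dec in blast)
  have l2: "(\<lambda>N. fcoef h (- int N - 1)) \<longlonglongrightarrow> 0" by (rule Lim_null_comparison[OF always_eventually l(2)]) (use dec in blast)
  have "(\<lambda>N. g 0 + (fcoef h (- int N - 1) - fcoef h (int N))) \<longlonglongrightarrow> g 0 + (0 - 0)"
    by (intro tendsto_intros l1 l2)
  then show ?thesis by (simp only: tele sum.distrib sumh sumc) simp
qed

text \<open>The expansion at the point 0 is applied to the translate
  \<open>t \<mapsto> g (t + \<theta>)\<close>, holomorphic on a narrower strip. The decay of the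
  coefficients makes the series absolutely summable, and the symmetric partial sums, being cofinal,
  identify its value.\<close>

lemma fourier_expansion:
  assumes g: "strip_periodic \<zeta> g" and z: "0 < \<zeta>'" "\<zeta>' < \<zeta>" and M: "\<And>\<theta>. \<bar>Im \<theta>\<bar> \<le> \<zeta>' \<Longrightarrow> norm (g \<theta>) \<le> M"
  shows "norm (fcoef g \<alpha>) \<le> M * exp (- \<zeta>' * \<bar>real_of_int \<alpha>\<bar>)"
    and "\<bar>Im \<theta>\<bar> < \<zeta>' \<Longrightarrow> ((\<lambda>\<alpha>. fcoef g \<alpha> * exp (\<i> * of_int \<alpha> * \<theta>)) has_sum g \<theta>) UNIV"
proof -
  show dec: "norm (fcoef g \<alpha>) \<le> M * exp (- \<zeta>' * \<bar>real_of_int \<alpha>\<bar>)" for \<alpha>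
    by (rule fcoef_decay[OF g]) (use z in \<open>auto intro!: M\<close>)
  assume t: "\<bar>Im \<theta>\<bar> < \<zeta>'"
  have M0: "M \<ge> 0" using M[of 0] z order_trans[OF norm_ge_zero] by force
  define g' where "g' = (\<lambda>t. g (t + \<theta>))"
  have st: "t + \<theta> \<in> strip \<zeta>" if "t \<in> strip (\<zeta> - \<bar>Im \<theta>\<bar>)" for t using that by (auto simp: strip_def)
  have "g' holomorphic_on strip (\<zeta> - \<bar>Im \<theta>\<bar>)"
  proof -
    have "(g \<circ> (\<lambda>t. t + \<theta>)) holomorphic_on strip (\<zeta> - \<bar>Im \<theta>\<bar>)"
      using g st by (intro holomorphic_on_compose_gen[of _ _ _ "strip \<zeta>"]) (auto simp: strip_periodic_def intro!: holomorphic_intros)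
    then show ?thesis by (simp add: g'_def o_def)
  qed
  moreover have "g' (t + 2 * of_real pi) = g' t" if "t \<in> strip (\<zeta> - \<bar>Im \<theta>\<bar>)" for t
    using g st[OF that] unfolding g'_def strip_periodic_def by (metis add.assoc add.commute)
  ultimately have "strip_periodic (\<zeta> - \<bar>Im \<theta>\<bar>) g'" by (auto simp: strip_periodic_def)
  then have "(\<lambda>N. \<Sum>\<alpha>\<in>{- int N..int N}. fcoef g' \<alpha>) \<longlonglongrightarrow> g' 0"
    by (rule fcoef_partial_sums) (use t z in auto)
  moreover have "fcoef g' \<alpha> = fcoef g \<alpha> * exp (\<i> * of_int \<alpha> * \<theta>)" for \<alpha>
    unfolding g'_def by (rule fcoef_shift[OF g]) (use t z in auto)
  ultimately have lim: "(\<lambda>N. \<Sum>\<alpha>\<in>{- int N..int N}. fcoef g \<alpha> * exp (\<i> * of_int \<alpha> * \<theta>)) \<longlonglongrightarrow> g \<theta>"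
    by (simp add: g'_def)
  have "norm (fcoef g \<alpha> * exp (\<i> * of_int \<alpha> * \<theta>)) \<le> M * exp (- (\<zeta>' - \<bar>Im \<theta>\<bar>) * \<bar>real_of_int \<alpha>\<bar>)" for \<alpha>
  proof -
    have "norm (exp (\<i> * of_int \<alpha> * \<theta>)) \<le> exp (\<bar>real_of_int \<alpha>\<bar> * \<bar>Im \<theta>\<bar>)"
      by (simp add: abs_mult[symmetric])
    then have "norm (fcoef g \<alpha> * exp (\<i> * of_int \<alpha> * \<theta>)) \<le> (M * exp (- \<zeta>' * \<bar>real_of_int \<alpha>\<bar>)) * exp (\<bar>real_of_int \<alpha>\<bar> * \<bar>Im \<theta>\<bar>)"
      unfolding norm_mult using dec M0 by (intro mult_mono) auto
    then show ?thesis by (simp add: exp_add[symmetric] algebra_simps)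
  qed
  note nb = this
  have "(\<lambda>\<alpha>. fcoef g \<alpha> * exp (\<i> * of_int \<alpha> * \<theta>)) summable_on UNIV"
    by (rule norm_summable_on[OF summable_on_cmult_right[OF int_symmetric_exp_summable] nb]) (use t in auto)
  then have s: "((\<lambda>\<alpha>. fcoef g \<alpha> * exp (\<i> * of_int \<alpha> * \<theta>)) has_sum (\<Sum>\<^sub>\<infinity>\<alpha>. fcoef g \<alpha> * exp (\<i> * of_int \<alpha> * \<theta>))) UNIV"
    by (rule has_sum_infsum)
  have "(\<Sum>\<^sub>\<infinity>\<alpha>. fcoef g \<alpha> * exp (\<i> * of_int \<alpha> * \<theta>)) = g \<theta>"
    using filterlim_compose[OF s[unfolded has_sum_def] symmetric_intervals_cofinal] lim LIMSEQ_unique by blast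
  then show "((\<lambda>\<alpha>. fcoef g \<alpha> * exp (\<i> * of_int \<alpha> * \<theta>)) has_sum g \<theta>) UNIV" using s by simp
qed

section \<open>Joint Taylor and Fourier expansion of the coefficients of the equation\<close>

lemma analytic_coefficient_along_line:
  fixes f :: "complex \<Rightarrow> complex ^ 'n \<Rightarrow> complex \<Rightarrow> complex" and d :: "complex ^ 'n"
  assumes f: "analytic_x_y_theta f S" and p: "(x0 + s * a, (\<chi> j. y0 $ j + s * d $ j), t0 + s * b) \<in> S"
  shows "(\<lambda>s. f (x0 + s * a) (\<chi> j. y0 $ j + s * d $ j) (t0 + s * b)) field_differentiable (at s)"
proof -
  let ?L = "\<lambda>s. (x0 + s * a, (\<chi> j. y0 $ j + s * d $ j), t0 + s * b)"
  obtain A B C where D: "((\<lambda>(x, y, \<theta>). f x y \<theta>) has_derivative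
        (\<lambda>(u, v, w). A * u + (\<Sum>j\<in>UNIV. B $ j * v $ j) + C * w)) (at (?L s))"
    using f p unfolding analytic_x_y_theta_def by blast
  have "linear (\<lambda>u. \<chi> j. u * d $ j)" by (rule linearI) (auto simp: vec_eq_iff algebra_simps)
  then have bl: "bounded_linear (\<lambda>u. \<chi> j. u * d $ j)" by (simp add: linear_conv_bounded_linear)
  have "((\<lambda>s. y0 + (\<chi> j. s * d $ j)) has_derivative (\<lambda>u. \<chi> j. u * d $ j)) (at s)"
    using has_derivative_add[OF has_derivative_const bounded_linear_imp_has_derivative[OF bl]] by simp
  moreover have "y0 + (\<chi> j. s * d $ j) = (\<chi> j. y0 $ j + s * d $ j)" for s by (simp add: vec_eq_iff)
  ultimately have dy: "((\<lambda>s. \<chi> j. y0 $ j + s * d $ j) has_derivative (\<lambda>u. \<chi> j. u * d $ j)) (at s)" by simp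
  have "(?L has_derivative (\<lambda>u. (u * a, (\<chi> j. u * d $ j), u * b))) (at s)"
    by (intro has_derivative_Pair dy) (auto intro!: derivative_eq_intros)
  from has_derivative_compose[OF this D]
  have "((\<lambda>s. f (x0 + s * a) (\<chi> j. y0 $ j + s * d $ j) (t0 + s * b)) has_derivative
     (\<lambda>u. A * (u * a) + (\<Sum>j\<in>UNIV. B $ j * (u * d $ j)) + C * (u * b))) (at s)" by simp
  moreover have "(\<lambda>u. A * (u * a) + (\<Sum>j\<in>UNIV. B $ j * (u * d $ j)) + C * (u * b)) =
     (*) (A * a + (\<Sum>j\<in>UNIV. B $ j * d $ j) + C * b)"
    by (auto simp: fun_eq_iff algebra_simps sum_distrib_left)
  ultimately show ?thesis unfolding field_differentiable_def has_field_derivative_def by auto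
qed

lemma coefficient_bounded:
  fixes f :: "complex \<Rightarrow> complex ^ 'n \<Rightarrow> complex \<Rightarrow> complex"
  assumes f: "analytic_coefficient \<kappa> \<zeta> f" and kz: "\<kappa> > 0" "\<zeta> > 0"
  shows "\<exists>M\<ge>1. \<forall>x y \<theta>. norm x \<le> \<kappa> / 2 \<longrightarrow> norm y \<le> \<kappa> / 2 \<longrightarrow> \<bar>Im \<theta>\<bar> \<le> \<zeta> / 2 \<longrightarrow> norm (f x y \<theta>) \<le> M"
proof -
  define K where "K = (cball 0 (\<kappa> / 2) :: complex set) \<times> (cball 0 (\<kappa> / 2) :: (complex ^ 'n) set) \<times> cbox (Complex 0 (- (\<zeta> / 2))) (Complex (2 * pi) (\<zeta> / 2))"
  have "compact K" unfolding K_def by (intro compact_Times compact_cball compact_cbox)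
  moreover have "K \<subseteq> pde_domain \<kappa> \<zeta>"
    using kz by (auto simp: K_def pde_domain_def strip_def in_cbox_complex_iff)
  then have "continuous_on K (\<lambda>(x, y, \<theta>). f x y \<theta>)"
    using f unfolding analytic_coefficient_def analytic_x_y_theta_def
    by (intro continuous_at_imp_continuous_on ballI) (blast dest: has_derivative_continuous)
  ultimately have "bounded ((\<lambda>(x, y, \<theta>). f x y \<theta>) ` K)" by (intro compact_imp_bounded compact_continuous_image)
  then obtain M where M: "\<And>x y \<theta>. (x, y, \<theta>) \<in> K \<Longrightarrow> norm (f x y \<theta>) \<le> M" by (force simp: bounded_iff)
  have "norm (f x y \<theta>) \<le> max 1 M" if xy: "norm x \<le> \<kappa> / 2" "norm y \<le> \<kappa> / 2" "\<bar>Im \<theta>\<bar> \<le> \<zeta> / 2" for x y \<theta>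
  proof -
    define k where "k = \<lfloor>Re \<theta> / (2 * pi)\<rfloor>"
    have "f x y (\<theta> + 2 * of_real pi) = f x y \<theta>" if "\<theta> \<in> strip \<zeta>" for \<theta>
    proof -
      have "(x, y, \<theta>) \<in> pde_domain \<kappa> \<zeta>" using xy kz that by (auto simp: pde_domain_def)
      then show ?thesis using f unfolding analytic_coefficient_def by blast
    qed
    then have "f x y (\<theta> + 2 * of_int (- k) * of_real pi) = f x y \<theta>"
      by (rule strip_periodic_int) (use xy kz in \<open>auto simp: strip_def\<close>)
    moreover have "(x, y, \<theta> + 2 * of_int (- k) * of_real pi) \<in> K"
    proof -
      have "real_of_int k \<le> Re \<theta> / (2 * pi)" "Re \<theta> / (2 * pi) < real_of_int k + 1" unfolding k_def by linarith+
      then have "real_of_int k * (2 * pi) \<le> Re \<theta>" "Re \<theta> < (real_of_int k + 1) * (2 * pi)"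
        by (simp_all add: pos_le_divide_eq pos_divide_less_eq)
      then show ?thesis using xy by (auto simp: K_def in_cbox_complex_iff algebra_simps)
    qed
    ultimately show ?thesis using M by (metis max.coboundedI2)
  qed
  then show ?thesis by (intro exI[of _ "max 1 M"]) auto
qed

text \<open>There are \<open>N\<close> scalar variables. Radius \<open>R = \<kappa> / (2 N)\<close>
  for each keeps the vector of components within \<open>\<kappa> / 2\<close>; half of it is the
  Cauchy radius \<open>r\<close>; and the factor \<open>q = 1 / (2 N)\<close> makes the sum over the
  \<open>N^k\<close> words of each length \<open>k\<close> converge. The strip shrinks to
  \<open>\<zeta> / 2\<close> for the Taylor coefficients and to \<open>\<zeta> / 4\<close> for their
  Fourier series.\<close>

lemma analytic_coefficient_expansion:
  fixes f :: "complex \<Rightarrow> complex ^ 'n \<Rightarrow> complex \<Rightarrow> complex"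
  assumes f: "analytic_coefficient \<kappa> \<zeta> f" and kz: "\<kappa> > 0" "\<zeta> > 0"
  defines "N \<equiv> real (CARD('n) + 1)"
  shows "\<exists>B\<ge>1. \<exists>c :: 'n option list \<Rightarrow> int \<Rightarrow> complex.
     (\<forall>l \<alpha>. norm (c l \<alpha>) \<le> B / (\<kappa> / (4 * N)) ^ length l * exp (- (\<zeta> / 4) * \<bar>real_of_int \<alpha>\<bar>)) \<and>
     (\<forall>z \<theta>. (\<forall>v. norm (z v) \<le> \<kappa> / (8 * N\<^sup>2)) \<and> \<bar>Im \<theta>\<bar> < \<zeta> / 4 \<longrightarrow>
       ((\<lambda>(l, \<alpha>). c l \<alpha> * prod_list (map z l) * exp (\<i> * of_int \<alpha> * \<theta>)) has_sum f (z None) (\<chi> j. z (Some j)) \<theta>) UNIV)"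
proof -
  have N: "N \<ge> 1" by (simp add: N_def)
  define R where "R = \<kappa> / (2 * N)"
  define r where "r = \<kappa> / (4 * N)"
  define q where "q = 1 / (2 * N)"
  have rR: "0 < r" "r < R" using kz N by (auto simp: r_def R_def field_simps)
  have q: "0 \<le> q" "q \<le> 1" "q * r = \<kappa> / (8 * N\<^sup>2)" "q > 0" using N by (auto simp: q_def r_def power2_eq_square)
  obtain M where M: "M \<ge> 1" "\<And>x y \<theta>. norm x \<le> \<kappa> / 2 \<Longrightarrow> norm y \<le> \<kappa> / 2 \<Longrightarrow> \<bar>Im \<theta>\<bar> \<le> \<zeta> / 2 \<Longrightarrow> norm (f x y \<theta>) \<le> M"
    using coefficient_bounded[OF f kz] by blast
  define D where "D = (\<lambda>z :: 'n option \<Rightarrow> complex. \<forall>v. z v \<in> ball 0 R)"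
  \<comment> \<open>The value 0 outside the polydisc makes
    \<open>F (\<theta> + 2 pi) = F \<theta>\<close> an equation between total functions of
    \<open>z\<close>, the form in which \<open>taylor_lists\<close> hands periodicity on.\<close>
  define F where "F = (\<lambda>\<theta> z. if D z then f (z None) (\<chi> j. z (Some j)) \<theta> else 0)"
  have dom: "norm (z None) \<le> \<kappa> / 2" "norm (\<chi> j. z (Some j)) \<le> \<kappa> / 2" if "D z" for z
  proof -
    have b: "norm (z v) < R" for v using that by (auto simp: D_def)
    have "R \<le> \<kappa> / 2" using kz N by (auto simp: R_def field_simps)
    then show "norm (z None) \<le> \<kappa> / 2" using b[of None] by linarith
    have "norm (\<chi> j. z (Some j)) \<le> (\<Sum>j\<in>UNIV. norm ((\<chi> j. z (Some j)) $ j))" by (simp add: norm_vec_def L2_set_le_sum)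
    also have "\<dots> \<le> (\<Sum>j\<in>(UNIV::'n set). R)" using b by (intro sum_mono) (auto intro: less_imp_le)
    also have "\<dots> \<le> N * R" using rR by (simp add: N_def distrib_right)
    also have "\<dots> = \<kappa> / 2" using N by (simp add: R_def)
    finally show "norm (\<chi> j. z (Some j)) \<le> \<kappa> / 2" .
  qed
  have af: "analytic_x_y_theta f (pde_domain \<kappa> \<zeta>)" using f by (simp add: analytic_coefficient_def)
  have pd: "(z None, (\<chi> j. z (Some j)), \<theta>) \<in> pde_domain \<kappa> \<zeta>" if "D z" "\<theta> \<in> strip (\<zeta> / 2)" for z \<theta>
    using dom[OF that(1)] that(2) kz by (auto simp: pde_domain_def strip_def)
  obtain vs :: "'n option list" where vs: "set vs = UNIV" "distinct vs" using finite_distinct_list[of "UNIV :: 'n option set"] by auto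
  have lvs: "length vs = CARD('n) + 1" using distinct_card[OF vs(2)] vs(1) by (simp add: card_UNIV_option)
  have "\<exists>c. (\<forall>l. c l holomorphic_on strip (\<zeta> / 2)) \<and> (\<forall>l. \<forall>\<theta>\<in>strip (\<zeta> / 2). norm (c l \<theta>) \<le> M / r ^ length l) \<and>
     (\<forall>\<theta> \<theta>'. F \<theta> = F \<theta>' \<longrightarrow> (\<forall>l. c l \<theta> = c l \<theta>')) \<and>
     (\<forall>\<theta>\<in>strip (\<zeta> / 2). \<forall>z. (\<forall>v. norm (z v) \<le> q * r) \<and> (\<forall>v. v \<notin> set vs \<longrightarrow> z v = 0) \<longrightarrow>
        ((\<lambda>l. c l \<theta> * prod_list (map z l)) has_sum F \<theta> z) (lists (set vs)))"
  proof (rule taylor_lists[OF open_strip rR q(1) _ q(2) vs(2)])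
    show "real (length vs) * q \<le> 1 / 2" using N unfolding lvs N_def[symmetric] by (simp add: q_def)
    show "(\<lambda>\<theta>. F \<theta> z) holomorphic_on strip (\<zeta> / 2)" if "\<And>v. z v \<in> ball 0 R" for z
    proof -
      have Dz: "D z" using that by (auto simp: D_def)
      have "(\<lambda>\<theta>. f (z None) (\<chi> j. z (Some j)) \<theta>) field_differentiable (at \<theta>)" if "\<theta> \<in> strip (\<zeta> / 2)" for \<theta>
        using analytic_coefficient_along_line[OF af, of "z None" \<theta> 0 "\<chi> j. z (Some j)" 0 0 1] pd[OF Dz that] by simp
      then show ?thesis using Dz by (auto simp: F_def holomorphic_on_def intro: field_differentiable_at_within)
    qed
    show "(\<lambda>s. F \<theta> (z(v := s))) holomorphic_on ball 0 R"
      if t: "\<theta> \<in> strip (\<zeta> / 2)" and z: "\<And>v. z v \<in> ball 0 R" for \<theta> z v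
    proof -
      have Ds: "D (z(v := s))" if "s \<in> ball 0 R" for s using z that by (auto simp: D_def)
      let ?x0 = "if v = None then 0 else z None" and ?a = "if v = None then 1 else 0"
      let ?y0 = "\<chi> j. if v = Some j then 0 else z (Some j)" and ?d = "\<chi> j. if v = Some j then 1 else 0"
      have eq: "(z(v := s)) None = ?x0 + s * ?a" "(\<chi> j. (z(v := s)) (Some j)) = (\<chi> j. ?y0 $ j + s * ?d $ j)" "\<theta> = \<theta> + s * 0" for s
        by (auto simp: vec_eq_iff)
      have "(\<lambda>s. f ((z(v := s)) None) (\<chi> j. (z(v := s)) (Some j)) (\<theta> + s * 0)) field_differentiable (at s)" if "s \<in> ball 0 R" for s
        unfolding eq(1,2) by (rule analytic_coefficient_along_line[OF af]) (use pd[OF Ds[OF that] t] in \<open>simp only: eq(1,2) mult_zero_right add_0_right\<close>)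
      then have "(\<lambda>s. f ((z(v := s)) None) (\<chi> j. (z(v := s)) (Some j)) \<theta>) holomorphic_on ball 0 R"
        by (auto simp: holomorphic_on_def intro: field_differentiable_at_within)
      then show ?thesis by (rule holomorphic_transform) (use Ds in \<open>simp add: F_def\<close>)
    qed
    show "norm (F \<theta> z) \<le> M" if "\<theta> \<in> strip (\<zeta> / 2)" for \<theta> z
      using M(2)[of "z None" "\<chi> j. z (Some j)" \<theta>] dom[of z] that M(1) by (auto simp: F_def strip_def)
    show "0 \<le> M" using M(1) by simp
  qed
  then obtain c where c: "\<And>l. c l holomorphic_on strip (\<zeta> / 2)" "\<And>l \<theta>. \<theta> \<in> strip (\<zeta> / 2) \<Longrightarrow> norm (c l \<theta>) \<le> M / r ^ length l"
     "\<And>\<theta> \<theta>' l. F \<theta> = F \<theta>' \<Longrightarrow> c l \<theta> = c l \<theta>'"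
     "\<And>\<theta> z. \<theta> \<in> strip (\<zeta> / 2) \<Longrightarrow> (\<forall>v. norm (z v) \<le> q * r) \<Longrightarrow>
        ((\<lambda>l. c l \<theta> * prod_list (map z l)) has_sum F \<theta> z) UNIV"
    unfolding vs(1) lists_UNIV by blast
  have cper: "strip_periodic (\<zeta> / 2) (c l)" for l
    unfolding strip_periodic_def
  proof (intro conjI ballI c(1) c(3))
    fix \<theta> assume t: "\<theta> \<in> strip (\<zeta> / 2)"
    show "F (\<theta> + 2 * of_real pi) = F \<theta>"
    proof
      fix z
      have "D z \<Longrightarrow> f (z None) (\<chi> j. z (Some j)) (\<theta> + 2 * of_real pi) = f (z None) (\<chi> j. z (Some j)) \<theta>"
        using f pd[OF _ t] unfolding analytic_coefficient_def by blast
      then show "F (\<theta> + 2 * of_real pi) z = F \<theta> z" by (simp add: F_def)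
    qed
  qed
  have zz: "0 < \<zeta> / 4" "\<zeta> / 4 < \<zeta> / 2" using kz by auto
  have cb: "norm (c l \<theta>) \<le> M / r ^ length l" if "\<bar>Im \<theta>\<bar> \<le> \<zeta> / 4" for l \<theta>
    by (rule c(2)) (use that kz in \<open>simp add: strip_def\<close>)
  define C where "C = (\<lambda>l. fcoef (c l))"
  have Cb: "norm (C l \<alpha>) \<le> M / r ^ length l * exp (- (\<zeta> / 4) * \<bar>real_of_int \<alpha>\<bar>)" for l \<alpha>
    unfolding C_def by (rule fourier_expansion(1)[OF cper zz cb])
  show ?thesis
  proof (intro exI[of _ M] conjI exI[of _ C] allI impI M(1))
    show "norm (C l \<alpha>) \<le> M / (\<kappa> / (4 * N)) ^ length l * exp (- (\<zeta> / 4) * \<bar>real_of_int \<alpha>\<bar>)" for l \<alpha>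
      using Cb unfolding r_def .
    fix z :: "'n option \<Rightarrow> complex" and \<theta> assume "(\<forall>v. norm (z v) \<le> \<kappa> / (8 * N\<^sup>2)) \<and> \<bar>Im \<theta>\<bar> < \<zeta> / 4"
    then have z: "\<forall>v. norm (z v) \<le> q * r" and t: "\<bar>Im \<theta>\<bar> < \<zeta> / 4" by (auto simp: q(3))
    have qr: "0 \<le> q * r" "q * r \<le> r" using mult_nonneg_nonneg[OF q(1), of r] mult_right_mono[OF q(2), of r] rR by linarith+
    have ts: "\<theta> \<in> strip (\<zeta> / 2)" using t by (simp add: strip_def)
    have "norm (z v) < R" for v
    proof -
      have "norm (z v) \<le> q * r" using z by blast
      then show ?thesis using qr rR by linarith
    qed
    then have Dz: "D z" by (simp add: D_def)
    have "((\<lambda>(l, \<alpha>). C l \<alpha> * prod_list (map z l) * exp (\<i> * of_int \<alpha> * \<theta>)) has_sum f (z None) (\<chi> j. z (Some j)) \<theta>) (UNIV \<times> UNIV)"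
    proof (rule has_sum_SigmaI)
      fix l :: "'n option list"
      have "((\<lambda>\<alpha>. (C l \<alpha> * exp (\<i> * of_int \<alpha> * \<theta>)) * prod_list (map z l)) has_sum c l \<theta> * prod_list (map z l)) UNIV"
        unfolding C_def by (intro has_sum_cmult_left fourier_expansion(2)[OF cper zz cb t])
      then show "((\<lambda>\<alpha>. case (l, \<alpha>) of (l, \<alpha>) \<Rightarrow> C l \<alpha> * prod_list (map z l) * exp (\<i> * of_int \<alpha> * \<theta>)) has_sum c l \<theta> * prod_list (map z l)) UNIV"
        by (simp add: mult_ac)
    next
      show "((\<lambda>l. c l \<theta> * prod_list (map z l)) has_sum f (z None) (\<chi> j. z (Some j)) \<theta>) UNIV"
        using c(4)[OF ts z] Dz by (simp add: F_def)
    next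
      have card: "real (card (UNIV :: 'n option set)) * q \<le> 1 / 2"
        using N lvs distinct_card[OF vs(2)] vs(1) by (simp add: q_def N_def)
      have s1: "(\<lambda>l::'n option list. M * q ^ length l) summable_on UNIV"
        using summable_on_cmult_right[OF summable_on_lists_geometric[OF _ q(1) card], of M] by simp
      have s2: "(\<lambda>\<alpha>::int. exp (- (\<zeta> / 4 - \<bar>Im \<theta>\<bar>) * \<bar>real_of_int \<alpha>\<bar>)) summable_on UNIV"
        by (rule int_symmetric_exp_summable) (use t in simp)
      have s: "(\<lambda>(l, \<alpha>). (M * q ^ length l) * exp (- (\<zeta> / 4 - \<bar>Im \<theta>\<bar>) * \<bar>real_of_int \<alpha>\<bar>)) summable_on ((UNIV :: 'n option list set) \<times> (UNIV :: int set))"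
        by (rule summable_on_times[OF s1 s2]) (use M q in auto)
      show "(\<lambda>(l, \<alpha>). C l \<alpha> * prod_list (map z l) * exp (\<i> * of_int \<alpha> * \<theta>)) summable_on UNIV \<times> UNIV"
      proof (rule norm_summable_on[OF s], clarify)
        fix l :: "'n option list" and \<alpha> :: int
        have "norm (prod_list (map z l)) \<le> (q * r) ^ length l"
          using z qr by (induction l) (auto simp: norm_mult intro!: mult_mono)
        moreover have "norm (exp (\<i> * of_int \<alpha> * \<theta>)) \<le> exp (\<bar>real_of_int \<alpha>\<bar> * \<bar>Im \<theta>\<bar>)"
          by (simp add: abs_mult[symmetric])
        ultimately have "norm (C l \<alpha> * prod_list (map z l) * exp (\<i> * of_int \<alpha> * \<theta>)) \<le>
           ((M / r ^ length l * exp (- (\<zeta> / 4) * \<bar>real_of_int \<alpha>\<bar>)) * (q * r) ^ length l) * exp (\<bar>real_of_int \<alpha>\<bar> * \<bar>Im \<theta>\<bar>)"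
          unfolding norm_mult using Cb[of l \<alpha>] M(1) rR qr by (intro mult_mono) auto
        also have "\<dots> = (M * q ^ length l) * (exp (- (\<zeta> / 4) * \<bar>real_of_int \<alpha>\<bar>) * exp (\<bar>real_of_int \<alpha>\<bar> * \<bar>Im \<theta>\<bar>))"
          using rR by (simp add: power_mult_distrib)
        also have "exp (- (\<zeta> / 4) * \<bar>real_of_int \<alpha>\<bar>) * exp (\<bar>real_of_int \<alpha>\<bar> * \<bar>Im \<theta>\<bar>) = exp (- (\<zeta> / 4 - \<bar>Im \<theta>\<bar>) * \<bar>real_of_int \<alpha>\<bar>)"
          by (simp add: exp_add[symmetric] algebra_simps)
        finally show "norm (C l \<alpha> * prod_list (map z l) * exp (\<i> * of_int \<alpha> * \<theta>)) \<le> M * q ^ length l * exp (- (\<zeta> / 4 - \<bar>Im \<theta>\<bar>) * \<bar>real_of_int \<alpha>\<bar>)" .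
      qed
    qed
    then show "((\<lambda>(l, \<alpha>). C l \<alpha> * prod_list (map z l) * exp (\<i> * of_int \<alpha> * \<theta>)) has_sum f (z None) (\<chi> j. z (Some j)) \<theta>) UNIV"
      by simp
  qed
qed

section \<open>Graded families and majorants\<close>

lemma causal_fixpoint:
  fixes \<Phi> :: "(nat \<Rightarrow> 'a) \<Rightarrow> nat \<Rightarrow> 'a"
  assumes "\<And>U V m. (\<And>k. k < m \<Longrightarrow> U k = V k) \<Longrightarrow> \<Phi> U m = \<Phi> V m"
  shows "\<exists>U. \<forall>m. U m = \<Phi> U m"
proof -
  have adm: "adm_wf less_than \<Phi>" unfolding adm_wf_def less_than_iff using assms by blast
  show ?thesis
    by (rule exI[of _ "wfrec less_than \<Phi>"], rule allI, rule fun_cong[OF wfrec_fixpoint[OF wf_less_than adm]])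
qed

text \<open>The weights \<open>hw\<close> are summable and, up to a constant, closed under convolution.\<close>

definition hw :: "nat \<Rightarrow> real" where "hw n = 1 / (1 + real n)\<^sup>2"

lemma hw_pos: "hw n > 0" by (simp add: hw_def)

lemma hw_0 [simp]: "hw 0 = 1" by (simp add: hw_def)

lemma sum_hw: "(\<Sum>a\<le>n. hw a) \<le> 2 - 1 / (1 + real n)"
proof (induction n)
  case (Suc n)
  have "hw (Suc n) \<le> 1 / (1 + real n) - 1 / (1 + real (Suc n))"
  proof -
    have "1 / ((2 + real n) * (2 + real n)) \<le> 1 / ((1 + real n) * (2 + real n))"
      by (intro divide_left_mono mult_right_mono) auto
    also have "\<dots> = 1 / (1 + real n) - 1 / (1 + real (Suc n))" by (simp add: field_simps)
    finally show ?thesis by (simp add: hw_def power2_eq_square)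
  qed
  with Suc show ?case by simp
qed simp

lemma sum_hw_le: "(\<Sum>a\<le>n. hw a) \<le> 2"
proof -
  have "1 / (1 + real n) \<ge> 0" by simp
  with sum_hw[of n] show ?thesis by linarith
qed

text \<open>From \<open>(x + y)^2 \<le> 2 (x^2 + y^2)\<close>, each product is at most
  \<open>2 * hw n\<close> times the sum of its factors, and both sums of weights are at most 2. The
  cube and the square of this constant are the factors 512 of \<open>gprod\<close> and 64 of
  \<open>cmul\<close>.\<close>

lemma sum_hw_mult: "(\<Sum>a\<le>n. hw a * hw (n - a)) \<le> 8 * hw n"
proof -
  have "hw a * hw (n - a) \<le> 2 * hw n * (hw a + hw (n - a))" if "a \<le> n" for a
  proof -
    define x where "x = 1 + real a"
    define y where "y = 1 + real (n - a)"
    have xy: "x > 0" "y > 0" "1 + real n \<le> x + y" using that by (auto simp: x_def y_def)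
    have "(1 + real n)\<^sup>2 \<le> (x + y)\<^sup>2" using xy by (intro power_mono) auto
    also have "\<dots> \<le> 2 * (x\<^sup>2 + y\<^sup>2)" using sum_squares_bound[of x y] by (simp add: power2_sum)
    finally have "(1 + real n)\<^sup>2 \<le> 2 * (x\<^sup>2 + y\<^sup>2)" .
    then have "1 / (x\<^sup>2 * y\<^sup>2) \<le> 2 * (x\<^sup>2 + y\<^sup>2) / ((1 + real n)\<^sup>2 * (x\<^sup>2 * y\<^sup>2))"
      using xy by (simp add: field_simps)
    also have "\<dots> = 2 * (1 / (1 + real n)\<^sup>2) * (1 / x\<^sup>2 + 1 / y\<^sup>2)"
      using xy by (simp add: field_simps)
    finally show ?thesis by (simp add: hw_def x_def y_def)
  qed
  then have "(\<Sum>a\<le>n. hw a * hw (n - a)) \<le> (\<Sum>a\<le>n. 2 * hw n * (hw a + hw (n - a)))" by (intro sum_mono) auto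
  also have "\<dots> = 2 * hw n * ((\<Sum>a\<le>n. hw a) + (\<Sum>a\<le>n. hw (n - a)))"
    unfolding sum.distrib[symmetric] sum_distrib_left ..
  also have "(\<Sum>a\<le>n. hw (n - a)) = (\<Sum>a\<le>n. hw a)"
    using sum.nat_diff_reindex[of hw "Suc n"] by (simp add: lessThan_Suc_atMost)
  also have "2 * hw n * ((\<Sum>a\<le>n. hw a) + (\<Sum>a\<le>n. hw a)) \<le> 2 * hw n * 4"
    using sum_hw_le[of n] hw_pos[of n] by (intro mult_left_mono) auto
  finally show ?thesis by simp
qed

section \<open>Graded families, their products, and evaluation of words\<close>

type_synonym idx = "nat \<times> nat \<times> nat"
type_synonym family = "idx \<Rightarrow> complex \<Rightarrow> complex"

text \<open>A family indexed by \<open>(m, p, q)\<close> stands for the sum of terms of degree \<open>m\<close> in \<open>x\<close> carrying the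
  factor \<open>exp (\<i> (p - q) \<theta>)\<close>; keeping \<open>p\<close> and \<open>q\<close> apart makes all products finite sums.\<close>

definition box :: "idx \<Rightarrow> idx set" where
  "box i = {..fst i} \<times> {..fst (snd i)} \<times> {..snd (snd i)}"

definition freq :: "idx \<Rightarrow> int" where
  "freq i = int (fst (snd i)) - int (snd (snd i))"

text \<open>The Cauchy product: \<open>box i\<close> lists all splittings
  \<open>i = a + (i - a)\<close>, on which the truncated subtraction is exact.\<close>

definition gprod :: "family \<Rightarrow> family \<Rightarrow> family" where
  "gprod f g i = (\<lambda>w. \<Sum>a\<in>box i. conv (f a) (g (i - a)) w)"

text \<open>Multiplication by a function of \<open>\<theta>\<close> alone. It is not an instance of
  \<open>gprod\<close>, since a factor of degree 0 has no Borel transform.\<close>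

definition cmul :: "(nat \<Rightarrow> nat \<Rightarrow> complex) \<Rightarrow> family \<Rightarrow> family" where
  "cmul c f i = (\<lambda>w. \<Sum>(p, q)\<in>{..fst (snd i)} \<times> {..snd (snd i)}. c p q * f (fst i, fst (snd i) - p, snd (snd i) - q) w)"

text \<open>Frequency \<open>\<alpha>\<close> sits at the one pair with
  \<open>p - q = \<alpha>\<close> in which \<open>p\<close> or \<open>q\<close> is 0.\<close>

definition laurent_coeff :: "(int \<Rightarrow> complex) \<Rightarrow> nat \<Rightarrow> nat \<Rightarrow> complex" where
  "laurent_coeff c p q = (if q = 0 then c (int p) else if p = 0 then c (- int q) else 0)"

definition gX :: "family" where
  "gX i = (if i = (1, 0, 0) then (\<lambda>_. 1) else (\<lambda>_. 0))"

text \<open>The seed \<open>s\<close> is the factor \<open>x\<close> or \<open>x Z\<close> that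
  accompanies every monomial. It replaces the empty product 1, which has no Borel transform.\<close>

primrec gword :: "('v \<Rightarrow> family) \<Rightarrow> 'v list \<Rightarrow> family \<Rightarrow> family" where
  "gword L [] s = s"
| "gword L (v # l) s = gprod (L v) (gword L l s)"

lemma finite_box [simp]: "finite (box i)" by (simp add: box_def)

lemma gprod_gX: "gprod f gX i = (if fst i = 0 then (\<lambda>_. 0) else conv (f (i - (1, 0, 0))) (\<lambda>_. 1))"
proof (cases "fst i = 0")
  case True
  then have "gX (i - a) = (\<lambda>_. 0)" if "a \<in> box i" for a using that by (cases i, cases a) (auto simp: gX_def box_def)
  then show ?thesis using True by (simp add: gprod_def)
next
  case False
  obtain m p q where i: "i = (m, p, q)" by (cases i)
  have z: "gX (i - a) = (\<lambda>_. 0)" if "a \<in> box i - {(m - 1, p, q)}" for a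
    using that False by (cases a) (auto simp: gX_def box_def i)
  have "gprod f gX i w = conv (f (m - 1, p, q)) (gX (i - (m - 1, p, q))) w" for w
  proof -
    have "gprod f gX i w = (\<Sum>a\<in>{(m - 1, p, q)}. conv (f a) (gX (i - a)) w)"
      unfolding gprod_def by (rule sum.mono_neutral_right) (use z in \<open>auto simp: box_def i\<close>)
    then show ?thesis by simp
  qed
  then show ?thesis using False by (auto simp: i gX_def fun_eq_iff zero_prod_def)
qed

text \<open>As \<open>g\<close> vanishes in degree 0, the product up to degree \<open>m\<close> uses
  \<open>f\<close> only in degrees below \<open>m\<close>. This strict inequality is what makes the
  system a recursion on the degree.\<close>

lemma gprod_cong:
  assumes f: "\<And>a. fst a < m \<Longrightarrow> f a = f' a" and g: "\<And>a. fst a \<le> m \<Longrightarrow> g a = g' a"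
    and z: "\<And>a. fst a = 0 \<Longrightarrow> g a = (\<lambda>_. 0)" and i: "fst i \<le> m"
  shows "gprod f g i = gprod f' g' i"
  unfolding gprod_def
proof (intro ext sum.cong refl)
  fix w a assume a: "a \<in> box i"
  show "conv (f a) (g (i - a)) w = conv (f' a) (g' (i - a)) w"
  proof (cases "fst (i - a) = 0")
    case True
    then have "g (i - a) = (\<lambda>_. 0)" "g' (i - a) = (\<lambda>_. 0)" using z g[of "i - a"] by simp_all
    then show ?thesis by simp
  next
    case False
    then have "fst a < m" "fst (i - a) \<le> m" using i by auto
    then show ?thesis using f[of a] g[of "i - a"] by simp
  qed
qed

lemma gprod_zero:
  assumes "\<And>a. fst a = 0 \<Longrightarrow> g a = (\<lambda>_. 0)" "fst i = 0"
  shows "gprod f g i = (\<lambda>_. 0)"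
  unfolding gprod_def by (intro ext sum.neutral ballI) (use assms in \<open>simp add: assms(1)\<close>)

lemma gword_zero:
  assumes "\<And>a. fst a = 0 \<Longrightarrow> s a = (\<lambda>_. 0)" "fst i = 0"
  shows "gword L l s i = (\<lambda>_. 0)"
  using assms(2) by (induction l arbitrary: i) (simp_all add: assms(1) gprod_zero)

lemma gword_cong:
  assumes f: "\<And>v a. fst a < m \<Longrightarrow> L v a = L' v a" and g: "\<And>a. fst a \<le> m \<Longrightarrow> s a = s' a"
    and z: "\<And>a. fst a = 0 \<Longrightarrow> s a = (\<lambda>_. 0)" and i: "fst i \<le> m"
  shows "gword L l s i = gword L' l s' i"
  using i
proof (induction l arbitrary: i)
  case (Cons v l)
  show ?case unfolding gword.simps
  proof (rule gprod_cong[where m = m])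
    show "L v a = L' v a" if "fst a < m" for a using f that by blast
    show "gword L l s a = gword L' l s' a" if "fst a \<le> m" for a using Cons.IH that by blast
    show "gword L l s a = (\<lambda>_. 0)" if "fst a = 0" for a using gword_zero[of s a L l] z that by blast
  qed (rule Cons.prems)
qed (use g in simp)

lemma conv_vanish:
  assumes S: "star0 S" and w: "w \<in> S" and z: "(\<forall>w\<in>S. f w = 0) \<or> (\<forall>w\<in>S. g w = 0)"
  shows "conv f g w = 0"
proof -
  have "f (of_real t * w) * g (of_real (1 - t) * w) = 0" if "t \<in> {0..1}" for t
    using z star0D[OF S w, of t] star0D'[OF S w, of t] that by auto
  then have "integral {0..1} (\<lambda>t. f (of_real t * w) * g (of_real (1 - t) * w)) = integral {0..1} (\<lambda>t::real. 0)"
    by (intro integral_cong) blast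
  then show ?thesis by (simp add: conv_def)
qed

section \<open>Weighted norms on graded families\<close>

locale weights =
  fixes S :: "complex set" and \<tau> \<sigma> :: real
  assumes star: "star0 S" and tau: "\<tau> > 0" and sigma: "0 < \<sigma>"
begin

text \<open>The powers of \<open>\<tau>\<close> allow exponential growth in the Borel plane, those
  of \<open>\<sigma>\<close> encode the decay of the Fourier coefficients, and the \<open>hw\<close>
  factors make the weights stable under products up to a constant.\<close>

definition wts :: "idx \<Rightarrow> real" where
  "wts i = \<tau> ^ fst i * hw (fst i) * (\<sigma> ^ fst (snd i) * hw (fst (snd i))) * (\<sigma> ^ snd (snd i) * hw (snd (snd i)))"

text \<open>The cut-off at degree \<open>M\<close> allows the bounds to follow the recursion that
  defines the solution, one degree at a time.\<close>

definition nrm :: "nat \<Rightarrow> real \<Rightarrow> family \<Rightarrow> bool" where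
  "nrm M a f \<longleftrightarrow> (\<forall>i. fst i \<le> M \<longrightarrow> f i holomorphic_on S \<and> (\<forall>w\<in>S. norm (f i w) \<le> a * wts i * pw (fst i) (norm w)))"

lemma nrmD: "nrm M a f \<Longrightarrow> fst i \<le> M \<Longrightarrow> f i holomorphic_on S"
  "nrm M a f \<Longrightarrow> fst i \<le> M \<Longrightarrow> w \<in> S \<Longrightarrow> norm (f i w) \<le> a * wts i * pw (fst i) (norm w)"
  unfolding nrm_def by blast+

lemma wts_pos: "wts i > 0"
  using tau sigma by (simp add: wts_def hw_pos)

lemma nrm_mono: "nrm M a f \<Longrightarrow> a \<le> b \<Longrightarrow> M' \<le> M \<Longrightarrow> nrm M' b f"
  unfolding nrm_def
  by (meson less_imp_le mult_right_mono norm_ge_zero order_trans pw_nonneg wts_pos)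

lemma nrm_zero_degree: "nrm M a f \<Longrightarrow> fst i = 0 \<Longrightarrow> w \<in> S \<Longrightarrow> f i w = 0"
  using nrmD(2)[of M a f i w] by (simp add: pw_def)

lemma sum_wts: "(\<Sum>a\<in>box i. wts a * wts (i - a)) \<le> 512 * wts i"
proof -
  obtain m p q where i: "i = (m, p, q)" by (cases i)
  have eq: "wts a * wts (i - a) = (\<tau> ^ m * \<sigma> ^ p * \<sigma> ^ q) *
     ((hw (fst a) * hw (m - fst a)) * ((hw (fst (snd a)) * hw (p - fst (snd a))) * (hw (snd (snd a)) * hw (q - snd (snd a)))))"
    if "a \<in> box i" for a
  proof -
    have "\<tau> ^ m = \<tau> ^ fst a * \<tau> ^ (m - fst a)" "\<sigma> ^ p = \<sigma> ^ fst (snd a) * \<sigma> ^ (p - fst (snd a))"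
      "\<sigma> ^ q = \<sigma> ^ snd (snd a) * \<sigma> ^ (q - snd (snd a))"
      using that by (auto simp: box_def i simp flip: power_add)
    then show ?thesis by (simp add: wts_def i)
  qed
  have "(\<Sum>a\<in>box i. wts a * wts (i - a)) = (\<tau> ^ m * \<sigma> ^ p * \<sigma> ^ q) *
     (\<Sum>a\<in>box i. (hw (fst a) * hw (m - fst a)) * ((hw (fst (snd a)) * hw (p - fst (snd a))) * (hw (snd (snd a)) * hw (q - snd (snd a)))))"
    unfolding sum_distrib_left by (rule sum.cong[OF refl eq])
  also have "(\<Sum>a\<in>box i. (hw (fst a) * hw (m - fst a)) * ((hw (fst (snd a)) * hw (p - fst (snd a))) * (hw (snd (snd a)) * hw (q - snd (snd a))))) =
     (\<Sum>a\<le>m. hw a * hw (m - a)) * ((\<Sum>a\<le>p. hw a * hw (p - a)) * (\<Sum>a\<le>q. hw a * hw (q - a)))"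
    by (simp add: box_def i sum_product sum.cartesian_product case_prod_unfold)
  also have "\<dots> \<le> (8 * hw m) * ((8 * hw p) * (8 * hw q))"
    by (intro mult_mono sum_hw_mult mult_nonneg_nonneg sum_nonneg less_imp_le[OF hw_pos]) (simp_all add: less_imp_le[OF hw_pos])
  finally show ?thesis using tau sigma by (simp add: wts_def i mult_ac mult_left_mono)
qed

text \<open>A degree is gained: terms with \<open>g\<close> in degree 0 vanish, so \<open>f\<close>
  is used up to degree \<open>M\<close> only. This is what advances the induction behind
  \<open>system_solution\<close>.\<close>

lemma nrm_gprod:
  assumes f: "nrm M a f" and g: "nrm (Suc M) b g" and ab: "a \<ge> 0" "b \<ge> 0"
  shows "nrm (Suc M) (512 * a * b) (gprod f g)"
  unfolding nrm_def
proof (intro allI impI conjI ballI)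
  fix i :: idx assume i: "fst i \<le> Suc M"
  have key: "conv (f c) (g (i - c)) holomorphic_on S \<and>
      (\<forall>w\<in>S. norm (conv (f c) (g (i - c)) w) \<le> (a * wts c) * (b * wts (i - c)) * pw (fst i) (norm w))" if c: "c \<in> box i" for c
  proof (cases "fst (i - c) = 0")
    case True
    then have "\<forall>w\<in>S. conv (f c) (g (i - c)) w = 0"
      using nrm_zero_degree[OF g True] by (auto intro!: conv_vanish[OF star])
    moreover have "(\<lambda>_. 0) holomorphic_on S" by simp
    ultimately show ?thesis using ab wts_pos pw_nonneg
      by (auto intro: holomorphic_transform[of "\<lambda>_. 0"] intro!: mult_nonneg_nonneg less_imp_le[OF wts_pos])
  next
    case False
    have c1: "fst c \<le> fst i" using c by (cases c, cases i) (auto simp: box_def)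
    have d: "fst c \<le> M" "fst (i - c) \<le> Suc M" using False i by auto
    have h: "f c holomorphic_on S" "g (i - c) holomorphic_on S" using nrmD(1)[OF f d(1)] nrmD(1)[OF g d(2)] .
    have "norm (conv (f c) (g (i - c)) w) \<le> (a * wts c) * (b * wts (i - c)) * pw (fst i) (norm w)" if w: "w \<in> S" for w
    proof -
      have "norm (conv (f c) (g (i - c)) w) \<le> (a * wts c) * (b * wts (i - c)) *
         (if fst c = 0 \<or> fst (i - c) = 0 then 0 else pw (fst c + fst (i - c)) (norm w))"
      proof (rule conv_bound[OF star h w])
        fix t :: real assume t: "t \<in> {0..1}"
        then have tS: "of_real t * w \<in> S" using star0D[OF star w] by auto
        show "norm (f c (of_real t * w)) \<le> a * wts c * pw (fst c) (norm (of_real t * w))" by (rule nrmD(2)[OF f d(1) tS])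
        show "norm (g (i - c) (of_real t * w)) \<le> b * wts (i - c) * pw (fst (i - c)) (norm (of_real t * w))"
          by (rule nrmD(2)[OF g d(2) tS])
      qed (use ab wts_pos in \<open>auto intro!: mult_nonneg_nonneg less_imp_le[OF wts_pos]\<close>)
      also have "\<dots> \<le> (a * wts c) * (b * wts (i - c)) * pw (fst i) (norm w)"
      proof (rule mult_left_mono)
        have "fst c + fst (i - c) = fst i" using c1 by simp
        then show "(if fst c = 0 \<or> fst (i - c) = 0 then 0 else pw (fst c + fst (i - c)) (norm w)) \<le> pw (fst i) (norm w)"
          using pw_nonneg[of "norm w" "fst i"] by simp
      qed (use ab wts_pos in \<open>auto intro!: mult_nonneg_nonneg less_imp_le[OF wts_pos]\<close>)
      finally show ?thesis .
    qed
    then show ?thesis using holomorphic_conv[OF star h] by blast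
  qed
  show "gprod f g i holomorphic_on S" unfolding gprod_def using key by (intro holomorphic_on_sum) blast
  fix w assume w: "w \<in> S"
  have "norm (gprod f g i w) \<le> (\<Sum>c\<in>box i. (a * wts c) * (b * wts (i - c)) * pw (fst i) (norm w))"
    unfolding gprod_def using key w by (intro sum_norm_le) blast
  also have "\<dots> = (a * b * pw (fst i) (norm w)) * (\<Sum>c\<in>box i. wts c * wts (i - c))"
    by (simp add: sum_distrib_left mult_ac)
  also have "\<dots> \<le> (a * b * pw (fst i) (norm w)) * (512 * wts i)"
    using ab by (intro mult_left_mono sum_wts) (auto intro!: mult_nonneg_nonneg pw_nonneg)
  finally show "norm (gprod f g i w) \<le> 512 * a * b * wts i * pw (fst i) (norm w)" by (simp add: mult_ac)
qed

lemma nrm_cmul: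
  assumes f: "nrm M a f" and c: "\<And>p q. norm (c p q) \<le> b * (\<sigma> ^ p * hw p) * (\<sigma> ^ q * hw q)" and ab: "a \<ge> 0" "b \<ge> 0"
  shows "nrm M (64 * a * b) (cmul c f)"
  unfolding nrm_def
proof (intro allI impI conjI ballI)
  fix i :: idx assume i: "fst i \<le> M"
  obtain m p q where ii: "i = (m, p, q)" by (cases i)
  show "cmul c f i holomorphic_on S" unfolding cmul_def case_prod_unfold
    using i by (intro holomorphic_on_sum holomorphic_on_mult holomorphic_on_const nrmD(1)[OF f]) auto
  fix w assume w: "w \<in> S"
  let ?B = "{..p} \<times> {..q}"
  define P where "P = a * b * (\<tau> ^ m * hw m * \<sigma> ^ p * \<sigma> ^ q) * pw m (norm w)"
  have P0: "P \<ge> 0" using ab tau sigma hw_pos[of m] by (auto simp: P_def intro!: mult_nonneg_nonneg pw_nonneg)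
  have "norm (cmul c f i w) \<le> (\<Sum>x\<in>?B. P * ((hw (fst x) * hw (p - fst x)) * (hw (snd x) * hw (q - snd x))))"
    unfolding cmul_def ii fst_conv snd_conv
  proof (rule sum_norm_le)
    fix x assume x: "x \<in> ?B"
    obtain u v where uv: "x = (u, v)" by (cases x)
    have "norm (f (m, p - u, q - v) w) \<le> a * wts (m, p - u, q - v) * pw m (norm w)"
      using nrmD(2)[OF f _ w, of "(m, p - u, q - v)"] i ii by simp
    then have "norm (c u v * f (m, p - u, q - v) w) \<le> (b * (\<sigma> ^ u * hw u) * (\<sigma> ^ v * hw v)) * (a * wts (m, p - u, q - v) * pw m (norm w))"
      unfolding norm_mult using c[of u v] ab sigma by (intro mult_mono) (auto intro!: mult_nonneg_nonneg less_imp_le[OF hw_pos])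
    also have "\<dots> = a * b * (\<tau> ^ m * hw m * (\<sigma> ^ u * \<sigma> ^ (p - u)) * (\<sigma> ^ v * \<sigma> ^ (q - v))) * pw m (norm w) * ((hw u * hw (p - u)) * (hw v * hw (q - v)))"
      by (simp add: wts_def)
    also have "\<dots> = a * b * (\<tau> ^ m * hw m * \<sigma> ^ p * \<sigma> ^ q) * pw m (norm w) * ((hw u * hw (p - u)) * (hw v * hw (q - v)))"
    proof -
      have "\<sigma> ^ u * \<sigma> ^ (p - u) = \<sigma> ^ p" "\<sigma> ^ v * \<sigma> ^ (q - v) = \<sigma> ^ q" using x uv by (auto simp flip: power_add)
      then show ?thesis by (simp only:)
    qed
    finally show "norm (case x of (u, v) \<Rightarrow> c u v * f (m, p - u, q - v) w) \<le> P * ((hw (fst x) * hw (p - fst x)) * (hw (snd x) * hw (q - snd x)))"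
      by (simp add: uv P_def)
  qed
  also have "\<dots> = P * ((\<Sum>u\<le>p. hw u * hw (p - u)) * (\<Sum>v\<le>q. hw v * hw (q - v)))"
    unfolding sum_distrib_left[symmetric] by (simp add: sum_product sum.cartesian_product case_prod_unfold)
  also have "\<dots> \<le> P * ((8 * hw p) * (8 * hw q))"
    by (intro mult_left_mono P0 mult_mono sum_hw_mult mult_nonneg_nonneg sum_nonneg less_imp_le[OF hw_pos]) (simp_all add: less_imp_le[OF hw_pos])
  also have "\<dots> = 64 * a * b * wts i * pw (fst i) (norm w)" by (simp add: P_def wts_def ii)
  finally show "norm (cmul c f i w) \<le> 64 * a * b * wts i * pw (fst i) (norm w)" .
qed

text \<open>The constant is \<open>1 / wts (1, 0, 0)\<close>, since \<open>hw 1 = 1 / 4\<close>.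
  This is the quantity that becomes small for large \<open>\<tau>\<close>.\<close>

lemma nrm_gX: "nrm M (4 / \<tau>) gX"
  unfolding nrm_def
proof (intro allI impI conjI ballI)
  fix i :: idx and w
  show "gX i holomorphic_on S" by (simp add: gX_def)
  show "norm (gX i w) \<le> 4 / \<tau> * wts i * pw (fst i) (norm w)"
  proof (cases "i = (1, 0, 0)")
    case True
    then show ?thesis using tau by (simp add: gX_def wts_def hw_def pw_def)
  qed (use tau in \<open>auto simp: gX_def intro!: divide_nonneg_nonneg mult_nonneg_nonneg pw_nonneg less_imp_le[OF wts_pos]\<close>)
qed

lemma nrm_gword:
  assumes L: "\<And>v. nrm M a (L v)" and s: "nrm (Suc M) b s" and ab: "a \<ge> 0" "b \<ge> 0"
  shows "nrm (Suc M) ((512 * a) ^ length l * b) (gword L l s)"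
proof (induction l)
  case (Cons v l)
  have "nrm (Suc M) (512 * a * ((512 * a) ^ length l * b)) (gprod (L v) (gword L l s))"
    by (rule nrm_gprod[OF L Cons]) (use ab in auto)
  then show ?case by (simp add: mult_ac)
qed (use s in simp)

lemma nrm_diff:
  assumes f: "nrm M a f" and g: "nrm M b g"
  shows "nrm M (a + norm c * b) (\<lambda>i w. f i w - c * g i w)"
  unfolding nrm_def
proof (intro allI impI conjI ballI)
  fix i :: idx assume i: "fst i \<le> M"
  show "(\<lambda>w. f i w - c * g i w) holomorphic_on S" using nrmD(1)[OF f i] nrmD(1)[OF g i] by (intro holomorphic_intros)
  fix w assume w: "w \<in> S"
  have "norm (f i w - c * g i w) \<le> norm (f i w) + norm c * norm (g i w)" by (metis norm_mult norm_triangle_ineq4)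
  also have "\<dots> \<le> a * wts i * pw (fst i) (norm w) + norm c * (b * wts i * pw (fst i) (norm w))"
    by (intro add_mono mult_left_mono nrmD(2)[OF f i w] nrmD(2)[OF g i w]) simp
  finally show "norm (f i w - c * g i w) \<le> (a + norm c * b) * wts i * pw (fst i) (norm w)" by (simp add: algebra_simps)
qed

lemma gprod_vanish:
  assumes f: "\<And>i w. fst i = 0 \<Longrightarrow> w \<in> S \<Longrightarrow> f i w = 0" and g: "\<And>i w. fst i \<le> n \<Longrightarrow> w \<in> S \<Longrightarrow> g i w = 0"
    and i: "fst i \<le> Suc n" and w: "w \<in> S"
  shows "gprod f g i w = 0"
  unfolding gprod_def
proof (rule sum.neutral, rule ballI, rule conv_vanish[OF star w])
  fix a :: idx
  show "(\<forall>w\<in>S. f a w = 0) \<or> (\<forall>w\<in>S. g (i - a) w = 0)"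
  proof (cases "fst a = 0")
    case False
    then have "fst (i - a) \<le> n" using i by auto
    then show ?thesis using g by blast
  qed (use f in blast)
qed

lemma gword_vanish:
  assumes L: "\<And>v i w. fst i = 0 \<Longrightarrow> w \<in> S \<Longrightarrow> L v i w = 0" and s: "\<And>i w. fst i = 0 \<Longrightarrow> w \<in> S \<Longrightarrow> s i w = 0"
    and "fst i \<le> length l" and "w \<in> S"
  shows "gword L l s i w = 0"
  using assms(3,4)
proof (induction l arbitrary: i w)
  case (Cons v l)
  show ?case unfolding gword.simps
    by (rule gprod_vanish[where n = "length l"]) (use L Cons in auto)
qed (use s in simp)

end

section \<open>The system in the Borel plane\<close>

text \<open>The four conditions \<open>small\<close> say in turn: the sum over words is dominated by
  a geometric series of ratio 1/2; the right hand side maps the ball of radius \<open>A\<close> into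
  itself; \<open>Z\<close> is no larger than \<open>A\<close>; the letter for \<open>x\<close> fits
  into the same ball as the letters for \<open>y\<close>.\<close>

locale borel_system = weights S \<tau> \<sigma> for S \<tau> \<sigma> +
  fixes k0 :: real and lam :: "'n::finite \<Rightarrow> real" and F0 :: complex
    and G :: "'n \<Rightarrow> 'n option list \<Rightarrow> int \<Rightarrow> complex" and F :: "'n option list \<Rightarrow> int \<Rightarrow> complex"
    and A B \<rho> Lam :: real
  assumes lam: "\<And>j. 0 < lam j" "\<And>j. lam j \<le> Lam"
    and k0: "1 \<le> k0"
    and resonance: "\<And>w \<alpha>. w \<in> S \<Longrightarrow> \<alpha> \<noteq> 0 \<Longrightarrow> w + \<i> * of_int \<alpha> \<noteq> 0"
      "\<And>w \<alpha>. w \<in> S \<Longrightarrow> \<alpha> \<noteq> 0 \<Longrightarrow> norm (w / (w + \<i> * of_int \<alpha>)) \<le> k0"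
      "\<And>w \<alpha>. w \<in> S \<Longrightarrow> \<alpha> \<noteq> 0 \<Longrightarrow> norm (1 / (w + \<i> * of_int \<alpha>)) \<le> k0"
    and coeffs: "\<And>j l p q. norm (laurent_coeff (G j l) p q) \<le> B / \<rho> ^ length l * (\<sigma> ^ p * hw p) * (\<sigma> ^ q * hw q)"
      "\<And>l p q. norm (laurent_coeff (F l) p q) \<le> B / \<rho> ^ length l * (\<sigma> ^ p * hw p) * (\<sigma> ^ q * hw q)"
    and pos: "0 < A" "0 \<le> B" "0 < \<rho>"
    and small: "real (card (UNIV :: 'n option set)) * (512 * A / \<rho>) \<le> 1 / 2"
      "128 * B * (4 / \<tau> + 512 * (k0 * 512 * (1 + Lam) * (4 / \<tau>) * A) * (4 / \<tau>)) + norm F0 * (k0 * 512 * (1 + Lam) * (4 / \<tau>) * A) \<le> A"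
      "k0 * 512 * (1 + Lam) * (4 / \<tau>) \<le> 1" "4 / \<tau> \<le> A"
begin

text \<open>The differential equation is rewritten as a system for \<open>Y\<close>, the Borel transform of the
  solution, and \<open>Q\<close>, the right hand side: with \<open>Z\<close> for \<open>x\<^sup>2 y'\<close> it reads
  \<open>Z + y'\<^sub>\<theta> = D\<close>, \<open>D = x (Q - \<lambda> y)\<close>, \<open>Q = x G - x F Z - F0 Z\<close>. A word \<open>l\<close> stands for a monomial in
  \<open>x\<close> (the letter \<open>None\<close>) and \<open>y\<close>.\<close>

definition gD :: "('n \<Rightarrow> family) \<Rightarrow> ('n \<Rightarrow> family) \<Rightarrow> 'n \<Rightarrow> family" where
  "gD Q Y j = gprod (\<lambda>i w. Q j i w - of_real (lam j) * Y j i w) gX"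

definition gZ :: "('n \<Rightarrow> family) \<Rightarrow> ('n \<Rightarrow> family) \<Rightarrow> 'n \<Rightarrow> family" where
  "gZ Q Y j i = (if freq i = 0 then gD Q Y j i else (\<lambda>w. w / (w + \<i> * of_int (freq i)) * gD Q Y j i w))"

definition letter :: "('n \<Rightarrow> family) \<Rightarrow> 'n option \<Rightarrow> family" where
  "letter Y v = (case v of None \<Rightarrow> gX | Some j \<Rightarrow> Y j)"

definition gterm_G :: "('n \<Rightarrow> family) \<Rightarrow> 'n \<Rightarrow> 'n option list \<Rightarrow> family" where
  "gterm_G Y j l = cmul (laurent_coeff (G j l)) (gword (letter Y) l gX)"

definition gterm_F :: "('n \<Rightarrow> family) \<Rightarrow> ('n \<Rightarrow> family) \<Rightarrow> 'n \<Rightarrow> 'n option list \<Rightarrow> family" where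
  "gterm_F Q Y j l = cmul (laurent_coeff (F l)) (gword (letter Y) l (gprod (gZ Q Y j) gX))"

text \<open>Each letter raises the degree in \<open>x\<close> by at least one, so longer words do not contribute.\<close>

definition gQ :: "('n \<Rightarrow> family) \<Rightarrow> ('n \<Rightarrow> family) \<Rightarrow> 'n \<Rightarrow> family" where
  "gQ Q Y j i = (\<lambda>w. (\<Sum>l | length l < fst i. gterm_G Y j l i w - gterm_F Q Y j l i w) - F0 * gZ Q Y j i w)"

text \<open>For the zero mode, \<open>Z = D\<close> becomes \<open>(w Y)' = Q - \<lambda> Y\<close>, whose regular solution is
  \<open>\<integral>\<^bsub>0\<^esub>\<^bsup>1\<^esup> t\<^sup>\<lambda> Q (t w) dt\<close>.\<close>

definition gY :: "(complex \<Rightarrow> complex) \<Rightarrow> ('n \<Rightarrow> family) \<Rightarrow> ('n \<Rightarrow> family) \<Rightarrow> 'n \<Rightarrow> family" where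
  "gY q Q Y j i = (if freq i = 0 then ray_avg (lam j) q else (\<lambda>w. gD Q Y j i w / (w + \<i> * of_int (freq i))))"

lemma gD_cong:
  assumes "\<And>j a. fst a < m \<Longrightarrow> Q j a = Q' j a" "\<And>j a. fst a < m \<Longrightarrow> Y j a = Y' j a" "fst i \<le> m"
  shows "gD Q Y j i = gD Q' Y' j i"
proof (cases "fst i = 0")
  case False
  then have "fst (i - (1, 0, 0)) < m" using assms(3) by auto
  then show ?thesis using assms by (simp add: gD_def gprod_gX)
qed (simp add: gD_def gprod_gX)

lemma gZ_zero: "fst i = 0 \<Longrightarrow> gZ Q Y j i = (\<lambda>_. 0)"
  by (simp add: gZ_def gD_def gprod_gX)

lemma gX_zero: "fst i = 0 \<Longrightarrow> gX i = (\<lambda>_. 0)"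
  by (auto simp: gX_def)

lemma gQ_cong:
  assumes Q: "\<And>j a. fst a < m \<Longrightarrow> Q j a = Q' j a" and Y: "\<And>j a. fst a < m \<Longrightarrow> Y j a = Y' j a" and i: "fst i \<le> m"
  shows "gQ Q Y j i = gQ Q' Y' j i"
proof -
  have Z: "gZ Q Y j a = gZ Q' Y' j a" if "fst a \<le> m" for a
    using gD_cong[of m Q Q' Y Y' a j, OF Q Y that] by (simp add: gZ_def)
  have L: "letter Y v a = letter Y' v a" if "fst a < m" for v a
    using Y[OF that] by (simp add: letter_def split: option.split)
  have z: "gprod f gX a = (\<lambda>_. 0)" if "fst a = 0" for a f using that by (simp add: gprod_gX)
  have ZX: "gprod (gZ Q Y j) gX a = gprod (gZ Q' Y' j) gX a" if "fst a \<le> m" for a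
    using Z[of "a - (1, 0, 0)"] that by (simp add: gprod_gX)
  have i': "fst (fst i, u) \<le> m" for u using i by simp
  have "gword (letter Y) l gX (fst i, u) = gword (letter Y') l gX (fst i, u)" for l u
    by (rule gword_cong[where m = m, OF L refl gX_zero i'])
  moreover have "gword (letter Y) l (gprod (gZ Q Y j) gX) (fst i, u) = gword (letter Y') l (gprod (gZ Q' Y' j) gX) (fst i, u)" for l u
    by (rule gword_cong[where m = m, OF L ZX z i'])
  ultimately show ?thesis unfolding gQ_def gterm_G_def gterm_F_def cmul_def Z[OF i] by (simp only:)
qed

lemma system_exists:
  "\<exists>Q Y. (\<forall>j i. Q j i = gQ Q Y j i) \<and> (\<forall>j i. Y j i = gY (Q j i) Q Y j i)"
proof -
  define QQ where "QQ = (\<lambda>(U :: nat \<Rightarrow> 'n \<Rightarrow> nat \<times> nat \<Rightarrow> (complex \<Rightarrow> complex) \<times> (complex \<Rightarrow> complex)) j i. fst (U (fst i) j (snd i)))"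
  define YY where "YY = (\<lambda>(U :: nat \<Rightarrow> 'n \<Rightarrow> nat \<times> nat \<Rightarrow> (complex \<Rightarrow> complex) \<times> (complex \<Rightarrow> complex)) j i. snd (U (fst i) j (snd i)))"
  \<comment> \<open>In the zero mode \<open>gY\<close> reads \<open>Q\<close> in the very degree
    being defined. Inserting the freshly computed \<open>gQ\<close> for it keeps the recursion
    dependent on lower degrees only.\<close>
  define \<Phi> where "\<Phi> = (\<lambda>U m j u. (gQ (QQ U) (YY U) j (m, u), gY (gQ (QQ U) (YY U) j (m, u)) (QQ U) (YY U) j (m, u)))"
  have "\<exists>U. \<forall>m. U m = \<Phi> U m"
  proof (rule causal_fixpoint)
    fix U V :: "nat \<Rightarrow> 'n \<Rightarrow> nat \<times> nat \<Rightarrow> (complex \<Rightarrow> complex) \<times> (complex \<Rightarrow> complex)" and m :: nat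
    assume UV: "\<And>k. k < m \<Longrightarrow> U k = V k"
    have Q: "QQ U j a = QQ V j a" and Y: "YY U j a = YY V j a" if "fst a < m" for j a
      using UV[OF that] by (simp_all add: QQ_def YY_def)
    have "gQ (QQ U) (YY U) j (m, u) = gQ (QQ V) (YY V) j (m, u)" for j u
      by (rule gQ_cong[where m = m]) (simp_all add: Q Y)
    moreover have "gD (QQ U) (YY U) j (m, u) = gD (QQ V) (YY V) j (m, u)" for j u
      by (rule gD_cong[where m = m]) (simp_all add: Q Y)
    ultimately show "\<Phi> U m = \<Phi> V m" unfolding \<Phi>_def gY_def by (simp only:)
  qed
  then obtain U where U: "\<And>m. U m = \<Phi> U m" by blast
  have "QQ U j i = gQ (QQ U) (YY U) j i" "YY U j i = gY (gQ (QQ U) (YY U) j i) (QQ U) (YY U) j i" for j i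
    unfolding QQ_def[of] YY_def[of] using U[of "fst i"] by (simp_all add: \<Phi>_def QQ_def YY_def)
  then show ?thesis by metis
qed

text \<open>The bound for \<open>Z\<close> when \<open>Q\<close> and \<open>Y\<close> have norm
  \<open>A\<close>: the product with \<open>x\<close> in \<open>D\<close> costs
  \<open>512 * (4 / \<tau>)\<close>, the difference \<open>Q - \<lambda> Y\<close> costs
  \<open>1 + Lam\<close>, and the resonant multiplier costs \<open>k0\<close>.\<close>

definition \<theta>A :: real where "\<theta>A = k0 * 512 * (1 + Lam) * (4 / \<tau>) * A"

lemma Lam_nonneg: "Lam \<ge> 0" using lam[of undefined] by linarith

lemma \<theta>A: "0 \<le> \<theta>A" "\<theta>A \<le> A"
proof -
  have "0 \<le> k0 * 512 * (1 + Lam) * (4 / \<tau>)" using k0 Lam_nonneg tau by (intro mult_nonneg_nonneg) auto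
  then show "0 \<le> \<theta>A" "\<theta>A \<le> A" using small(3) pos unfolding \<theta>A_def
    by (blast intro: mult_nonneg_nonneg mult_left_le_one_le less_imp_le)+
qed

lemma nrm_gD:
  assumes "nrm M A (Q j)" "nrm M A (Y j)"
  shows "nrm (Suc M) (\<theta>A / k0) (gD Q Y j)"
proof -
  have "nrm (Suc M) (512 * (A + norm (complex_of_real (lam j)) * A) * (4 / \<tau>)) (gD Q Y j)"
    unfolding gD_def using pos tau by (intro nrm_gprod nrm_diff assms nrm_gX add_nonneg_nonneg mult_nonneg_nonneg) auto
  moreover have "512 * (A + norm (complex_of_real (lam j)) * A) * (4 / \<tau>) \<le> 512 * (A + Lam * A) * (4 / \<tau>)"
    using lam(1)[of j] lam(2)[of j] pos tau by (intro mult_right_mono mult_left_mono add_left_mono) auto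
  moreover have "\<theta>A / k0 = 512 * (1 + Lam) * (4 / \<tau>) * A" using k0 by (simp add: \<theta>A_def)
  then have "512 * (A + Lam * A) * (4 / \<tau>) = \<theta>A / k0" by (simp add: distrib_left distrib_right mult_ac add_divide_distrib)
  ultimately show ?thesis using nrm_mono[OF _ _ order_refl] by metis
qed

lemma nrm_divisor:
  assumes f: "nrm M a f" and a: "a \<ge> 0"
    and h: "\<And>i w. freq i = 0 \<Longrightarrow> h i w = f i w" 
      "\<And>i w. freq i \<noteq> 0 \<Longrightarrow> h i w = k i w * f i w" "\<And>i w. freq i \<noteq> 0 \<Longrightarrow> w \<in> S \<Longrightarrow> norm (k i w) \<le> k0"
      "\<And>i. freq i \<noteq> 0 \<Longrightarrow> k i holomorphic_on S"
  shows "nrm M (k0 * a) h"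
  unfolding nrm_def
proof (intro allI impI conjI ballI)
  fix i :: idx assume i: "fst i \<le> M"
  have "h i = (if freq i = 0 then f i else (\<lambda>w. k i w * f i w))" using h by (auto simp: fun_eq_iff)
  then show "h i holomorphic_on S" using nrmD(1)[OF f i] h(4)[of i] by (auto intro: holomorphic_on_mult)
  fix w assume w: "w \<in> S"
  have "norm (h i w) \<le> k0 * norm (f i w)"
  proof (cases "freq i = 0")
    case True
    then show ?thesis using h(1) k0 mult_right_mono[of 1 k0 "norm (f i w)"] by simp
  next
    case False
    then show ?thesis using h(2,3) w by (simp add: norm_mult mult_right_mono)
  qed
  also have "\<dots> \<le> k0 * (a * wts i * pw (fst i) (norm w))" using nrmD(2)[OF f i w] k0 by (intro mult_left_mono) auto
  finally show "norm (h i w) \<le> k0 * a * wts i * pw (fst i) (norm w)" by (simp add: mult_ac)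
qed

lemma holomorphic_resonance:
  "\<alpha> \<noteq> 0 \<Longrightarrow> (\<lambda>w. w / (w + \<i> * of_int \<alpha>)) holomorphic_on S" "\<alpha> \<noteq> 0 \<Longrightarrow> (\<lambda>w. 1 / (w + \<i> * of_int \<alpha>)) holomorphic_on S"
  using resonance(1) by (auto intro!: holomorphic_intros)

lemma nrm_gZ:
  assumes "nrm M A (Q j)" "nrm M A (Y j)"
  shows "nrm (Suc M) \<theta>A (gZ Q Y j)"
proof -
  have "nrm (Suc M) (k0 * (\<theta>A / k0)) (gZ Q Y j)"
    by (rule nrm_divisor[OF nrm_gD[of M Q j Y, OF assms], where k = "\<lambda>i w. w / (w + \<i> * of_int (freq i))"])
      (use \<theta>A k0 in \<open>auto simp: gZ_def intro: resonance holomorphic_resonance\<close>)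
  then show ?thesis using k0 by simp
qed

lemma nrm_letter:
  assumes "\<And>j. nrm M A (Y j)"
  shows "nrm M A (letter Y v)"
  using assms nrm_mono[OF nrm_gX small(4) order_refl] by (simp add: letter_def split: option.split)

lemma nrm_gterm_G:
  assumes "\<And>j. nrm M A (Y j)"
  shows "nrm (Suc M) (64 * B * (4 / \<tau>) * (512 * A / \<rho>) ^ length l) (gterm_G Y j l)"
proof -
  have "nrm (Suc M) (64 * ((512 * A) ^ length l * (4 / \<tau>)) * (B / \<rho> ^ length l)) (gterm_G Y j l)"
    unfolding gterm_G_def
    by (intro nrm_cmul nrm_gword[OF nrm_letter[OF assms] nrm_gX] coeffs mult_nonneg_nonneg) (use pos tau in auto)
  then show ?thesis by (simp add: power_divide mult_ac)
qed

lemma nrm_gterm_F: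
  assumes Q: "\<And>j. nrm M A (Q j)" and Y: "\<And>j. nrm M A (Y j)"
  shows "nrm (Suc M) (64 * B * (512 * \<theta>A * (4 / \<tau>)) * (512 * A / \<rho>) ^ length l) (gterm_F Q Y j l)"
proof -
  have Z: "nrm M \<theta>A (gZ Q Y j)" by (rule nrm_mono[OF nrm_gZ[of M Q j Y, OF Q Y]]) auto
  have "nrm (Suc M) (64 * ((512 * A) ^ length l * (512 * \<theta>A * (4 / \<tau>))) * (B / \<rho> ^ length l)) (gterm_F Q Y j l)"
    unfolding gterm_F_def
    by (intro nrm_cmul nrm_gword[OF nrm_letter[OF Y] nrm_gprod[OF Z nrm_gX]] coeffs mult_nonneg_nonneg) (use pos tau \<theta>A in auto)
  then show ?thesis by (simp add: power_divide mult_ac)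
qed

text \<open>A word of length \<open>k\<close> contributes the \<open>k\<close>-th power of
  \<open>512 A / \<rho>\<close>, so by \<open>small(1)\<close> all words together cost at most twice
  the empty one. Condition \<open>small(2)\<close> then returns the same constant \<open>A\<close>,
  one degree higher.\<close>

lemma nrm_gQ:
  assumes Q: "\<And>j. nrm M A (Q j)" and Y: "\<And>j. nrm M A (Y j)"
  shows "nrm (Suc M) A (gQ Q Y j)"
  unfolding nrm_def
proof (intro allI impI conjI ballI)
  fix i :: idx assume i: "fst i \<le> Suc M"
  let ?I = "{l :: 'n option list. length l < fst i}"
  let ?q = "512 * A / \<rho>"
  have I: "?I = {l \<in> lists UNIV. length l < fst i}" by simp
  note GF = nrm_gterm_G[where j = j and Y = Y, OF Y] nrm_gterm_F[where j = j and Q = Q and Y = Y, OF Q Y]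
  have Z: "nrm (Suc M) \<theta>A (gZ Q Y j)" by (rule nrm_gZ[of M Q j Y, OF Q Y])
  show "gQ Q Y j i holomorphic_on S" unfolding gQ_def
    by (intro holomorphic_intros nrmD(1)[OF GF(1) i] nrmD(1)[OF GF(2) i] nrmD(1)[OF Z i])
  fix w assume w: "w \<in> S"
  define W where "W = wts i * pw (fst i) (norm w)"
  have W: "W \<ge> 0" unfolding W_def using wts_pos[of i] pw_nonneg[of "norm w" "fst i"] by simp
  define E where "E = 64 * B * (4 / \<tau> + 512 * \<theta>A * (4 / \<tau>))"
  have E: "E \<ge> 0" unfolding E_def using pos tau \<theta>A by (intro mult_nonneg_nonneg add_nonneg_nonneg) auto
  have "norm (gterm_G Y j l i w - gterm_F Q Y j l i w) \<le> E * W * ?q ^ length l" for l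
  proof -
    have "norm (gterm_G Y j l i w) \<le> 64 * B * (4 / \<tau>) * ?q ^ length l * wts i * pw (fst i) (norm w)"
      "norm (gterm_F Q Y j l i w) \<le> 64 * B * (512 * \<theta>A * (4 / \<tau>)) * ?q ^ length l * wts i * pw (fst i) (norm w)"
      using nrmD(2)[OF GF(1) i w] nrmD(2)[OF GF(2) i w] by blast+
    then have "norm (gterm_G Y j l i w - gterm_F Q Y j l i w) \<le> 64 * B * (4 / \<tau>) * ?q ^ length l * wts i * pw (fst i) (norm w)
      + 64 * B * (512 * \<theta>A * (4 / \<tau>)) * ?q ^ length l * wts i * pw (fst i) (norm w)"
      using norm_triangle_ineq4[of "gterm_G Y j l i w" "gterm_F Q Y j l i w"] by linarith
    also have "\<dots> = E * W * ?q ^ length l" unfolding E_def W_def by algebra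
    finally show ?thesis .
  qed
  then have "norm (\<Sum>l\<in>?I. gterm_G Y j l i w - gterm_F Q Y j l i w) \<le> (\<Sum>l\<in>?I. E * W * ?q ^ length l)"
    by (intro sum_norm_le) blast
  also have "\<dots> = E * W * (\<Sum>l\<in>?I. ?q ^ length l)" by (simp add: sum_distrib_left)
  also have "\<dots> \<le> E * W * 2"
    unfolding I using pos small(1) E W by (intro mult_left_mono sum_lists_geometric) auto
  finally have 1: "norm (\<Sum>l\<in>?I. gterm_G Y j l i w - gterm_F Q Y j l i w) \<le> E * W * 2" .
  have 2: "norm (F0 * gZ Q Y j i w) \<le> norm F0 * (\<theta>A * W)"
    unfolding norm_mult W_def using nrmD(2)[OF Z i w] by (intro mult_left_mono) (auto simp: mult.assoc)
  have "norm (gQ Q Y j i w) \<le> E * W * 2 + norm F0 * (\<theta>A * W)"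
    unfolding gQ_def using norm_triangle_ineq4[of "\<Sum>l\<in>?I. gterm_G Y j l i w - gterm_F Q Y j l i w" "F0 * gZ Q Y j i w"] 1 2
    by linarith
  also have "\<dots> = (128 * B * (4 / \<tau> + 512 * \<theta>A * (4 / \<tau>)) + norm F0 * \<theta>A) * W" unfolding E_def by algebra
  also have "\<dots> \<le> A * W" using small(2) W unfolding \<theta>A_def by (rule mult_right_mono)
  finally show "norm (gQ Q Y j i w) \<le> A * wts i * pw (fst i) (norm w)" by (simp add: W_def mult_ac)
qed

text \<open>The two hypotheses on \<open>Q\<close> reflect the two kinds of modes: averaging along
  rays does not raise the degree and needs \<open>Q\<close> up to \<open>Suc M\<close>, whereas the
  other modes pass through the factor \<open>x\<close> in \<open>gD\<close> and need it up to
  \<open>M\<close>.\<close>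

lemma nrm_gY:
  assumes Q: "nrm (Suc M) A (Q j)" and Q': "nrm M A (Q j)" and Y: "nrm M A (Y j)"
    and Yn: "\<And>i. Y' i = gY (Q j i) Q Y j i"
  shows "nrm (Suc M) A Y'"
  unfolding nrm_def
proof (intro allI impI conjI ballI)
  fix i :: idx assume i: "fst i \<le> Suc M"
  have D: "nrm (Suc M) (\<theta>A / k0) (gD Q Y j)" by (rule nrm_gD[of M Q j Y, OF Q' Y])
  show "Y' i holomorphic_on S"
    using holomorphic_ray_avg[OF star nrmD(1)[OF Q i] lam(1)] nrmD(1)[OF D i] resonance(1)
    by (auto simp: Yn gY_def intro!: holomorphic_intros)
  fix w assume w: "w \<in> S"
  show "norm (Y' i w) \<le> A * wts i * pw (fst i) (norm w)"
  proof (cases "freq i = 0")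
    case True
    have "norm (ray_avg (lam j) (Q j i) w) \<le> A * wts i * pw (fst i) (norm w)"
    proof (rule ray_avg_bound[OF star nrmD(1)[OF Q i] w lam(1)])
      fix t :: real assume t: "t \<in> {0..1}"
      have "norm (Q j i (of_real t * w)) \<le> A * wts i * pw (fst i) (norm (of_real t * w))"
        by (rule nrmD(2)[OF Q i]) (use star0D[OF star w] t in auto)
      also have "\<dots> \<le> A * wts i * pw (fst i) (norm w)"
        using t pos wts_pos[of i] by (intro mult_left_mono pw_mono) (auto simp: norm_mult mult_left_le_one_le)
      finally show "norm (Q j i (of_real t * w)) \<le> A * wts i * pw (fst i) (norm w)" .
    qed
    then show ?thesis using True by (simp add: Yn gY_def)
  next
    case False
    have "norm (Y' i w) = norm (1 / (w + \<i> * of_int (freq i))) * norm (gD Q Y j i w)"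
      using False by (simp add: Yn gY_def norm_divide)
    also have "\<dots> \<le> k0 * (\<theta>A / k0 * wts i * pw (fst i) (norm w))"
      using nrmD(2)[OF D i w] resonance(3)[OF w False] k0 by (intro mult_mono) auto
    also have "\<dots> = \<theta>A * (wts i * pw (fst i) (norm w))" using k0 by simp
    also have "\<dots> \<le> A * (wts i * pw (fst i) (norm w))"
      using \<theta>A wts_pos[of i] pw_nonneg[of "norm w" "fst i"] by (intro mult_right_mono) auto
    finally show ?thesis by (simp add: mult.assoc)
  qed
qed

text \<open>Existence comes from the recursion alone; the bounds follow by induction on the degree
  with one constant \<open>A\<close> throughout. In degree 0 everything vanishes, as
  \<open>pw 0 = 0\<close> demands.\<close>

theorem system_solution:
  "\<exists>Q Y. (\<forall>j i. Q j i = gQ Q Y j i) \<and> (\<forall>j i. Y j i = gY (Q j i) Q Y j i) \<and> (\<forall>M j. nrm M A (Q j) \<and> nrm M A (Y j))"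
proof -
  obtain Q Y where Q: "\<And>j i. Q j i = gQ Q Y j i" and Y: "\<And>j i. Y j i = gY (Q j i) Q Y j i"
    using system_exists by blast
  have "\<forall>j. nrm M A (Q j) \<and> nrm M A (Y j)" for M
  proof (induction M)
    case 0
    have "Q j i = (\<lambda>_. 0)" if "fst i = 0" for j i
      unfolding Q[of j i] gQ_def using that by (simp add: gZ_zero)
    moreover from this have "Y j i = (\<lambda>_. 0)" if "fst i = 0" for j i
      unfolding Y[of j i] gY_def using that by (auto simp: gD_def gprod_gX ray_avg_def fun_eq_iff)
    ultimately show ?case by (simp add: nrm_def pw_def)
  next
    case (Suc M)
    have "nrm (Suc M) A (gQ Q Y j)" for j using Suc by (intro nrm_gQ) auto
    then have QS: "nrm (Suc M) A (Q j)" for j using Q by (simp add: nrm_def)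
    have "nrm (Suc M) A (Y j)" for j
      by (rule nrm_gY[OF QS _ _ Y]) (use Suc in auto)
    then show ?case using QS by blast
  qed
  then show ?thesis using Q Y by blast
qed

end

section \<open>Summation over the grading\<close>

lemma holomorphic_infsum:
  fixes f :: "'i \<Rightarrow> complex \<Rightarrow> complex"
  assumes S: "open S" and f: "\<And>i. i \<in> A \<Longrightarrow> f i holomorphic_on S"
    and b: "\<And>i y. i \<in> A \<Longrightarrow> y \<in> S \<Longrightarrow> norm (f i y) \<le> M i * b y"
    and M: "M summable_on A" "\<And>i. i \<in> A \<Longrightarrow> M i \<ge> 0" and bc: "continuous_on S b"
  shows "(\<lambda>y. \<Sum>\<^sub>\<infinity>i\<in>A. f i y) holomorphic_on S"
    and "y \<in> S \<Longrightarrow> ((\<lambda>i. deriv (f i) y) has_sum deriv (\<lambda>y. \<Sum>\<^sub>\<infinity>i\<in>A. f i y) y) A"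
proof -
  let ?g = "\<lambda>y. \<Sum>\<^sub>\<infinity>i\<in>A. f i y"
  have "\<exists>d. (?g has_field_derivative d) (at x) \<and> ((\<lambda>i. deriv (f i) x) has_sum d) A" if x: "x \<in> S" for x
  proof -
    obtain r where r: "r > 0" "cball x r \<subseteq> S" using S x open_contains_cball[of S] by blast
    have "bounded (b ` cball x r)"
      by (intro compact_imp_bounded compact_continuous_image continuous_on_subset[OF bc r(2)] compact_cball)
    then obtain K where K: "\<forall>y\<in>cball x r. \<bar>b y\<bar> \<le> K" by (auto simp: bounded_iff simp del: mem_cball)
    have ul: "uniform_limit (cball x r) (\<lambda>X y. \<Sum>i\<in>X. f i y) ?g (finite_subsets_at_top A)"
    proof (rule Weierstrass_m_test_general)
      show "norm (f i y) \<le> M i * K" if "i \<in> A" "y \<in> cball x r" for i y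
      proof -
        have "norm (f i y) \<le> M i * b y" using b that r by blast
        also have "\<dots> \<le> M i * K" using bspec[OF K that(2)] M(2)[OF that(1)] by (intro mult_left_mono) auto
        finally show ?thesis .
      qed
      show "(\<lambda>i. M i * K) summable_on A" by (rule summable_on_cmult_left[OF M(1)])
    qed
    have ev: "\<forall>\<^sub>F X in finite_subsets_at_top A. continuous_on (cball x r) (\<lambda>y. \<Sum>i\<in>X. f i y) \<and>
       (\<forall>w\<in>ball x r. ((\<lambda>y. \<Sum>i\<in>X. f i y) has_field_derivative (\<Sum>i\<in>X. deriv (f i) w)) (at w))"
    proof (rule eventually_finite_subsets_at_top_weakI, intro conjI ballI)
      fix X assume X: "finite X" "X \<subseteq> A"
      show "continuous_on (cball x r) (\<lambda>y. \<Sum>i\<in>X. f i y)"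
        using X f r by (intro continuous_on_sum) (auto intro!: holomorphic_on_imp_continuous_on intro: holomorphic_on_subset)
      fix w assume "w \<in> ball x r"
      then have "w \<in> S" using r by auto
      then show "((\<lambda>y. \<Sum>i\<in>X. f i y) has_field_derivative (\<Sum>i\<in>X. deriv (f i) w)) (at w)"
        using X f S by (intro DERIV_sum) (auto intro: holomorphic_derivI)
    qed
    obtain g' where g': "\<And>w. w \<in> ball x r \<Longrightarrow> (?g has_field_derivative (g' w)) (at w) \<and>
        ((\<lambda>X. \<Sum>i\<in>X. deriv (f i) w) \<longlongrightarrow> g' w) (finite_subsets_at_top A)"
      using has_complex_derivative_uniform_limit[OF ev ul finite_subsets_at_top_neq_bot r(1)] by metis
    have "x \<in> ball x r" using r by simp
    then show ?thesis unfolding has_sum_def using g' by blast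
  qed
  then obtain d where d: "\<And>x. x \<in> S \<Longrightarrow> (?g has_field_derivative d x) (at x)" "\<And>x. x \<in> S \<Longrightarrow> ((\<lambda>i. deriv (f i) x) has_sum d x) A"
    by metis
  show "?g holomorphic_on S" using d(1) S by (auto simp: holomorphic_on_open)
  show "y \<in> S \<Longrightarrow> ((\<lambda>i. deriv (f i) y) has_sum deriv ?g y) A" using d DERIV_imp_deriv by metis
qed

lemma has_sum_times:
  fixes f :: "'a \<Rightarrow> complex" and g :: "'b \<Rightarrow> complex"
  assumes f: "(f has_sum s) A" and g: "(g has_sum t) B"
    and M: "M summable_on A" "\<And>x. x \<in> A \<Longrightarrow> norm (f x) \<le> M x" and N: "N summable_on B" "\<And>x. x \<in> B \<Longrightarrow> norm (g x) \<le> N x"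
  shows "((\<lambda>(x, y). f x * g y) has_sum s * t) (A \<times> B)"
proof (rule has_sum_SigmaI[where g = "\<lambda>x. f x * t"])
  show "((\<lambda>y. case (x, y) of (x, y) \<Rightarrow> f x * g y) has_sum f x * t) B" for x
    using has_sum_cmult_right[OF g, of "f x"] by simp
  show "((\<lambda>x. f x * t) has_sum s * t) A" by (rule has_sum_cmult_left[OF f])
  have M0: "M x \<ge> 0" if "x \<in> A" for x using M(2)[OF that] norm_ge_zero order_trans by blast
  have N0: "N x \<ge> 0" if "x \<in> B" for x using N(2)[OF that] norm_ge_zero order_trans by blast
  show "(\<lambda>(x, y). f x * g y) summable_on A \<times> B"
    by (rule norm_summable_on[OF summable_on_times[OF M(1) N(1) M0 N0]])
      (use M N M0 in \<open>auto simp: norm_mult intro!: mult_mono\<close>)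
qed

lemma conv_commute: "conv f g = conv g f"
proof
  fix w
  let ?h = "\<lambda>t::real. f (of_real t * w) * g (of_real (1 - t) * w)"
  have "integral {0..1} (\<lambda>t. ?h (1 - t)) = integral {0..1} ?h"
  proof (cases "?h integrable_on {0..1}")
    case True
    then have "(?h has_integral integral {0..1} ?h) (cbox 0 1)" by auto
    from has_integral_affinity[OF this, of "-1" 1]
    have "((\<lambda>t. ?h (1 - t)) has_integral integral {0..1} ?h) ((\<lambda>x. 1 - x) ` {0..1})" by simp
    moreover have "(\<lambda>x. 1 - x) ` {0..1::real} = {0..1}" by (auto simp: image_iff intro!: bexI[of _ "1 - x" for x])
    ultimately show ?thesis by (auto dest: integral_unique)
  next
    \<comment> \<open>A non-integrable integrand has integral 0 by convention, and the reflection
      \<open>t \<mapsto> 1 - t\<close> preserves non-integrability.\<close>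
    case False
    have "\<not> (\<lambda>t. ?h (1 - t)) integrable_on {0..1}"
    proof
      assume "(\<lambda>t. ?h (1 - t)) integrable_on {0..1}"
      then have "((\<lambda>t. ?h (1 - t)) has_integral integral {0..1} (\<lambda>t. ?h (1 - t))) (cbox 0 1)" by auto
      from has_integral_affinity[OF this, of "-1" 1]
      have "(?h has_integral integral {0..1} (\<lambda>t. ?h (1 - t))) ((\<lambda>x. 1 - x) ` {0..1})" by simp
      moreover have "(\<lambda>x. 1 - x) ` {0..1::real} = {0..1}" by (auto simp: image_iff intro!: bexI[of _ "1 - x" for x])
      ultimately show False using False by (auto simp: integrable_on_def)
    qed
    then show ?thesis using False by (simp add: not_integrable_integral)
  qed
  moreover have "(\<lambda>t. ?h (1 - t)) = (\<lambda>t. g (of_real t * w) * f (of_real (1 - t) * w))" by (auto simp: mult.commute)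
  ultimately show "conv f g w = conv g f w" unfolding conv_def by (simp only:)
qed

lemma power_fact_le_exp: "(x::real) \<ge> 0 \<Longrightarrow> x ^ n / fact n \<le> exp x"
  using sum_le_suminf[of "\<lambda>n. x ^ n /\<^sub>R fact n" "{n}"] summable_exp_generic[of x]
  by (simp add: exp_def divide_inverse mult.commute)

text \<open>Trades degree for exponential type: \<open>(\<tau> r)^k / k!\<close> is a single term of
  the series of \<open>exp (\<tau> r)\<close>.\<close>

lemma pw_le_exp:
  assumes "\<tau> > 0" "r \<ge> 0"
  shows "\<tau> ^ m * pw m r \<le> \<tau> * exp (\<tau> * r)"
proof (cases m)
  case (Suc k)
  have "\<tau> ^ m * pw m r = \<tau> * ((\<tau> * r) ^ k / fact k)" by (simp add: Suc pw_def power_mult_distrib)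
  also have "\<dots> \<le> \<tau> * exp (\<tau> * r)" using assms by (intro mult_left_mono power_fact_le_exp) auto
  finally show ?thesis .
qed (use assms in \<open>simp add: pw_def\<close>)

text \<open>What remains of \<open>wts\<close> once the powers of \<open>\<tau>\<close> have been
  turned into exponential growth and those of \<open>\<sigma>\<close> into decay in the
  frequency.\<close>

definition hw3 :: "idx \<Rightarrow> real" where "hw3 i = hw (fst i) * (hw (fst (snd i)) * hw (snd (snd i)))"

lemma hw_summable: "hw summable_on UNIV"
proof -
  have "summable hw"
  proof (rule bounded_imp_summable)
    show "0 \<le> hw n" for n using hw_pos[of n] by simp
    show "sum hw {..n} \<le> 2" for n by (rule sum_hw_le)
  qed
  then show ?thesis using hw_pos by (intro norm_summable_imp_summable_on) (simp add: less_imp_le)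
qed

lemma hw3_pos: "hw3 i > 0" by (simp add: hw3_def hw_pos)

lemma hw3_summable: "hw3 summable_on A"
proof -
  have "(\<lambda>(m, p, q). hw m * (hw p * hw q)) summable_on (UNIV \<times> (UNIV \<times> UNIV))"
    using summable_on_times[OF hw_summable summable_on_times[OF hw_summable hw_summable]]
    by (simp add: hw_pos less_imp_le case_prod_unfold)
  moreover have "hw3 = (\<lambda>(m, p, q). hw m * (hw p * hw q))" by (auto simp: hw3_def)
  ultimately have "hw3 summable_on UNIV" by simp
  then show ?thesis by (rule summable_on_subset_banach) simp
qed

text \<open>Absolute summability allows the double sum over \<open>(a, b)\<close> to be regrouped
  along \<open>i = a + b\<close>.\<close>

lemma has_sum_box:
  fixes x y :: "idx \<Rightarrow> complex"
  assumes x: "(x has_sum s) UNIV" and y: "(y has_sum t) UNIV"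
    and xb: "\<And>i. norm (x i) \<le> K * hw3 i" and yb: "\<And>i. norm (y i) \<le> L * hw3 i"
  shows "((\<lambda>i. \<Sum>a\<in>box i. x a * y (i - a)) has_sum s * t) UNIV"
proof -
  have "((\<lambda>(a, b). x a * y b) has_sum s * t) (UNIV \<times> UNIV)"
    by (rule has_sum_times[OF x y summable_on_cmult_right[OF hw3_summable] _ summable_on_cmult_right[OF hw3_summable]])
       (use xb yb in auto)
  moreover have "((\<lambda>(i, a). x a * y (i - a)) has_sum s * t) (Sigma UNIV box) \<longleftrightarrow> ((\<lambda>(a, b). x a * y b) has_sum s * t) (UNIV \<times> UNIV)"
    by (rule has_sum_reindex_bij_witness[where j = "\<lambda>(i, a). (a, i - a)" and i = "\<lambda>(a, b). (a + b, a)"])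
       (auto simp: box_def)
  ultimately have "((\<lambda>(i, a). x a * y (i - a)) has_sum s * t) (Sigma UNIV box)" by blast
  then show ?thesis by (rule has_sum_Sigma') (simp add: has_sum_finite_iff)
qed

lemma abs_freq_le: "\<bar>freq i\<bar> \<le> int (fst (snd i) + snd (snd i))"
  by (auto simp: freq_def)

lemma freq_add: "a \<in> box i \<Longrightarrow> freq a + freq (i - a) = freq i"
  by (auto simp: freq_def box_def)

section \<open>Fourier modes of a graded family\<close>

context weights
begin

definition good :: "real \<Rightarrow> family \<Rightarrow> bool" where
  "good a f \<longleftrightarrow> (\<forall>M. nrm M a f)"

lemma goodD:
  assumes "good a f"
  shows "f i holomorphic_on S" and "w \<in> S \<Longrightarrow> norm (f i w) \<le> a * wts i * pw (fst i) (norm w)"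
    and "fst i = 0 \<Longrightarrow> w \<in> S \<Longrightarrow> f i w = 0"
  using assms nrmD[of "fst i" a f i] nrm_zero_degree[of 0 a f i w] by (auto simp: good_def)

lemma good_bound:
  assumes f: "good a f" and a: "a \<ge> 0" and w: "w \<in> S"
  shows "norm (f i w) \<le> (a * \<tau> * (\<sigma> ^ (fst (snd i) + snd (snd i)) * hw3 i)) * exp (\<tau> * norm w)"
proof -
  have "norm (f i w) \<le> a * wts i * pw (fst i) (norm w)" by (rule goodD(2)[OF f w])
  also have "\<dots> = (a * (\<sigma> ^ (fst (snd i) + snd (snd i)) * hw3 i)) * (\<tau> ^ fst i * pw (fst i) (norm w))"
    by (simp add: wts_def hw3_def power_add mult_ac)
  also have "\<dots> \<le> (a * (\<sigma> ^ (fst (snd i) + snd (snd i)) * hw3 i)) * (\<tau> * exp (\<tau> * norm w))"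
    using a sigma tau hw3_pos[of i] by (intro mult_left_mono pw_le_exp) (auto intro!: mult_nonneg_nonneg)
  finally show ?thesis by (simp add: mult_ac)
qed

end

locale decaying_weights = weights S \<tau> \<sigma> for S \<tau> \<sigma> + assumes sigma1: "\<sigma> \<le> 1"
begin

text \<open>The Borel transform of the \<open>\<alpha>\<close>-th Fourier coefficient: entries of
  every degree with \<open>p - q = \<alpha>\<close> are collected.\<close>

definition hat :: "family \<Rightarrow> int \<Rightarrow> complex \<Rightarrow> complex" where
  "hat f \<alpha> w = (\<Sum>\<^sub>\<infinity>i\<in>{i. freq i = \<alpha>}. f i w)"

definition H3 :: real where "H3 = infsum hw3 UNIV"

lemma H3_nonneg: "H3 \<ge> 0" unfolding H3_def by (rule infsum_nonneg) (simp add: less_imp_le[OF hw3_pos])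

lemma sigma_freq: "\<sigma> ^ (fst (snd i) + snd (snd i)) \<le> \<sigma> ^ nat \<bar>freq i\<bar>"
  using abs_freq_le[of i] sigma sigma1 by (intro power_decreasing) auto

lemma good_bound':
  assumes f: "good a f" and a: "a \<ge> 0" and w: "w \<in> S"
  shows "norm (f i w) \<le> (a * \<tau> * \<sigma> ^ nat \<bar>freq i\<bar> * hw3 i) * exp (\<tau> * norm w)"
proof -
  have "norm (f i w) \<le> (a * \<tau> * (\<sigma> ^ (fst (snd i) + snd (snd i)) * hw3 i)) * exp (\<tau> * norm w)" by (rule good_bound[OF assms])
  also have "\<dots> \<le> (a * \<tau> * (\<sigma> ^ nat \<bar>freq i\<bar> * hw3 i)) * exp (\<tau> * norm w)"
    using a tau hw3_pos[of i] sigma_freq[of i] by (intro mult_right_mono mult_left_mono) auto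
  finally show ?thesis by (simp add: mult_ac)
qed

lemma hat_has_sum:
  assumes f: "good a f" and a: "a \<ge> 0" and w: "w \<in> S"
  shows "((\<lambda>i. f i w) has_sum hat f \<alpha> w) {i. freq i = \<alpha>}"
  unfolding hat_def
proof (rule has_sum_infsum, rule norm_summable_on)
  show "norm (f i w) \<le> (a * \<tau> * exp (\<tau> * norm w)) * hw3 i" for i
  proof -
    have "norm (f i w) \<le> (a * \<tau> * (\<sigma> ^ nat \<bar>freq i\<bar> * hw3 i)) * exp (\<tau> * norm w)" using good_bound'[OF assms, of i] by (simp add: mult_ac)
    also have "\<dots> \<le> (a * \<tau> * (1 * hw3 i)) * exp (\<tau> * norm w)"
      using a tau hw3_pos[of i] sigma sigma1 by (intro mult_right_mono mult_left_mono power_le_one) auto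
    finally show ?thesis by (simp add: mult_ac)
  qed
  show "(\<lambda>i. (a * \<tau> * exp (\<tau> * norm w)) * hw3 i) summable_on {i. freq i = \<alpha>}" by (rule summable_on_cmult_right[OF hw3_summable])
qed

lemma hat_bound:
  assumes f: "good a f" and a: "a \<ge> 0" and w: "w \<in> S"
  shows "norm (hat f \<alpha> w) \<le> (a * \<tau> * H3 * \<sigma> ^ nat \<bar>\<alpha>\<bar>) * exp (\<tau> * norm w)"
proof -
  let ?c = "a * \<tau> * \<sigma> ^ nat \<bar>\<alpha>\<bar> * exp (\<tau> * norm w)"
  have c: "?c \<ge> 0" using a tau sigma by simp
  have "norm (hat f \<alpha> w) \<le> ?c * infsum hw3 {i. freq i = \<alpha>}"
  proof (rule norm_infsum_le[OF hat_has_sum[OF assms] has_sum_cmult_right[OF has_sum_infsum[OF hw3_summable]]])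
    show "norm (f i w) \<le> ?c * hw3 i" if "i \<in> {i. freq i = \<alpha>}" for i
      using good_bound'[OF assms, of i] that by (simp add: mult_ac)
  qed
  also have "\<dots> \<le> ?c * H3" unfolding H3_def
    by (rule mult_left_mono[OF infsum_mono_neutral c]) (auto simp: hw3_summable less_imp_le[OF hw3_pos])
  finally show ?thesis by (simp add: mult_ac)
qed

lemma hat_holomorphic:
  assumes f: "good a f" and a: "a \<ge> 0"
  shows "hat f \<alpha> holomorphic_on S"
proof -
  have "(\<lambda>w. \<Sum>\<^sub>\<infinity>i\<in>{i. freq i = \<alpha>}. f i w) holomorphic_on S"
  proof (rule holomorphic_infsum(1)[where M = "\<lambda>i. a * \<tau> * \<sigma> ^ nat \<bar>\<alpha>\<bar> * hw3 i" and b = "\<lambda>w. exp (\<tau> * norm w)"])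
    show "norm (f i w) \<le> (a * \<tau> * \<sigma> ^ nat \<bar>\<alpha>\<bar> * hw3 i) * exp (\<tau> * norm w)" if "i \<in> {i. freq i = \<alpha>}" "w \<in> S" for i w
      using good_bound'[OF f a that(2), of i] that(1) by simp
    show "(\<lambda>i. a * \<tau> * \<sigma> ^ nat \<bar>\<alpha>\<bar> * hw3 i) summable_on {i. freq i = \<alpha>}" by (rule summable_on_cmult_right[OF hw3_summable])
    show "a * \<tau> * \<sigma> ^ nat \<bar>\<alpha>\<bar> * hw3 i \<ge> 0" for i using a tau sigma hw3_pos[of i] by simp
  qed (auto intro!: continuous_intros goodD(1)[OF f] star0_open[OF star])
  then show ?thesis by (simp add: hat_def[abs_def])
qed

end

section \<open>Evaluation of families by Laplace transforms along a ray\<close>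

locale ray_weights = decaying_weights S \<tau> \<sigma> for S \<tau> \<sigma> +
  fixes e z \<theta> :: complex
  assumes e: "norm e = 1" and ray: "\<And>r. r \<ge> 0 \<Longrightarrow> of_real r * e \<in> S" and ez: "Re (e * z) > 2 * \<tau>"
    and theta: "\<sigma> * exp \<bar>Im \<theta>\<bar> \<le> 1"
begin

text \<open>The margin \<open>2 * \<tau>\<close> makes the denominator of the Laplace bound at least
  \<open>\<tau>\<close>, which cancels the factor \<open>\<tau>\<close> coming from
  \<open>pw_le_exp\<close>.\<close>

lemma ez': "Re (e * z) > \<tau>" "Re (e * z) - \<tau> \<ge> \<tau>" using ez tau by linarith+

lemma ray_boundedI:
  assumes "g holomorphic_on S" "\<And>w. w \<in> S \<Longrightarrow> norm (g w) \<le> C * exp (\<tau> * norm w)"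
  shows "ray_bounded e \<tau> C g"
  unfolding ray_bounded_def
proof safe
  show "continuous_on {0..} (\<lambda>r. g (of_real r * e))"
    by (rule continuous_on_compose2[OF holomorphic_on_imp_continuous_on[OF assms(1)]]) (use ray in \<open>auto intro!: continuous_intros\<close>)
  show "norm (g (of_real r * e)) \<le> C * exp (\<tau> * r)" if "0 \<le> r" for r
    using assms(2)[OF ray[OF that]] that e by (simp add: norm_mult)
qed

definition mode :: "idx \<Rightarrow> complex" where "mode i = exp (\<i> * of_int (freq i) * \<theta>)"

definition summand :: "family \<Rightarrow> idx \<Rightarrow> complex" where
  "summand f i = mode i * lap e z (f i)"

text \<open>The value at \<open>(1 / z, \<theta>)\<close> of the series for which a family stands.
  On families with finite norm it is additive and multiplicative, so it carries the Borel system
  back to an equation between numbers.\<close>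

definition val :: "family \<Rightarrow> complex" where
  "val f = (\<Sum>\<^sub>\<infinity>i. summand f i)"

lemma mode_box: "a \<in> box i \<Longrightarrow> mode i = mode a * mode (i - a)"
proof -
  assume "a \<in> box i"
  from freq_add[OF this] have "\<i> * of_int (freq i) * \<theta> = \<i> * of_int (freq a) * \<theta> + \<i> * of_int (freq (i - a)) * \<theta>"
    by (metis distrib_left distrib_right of_int_add)
  then show ?thesis unfolding mode_def by (simp only: exp_add)
qed

text \<open>A mode grows at most like \<open>exp \<bar>Im \<theta>\<bar>\<close> to the power
  \<open>p + q\<close>, and \<open>theta\<close> says that \<open>\<sigma>\<close> compensates each
  such factor.\<close>

lemma sigma_mode: "\<sigma> ^ (fst (snd i) + snd (snd i)) * norm (mode i) \<le> 1"
proof -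
  have "norm (mode i) \<le> exp \<bar>Im \<theta>\<bar> ^ nat \<bar>freq i\<bar>"
    by (simp add: mode_def exp_of_nat_mult[symmetric] abs_mult[symmetric])
  also have "\<dots> \<le> exp \<bar>Im \<theta>\<bar> ^ (fst (snd i) + snd (snd i))"
    using abs_freq_le[of i] by (intro power_increasing) auto
  finally have "\<sigma> ^ (fst (snd i) + snd (snd i)) * norm (mode i) \<le> (\<sigma> * exp \<bar>Im \<theta>\<bar>) ^ (fst (snd i) + snd (snd i))"
    using sigma by (simp add: power_mult_distrib)
  also have "\<dots> \<le> 1" using theta sigma by (intro power_le_one) auto
  finally show ?thesis .
qed

lemma good_ray_bounded:
  assumes f: "good a f" and a: "a \<ge> 0"
  shows "ray_bounded e \<tau> (a * \<tau> * (\<sigma> ^ (fst (snd i) + snd (snd i)) * hw3 i)) (f i)"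
  by (rule ray_boundedI[OF goodD(1)[OF f] good_bound[OF f a]])

lemma summand_bound:
  assumes f: "good a f" and a: "a \<ge> 0"
  shows "norm (summand f i) \<le> a * hw3 i"
proof -
  let ?s = "\<sigma> ^ (fst (snd i) + snd (snd i))"
  have n: "0 \<le> a * \<tau> * (?s * hw3 i)" using a tau sigma hw3_pos[of i] by simp
  have "norm (lap e z (f i)) \<le> a * \<tau> * (?s * hw3 i) / (Re (e * z) - \<tau>)"
    by (rule lap_integrable(2)[OF good_ray_bounded[OF assms] ez'(1) e])
  also have "\<dots> \<le> a * \<tau> * (?s * hw3 i) / \<tau>" using ez' tau n by (intro divide_left_mono) auto
  also have "\<dots> = a * (?s * hw3 i)" using tau by simp
  finally have "norm (mode i) * norm (lap e z (f i)) \<le> norm (mode i) * (a * (?s * hw3 i))" by (rule mult_left_mono) simp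
  also have "\<dots> = (?s * norm (mode i)) * (a * hw3 i)" by (simp add: mult_ac)
  also have "\<dots> \<le> 1 * (a * hw3 i)" using sigma_mode[of i] a hw3_pos[of i] by (intro mult_right_mono) auto
  finally show ?thesis by (simp add: summand_def norm_mult)
qed

lemma val_has_sum:
  assumes f: "good a f" and a: "a \<ge> 0"
  shows "(summand f has_sum val f) UNIV"
  unfolding val_def
  by (rule has_sum_infsum, rule norm_summable_on[OF summable_on_cmult_right[OF hw3_summable] summand_bound[OF assms]])

lemma val_bound:
  assumes f: "good a f" and a: "a \<ge> 0"
  shows "norm (val f) \<le> a * H3"
  unfolding H3_def
  by (rule norm_infsum_le[OF val_has_sum[OF assms] has_sum_cmult_right[OF has_sum_infsum[OF hw3_summable]] summand_bound[OF assms]])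

lemma lap_sum_ex:
  assumes "finite A" "\<And>i. i \<in> A \<Longrightarrow> \<exists>C. ray_bounded e \<tau> C (f i)"
  shows "lap e z (\<lambda>w. \<Sum>i\<in>A. f i w) = (\<Sum>i\<in>A. lap e z (f i))"
proof -
  obtain C where "\<And>i. i \<in> A \<Longrightarrow> ray_bounded e \<tau> (C i) (f i)" using assms(2) by metis
  then show ?thesis by (rule lap_sum[OF assms(1) _ ez'(1) e])
qed

lemma conv_ray_bounded:
  assumes f: "good a f" "a \<ge> 0" and g: "good b g" "b \<ge> 0"
  shows "\<exists>C. ray_bounded e \<tau> C (conv (f i) (g j))"
proof -
  let ?k = "(a * wts i) * (b * wts j)"
  have k: "?k \<ge> 0" using f g wts_pos by (simp add: less_imp_le)
  have "norm (conv (f i) (g j) w) \<le> ?k / \<tau> ^ (fst i + fst j) * \<tau> * exp (\<tau> * norm w)" if w: "w \<in> S" for w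
  proof -
    have "norm (conv (f i) (g j) w) \<le> ?k * (if fst i = 0 \<or> fst j = 0 then 0 else pw (fst i + fst j) (norm w))"
      by (rule conv_bound[OF star goodD(1)[OF f(1)] goodD(1)[OF g(1)] w goodD(2)[OF f(1)] goodD(2)[OF g(1)]])
        (use star0D[OF star w] f g wts_pos in \<open>auto simp: less_imp_le\<close>)
    also have "\<dots> \<le> ?k * pw (fst i + fst j) (norm w)" using pw_nonneg[of "norm w"] k by (intro mult_left_mono) auto
    also have "\<dots> = ?k / \<tau> ^ (fst i + fst j) * (\<tau> ^ (fst i + fst j) * pw (fst i + fst j) (norm w))" using tau by simp
    also have "\<dots> \<le> ?k / \<tau> ^ (fst i + fst j) * (\<tau> * exp (\<tau> * norm w))"
      using k tau by (intro mult_left_mono pw_le_exp) auto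
    finally show ?thesis by (simp add: mult_ac)
  qed
  from ray_boundedI[OF holomorphic_conv[OF star goodD(1)[OF f(1)] goodD(1)[OF g(1)]] this] show ?thesis by blast
qed

text \<open>The Laplace transform turns \<open>conv\<close> into a product, the modes multiply
  because frequencies add on \<open>box\<close>, and \<open>has_sum_box\<close> does the
  regrouping.\<close>

lemma val_gprod:
  assumes f: "good a f" "a \<ge> 0" and g: "good b g" "b \<ge> 0"
  shows "val (gprod f g) = val f * val g"
proof -
  have "summand (gprod f g) i = (\<Sum>c\<in>box i. summand f c * summand g (i - c))" for i
  proof -
    have "lap e z (gprod f g i) = (\<Sum>c\<in>box i. lap e z (conv (f c) (g (i - c))))"
      unfolding gprod_def by (rule lap_sum_ex) (auto intro: conv_ray_bounded[OF f g])
    also have "\<dots> = (\<Sum>c\<in>box i. lap e z (f c) * lap e z (g (i - c)))"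
      by (intro sum.cong refl lap_conv[OF good_ray_bounded[OF f] good_ray_bounded[OF g] ez'(1) e])
    also have "mode i * \<dots> = (\<Sum>c\<in>box i. summand f c * summand g (i - c))"
      unfolding sum_distrib_left
    proof (intro sum.cong refl)
      fix c assume "c \<in> box i"
      from mode_box[OF this] have "mode i = mode c * mode (i - c)" .
      then show "mode i * (lap e z (f c) * lap e z (g (i - c))) = summand f c * summand g (i - c)" by (simp add: summand_def)
    qed
    finally show ?thesis by (simp add: summand_def)
  qed
  then have "(summand (gprod f g) has_sum val f * val g) UNIV"
    using has_sum_box[OF val_has_sum[OF f] val_has_sum[OF g] summand_bound[OF f] summand_bound[OF g]] by (simp add: fun_eq_iff[symmetric] cong: has_sum_cong)
  then show ?thesis by (simp add: val_def infsumI)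
qed

lemma val_cmul:
  assumes f: "good a f" "a \<ge> 0" and c: "\<And>p q. norm (laurent_coeff c p q) \<le> K * (\<sigma> ^ p * hw p) * (\<sigma> ^ q * hw q)" and K: "K \<ge> 0"
    and s: "((\<lambda>\<alpha>. c \<alpha> * exp (\<i> * of_int \<alpha> * \<theta>)) has_sum s) UNIV"
  shows "val (cmul (laurent_coeff c) f) = s * val f"
proof -
  \<comment> \<open>The function of \<open>\<theta>\<close> is treated as a family of numbers
    concentrated in degree 0, so that the product formula \<open>has_sum_box\<close> applies
    although this factor has no Borel transform.\<close>
  define x where "x = (\<lambda>i. if fst i = 0 then laurent_coeff c (fst (snd i)) (snd (snd i)) * mode i else 0)"
  have xb: "norm (x i) \<le> K * hw3 i" for i
  proof (cases "fst i = 0")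
    case True
    have "norm (x i) \<le> (K * (\<sigma> ^ fst (snd i) * hw (fst (snd i))) * (\<sigma> ^ snd (snd i) * hw (snd (snd i)))) * norm (mode i)"
      using True c by (simp add: x_def norm_mult mult_right_mono)
    also have "\<dots> = (\<sigma> ^ (fst (snd i) + snd (snd i)) * norm (mode i)) * (K * hw3 i)" using True by (simp add: hw3_def power_add mult_ac)
    also have "\<dots> \<le> 1 * (K * hw3 i)" using sigma_mode[of i] K hw3_pos[of i] by (intro mult_right_mono) auto
    finally show ?thesis by simp
  qed (use K hw3_pos[of i] in \<open>simp add: x_def\<close>)
  have xs: "(x has_sum s) UNIV"
  proof -
    let ?h = "\<lambda>\<alpha>::int. (0::nat, nat \<alpha>, nat (- \<alpha>))"
    have inj: "inj ?h" by (rule inj_on_inverseI[where g = freq]) (simp add: freq_def)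
    have "x (?h \<alpha>) = c \<alpha> * exp (\<i> * of_int \<alpha> * \<theta>)" for \<alpha>
      by (cases "\<alpha> \<ge> 0") (auto simp: x_def laurent_coeff_def mode_def freq_def)
    then have "((x \<circ> ?h) has_sum s) UNIV" using s by (simp add: o_def)
    then have "(x has_sum s) (range ?h)" by (simp add: has_sum_reindex[OF inj])
    moreover have "x i = 0" if "i \<notin> range ?h" for i
    proof (rule ccontr)
      assume "x i \<noteq> 0"
      then have "fst i = 0" "snd (snd i) = 0 \<or> fst (snd i) = 0" by (auto simp: x_def laurent_coeff_def split: if_splits)
      then have "i = ?h (freq i)" by (cases i) (auto simp: freq_def)
      then show False using that by blast
    qed
    ultimately show ?thesis by (subst has_sum_cong_neutral[where S = UNIV and T = "range ?h" and g = x]) auto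
  qed
  have "summand (cmul (laurent_coeff c) f) i = (\<Sum>a\<in>box i. x a * summand f (i - a))" for i
  proof -
    obtain m p q where i: "i = (m, p, q)" by (cases i)
    have "lap e z (cmul (laurent_coeff c) f i) = (\<Sum>u\<in>{..p} \<times> {..q}. lap e z (\<lambda>w. laurent_coeff c (fst u) (snd u) * f (m, p - fst u, q - snd u) w))"
      unfolding cmul_def i fst_conv snd_conv case_prod_unfold
      by (rule lap_sum_ex) (auto intro: ray_bounded_cmult[OF good_ray_bounded[OF f]])
    also have "\<dots> = (\<Sum>u\<in>{..p} \<times> {..q}. laurent_coeff c (fst u) (snd u) * lap e z (f (m, p - fst u, q - snd u)))"
      by (simp only: lap_cmult)
    finally have "summand (cmul (laurent_coeff c) f) i = (\<Sum>u\<in>{..p} \<times> {..q}. x (0, u) * summand f (i - (0, u)))"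
    proof -
      assume eq: "lap e z (cmul (laurent_coeff c) f i) = (\<Sum>u\<in>{..p} \<times> {..q}. laurent_coeff c (fst u) (snd u) * lap e z (f (m, p - fst u, q - snd u)))"
      have "mode i = mode (0, u) * mode (i - (0, u))" if "u \<in> {..p} \<times> {..q}" for u
        using that by (intro mode_box) (auto simp: box_def i)
      then show ?thesis unfolding summand_def eq sum_distrib_left
        by (intro sum.cong refl) (auto simp: x_def i mult_ac)
    qed
    also have "\<dots> = (\<Sum>a\<in>Pair 0 ` ({..p} \<times> {..q}). x a * summand f (i - a))"
      by (subst sum.reindex) (auto simp: inj_on_def)
    also have "\<dots> = (\<Sum>a\<in>box i. x a * summand f (i - a))"
      by (rule sum.mono_neutral_left) (auto simp: box_def i x_def image_iff)
    finally show ?thesis .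
  qed
  then have "(summand (cmul (laurent_coeff c) f) has_sum s * val f) UNIV"
    using has_sum_box[OF xs val_has_sum[OF f] xb summand_bound[OF f]] by (simp add: fun_eq_iff[symmetric] cong: has_sum_cong)
  then show ?thesis by (simp add: val_def infsumI)
qed

text \<open>The same absolutely convergent sum grouped by frequency. It exhibits the value as a
  Fourier series whose coefficients are Laplace transforms of \<open>hat\<close>.\<close>

lemma val_hat_has_sum:
  assumes f: "good a f" "a \<ge> 0"
  shows "((\<lambda>\<alpha>. exp (\<i> * of_int \<alpha> * \<theta>) * lap e z (hat f \<alpha>)) has_sum val f) UNIV"
proof -
  have h: "((\<lambda>i. lap e z (f i)) has_sum lap e z (hat f \<alpha>)) {i. freq i = \<alpha>}" for \<alpha>
  proof (rule lap_has_sum[OF good_ray_bounded[OF f] _ _ ez'(1) e])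
    show "((\<lambda>i. f i w) has_sum hat f \<alpha> w) {i. freq i = \<alpha>}" if "w \<in> (\<lambda>r. of_real r * e) ` {0..}" for w
      using hat_has_sum[OF f] ray that by auto
    show "(\<lambda>i. a * \<tau> * (\<sigma> ^ (fst (snd i) + snd (snd i)) * hw3 i)) summable_on {i. freq i = \<alpha>}"
    proof (rule norm_summable_on[OF summable_on_cmult_right[OF hw3_summable]])
      fix i
      have "\<sigma> ^ (fst (snd i) + snd (snd i)) * hw3 i \<le> 1 * hw3 i" 
        using sigma sigma1 hw3_pos[of i] by (intro mult_right_mono power_le_one) auto
      then have "a * \<tau> * (\<sigma> ^ (fst (snd i) + snd (snd i)) * hw3 i) \<le> a * \<tau> * (1 * hw3 i)"
        using f tau by (intro mult_left_mono) auto
      moreover have "0 \<le> a * \<tau> * (\<sigma> ^ (fst (snd i) + snd (snd i)) * hw3 i)" using f tau sigma hw3_pos[of i] by simp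
      ultimately show "norm (a * \<tau> * (\<sigma> ^ (fst (snd i) + snd (snd i)) * hw3 i)) \<le> a * \<tau> * hw3 i" by simp
    qed
    show "continuous_on {0..} (\<lambda>r. hat f \<alpha> (of_real r * e))"
      by (rule continuous_on_compose2[OF holomorphic_on_imp_continuous_on[OF hat_holomorphic[OF f]]]) (use ray in \<open>auto intro!: continuous_intros\<close>)
  qed
  have "((\<lambda>(\<alpha>, i). summand f i) has_sum val f) (SIGMA \<alpha>:UNIV. {i. freq i = \<alpha>}) \<longleftrightarrow> (summand f has_sum val f) UNIV"
    by (rule has_sum_reindex_bij_witness[where j = snd and i = "\<lambda>i. (freq i, i)"]) auto
  then have "((\<lambda>(\<alpha>, i). summand f i) has_sum val f) (SIGMA \<alpha>:UNIV. {i. freq i = \<alpha>})" using val_has_sum[OF f] by blast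
  then show ?thesis
  proof (rule has_sum_Sigma')
    fix \<alpha> :: int
    have "((\<lambda>i. exp (\<i> * of_int \<alpha> * \<theta>) * lap e z (f i)) has_sum exp (\<i> * of_int \<alpha> * \<theta>) * lap e z (hat f \<alpha>)) {i. freq i = \<alpha>}"
      by (rule has_sum_cmult_right[OF h])
    then show "((\<lambda>i. case (\<alpha>, i) of (\<alpha>, i) \<Rightarrow> summand f i) has_sum exp (\<i> * of_int \<alpha> * \<theta>) * lap e z (hat f \<alpha>)) {i. freq i = \<alpha>}"
      by (rule has_sum_cong[THEN iffD2, rotated]) (simp add: summand_def mode_def)
  qed
qed

lemma hat_ray_bounded:
  assumes f: "good a f" "a \<ge> 0"
  shows "ray_bounded e \<tau> (a * \<tau> * H3 * \<sigma> ^ nat \<bar>\<alpha>\<bar>) (hat f \<alpha>)"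
  by (rule ray_boundedI[OF hat_holomorphic[OF f] hat_bound[OF f]])

end

lemma has_sum_subtract:
  fixes f g :: "'a \<Rightarrow> complex"
  assumes "(f has_sum a) A" "(g has_sum b) A"
  shows "((\<lambda>x. f x - g x) has_sum (a - b)) A"
  using has_sum_add[OF assms(1) has_sum_cmult_right[OF assms(2), of "-1"]] by simp

section \<open>The convolution equation of each Fourier mode\<close>

locale borel_solution = borel_system S \<tau> \<sigma> k0 lam F0 G F A B \<rho> Lam + decaying_weights S \<tau> \<sigma>
  for S \<tau> \<sigma> k0 and lam :: "'n::finite \<Rightarrow> real" and F0 G F A B \<rho> Lam +
  fixes Q Y :: "'n \<Rightarrow> family"
  assumes Q_eq: "Q j i = gQ Q Y j i" and Y_eq: "Y j i = gY (Q j i) Q Y j i"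
    and nrm_Q: "nrm M A (Q j)" and nrm_Y: "nrm M A (Y j)"
begin

lemma good_nonneg: "A \<ge> 0" "\<theta>A \<ge> 0" "\<theta>A / k0 \<ge> 0" "4 / \<tau> \<ge> 0"
  using pos \<theta>A k0 tau by auto

lemma goodI: "(\<And>M. nrm (Suc M) a f) \<Longrightarrow> good a f"
  unfolding good_def using nrm_mono[OF _ order_refl] by (meson le_SucI order_refl)

lemma good_Q: "good A (Q j)" and good_Y: "good A (Y j)"
  and good_D: "good (\<theta>A / k0) (gD Q Y j)" and good_Z: "good \<theta>A (gZ Q Y j)" and good_X: "good (4 / \<tau>) gX"
  using nrm_Q nrm_Y nrm_gX by (auto intro!: goodI nrm_gD nrm_gZ)

lemma good_letter: "good A (letter Y v)"
  unfolding good_def using nrm_letter nrm_Y by blast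

lemma good_gword: "good b s \<Longrightarrow> b \<ge> 0 \<Longrightarrow> good ((512 * A) ^ length l * b) (gword (letter Y) l s)"
  by (rule goodI, rule nrm_gword) (use good_letter good_nonneg in \<open>auto simp: good_def\<close>)

lemma good_gprod: "good a f \<Longrightarrow> good b g \<Longrightarrow> a \<ge> 0 \<Longrightarrow> b \<ge> 0 \<Longrightarrow> good (512 * a * b) (gprod f g)"
  by (rule goodI, rule nrm_gprod) (auto simp: good_def)

lemma hat_D_nonzero:
  assumes w: "w \<in> S" and \<alpha>: "\<alpha> \<noteq> 0"
  shows "(w + \<i> * of_int \<alpha>) * hat (Y j) \<alpha> w = hat (gD Q Y j) \<alpha> w" "w * hat (Y j) \<alpha> w = hat (gZ Q Y j) \<alpha> w"
proof -
  have D: "(w + \<i> * of_int \<alpha>) * Y j i w = gD Q Y j i w" "w * Y j i w = gZ Q Y j i w" if "i \<in> {i. freq i = \<alpha>}" for i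
    unfolding Y_eq[of j i] using that \<alpha> resonance(1)[OF w \<alpha>] by (simp_all add: gY_def gZ_def)
  have "((\<lambda>i. (w + \<i> * of_int \<alpha>) * Y j i w) has_sum (w + \<i> * of_int \<alpha>) * hat (Y j) \<alpha> w) {i. freq i = \<alpha>}"
    by (rule has_sum_cmult_right[OF hat_has_sum[OF good_Y good_nonneg(1) w]])
  then have "((\<lambda>i. gD Q Y j i w) has_sum (w + \<i> * of_int \<alpha>) * hat (Y j) \<alpha> w) {i. freq i = \<alpha>}"
    by (rule has_sum_cong[THEN iffD1, rotated]) (rule D(1))
  then show "(w + \<i> * of_int \<alpha>) * hat (Y j) \<alpha> w = hat (gD Q Y j) \<alpha> w"
    using hat_has_sum[OF good_D good_nonneg(3) w] has_sum_unique by blast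
  have "((\<lambda>i. w * Y j i w) has_sum w * hat (Y j) \<alpha> w) {i. freq i = \<alpha>}"
    by (rule has_sum_cmult_right[OF hat_has_sum[OF good_Y good_nonneg(1) w]])
  then have "((\<lambda>i. gZ Q Y j i w) has_sum w * hat (Y j) \<alpha> w) {i. freq i = \<alpha>}"
    by (rule has_sum_cong[THEN iffD1, rotated]) (rule D(2))
  then show "w * hat (Y j) \<alpha> w = hat (gZ Q Y j) \<alpha> w"
    using hat_has_sum[OF good_Z good_nonneg(2) w] has_sum_unique by blast
qed

text \<open>For the zero mode the equation loses one degree in \<open>x\<close>.\<close>

lemma hat_D_zero:
  assumes w: "w \<in> S"
  shows "w * hat (Y j) 0 w = hat (gD Q Y j) 0 w" "w * hat (Y j) 0 w = hat (gZ Q Y j) 0 w"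
proof -
  let ?h = "\<lambda>i::idx. i + (1, 0, 0)"
  let ?Z = "{i. freq i = 0}"
  have inj: "inj_on ?h ?Z" by (auto simp: inj_on_def)
  \<comment> \<open>By \<open>ray_avg_eq_conv\<close>, \<open>w * Y\<close> in degree
    \<open>m\<close> equals \<open>D\<close> in degree \<open>m + 1\<close>. The shift disappears
    when all degrees are summed, since \<open>D\<close> vanishes in degree 0.\<close>
  have D: "gD Q Y j (?h i) w = w * Y j i w" if "i \<in> ?Z" for i
  proof -
    have Y: "Y j i = ray_avg (lam j) (Q j i)" using Y_eq[of j i] that by (simp add: gY_def)
    have "?h i - (1, 0, 0) = i" by (cases i) auto
    then have "gD Q Y j (?h i) w = conv (\<lambda>w. Q j i w - of_real (lam j) * Y j i w) (\<lambda>_. 1) w"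
      by (simp add: gD_def gprod_gX)
    also have "\<dots> = conv (\<lambda>_. 1) (\<lambda>w. Q j i w - of_real (lam j) * ray_avg (lam j) (Q j i) w) w"
      by (simp only: conv_commute[of _ "\<lambda>_. 1"] Y)
    also have "\<dots> = w * Y j i w" unfolding Y
      by (rule ray_avg_eq_conv[OF star goodD(1)[OF good_Q] lam(1) w, symmetric])
    finally show ?thesis .
  qed
  have "((\<lambda>i. w * Y j i w) has_sum w * hat (Y j) 0 w) ?Z"
    by (rule has_sum_cmult_right[OF hat_has_sum[OF good_Y good_nonneg(1) w]])
  then have "(((\<lambda>i. gD Q Y j i w) \<circ> ?h) has_sum w * hat (Y j) 0 w) ?Z"
    by (rule has_sum_cong[THEN iffD2, rotated]) (simp only: o_def D)
  then have "((\<lambda>i. gD Q Y j i w) has_sum w * hat (Y j) 0 w) (?h ` ?Z)"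
    by (simp only: has_sum_reindex[OF inj])
  then have s: "((\<lambda>i. gD Q Y j i w) has_sum w * hat (Y j) 0 w) ?Z"
  proof (rule has_sum_cong_neutral[THEN iffD1, rotated -1])
    fix i assume i: "i \<in> ?Z - ?h ` ?Z"
    have "fst i = 0"
    proof (rule ccontr)
      assume "fst i \<noteq> 0"
      then have "i = ?h (i - (1, 0, 0))" "i - (1, 0, 0) \<in> ?Z" using i by (cases i; auto simp: freq_def)+
      then show False using i by blast
    qed
    then show "gD Q Y j i w = 0" by (simp add: gD_def gprod_gX)
  qed (auto simp: freq_def)
  then show "w * hat (Y j) 0 w = hat (gD Q Y j) 0 w"
    using hat_has_sum[OF good_D good_nonneg(3) w] has_sum_unique by blast
  have "((\<lambda>i. gZ Q Y j i w) has_sum w * hat (Y j) 0 w) ?Z"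
    by (rule has_sum_cong[THEN iffD2, rotated, OF s]) (simp add: gZ_def)
  then show "w * hat (Y j) 0 w = hat (gZ Q Y j) 0 w"
    using hat_has_sum[OF good_Z good_nonneg(2) w] has_sum_unique by blast
qed

text \<open>The Borel forms of \<open>x^2 y' + y'_\<theta> = D\<close> and of
  \<open>x^2 y' = Z\<close>, now uniform in the frequency.\<close>

lemma hat_equations:
  assumes w: "w \<in> S"
  shows "(w + \<i> * of_int \<alpha>) * hat (Y j) \<alpha> w = hat (gD Q Y j) \<alpha> w" "w * hat (Y j) \<alpha> w = hat (gZ Q Y j) \<alpha> w"
  using hat_D_nonzero[OF w, of \<alpha> j] hat_D_zero[OF w, of j] by (cases "\<alpha> = 0"; simp)+

end

context ray_weights
begin

lemma summand_zero: "(\<And>w. w \<in> S \<Longrightarrow> f i w = 0) \<Longrightarrow> summand f i = 0"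
  using lap_cong[of "f i" e "\<lambda>_. 0" z] ray by (simp add: summand_def lap_zero)

lemma val_gX: "val gX = 1 / z"
proof -
  have "summand gX i = (if i = (1, 0, 0) then 1 / z else 0)" for i
    using lap_one[OF e, of z] ez tau by (auto simp: summand_def gX_def mode_def freq_def lap_zero)
  then have "(summand gX has_sum (1 / z)) UNIV"
    by (intro has_sum_finite_neutralI[of "{(1, 0, 0)}"]) auto
  then show ?thesis by (simp add: val_def infsumI)
qed

lemma val_diff:
  assumes f: "good a f" "a \<ge> 0" and g: "good b g" "b \<ge> 0"
  shows "val (\<lambda>i w. f i w - c * g i w) = val f - c * val g"
proof -
  have "summand (\<lambda>i w. f i w - c * g i w) i = summand f i - c * summand g i" for i
    unfolding summand_def lap_diff[OF good_ray_bounded[OF f] ray_bounded_cmult[OF good_ray_bounded[OF g]] ez'(1) e] lap_cmult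
    by (simp add: algebra_simps)
  moreover have "((\<lambda>i. summand f i - c * summand g i) has_sum val f - c * val g) UNIV"
    by (rule has_sum_subtract[OF val_has_sum[OF f] has_sum_cmult_right[OF val_has_sum[OF g]]])
  ultimately show ?thesis by (simp add: val_def infsumI)
qed

end

section \<open>The system evaluated at a point\<close>

locale ray_solution = borel_solution S \<tau> \<sigma> k0 lam F0 G F A B \<rho> Lam Q Y + ray_weights S \<tau> \<sigma> e z \<theta>
  for S \<tau> \<sigma> k0 and lam :: "'n::finite \<Rightarrow> real" and F0 G F A B \<rho> Lam Q Y e z \<theta>
begin

lemma val_gword:
  assumes "good b s" "b \<ge> 0"
  shows "val (gword (letter Y) l s) = prod_list (map (\<lambda>v. val (letter Y v)) l) * val s"
proof (induction l)
  case (Cons v l)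
  show ?case unfolding gword.simps
    by (subst val_gprod[OF good_letter good_nonneg(1) good_gword[OF assms]]) (use good_nonneg assms Cons in auto)
qed simp

lemma val_D: "val (gD Q Y j) = (val (Q j) - of_real (lam j) * val (Y j)) * (1 / z)"
proof -
  have "good (A + norm (complex_of_real (lam j)) * A) (\<lambda>i w. Q j i w - of_real (lam j) * Y j i w)"
    unfolding good_def using nrm_diff[where c = "of_real (lam j)" and f = "Q j" and g = "Y j", OF nrm_Q nrm_Y] by blast
  moreover have "A + norm (complex_of_real (lam j)) * A \<ge> 0" using good_nonneg by simp
  ultimately have "val (gD Q Y j) = val (\<lambda>i w. Q j i w - of_real (lam j) * Y j i w) * val gX"
    unfolding gD_def by (rule val_gprod[OF _ _ good_X good_nonneg(4)])
  then show ?thesis by (simp only: val_gX val_diff[OF good_Q good_nonneg(1) good_Y good_nonneg(1)])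
qed

lemma val_Z_has_sum:
  "((\<lambda>\<alpha>. exp (\<i> * of_int \<alpha> * \<theta>) * lap e z (\<lambda>w. w * hat (Y j) \<alpha> w)) has_sum val (gZ Q Y j)) UNIV"
proof -
  have "lap e z (\<lambda>w. w * hat (Y j) \<alpha> w) = lap e z (hat (gZ Q Y j) \<alpha>)" for \<alpha>
    by (rule lap_cong) (rule hat_equations(2)[OF ray])
  then show ?thesis using val_hat_has_sum[OF good_Z good_nonneg(2)] by simp
qed

text \<open>Mode by mode \<open>\<i> \<alpha> Y = D - Z\<close>, so summability of the
  differentiated series is inherited from \<open>D\<close> and \<open>Z\<close>.\<close>

lemma theta_derivative_has_sum:
  "((\<lambda>\<alpha>. \<i> * of_int \<alpha> * exp (\<i> * of_int \<alpha> * \<theta>) * lap e z (hat (Y j) \<alpha>)) has_sum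
     (val (Q j) - of_real (lam j) * val (Y j)) / z - val (gZ Q Y j)) UNIV"
proof -
  have "\<i> * of_int \<alpha> * lap e z (hat (Y j) \<alpha>) = lap e z (hat (gD Q Y j) \<alpha>) - lap e z (hat (gZ Q Y j) \<alpha>)" for \<alpha>
  proof -
    have "\<i> * of_int \<alpha> * lap e z (hat (Y j) \<alpha>) = lap e z (\<lambda>w. \<i> * of_int \<alpha> * hat (Y j) \<alpha> w)" by (simp add: lap_cmult)
    also have "\<dots> = lap e z (\<lambda>w. hat (gD Q Y j) \<alpha> w - hat (gZ Q Y j) \<alpha> w)"
    proof (rule lap_cong)
      fix r :: real assume "0 \<le> r"
      from hat_equations[OF ray[OF this], where \<alpha> = \<alpha> and j = j]
      show "\<i> * of_int \<alpha> * hat (Y j) \<alpha> (of_real r * e) = hat (gD Q Y j) \<alpha> (of_real r * e) - hat (gZ Q Y j) \<alpha> (of_real r * e)"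
        by (metis add_diff_cancel_left' distrib_right)
    qed
    also have "\<dots> = lap e z (hat (gD Q Y j) \<alpha>) - lap e z (hat (gZ Q Y j) \<alpha>)"
      by (rule lap_diff[OF hat_ray_bounded[OF good_D good_nonneg(3)] hat_ray_bounded[OF good_Z good_nonneg(2)] ez'(1) e])
    finally show ?thesis .
  qed
  then have eq: "\<i> * of_int \<alpha> * exp (\<i> * of_int \<alpha> * \<theta>) * lap e z (hat (Y j) \<alpha>) =
     exp (\<i> * of_int \<alpha> * \<theta>) * lap e z (hat (gD Q Y j) \<alpha>) - exp (\<i> * of_int \<alpha> * \<theta>) * lap e z (hat (gZ Q Y j) \<alpha>)" for \<alpha>
    by (metis (no_types, opaque_lifting) mult.assoc mult.commute right_diff_distrib)
  show ?thesis unfolding eq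
    using has_sum_subtract[OF val_hat_has_sum[OF good_D good_nonneg(3), of j] val_hat_has_sum[OF good_Z good_nonneg(2), of j]]
    by (simp add: val_D)
qed

lemma gterm_vanish:
  assumes "fst i \<le> length l" "w \<in> S"
  shows "gterm_G Y j l i w = 0" "gterm_F Q Y j l i w = 0"
proof -
  have L: "letter Y v i w = 0" if "fst i = 0" "w \<in> S" for v i w using goodD(3)[OF good_letter that] .
  have 1: "gword (letter Y) l gX (fst i, u) w = 0" for u
    by (rule gword_vanish[OF L _ _ assms(2)]) (use assms(1) in \<open>auto simp: gX_def\<close>)
  have 2: "gword (letter Y) l (gprod (gZ Q Y j) gX) (fst i, u) w = 0" for u
    by (rule gword_vanish[OF L _ _ assms(2)]) (use assms(1) in \<open>auto simp: gprod_gX\<close>)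
  show "gterm_G Y j l i w = 0" "gterm_F Q Y j l i w = 0"
    unfolding gterm_G_def gterm_F_def cmul_def by (simp_all add: 1 2 case_prod_unfold)
qed

text \<open>The cut-off \<open>length l < fst i\<close> in \<open>gQ\<close> changes nothing,
  because longer words vanish in degree \<open>i\<close>. What is left is an interchange of the sums
  over words and over indices, justified by the geometric series in the word length times
  \<open>hw3\<close>.\<close>

lemma val_Q:
  assumes sG: "\<And>l. ((\<lambda>\<alpha>. G j l \<alpha> * exp (\<i> * of_int \<alpha> * \<theta>)) has_sum sG l) UNIV"
    and sF: "\<And>l. ((\<lambda>\<alpha>. F l \<alpha> * exp (\<i> * of_int \<alpha> * \<theta>)) has_sum sF l) UNIV"
    and g: "((\<lambda>l. sG l * prod_list (map (\<lambda>v. val (letter Y v)) l)) has_sum g) UNIV"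
    and f: "((\<lambda>l. sF l * prod_list (map (\<lambda>v. val (letter Y v)) l)) has_sum f) UNIV"
  shows "val (Q j) = g * (1 / z) - f * (val (gZ Q Y j) * (1 / z)) - F0 * val (gZ Q Y j)"
proof -
  let ?q = "512 * A / \<rho>"
  define a where "a = (\<lambda>l :: 'n option list. 64 * B * (4 / \<tau>) * ?q ^ length l)"
  define b where "b = (\<lambda>l :: 'n option list. 64 * B * (512 * \<theta>A * (4 / \<tau>)) * ?q ^ length l)"
  have q: "?q \<ge> 0" using pos by simp
  have ab: "a l \<ge> 0" "b l \<ge> 0" for l using pos tau \<theta>A q unfolding a_def b_def by (auto intro!: mult_nonneg_nonneg)
  have gG: "good (a l) (gterm_G Y j l)" and gF: "good (b l) (gterm_F Q Y j l)" for l
    unfolding a_def b_def by (rule goodI, rule nrm_gterm_G nrm_gterm_F; rule nrm_Q nrm_Y)+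
  define T where "T = (\<lambda>l i w. gterm_G Y j l i w - 1 * gterm_F Q Y j l i w)"
  have gT: "good (a l + b l) (T l)" for l
    using gG[of l] gF[of l] nrm_diff[of _ "a l" "gterm_G Y j l" "b l" "gterm_F Q Y j l" 1] unfolding good_def T_def by simp
  have gZX: "good (512 * \<theta>A * (4 / \<tau>)) (gprod (gZ Q Y j) gX)" "512 * \<theta>A * (4 / \<tau>) \<ge> 0"
    using good_gprod[OF good_Z good_X good_nonneg(2,4)] good_nonneg by auto
  have BR: "B / \<rho> ^ length l \<ge> 0" for l :: "'n option list" using pos by simp
  let ?P = "\<lambda>l. prod_list (map (\<lambda>v. val (letter Y v)) l)"
  have "val (gterm_G Y j l) = sG l * (?P l * (1 / z))" for l
    unfolding gterm_G_def
    by (subst val_cmul[OF good_gword[OF good_X good_nonneg(4)] _ coeffs(1) BR sG])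
       (use pos tau in \<open>auto simp: val_gword[OF good_X good_nonneg(4)] val_gX\<close>)
  moreover have "val (gterm_F Q Y j l) = sF l * (?P l * (val (gZ Q Y j) * (1 / z)))" for l
    unfolding gterm_F_def
    by (subst val_cmul[OF good_gword[OF gZX] _ coeffs(2) BR sF])
       (use pos mult_nonneg_nonneg[OF _ gZX(2), of "(512 * A) ^ length l"] in \<open>auto simp: val_gword[OF gZX] val_gprod[OF good_Z good_nonneg(2) good_X good_nonneg(4)] val_gX intro!: mult_nonneg_nonneg\<close>)
  ultimately have vT: "val (T l) = (sG l * ?P l) * (1 / z) - (sF l * ?P l) * (val (gZ Q Y j) * (1 / z))" for l
    unfolding T_def by (subst val_diff[OF gG ab(1) gF ab(2)]) simp
  have outer: "((\<lambda>l. val (T l)) has_sum g * (1 / z) - f * (val (gZ Q Y j) * (1 / z))) UNIV"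
    unfolding vT by (intro has_sum_subtract has_sum_cmult_left g f)
  have card: "real (card (UNIV :: 'n option set)) * ?q \<le> 1 / 2" by (rule small(1))
  have s1: "(\<lambda>l. a l + b l) summable_on UNIV"
    unfolding a_def b_def using summable_on_lists_geometric[OF _ q card] by (intro summable_on_add summable_on_cmult_right) auto
  have "(\<lambda>(l, i). (a l + b l) * hw3 i) summable_on (UNIV \<times> UNIV)"
    by (rule summable_on_times[OF s1 hw3_summable]) (use ab hw3_pos in \<open>auto simp: less_imp_le\<close>)
  then have "(\<lambda>(l, i). summand (T l) i) summable_on (UNIV \<times> UNIV)"
    by (rule norm_summable_on) (use summand_bound[OF gT] ab in \<open>auto\<close>)
  then have "((\<lambda>(l, i). summand (T l) i) has_sum g * (1 / z) - f * (val (gZ Q Y j) * (1 / z))) (UNIV \<times> UNIV)"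
    by (intro has_sum_SigmaI[OF _ outer]) (use val_has_sum[OF gT] ab in auto)
  then have "((\<lambda>(i, l). summand (T l) i) has_sum g * (1 / z) - f * (val (gZ Q Y j) * (1 / z))) (UNIV \<times> UNIV)"
    by (subst has_sum_swap) simp
  then have "((\<lambda>i. summand (Q j) i + F0 * summand (gZ Q Y j) i) has_sum g * (1 / z) - f * (val (gZ Q Y j) * (1 / z))) UNIV"
  proof (rule has_sum_Sigma')
    fix i :: idx
    let ?I = "{l :: 'n option list. length l < fst i}"
    have fin: "finite ?I" using finite_lists_length_le[of "UNIV :: 'n option set" "fst i"]
      by (rule finite_subset[rotated]) auto
    have "lap e z (\<lambda>w. \<Sum>l\<in>?I. T l i w) = lap e z (\<lambda>w. Q j i w - (- F0) * gZ Q Y j i w)"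
      by (rule lap_cong, subst Q_eq) (simp add: gQ_def T_def)
    also have "\<dots> = lap e z (Q j i) - (- F0) * lap e z (gZ Q Y j i)"
      unfolding lap_diff[OF good_ray_bounded[OF good_Q good_nonneg(1)] ray_bounded_cmult[OF good_ray_bounded[OF good_Z good_nonneg(2)]] ez'(1) e] lap_cmult ..
    also have "lap e z (\<lambda>w. \<Sum>l\<in>?I. T l i w) = (\<Sum>l\<in>?I. lap e z (T l i))"
      by (rule lap_sum_ex[OF fin]) (rule exI, rule good_ray_bounded[OF gT add_nonneg_nonneg[OF ab]])
    finally have "(\<Sum>l\<in>?I. summand (T l) i) = summand (Q j) i + F0 * summand (gZ Q Y j) i"
      unfolding summand_def sum_distrib_left[symmetric] by (simp add: algebra_simps)
    moreover have "summand (T l) i = 0" if "l \<notin> ?I" for l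
      by (rule summand_zero) (use that gterm_vanish[of i l] in \<open>simp add: T_def\<close>)
    ultimately show "((\<lambda>l. case (i, l) of (i, l) \<Rightarrow> summand (T l) i) has_sum summand (Q j) i + F0 * summand (gZ Q Y j) i) UNIV"
      using fin by (intro has_sum_finite_neutralI[of ?I]) auto
  qed
  moreover have "((\<lambda>i. summand (Q j) i + F0 * summand (gZ Q Y j) i) has_sum val (Q j) + F0 * val (gZ Q Y j)) UNIV"
    by (rule has_sum_add[OF val_has_sum[OF good_Q good_nonneg(1)] has_sum_cmult_right[OF val_has_sum[OF good_Z good_nonneg(2)]]])
  ultimately have "val (Q j) + F0 * val (gZ Q Y j) = g * (1 / z) - f * (val (gZ Q Y j) * (1 / z))"
    using has_sum_unique by blast
  then show ?thesis by (simp add: algebra_simps)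
qed

end

section \<open>Sums on a region\<close>

lemma fcoef_of_series:
  assumes M: "M summable_on UNIV" and c: "\<And>\<alpha>. norm (c \<alpha>) \<le> M \<alpha>"
    and g: "\<And>t::real. g (of_real t) = (\<Sum>\<^sub>\<infinity>\<alpha>. exp (\<i> * of_int \<alpha> * of_real t) * c \<alpha>)"
  shows "fcoef g \<beta> = c \<beta>"
proof -
  let ?f = "\<lambda>\<alpha> t::real. exp (\<i> * of_int \<alpha> * of_real t) * c \<alpha> * exp (- \<i> * of_int \<beta> * of_real t)"
  have nb: "norm (?f \<alpha> t) \<le> M \<alpha>" for \<alpha> t using c[of \<alpha>] by (simp add: norm_mult)
  have ul: "uniform_limit {0..2 * pi} (\<lambda>X t. \<Sum>\<alpha>\<in>X. ?f \<alpha> t) (\<lambda>t. \<Sum>\<^sub>\<infinity>\<alpha>. ?f \<alpha> t) (finite_subsets_at_top UNIV)"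
    by (rule Weierstrass_m_test_general[OF nb M])
  have cont: "continuous_on {0..2 * pi} (\<lambda>t. \<Sum>\<alpha>\<in>X. ?f \<alpha> t)" for X by (intro continuous_intros)
  obtain I J where IJ: "\<And>X. ((\<lambda>t. \<Sum>\<alpha>\<in>X. ?f \<alpha> t) has_integral I X) {0..2 * pi}"
     "((\<lambda>t. \<Sum>\<^sub>\<infinity>\<alpha>. ?f \<alpha> t) has_integral J) {0..2 * pi}" "(I \<longlongrightarrow> J) (finite_subsets_at_top UNIV)"
    by (rule uniform_limit_integral[OF ul cont finite_subsets_at_top_neq_bot]) (rule that)
  have mode: "(?f \<alpha> has_integral (if \<alpha> = \<beta> then 2 * of_real pi * c \<beta> else 0)) {0..2 * pi}" for \<alpha>
  proof -
    have e: "?f \<alpha> t = c \<alpha> * (1 * exp (- \<i> * of_int (\<beta> - \<alpha>) * of_real t))" for t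
    proof -
      have "exp (\<i> * of_int \<alpha> * of_real t) * exp (- \<i> * of_int \<beta> * of_real t) = exp (- \<i> * of_int (\<beta> - \<alpha>) * of_real t)"
        by (simp add: exp_add[symmetric] algebra_simps)
      then show ?thesis by (metis mult.assoc mult.commute mult_1)
    qed
    have "integral {0..2 * pi} (\<lambda>t. 1 * exp (- \<i> * of_int (\<beta> - \<alpha>) * of_real t)) = (if \<alpha> = \<beta> then 2 * of_real pi else 0)"
      using fcoef_const[of 1 "\<beta> - \<alpha>"] unfolding fcoef_def by (auto simp: divide_eq_eq split: if_splits)
    moreover have "(\<lambda>t. 1 * exp (- \<i> * of_int (\<beta> - \<alpha>) * of_real t)) integrable_on {0..2 * pi}"
      by (intro integrable_continuous_real continuous_intros)
    ultimately have "((\<lambda>t. 1 * exp (- \<i> * of_int (\<beta> - \<alpha>) * of_real t)) has_integral (if \<alpha> = \<beta> then 2 * of_real pi else 0)) {0..2 * pi}"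
      unfolding has_integral_iff by blast
    from has_integral_mult_right[OF this, of "c \<alpha>"] show ?thesis unfolding e by (auto simp: mult.commute)
  qed
  have "I X = 2 * of_real pi * c \<beta>" if "finite X" "\<beta> \<in> X" for X
  proof -
    have "((\<lambda>t. \<Sum>\<alpha>\<in>X. ?f \<alpha> t) has_integral (\<Sum>\<alpha>\<in>X. if \<alpha> = \<beta> then 2 * of_real pi * c \<beta> else 0)) {0..2 * pi}"
      by (rule has_integral_sum[OF that(1) mode])
    from has_integral_unique[OF IJ(1)[of X] this] show ?thesis using that by (simp add: sum.delta)
  qed
  then have "\<forall>\<^sub>F X in finite_subsets_at_top UNIV. I X = 2 * of_real pi * c \<beta>"
    by (auto simp: eventually_finite_subsets_at_top intro!: exI[of _ "{\<beta>}"])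
  then have "(I \<longlongrightarrow> 2 * of_real pi * c \<beta>) (finite_subsets_at_top UNIV)" by (rule tendsto_eventually)
  then have J: "J = 2 * of_real pi * c \<beta>" by (rule tendsto_unique[OF finite_subsets_at_top_neq_bot IJ(3)])
  have "(\<lambda>t. \<Sum>\<^sub>\<infinity>\<alpha>. ?f \<alpha> t) = (\<lambda>t. g (of_real t) * exp (- \<i> * of_int \<beta> * of_real t))"
  proof
    fix t :: real
    have "(\<lambda>\<alpha>. exp (\<i> * of_int \<alpha> * of_real t) * c \<alpha>) summable_on UNIV"
      by (rule norm_summable_on[OF M]) (use c in \<open>simp add: norm_mult\<close>)
    then show "(\<Sum>\<^sub>\<infinity>\<alpha>. ?f \<alpha> t) = g (of_real t) * exp (- \<i> * of_int \<beta> * of_real t)"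
      unfolding g by (subst infsum_cmult_left) auto
  qed
  then show ?thesis using integral_unique[OF IJ(2)] J by (simp add: fcoef_def)
qed

lemma has_sum_vec:
  fixes f :: "'i \<Rightarrow> complex ^ 'n"
  assumes "\<And>j. ((\<lambda>i. f i $ j) has_sum s $ j) A"
  shows "(f has_sum s) A"
  using assms unfolding has_sum_def by (intro vec_tendstoI) simp

text \<open>One setting for both signs: \<open>W\<close> is the cone of directions around
  \<open>\<phi>\<close>, which is 0 or \<open>pi\<close>, and \<open>R\<close> is the sector in
  \<open>x\<close>. The constant \<open>c0\<close> measures how well the best admissible direction
  is aligned with \<open>x\<close>.\<close>

locale sum_region = borel_solution S \<tau> \<sigma> k0 lam F0 G F A B \<rho> Lam Q Y
  for S \<tau> \<sigma> k0 and lam :: "'n::finite \<Rightarrow> real" and F0 G F A B \<rho> Lam Q Y +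
  fixes W R :: "complex set" and \<phi> \<epsilon> c0 \<xi>0 :: real
  assumes W: "convex W" "W \<subseteq> S" "\<And>w r. w \<in> W \<Longrightarrow> r > 0 \<Longrightarrow> of_real r * w \<in> W"
    and dirs: "\<epsilon> > 0" "\<And>\<psi>. \<bar>\<psi> - \<phi>\<bar> < \<epsilon> \<Longrightarrow> cis \<psi> \<in> W" "ray_sector \<phi> \<epsilon> \<subseteq> W"
    and R: "open R" "\<And>x. x \<in> R \<Longrightarrow> x \<noteq> 0" "\<And>x. x \<in> R \<Longrightarrow> \<exists>\<psi>. \<bar>\<psi> - \<phi>\<bar> < \<epsilon> \<and> Re (cis \<psi> / x) \<ge> c0 / norm x"
      "\<And>x. x \<in> R \<Longrightarrow> norm x * (2 * \<tau>) < c0"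
    and c0: "c0 > 0"
    and xi0: "\<xi>0 > 0" "\<sigma> = exp (- \<xi>0)"
begin

lemma zero_S: "0 \<in> S"
  using dirs(1) dirs(2)[of \<phi>] W(2) star0_zero[OF star] by auto

lemma ray_S: "w \<in> W \<Longrightarrow> r \<ge> 0 \<Longrightarrow> of_real r * w \<in> S"
  using W(2,3) zero_S by (cases "r = 0") auto

definition dirn :: "complex \<Rightarrow> complex" where
  "dirn x = cis (SOME \<psi>. \<bar>\<psi> - \<phi>\<bar> < \<epsilon> \<and> Re (cis \<psi> / x) \<ge> c0 / norm x)"

lemma dirn:
  assumes "x \<in> R"
  shows "dirn x \<in> W" "norm (dirn x) = 1" "Re (dirn x * (1 / x)) \<ge> c0 / norm x" "c0 / norm x > 2 * \<tau>"
proof -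
  have "\<bar>(SOME \<psi>. \<bar>\<psi> - \<phi>\<bar> < \<epsilon> \<and> Re (cis \<psi> / x) \<ge> c0 / norm x) - \<phi>\<bar> < \<epsilon> \<and>
     Re (cis (SOME \<psi>. \<bar>\<psi> - \<phi>\<bar> < \<epsilon> \<and> Re (cis \<psi> / x) \<ge> c0 / norm x) / x) \<ge> c0 / norm x"
    by (rule someI_ex[OF R(3)[OF assms]])
  then show "dirn x \<in> W" "norm (dirn x) = 1" "Re (dirn x * (1 / x)) \<ge> c0 / norm x"
    using dirs(2) by (auto simp: dirn_def)
  show "c0 / norm x > 2 * \<tau>" using R(2,4)[OF assms] by (simp add: field_simps)
qed

definition yc :: "'n \<Rightarrow> int \<Rightarrow> complex \<Rightarrow> complex" where
  "yc j \<alpha> x = lap (dirn x) (1 / x) (hat (Y j) \<alpha>)"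

lemma hat_Y_bound:
  "w \<in> S \<Longrightarrow> norm (hat (Y j) \<alpha> w) \<le> (A * \<tau> * H3 * \<sigma> ^ nat \<bar>\<alpha>\<bar>) * exp (\<tau> * norm w)"
  by (rule hat_bound[OF good_Y good_nonneg(1)])

text \<open>By rotation of the ray inside the cone \<open>W\<close>, the value does not depend on
  the choice made in \<open>dirn\<close>. Hence one direction may be kept fixed near a point, and
  every admissible direction gives the same 1-sum.\<close>

lemma yc_direction:
  assumes e: "e \<in> W" "norm e = 1" "Re (e * (1 / x)) > \<tau>" and x: "x \<in> R"
  shows "lap e (1 / x) (hat (Y j) \<alpha>) = yc j \<alpha> x"
  unfolding yc_def
proof (rule lap_direction[OF W(1,3) star W(2) hat_holomorphic[OF good_Y good_nonneg(1)] _ _ e])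
  show "norm (hat (Y j) \<alpha> w) \<le> (A * \<tau> * H3 * \<sigma> ^ nat \<bar>\<alpha>\<bar>) * exp (\<tau> * norm w)" if "w \<in> insert 0 W" for w
    using hat_Y_bound that W(2) zero_S by blast
  show "\<tau> < Re (dirn x * (1 / x))" using dirn(3,4)[OF x] tau by linarith
qed (use dirn[OF x] tau in auto)

lemma ray_solution:
  assumes e: "e \<in> W" "norm e = 1" "Re (e * (1 / x)) > 2 * \<tau>" and t: "\<bar>Im \<theta>\<bar> < \<xi>0"
  shows "ray_solution S \<tau> \<sigma> k0 lam F0 G F A B \<rho> Lam Q Y e (1 / x) \<theta>"
proof (unfold_locales)
  show "\<sigma> * exp \<bar>Im \<theta>\<bar> \<le> 1" using t by (simp add: xi0(2) exp_add[symmetric])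
qed (use e ray_S in auto)

lemma ray_bounded_Y:
  assumes e: "e \<in> W" "norm e = 1"
  shows "ray_bounded e \<tau> (A * \<tau> * H3 * \<sigma> ^ nat \<bar>\<alpha>\<bar>) (hat (Y j) \<alpha>)"
proof -
  \<comment> \<open>The point \<open>e / (3 \<tau>)\<close> is an auxiliary value of
    \<open>x\<close>, aligned with the ray, at which the locale \<open>ray_solution\<close> can be
    entered; the bound obtained no longer mentions it.\<close>
  have "Re (e * (1 / (e / of_real (3 * \<tau>)))) = 3 * \<tau>" using e tau by (cases "e = 0") (auto simp: field_simps)
  then have "Re (e * (1 / (e / of_real (3 * \<tau>)))) > 2 * \<tau>" using tau by linarith
  from ray_solution[OF e this, of 0]
  interpret ray_solution S \<tau> \<sigma> k0 lam F0 G F A B \<rho> Lam Q Y e "1 / (e / of_real (3 * \<tau>))" 0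
    using xi0 by simp
  show ?thesis by (rule hat_ray_bounded[OF good_Y good_nonneg(1)])
qed

definition CY :: real where "CY = 2 * A * \<tau> * H3 / c0"

lemma CY_nonneg: "CY \<ge> 0" unfolding CY_def using good_nonneg tau H3_nonneg c0 by simp

lemma sigma_pow: "\<sigma> ^ nat \<bar>\<alpha>\<bar> = exp (- \<xi>0 * \<bar>real_of_int \<alpha>\<bar>)"
  by (simp add: xi0(2) exp_of_nat_mult[symmetric] mult.commute)

text \<open>From \<open>Re (e / x) \<ge> c0 / norm x > 2 \<tau>\<close> the denominator of the
  Laplace bound is at least \<open>c0 / (2 norm x)\<close>. This is the origin of the factor
  \<open>norm x\<close> and of the 2 in \<open>CY\<close>.\<close>

lemma yc_bound:
  assumes x: "x \<in> R"
  shows "norm (yc j \<alpha> x) \<le> CY * norm x * exp (- \<xi>0 * \<bar>real_of_int \<alpha>\<bar>)"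
proof -
  let ?c = "Re (dirn x * (1 / x))" and ?K = "A * \<tau> * H3 * \<sigma> ^ nat \<bar>\<alpha>\<bar>"
  note d = dirn[OF x]
  have K: "?K \<ge> 0" using good_nonneg tau H3_nonneg sigma by simp
  have "k \<le> a \<Longrightarrow> 2 * \<tau> < k \<Longrightarrow> \<tau> < a \<and> k / 2 \<le> a - \<tau>" for k a using tau by auto
  from this[OF d(3,4)] have c: "?c > \<tau>" "?c - \<tau> \<ge> c0 / norm x / 2" by blast+
  have x0: "norm x > 0" using R(2)[OF x] by simp
  have "norm (yc j \<alpha> x) \<le> ?K / (?c - \<tau>)"
    unfolding yc_def by (rule lap_integrable(2)[OF ray_bounded_Y[OF d(1,2)] c(1) d(2)])
  also have "\<dots> \<le> ?K / (c0 / norm x / 2)" using c c0 x0 K by (intro divide_left_mono mult_pos_pos) auto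
  also have "\<dots> = CY * norm x * \<sigma> ^ nat \<bar>\<alpha>\<bar>" using c0 x0 by (simp add: CY_def field_simps)
  finally show ?thesis by (simp only: sigma_pow)
qed

text \<open>The direction chosen at \<open>x\<close> remains admissible nearby, so \<open>yc\<close>
  is locally a Laplace transform along a fixed ray, composed with
  \<open>u \<mapsto> 1 / u\<close>.\<close>

lemma DERIV_yc:
  assumes x: "x \<in> R"
  shows "(yc j \<alpha> has_field_derivative lap (dirn x) (1 / x) (\<lambda>w. w * hat (Y j) \<alpha> w) / x\<^sup>2) (at x)"
proof -
  let ?e = "dirn x"
  note d = dirn[OF x]
  have x0: "x \<noteq> 0" using R(2)[OF x] .
  have c: "Re (?e * (1 / x)) > \<tau>" using d(3,4) tau by linarith
  have "((\<lambda>u. lap ?e (1 / u) (hat (Y j) \<alpha>)) has_field_derivative - lap ?e (1 / x) (\<lambda>w. w * hat (Y j) \<alpha> w) * (- 1 / x\<^sup>2)) (at x)"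
  proof (rule DERIV_chain2[where f = "\<lambda>z. lap ?e z (hat (Y j) \<alpha>)" and g = "\<lambda>u. 1 / u", OF DERIV_lap[OF ray_bounded_Y[OF d(1,2)] c d(2)]])
    show "((\<lambda>u. 1 / u) has_field_derivative - 1 / x\<^sup>2) (at x)"
      using x0 by (auto intro!: derivative_eq_intros simp: power2_eq_square)
  qed
  moreover have "\<forall>\<^sub>F u in nhds x. lap ?e (1 / u) (hat (Y j) \<alpha>) = yc j \<alpha> u"
  proof -
    have "(\<lambda>u. Re (?e * (1 / u))) \<midarrow>x\<rightarrow> Re (?e * (1 / x))" by (intro tendsto_intros x0)
    then have "\<forall>\<^sub>F u in at x. Re (?e * (1 / u)) > \<tau>" using c by (rule order_tendstoD(1))
    then have "\<forall>\<^sub>F u in nhds x. Re (?e * (1 / u)) > \<tau>" unfolding eventually_at_filter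
      by (rule eventually_mono) (metis c UNIV_I)
    moreover have "\<forall>\<^sub>F u in nhds x. u \<in> R" using R(1) x by (auto simp: eventually_nhds)
    ultimately show ?thesis by eventually_elim (rule yc_direction[OF d(1,2)])
  qed
  ultimately have "(yc j \<alpha> has_field_derivative - lap ?e (1 / x) (\<lambda>w. w * hat (Y j) \<alpha> w) * (- 1 / x\<^sup>2)) (at x)"
    by (subst (asm) DERIV_cong_ev[OF refl _ refl])
  then show ?thesis by simp
qed

lemma yc_holomorphic: "yc j \<alpha> holomorphic_on R"
  using DERIV_yc R(1) by (auto simp: holomorphic_on_open)

definition ysol :: "complex \<Rightarrow> complex \<Rightarrow> complex ^ 'n" where
  "ysol x \<theta> = (\<chi> j. \<Sum>\<^sub>\<infinity>\<alpha>. exp (\<i> * of_int \<alpha> * \<theta>) * yc j \<alpha> x)"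

lemma norm_exp_mode: "norm (exp (\<i> * of_int \<alpha> * \<theta>)) \<le> exp (\<bar>Im \<theta>\<bar> * \<bar>real_of_int \<alpha>\<bar>)"
  by (simp add: abs_mult[symmetric] mult.commute)

lemma mode_bound:
  assumes x: "x \<in> R" and t: "\<bar>Im \<theta>\<bar> \<le> \<xi>"
  shows "norm (exp (\<i> * of_int \<alpha> * \<theta>) * yc j \<alpha> x) \<le> exp (- (\<xi>0 - \<xi>) * \<bar>real_of_int \<alpha>\<bar>) * (CY * norm x)"
proof -
  have "exp (\<bar>Im \<theta>\<bar> * \<bar>real_of_int \<alpha>\<bar>) \<le> exp (\<xi> * \<bar>real_of_int \<alpha>\<bar>)" using t by (simp add: mult_right_mono)
  with norm_exp_mode have "norm (exp (\<i> * of_int \<alpha> * \<theta>)) \<le> exp (\<xi> * \<bar>real_of_int \<alpha>\<bar>)" by (rule order_trans)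
  then have "norm (exp (\<i> * of_int \<alpha> * \<theta>) * yc j \<alpha> x) \<le> exp (\<xi> * \<bar>real_of_int \<alpha>\<bar>) * (CY * norm x * exp (- \<xi>0 * \<bar>real_of_int \<alpha>\<bar>))"
    unfolding norm_mult using yc_bound[OF x] by (intro mult_mono) auto
  also have "\<dots> = (exp (\<xi> * \<bar>real_of_int \<alpha>\<bar>) * exp (- \<xi>0 * \<bar>real_of_int \<alpha>\<bar>)) * (CY * norm x)" by (simp add: mult_ac)
  also have "exp (\<xi> * \<bar>real_of_int \<alpha>\<bar>) * exp (- \<xi>0 * \<bar>real_of_int \<alpha>\<bar>) = exp (- (\<xi>0 - \<xi>) * \<bar>real_of_int \<alpha>\<bar>)"
    by (simp add: exp_add[symmetric] algebra_simps)
  finally show ?thesis .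
qed

lemma mode_summable: "\<xi> < \<xi>0 \<Longrightarrow> (\<lambda>\<alpha>. exp (- (\<xi>0 - \<xi>) * \<bar>real_of_int \<alpha>\<bar>)) summable_on UNIV"
  by (rule int_symmetric_exp_summable) simp

lemma ysol_has_sum:
  assumes x: "x \<in> R" and t: "\<bar>Im \<theta>\<bar> < \<xi>0"
  shows "((\<lambda>\<alpha>. exp (\<i> * of_int \<alpha> * \<theta>) * yc j \<alpha> x) has_sum ysol x \<theta> $ j) UNIV"
  unfolding ysol_def vec_lambda_beta
  by (rule has_sum_infsum, rule norm_summable_on[OF summable_on_cmult_left[OF mode_summable[OF t]] mode_bound[OF x order_refl]])

lemma ysol_deriv_x:
  assumes x: "x \<in> R" and t: "\<bar>Im \<theta>\<bar> < \<xi>0"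
  shows "(\<lambda>x. ysol x \<theta> $ j) holomorphic_on R"
    "((\<lambda>\<alpha>. exp (\<i> * of_int \<alpha> * \<theta>) * deriv (yc j \<alpha>) x) has_sum deriv (\<lambda>x. ysol x \<theta> $ j) x) UNIV"
proof -
  have h: "(\<lambda>x. exp (\<i> * of_int \<alpha> * \<theta>) * yc j \<alpha> x) holomorphic_on R" for \<alpha>
    using yc_holomorphic by (intro holomorphic_intros)
  note W = holomorphic_infsum[OF R(1) h mode_bound[OF _ order_refl] mode_summable[OF t] _ ]
  have c: "continuous_on R (\<lambda>x. CY * norm x)" by (intro continuous_intros)
  show "(\<lambda>x. ysol x \<theta> $ j) holomorphic_on R" unfolding ysol_def vec_lambda_beta
    by (rule W(1)[OF _ _ c]) auto
  have "((\<lambda>\<alpha>. deriv (\<lambda>x. exp (\<i> * of_int \<alpha> * \<theta>) * yc j \<alpha> x) x) has_sum deriv (\<lambda>x. ysol x \<theta> $ j) x) UNIV"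
    unfolding ysol_def vec_lambda_beta by (rule W(2)[OF _ _ c x]) auto
  moreover have "deriv (\<lambda>x. exp (\<i> * of_int \<alpha> * \<theta>) * yc j \<alpha> x) x = exp (\<i> * of_int \<alpha> * \<theta>) * deriv (yc j \<alpha>) x" for \<alpha>
    using DERIV_yc[OF x, of j \<alpha>] by (intro deriv_cmult) (auto simp: field_differentiable_def)
  ultimately show "((\<lambda>\<alpha>. exp (\<i> * of_int \<alpha> * \<theta>) * deriv (yc j \<alpha>) x) has_sum deriv (\<lambda>x. ysol x \<theta> $ j) x) UNIV" by simp
qed

lemma ysol_deriv_theta:
  assumes x: "x \<in> R" and t: "\<bar>Im \<theta>\<bar> < \<xi>0"
  shows "((\<lambda>\<theta>. ysol x \<theta> $ j) has_field_derivative deriv (\<lambda>\<theta>. ysol x \<theta> $ j) \<theta>) (at \<theta>)"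
    "((\<lambda>\<alpha>. \<i> * of_int \<alpha> * exp (\<i> * of_int \<alpha> * \<theta>) * yc j \<alpha> x) has_sum deriv (\<lambda>\<theta>. ysol x \<theta> $ j) \<theta>) UNIV"
proof -
  \<comment> \<open>A strip strictly between \<open>\<theta>\<close> and the limit
    \<open>\<xi>0\<close>, on which one summable majorant works for all modes.\<close>
  define \<xi> where "\<xi> = (\<bar>Im \<theta>\<bar> + \<xi>0) / 2"
  have xi: "\<bar>Im \<theta>\<bar> < \<xi>" "\<xi> < \<xi>0" using t by (auto simp: \<xi>_def)
  have ts: "\<theta> \<in> strip \<xi>" using xi by (simp add: strip_def)
  have h: "(\<lambda>\<theta>. exp (\<i> * of_int \<alpha> * \<theta>) * yc j \<alpha> x) holomorphic_on strip \<xi>" for \<alpha> by (intro holomorphic_intros)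
  have b: "norm (exp (\<i> * of_int \<alpha> * \<theta>) * yc j \<alpha> x) \<le> exp (- (\<xi>0 - \<xi>) * \<bar>real_of_int \<alpha>\<bar>) * (CY * norm x)" if "\<theta> \<in> strip \<xi>" for \<alpha> \<theta>
    by (rule mode_bound[OF x]) (use that in \<open>simp add: strip_def\<close>)
  have c: "continuous_on (strip \<xi>) (\<lambda>_. CY * norm x)" by (intro continuous_intros)
  have "(\<lambda>\<theta>. ysol x \<theta> $ j) holomorphic_on strip \<xi>" unfolding ysol_def vec_lambda_beta
    by (rule holomorphic_infsum(1)[OF open_strip h b mode_summable[OF xi(2)] _ c]) auto
  then show "((\<lambda>\<theta>. ysol x \<theta> $ j) has_field_derivative deriv (\<lambda>\<theta>. ysol x \<theta> $ j) \<theta>) (at \<theta>)"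
    by (rule holomorphic_derivI[OF _ open_strip ts])
  have "((\<lambda>\<alpha>. deriv (\<lambda>\<theta>. exp (\<i> * of_int \<alpha> * \<theta>) * yc j \<alpha> x) \<theta>) has_sum deriv (\<lambda>\<theta>. ysol x \<theta> $ j) \<theta>) UNIV"
    unfolding ysol_def vec_lambda_beta
    by (rule holomorphic_infsum(2)[OF open_strip h b mode_summable[OF xi(2)] _ c ts]) auto
  moreover have "deriv (\<lambda>\<theta>. exp (\<i> * of_int \<alpha> * \<theta>) * yc j \<alpha> x) \<theta> = \<i> * of_int \<alpha> * exp (\<i> * of_int \<alpha> * \<theta>) * yc j \<alpha> x" for \<alpha>
    by (rule DERIV_imp_deriv) (auto intro!: derivative_eq_intros)
  ultimately show "((\<lambda>\<alpha>. \<i> * of_int \<alpha> * exp (\<i> * of_int \<alpha> * \<theta>) * yc j \<alpha> x) has_sum deriv (\<lambda>\<theta>. ysol x \<theta> $ j) \<theta>) UNIV" by simp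
qed

text \<open>Half of the gap \<open>\<xi>0 - \<xi>\<close> absorbs the factor
  \<open>\<bar>\<alpha>\<bar>\<close> from differentiation, and \<open>norm x\<close> is bounded on
  \<open>R\<close>; the convergence is therefore uniform in both variables.\<close>

lemma deriv_theta_continuous:
  assumes xi: "\<xi> < \<xi>0"
  shows "continuous_on (R \<times> strip \<xi>) (\<lambda>p. deriv (\<lambda>\<theta>. ysol (fst p) \<theta> $ j) (snd p))"
proof -
  define \<eta> where "\<eta> = (\<xi>0 - \<xi>) / 2"
  have eta: "\<eta> > 0" using xi by (simp add: \<eta>_def)
  let ?f = "\<lambda>\<alpha> p. \<i> * of_int \<alpha> * exp (\<i> * of_int \<alpha> * snd p) * yc j \<alpha> (fst p)"
  have ul: "uniform_limit (R \<times> strip \<xi>) (\<lambda>X p. \<Sum>\<alpha>\<in>X. ?f \<alpha> p) (\<lambda>p. \<Sum>\<^sub>\<infinity>\<alpha>. ?f \<alpha> p) (finite_subsets_at_top UNIV)"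
  proof (rule Weierstrass_m_test_general)
    fix \<alpha> :: int and p assume p: "p \<in> R \<times> strip \<xi>"
    obtain x \<theta> where xt: "p = (x, \<theta>)" by (cases p)
    have x: "x \<in> R" and t: "\<bar>Im \<theta>\<bar> \<le> \<xi>" using p xt by (auto simp: strip_def)
    have nx: "norm x \<le> c0 / (2 * \<tau>)" using R(4)[OF x] tau by (simp add: field_simps)
    have "\<bar>real_of_int \<alpha>\<bar> \<le> 1 / \<eta> * exp (\<eta> * \<bar>real_of_int \<alpha>\<bar>)"
    proof -
      have "\<eta> * \<bar>real_of_int \<alpha>\<bar> \<le> exp (\<eta> * \<bar>real_of_int \<alpha>\<bar>)"
        using exp_ge_add_one_self[of "\<eta> * \<bar>real_of_int \<alpha>\<bar>"] by linarith
      then show ?thesis using eta by (simp add: pos_le_divide_eq mult.commute)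
    qed
    moreover have "norm (exp (\<i> * of_int \<alpha> * \<theta>) * yc j \<alpha> x) \<le> exp (- (\<xi>0 - \<xi>) * \<bar>real_of_int \<alpha>\<bar>) * (CY * (c0 / (2 * \<tau>)))"
      using mode_bound[OF x t, of \<alpha> j] nx CY_nonneg
      by (meson exp_ge_zero mult_left_mono order_trans)
    ultimately have "\<bar>real_of_int \<alpha>\<bar> * norm (exp (\<i> * of_int \<alpha> * \<theta>) * yc j \<alpha> x) \<le>
        (1 / \<eta> * exp (\<eta> * \<bar>real_of_int \<alpha>\<bar>)) * (exp (- (\<xi>0 - \<xi>) * \<bar>real_of_int \<alpha>\<bar>) * (CY * (c0 / (2 * \<tau>))))"
      using eta by (intro mult_mono) auto
    also have "\<dots> = (exp (\<eta> * \<bar>real_of_int \<alpha>\<bar>) * exp (- (\<xi>0 - \<xi>) * \<bar>real_of_int \<alpha>\<bar>)) * (1 / \<eta> * (CY * (c0 / (2 * \<tau>))))" by (simp add: mult_ac)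
    also have "exp (\<eta> * \<bar>real_of_int \<alpha>\<bar>) * exp (- (\<xi>0 - \<xi>) * \<bar>real_of_int \<alpha>\<bar>) = exp (- \<eta> * \<bar>real_of_int \<alpha>\<bar>)"
    proof -
      have "\<xi>0 - \<xi> = 2 * \<eta>" by (simp add: \<eta>_def)
      then show ?thesis by (simp add: exp_add[symmetric])
    qed
    finally show "norm (?f \<alpha> p) \<le> exp (- \<eta> * \<bar>real_of_int \<alpha>\<bar>) * (1 / \<eta> * (CY * (c0 / (2 * \<tau>))))"
      by (simp add: xt norm_mult mult.assoc)
  next
    show "(\<lambda>\<alpha>. exp (- \<eta> * \<bar>real_of_int \<alpha>\<bar>) * (1 / \<eta> * (CY * (c0 / (2 * \<tau>))))) summable_on UNIV"
      by (rule summable_on_cmult_left[OF int_symmetric_exp_summable[OF eta]])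
  qed
  have yc: "continuous_on (R \<times> strip \<xi>) (\<lambda>p. yc j \<alpha> (fst p))" for \<alpha>
    by (rule continuous_on_compose2[OF holomorphic_on_imp_continuous_on[OF yc_holomorphic]]) (auto intro!: continuous_intros)
  have "continuous_on (R \<times> strip \<xi>) (\<lambda>p. \<Sum>\<^sub>\<infinity>\<alpha>. ?f \<alpha> p)"
    by (rule uniform_limit_theorem[OF always_eventually ul finite_subsets_at_top_neq_bot]) (intro allI continuous_intros yc)
  moreover have "(\<Sum>\<^sub>\<infinity>\<alpha>. ?f \<alpha> p) = deriv (\<lambda>\<theta>. ysol (fst p) \<theta> $ j) (snd p)" if "p \<in> R \<times> strip \<xi>" for p
    by (rule infsumI, rule ysol_deriv_theta(2)) (use that xi in \<open>auto simp: strip_def\<close>)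
  ultimately show ?thesis by (simp cong: continuous_on_cong)
qed

text \<open>Joint differentiability follows from the partial derivative in \<open>x\<close> together
  with a partial derivative in \<open>\<theta>\<close> that is jointly continuous.\<close>

lemma ysol_analytic:
  assumes xi: "\<xi> < \<xi>0"
  shows "analytic_x_theta (\<lambda>x \<theta>. ysol x \<theta> $ j) (R \<times> strip \<xi>)"
  unfolding analytic_x_theta_def
proof safe
  fix x \<theta> assume x: "x \<in> R" and t: "\<theta> \<in> strip \<xi>"
  have st: "\<bar>Im \<theta>\<bar> < \<xi>0" if "\<theta> \<in> strip \<xi>" for \<theta> using that xi by (simp add: strip_def)
  let ?a = "deriv (\<lambda>x. ysol x \<theta> $ j) x" and ?d = "\<lambda>x \<theta>. deriv (\<lambda>\<theta>. ysol x \<theta> $ j) \<theta>"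
  have op: "open (R \<times> strip \<xi>)" using R(1) open_strip by (rule open_Times)
  have "((\<lambda>(x, \<theta>). ysol x \<theta> $ j) has_derivative (\<lambda>(tx, ty). ?a * tx + blinfun_mult_right (?d x \<theta>) ty)) (at (x, \<theta>) within R \<times> strip \<xi>)"
  proof (rule has_derivative_partialsI)
    show "((\<lambda>x. ysol x \<theta> $ j) has_derivative (*) ?a) (at x within R)"
      using holomorphic_derivI[OF ysol_deriv_x(1)[OF x st[OF t]] R(1) x]
      unfolding has_field_derivative_def by (rule has_derivative_at_withinI)
    show "((\<lambda>\<theta>. ysol x \<theta> $ j) has_derivative blinfun_apply (blinfun_mult_right (?d x \<theta>))) (at \<theta> within strip \<xi>)"
      if "x \<in> R" "\<theta> \<in> strip \<xi>" for x \<theta>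
      using ysol_deriv_theta(1)[OF that(1) st[OF that(2)], of j] unfolding has_field_derivative_def
      by (auto intro: has_derivative_at_withinI)
    have "continuous_on (R \<times> strip \<xi>) (\<lambda>p. blinfun_mult_right (?d (fst p) (snd p)))"
      by (intro bounded_linear.continuous_on[OF bounded_linear_blinfun_mult_right] deriv_theta_continuous[OF xi])
    then show "continuous (at (x, \<theta>) within R \<times> strip \<xi>) (\<lambda>(x, \<theta>). blinfun_mult_right (?d x \<theta>))"
      using x t by (auto simp: continuous_on_eq_continuous_within case_prod_unfold)
  qed (use t convex_strip in auto)
  moreover have "at (x, \<theta>) within R \<times> strip \<xi> = at (x, \<theta>)" using x t by (intro at_within_open op) auto
  ultimately show "\<exists>a c. ((\<lambda>(x, \<theta>). ysol x \<theta> $ j) has_derivative (\<lambda>(u, w). a * u + c * w)) (at (x, \<theta>))"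
    by auto
qed

lemma ysol_fourier:
  assumes x: "x \<in> R"
  shows "fourier_coeff ysol \<alpha> x $ j = yc j \<alpha> x"
proof -
  have "fcoef (\<lambda>\<theta>. ysol x \<theta> $ j) \<alpha> = yc j \<alpha> x"
  proof (rule fcoef_of_series[where M = "\<lambda>\<alpha>. exp (- (\<xi>0 - 0) * \<bar>real_of_int \<alpha>\<bar>) * (CY * norm x)"])
    show "(\<lambda>\<alpha>. exp (- (\<xi>0 - 0) * \<bar>real_of_int \<alpha>\<bar>) * (CY * norm x)) summable_on UNIV"
      by (rule summable_on_cmult_left[OF mode_summable[OF xi0(1)]])
    show "norm (yc j \<alpha> x) \<le> exp (- (\<xi>0 - 0) * \<bar>real_of_int \<alpha>\<bar>) * (CY * norm x)" for \<alpha>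
      using yc_bound[OF x, of j \<alpha>] by (simp add: mult_ac)
  qed (simp add: ysol_def)
  then show ?thesis by (simp add: fourier_coeff_def fcoef_def)
qed

lemma ysol_fourier_has_sum:
  assumes x: "x \<in> R" and t: "\<bar>Im \<theta>\<bar> < \<xi>0"
  shows "((\<lambda>\<alpha>. exp (\<i> * of_int \<alpha> * \<theta>) *s fourier_coeff ysol \<alpha> x) has_sum ysol x \<theta>) UNIV"
  by (rule has_sum_vec) (simp add: ysol_fourier[OF x] ysol_has_sum[OF x t])

lemma ysol_fourier_bound:
  assumes x: "x \<in> R" and xi: "\<xi> \<le> \<xi>0"
  shows "norm (fourier_coeff ysol \<alpha> x) \<le> (real CARD('n) * CY) * (norm x * exp (- \<bar>real_of_int \<alpha>\<bar> * \<xi>))"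
proof -
  have "norm (fourier_coeff ysol \<alpha> x) \<le> (\<Sum>j\<in>UNIV. norm (fourier_coeff ysol \<alpha> x $ j))"
    by (simp add: norm_vec_def L2_set_le_sum)
  also have "\<dots> \<le> (\<Sum>j\<in>(UNIV::'n set). CY * (norm x * exp (- \<bar>real_of_int \<alpha>\<bar> * \<xi>)))"
  proof (rule sum_mono)
    fix j
    have "norm (yc j \<alpha> x) \<le> CY * norm x * exp (- \<xi>0 * \<bar>real_of_int \<alpha>\<bar>)" by (rule yc_bound[OF x])
    also have "\<dots> \<le> CY * norm x * exp (- \<bar>real_of_int \<alpha>\<bar> * \<xi>)"
      using mult_right_mono[OF xi, of "\<bar>real_of_int \<alpha>\<bar>"] CY_nonneg by (intro mult_left_mono) (auto simp: mult.commute)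
    finally show "norm (fourier_coeff ysol \<alpha> x $ j) \<le> CY * (norm x * exp (- \<bar>real_of_int \<alpha>\<bar> * \<xi>))"
      by (simp add: ysol_fourier[OF x] mult.assoc)
  qed
  finally show ?thesis by (simp add: mult_ac)
qed

lemma ysol_periodic: "ysol x (\<theta> + 2 * of_real pi) = ysol x \<theta>"
  unfolding ysol_def exp_ii_periodic ..

lemma ysol_one_sum:
  assumes W': "borel_transform V = fps_expansion (hat (Y j) \<alpha>) 0" and R': "R' \<subseteq> R"
  shows "is_one_sum V \<phi> R' (\<lambda>x. fourier_coeff ysol \<alpha> x $ j)"
  unfolding is_one_sum_def
proof (intro exI conjI)
  let ?H = "hat (Y j) \<alpha>"
  have hol: "?H holomorphic_on S" by (rule hat_holomorphic[OF good_Y good_nonneg(1)])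
  show "\<epsilon> > 0" by (rule dirs(1))
  \<comment> \<open>The Borel transform has growth type \<open>\<tau>\<close>; the value
    \<open>2 * \<tau>\<close> is the rate that some admissible direction exceeds at each point of
    \<open>R\<close>.\<close>
  show "2 * \<tau> > 0" using tau by simp
  show "borel_continuation V \<phi> \<epsilon> (2 * \<tau>) ?H"
    unfolding borel_continuation_def
  proof (intro conjI)
    show "?H has_fps_expansion borel_transform V"
      unfolding W' by (rule has_fps_expansion_fps_expansion[OF star0_open[OF star] zero_S hol])
    obtain r where "r > 0" "ball 0 r \<subseteq> S" using star0_open[OF star] zero_S open_contains_ball by blast
    then show "\<exists>\<rho>>0. ?H holomorphic_on (ball 0 \<rho> \<union> ray_sector \<phi> \<epsilon>)"
      using dirs(3) W(2) by (auto intro!: exI[of _ r] holomorphic_on_subset[OF hol])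
    have "exp (- (2 * \<tau>) * norm w) * norm (?H w) \<le> A * \<tau> * H3 * \<sigma> ^ nat \<bar>\<alpha>\<bar>" if "w \<in> S" for w
    proof -
      let ?K = "A * \<tau> * H3 * \<sigma> ^ nat \<bar>\<alpha>\<bar>"
      have K: "?K \<ge> 0" using good_nonneg tau H3_nonneg sigma by simp
      have "exp (- (2 * \<tau>) * norm w) * norm (?H w) \<le> exp (- (2 * \<tau>) * norm w) * (?K * exp (\<tau> * norm w))"
        using hat_Y_bound[OF that] by (intro mult_left_mono) auto
      also have "\<dots> = ?K * (exp (- (2 * \<tau>) * norm w) * exp (\<tau> * norm w))" by (simp add: mult_ac)
      also have "exp (- (2 * \<tau>) * norm w) * exp (\<tau> * norm w) = exp (- (\<tau> * norm w))" by (simp add: exp_add[symmetric])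
      also have "?K * \<dots> \<le> ?K * 1" using K tau by (intro mult_left_mono) auto
      finally show ?thesis by simp
    qed
    then show "\<exists>C Ra. \<forall>w\<in>ray_sector \<phi> \<epsilon>. Ra \<le> norm w \<longrightarrow> exp (- (2 * \<tau>) * norm w) * norm (?H w) \<le> C"
      using dirs(3) W(2) by blast
  qed
  show "\<forall>x\<in>R'. (\<exists>\<psi>. \<bar>\<psi> - \<phi>\<bar> < \<epsilon> \<and> 2 * \<tau> < Re (cis \<psi> / x)) \<and>
      (\<forall>\<psi>. \<bar>\<psi> - \<phi>\<bar> < \<epsilon> \<and> 2 * \<tau> < Re (cis \<psi> / x) \<longrightarrow> has_laplace ?H \<psi> x (fourier_coeff ysol \<alpha> x $ j))"
  proof (intro ballI conjI allI impI)
    fix x assume "x \<in> R'"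
    then have x: "x \<in> R" using R' by blast
    show "\<exists>\<psi>. \<bar>\<psi> - \<phi>\<bar> < \<epsilon> \<and> 2 * \<tau> < Re (cis \<psi> / x)"
      using R(3)[OF x] dirn(4)[OF x] by (meson less_le_trans)
    fix \<psi> assume psi: "\<bar>\<psi> - \<phi>\<bar> < \<epsilon> \<and> 2 * \<tau> < Re (cis \<psi> / x)"
    have e: "cis \<psi> \<in> W" "norm (cis \<psi>) = 1" "Re (cis \<psi> * (1 / x)) > \<tau>"
      using dirs(2) psi tau by auto
    note si = lap_integrable(1)[OF ray_bounded_Y[OF e(1,2), where j = j and \<alpha> = \<alpha>] e(3,2)]
    have "((\<lambda>r. ?H (of_real r * cis \<psi>) * exp (- (of_real r * cis \<psi> * (1 / x))) * cis \<psi>) has_integral lap (cis \<psi>) (1 / x) ?H) {0..}"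
      unfolding lap_def using integrable_integral[OF set_borel_integral_eq_integral(1)[OF si]] set_borel_integral_eq_integral(2)[OF si] by simp
    then show "has_laplace ?H \<psi> x (fourier_coeff ysol \<alpha> x $ j)"
      unfolding has_laplace_def ysol_fourier[OF x] yc_direction[OF e x] by simp
  qed
qed

text \<open>The values of \<open>Y\<close>, \<open>Z\<close> and \<open>D - Z\<close> are the
  solution, \<open>x^2\<close> times its \<open>x\<close>-derivative and its
  \<open>\<theta>\<close>-derivative, each by uniqueness of a sum over modes. Inserting the value of
  \<open>Q\<close> leaves an algebraic identity.\<close>

lemma ysol_equation:
  assumes x: "x \<in> R" and t: "\<bar>Im \<theta>\<bar> < \<xi>0"
    and sG: "\<And>l. ((\<lambda>\<alpha>. G j l \<alpha> * exp (\<i> * of_int \<alpha> * \<theta>)) has_sum sG l) UNIV"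
    and sF: "\<And>l. ((\<lambda>\<alpha>. F l \<alpha> * exp (\<i> * of_int \<alpha> * \<theta>)) has_sum sF l) UNIV"
    and zv: "zv = (\<lambda>v. case v of None \<Rightarrow> x | Some j \<Rightarrow> ysol x \<theta> $ j)"
    and g: "((\<lambda>l. sG l * prod_list (map zv l)) has_sum g) UNIV"
    and f: "((\<lambda>l. sF l * prod_list (map zv l)) has_sum f) UNIV"
  shows "x\<^sup>2 * deriv (\<lambda>x. ysol x \<theta> $ j) x * (1 + x * F0 + x\<^sup>2 * f) + deriv (\<lambda>\<theta>. ysol x \<theta> $ j) \<theta>
             + x * (of_real (lam j) * ysol x \<theta> $ j) = x\<^sup>2 * g"
proof -
  note d = dirn[OF x]
  have x0: "x \<noteq> 0" using R(2)[OF x] .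
  have "Re (dirn x * (1 / x)) > 2 * \<tau>" using d(3,4) by linarith
  from ray_solution[OF d(1,2) this t]
  interpret ray: ray_solution S \<tau> \<sigma> k0 lam F0 G F A B \<rho> Lam Q Y "dirn x" "1 / x" \<theta> .
  have vY: "ray.val (Y j) = ysol x \<theta> $ j" for j
    using ray.val_hat_has_sum[OF good_Y good_nonneg(1), of j] ysol_has_sum[OF x t, of j] has_sum_unique unfolding yc_def by blast
  have "(\<lambda>v. ray.val (letter Y v)) = zv"
    unfolding zv by (auto simp: fun_eq_iff letter_def vY ray.val_gX split: option.split)
  then have Q: "ray.val (Q j) = g * x - f * (ray.val (gZ Q Y j) * x) - F0 * ray.val (gZ Q Y j)"
    using ray.val_Q[OF sG sF] g f by simp
  have Zs: "((\<lambda>\<alpha>. x\<^sup>2 * (exp (\<i> * of_int \<alpha> * \<theta>) * deriv (yc j \<alpha>) x)) has_sum ray.val (gZ Q Y j)) UNIV"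
    using ray.val_Z_has_sum[of j] DERIV_imp_deriv[OF DERIV_yc[OF x, of j]] x0 by simp
  have Z: "x\<^sup>2 * deriv (\<lambda>x. ysol x \<theta> $ j) x = ray.val (gZ Q Y j)"
    by (rule has_sum_unique[OF has_sum_cmult_right[OF ysol_deriv_x(2)[OF x t]] Zs])
  have Ts: "((\<lambda>\<alpha>. \<i> * of_int \<alpha> * exp (\<i> * of_int \<alpha> * \<theta>) * yc j \<alpha> x) has_sum
     (ray.val (Q j) - of_real (lam j) * ray.val (Y j)) / (1 / x) - ray.val (gZ Q Y j)) UNIV"
    using ray.theta_derivative_has_sum[of j] unfolding yc_def .
  have T: "deriv (\<lambda>\<theta>. ysol x \<theta> $ j) \<theta> = x * (ray.val (Q j) - of_real (lam j) * ysol x \<theta> $ j) - ray.val (gZ Q Y j)"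
    using has_sum_unique[OF ysol_deriv_theta(2)[OF x t] Ts] by (simp add: vY mult.commute)
  show ?thesis unfolding Z T Q by (simp add: algebra_simps power2_eq_square)
qed

lemma ysol_bound:
  assumes x: "x \<in> R" and t: "\<bar>Im \<theta>\<bar> < \<xi>0"
  shows "norm (ysol x \<theta> $ j) \<le> A * H3"
proof -
  note d = dirn[OF x]
  have "Re (dirn x * (1 / x)) > 2 * \<tau>" using d(3,4) by linarith
  from ray_solution[OF d(1,2) this t]
  interpret ray: ray_solution S \<tau> \<sigma> k0 lam F0 G F A B \<rho> Lam Q Y "dirn x" "1 / x" \<theta> .
  have "ray.val (Y j) = ysol x \<theta> $ j"
    using ray.val_hat_has_sum[OF good_Y good_nonneg(1), of j] ysol_has_sum[OF x t, of j] has_sum_unique unfolding yc_def by blast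
  then show ?thesis using ray.val_bound[OF good_Y good_nonneg(1), of j] by simp
qed

lemma ysol_analytic_solution:
  fixes F1 :: "complex \<Rightarrow> complex ^ 'n \<Rightarrow> complex \<Rightarrow> complex" and G1 :: "complex \<Rightarrow> complex ^ 'n \<Rightarrow> complex \<Rightarrow> complex ^ 'n"
    and lamv :: "real ^ 'n"
  assumes lamv: "lam = ($) lamv"
    and eF: "\<And>z \<theta>. (\<And>v. norm (z v) \<le> r0) \<Longrightarrow> \<bar>Im \<theta>\<bar> < \<xi>0 \<Longrightarrow>
      ((\<lambda>(l, \<alpha>). F l \<alpha> * prod_list (map z l) * exp (\<i> * of_int \<alpha> * \<theta>)) has_sum F1 (z None) (\<chi> j. z (Some j)) \<theta>) UNIV"
    and eG: "\<And>j z \<theta>. (\<And>v. norm (z v) \<le> r0) \<Longrightarrow> \<bar>Im \<theta>\<bar> < \<xi>0 \<Longrightarrow>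
      ((\<lambda>(l, \<alpha>). G j l \<alpha> * prod_list (map z l) * exp (\<i> * of_int \<alpha> * \<theta>)) has_sum G1 (z None) (\<chi> j. z (Some j)) \<theta> $ j) UNIV"
    and sF: "\<And>l \<theta>. \<bar>Im \<theta>\<bar> < \<xi>0 \<Longrightarrow> (\<lambda>\<alpha>. F l \<alpha> * exp (\<i> * of_int \<alpha> * \<theta>)) summable_on UNIV"
    and sG: "\<And>j l \<theta>. \<bar>Im \<theta>\<bar> < \<xi>0 \<Longrightarrow> (\<lambda>\<alpha>. G j l \<alpha> * exp (\<i> * of_int \<alpha> * \<theta>)) summable_on UNIV"
    and r0: "A * H3 \<le> r0" "\<And>x. x \<in> R \<Longrightarrow> norm x \<le> r0" "real (CARD('n) + 1) * r0 < \<kappa>"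
    and xi: "\<xi> < \<xi>0" "\<xi>0 \<le> \<zeta>" and R': "R' \<subseteq> R"
  shows "analytic_solution \<kappa> \<zeta> F0 F1 lamv G1 R' \<xi> ysol"
  unfolding analytic_solution_def
proof (intro conjI allI ballI)
  fix j
  show "analytic_x_theta (\<lambda>x \<theta>. ysol x \<theta> $ j) (R' \<times> strip \<xi>)"
    using ysol_analytic[OF xi(1), of j] R' unfolding analytic_x_theta_def by blast
next
  fix x \<theta> assume "x \<in> R'" "\<theta> \<in> strip \<xi>"
  then have x: "x \<in> R" and t: "\<bar>Im \<theta>\<bar> < \<xi>0" using R' xi by (auto simp: strip_def)
  have r0p: "r0 \<ge> 0" using order_trans[OF norm_ge_zero r0(2)[OF x]] .
  show "ysol x (\<theta> + 2 * of_real pi) = ysol x \<theta>" by (rule ysol_periodic)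
  have "norm (ysol x \<theta>) \<le> (\<Sum>j\<in>UNIV. norm (ysol x \<theta> $ j))" by (simp add: norm_vec_def L2_set_le_sum)
  also have "\<dots> \<le> (\<Sum>j\<in>(UNIV::'n set). r0)" using ysol_bound[OF x t] r0(1) by (intro sum_mono) (meson order_trans)
  also have "\<dots> \<le> real (CARD('n) + 1) * r0" using r0p by (simp add: distrib_right)
  finally have "norm (ysol x \<theta>) < \<kappa>" using r0(3) by linarith
  moreover have "norm x < \<kappa>"
  proof -
    have "1 * r0 \<le> real (CARD('n) + 1) * r0" using r0p by (intro mult_right_mono) auto
    then show ?thesis using r0(2)[OF x] r0(3) by linarith
  qed
  ultimately show "(x, ysol x \<theta>, \<theta>) \<in> pde_domain \<kappa> \<zeta>"
    using t xi by (simp add: pde_domain_def strip_def)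
  fix j
  define zv where "zv = (\<lambda>v. case v of None \<Rightarrow> x | Some j \<Rightarrow> ysol x \<theta> $ j)"
  have z: "norm (zv v) \<le> r0" for v
    using r0(2)[OF x] ysol_bound[OF x t] r0(1) by (auto simp: zv_def split: option.split intro: order_trans)
  have zz: "zv None = x" "(\<chi> j. zv (Some j)) = ysol x \<theta>" by (simp_all add: zv_def)
  have sum_l: "((\<lambda>l. (\<Sum>\<^sub>\<infinity>\<alpha>. c l \<alpha> * exp (\<i> * of_int \<alpha> * \<theta>)) * prod_list (map zv l)) has_sum s) UNIV"
    if s: "((\<lambda>(l, \<alpha>). c l \<alpha> * prod_list (map zv l) * exp (\<i> * of_int \<alpha> * \<theta>)) has_sum s) UNIV"
      and c: "\<And>l. (\<lambda>\<alpha>. c l \<alpha> * exp (\<i> * of_int \<alpha> * \<theta>)) summable_on UNIV" for c :: "'n option list \<Rightarrow> int \<Rightarrow> complex" and s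
  proof (rule has_sum_Sigma'[OF s[folded UNIV_Times_UNIV]])
    fix l
    have "((\<lambda>\<alpha>. c l \<alpha> * exp (\<i> * of_int \<alpha> * \<theta>) * prod_list (map zv l)) has_sum
       (\<Sum>\<^sub>\<infinity>\<alpha>. c l \<alpha> * exp (\<i> * of_int \<alpha> * \<theta>)) * prod_list (map zv l)) UNIV"
      by (intro has_sum_cmult_left has_sum_infsum c)
    then show "((\<lambda>\<alpha>. case (l, \<alpha>) of (l, \<alpha>) \<Rightarrow> c l \<alpha> * prod_list (map zv l) * exp (\<i> * of_int \<alpha> * \<theta>)) has_sum
       (\<Sum>\<^sub>\<infinity>\<alpha>. c l \<alpha> * exp (\<i> * of_int \<alpha> * \<theta>)) * prod_list (map zv l)) UNIV"
      by (simp add: mult_ac)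
  qed
  have "x\<^sup>2 * deriv (\<lambda>x. ysol x \<theta> $ j) x * (1 + x * F0 + x\<^sup>2 * F1 x (ysol x \<theta>) \<theta>) + deriv (\<lambda>\<theta>. ysol x \<theta> $ j) \<theta>
             + x * (of_real (lam j) * ysol x \<theta> $ j) = x\<^sup>2 * G1 x (ysol x \<theta>) \<theta> $ j"
  proof (rule ysol_equation[OF x t _ _ zv_def])
    show "((\<lambda>\<alpha>. G j l \<alpha> * exp (\<i> * of_int \<alpha> * \<theta>)) has_sum (\<Sum>\<^sub>\<infinity>\<alpha>. G j l \<alpha> * exp (\<i> * of_int \<alpha> * \<theta>))) UNIV" for l
      by (rule has_sum_infsum[OF sG[OF t]])
    show "((\<lambda>\<alpha>. F l \<alpha> * exp (\<i> * of_int \<alpha> * \<theta>)) has_sum (\<Sum>\<^sub>\<infinity>\<alpha>. F l \<alpha> * exp (\<i> * of_int \<alpha> * \<theta>))) UNIV" for l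
      by (rule has_sum_infsum[OF sF[OF t]])
    show "((\<lambda>l. (\<Sum>\<^sub>\<infinity>\<alpha>. G j l \<alpha> * exp (\<i> * of_int \<alpha> * \<theta>)) * prod_list (map zv l)) has_sum G1 x (ysol x \<theta>) \<theta> $ j) UNIV"
      using sum_l[OF eG[OF z t, of j] sG[OF t]] unfolding zz .
    show "((\<lambda>l. (\<Sum>\<^sub>\<infinity>\<alpha>. F l \<alpha> * exp (\<i> * of_int \<alpha> * \<theta>)) * prod_list (map zv l)) has_sum F1 x (ysol x \<theta>) \<theta>) UNIV"
      using sum_l[OF eF[OF z t] sF[OF t]] unfolding zz .
  qed
  then show "x\<^sup>2 * deriv (\<lambda>x. ysol x \<theta> $ j) x * (1 + x * F0 + x\<^sup>2 * F1 x (ysol x \<theta>) \<theta>) + deriv (\<lambda>\<theta>. ysol x \<theta> $ j) \<theta>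
             + x * (of_real (lamv $ j) * ysol x \<theta> $ j) = x\<^sup>2 * G1 x (ysol x \<theta>) \<theta> $ j"
    by (simp add: lamv)
qed

end

section \<open>Domains and sectors\<close>

text \<open>The singularities of \<open>1 / (w + \<i> \<alpha>)\<close>, \<open>\<alpha> \<noteq> 0\<close>, lie on the imaginary axis outside the disc of
  radius \<open>1 / 2\<close>; the domain keeps a uniform distance from them and contains the sectors around both
  half axes.\<close>

definition Om :: "real \<Rightarrow> complex set" where "Om K = {w. \<bar>Im w\<bar> < 1 / 2 + K * \<bar>Re w\<bar>}"

text \<open>For positive \<open>K\<close>, the tangent of the half-opening, the sign
  \<open>s = 1\<close> gives the cone around the positive real axis and \<open>s = -1\<close> the
  one around the negative real axis.\<close>

definition wedge :: "real \<Rightarrow> real \<Rightarrow> complex set" where "wedge K s = {w. \<bar>Im w\<bar> < K * (s * Re w)}"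

lemma star0_Om: "K > 0 \<Longrightarrow> star0 (Om K)"
  unfolding star0_def
proof (intro conjI ballI)
  assume K: "K > 0"
  show "open (Om K)" unfolding Om_def by (intro open_Collect_less continuous_intros)
  fix w and t :: real assume w: "w \<in> Om K" and t: "t \<in> {0..1}"
  show "of_real t * w \<in> Om K"
  proof (cases "t = 0")
    case False
    then have "t > 0" using t by simp
    then have "t * \<bar>Im w\<bar> < t * (1 / 2 + K * \<bar>Re w\<bar>)" using w by (simp add: Om_def)
    also have "\<dots> \<le> 1 / 2 + K * (t * \<bar>Re w\<bar>)" using t by (simp add: algebra_simps)
    finally show ?thesis using t by (simp add: Om_def abs_mult)
  qed (simp add: Om_def)
qed

lemma Om_resonance:
  assumes K: "K > 0" and w: "w \<in> Om K" and \<alpha>: "\<alpha> \<noteq> 0"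
  shows "w + \<i> * of_int \<alpha> \<noteq> 0" "norm (w / (w + \<i> * of_int \<alpha>)) \<le> 2 * (1 + K)" "norm (1 / (w + \<i> * of_int \<alpha>)) \<le> 2 * (1 + K)"
proof -
  let ?d = "norm (w + \<i> * of_int \<alpha>)"
  have a1: "1 \<le> \<bar>real_of_int \<alpha>\<bar>" using \<alpha> by linarith
  have re: "\<bar>Re w\<bar> \<le> ?d" using abs_Re_le_cmod[of "w + \<i> * of_int \<alpha>"] by simp
  have im: "\<bar>Im w + real_of_int \<alpha>\<bar> \<le> ?d" using abs_Im_le_cmod[of "w + \<i> * of_int \<alpha>"] by simp
  have kr: "K * \<bar>Re w\<bar> \<le> K * ?d" using re K by (intro mult_left_mono) auto
  have w': "\<bar>Im w\<bar> < 1 / 2 + K * \<bar>Re w\<bar>" using w by (simp add: Om_def)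
  \<comment> \<open>With \<open>d\<close> the distance to the resonance,
    \<open>\<bar>Im w\<bar> \<ge> 1 - d\<close>, while membership in \<open>Om K\<close> gives
    \<open>\<bar>Im w\<bar> < 1/2 + K d\<close>.\<close>
  then have half: "1 / 2 < (1 + K) * ?d" using im a1 kr by (simp add: distrib_right)
  then have d0: "?d > 0" using K by (metis less_add_one less_trans mult_eq_0_iff norm_ge_zero order_le_less half_gt_zero_iff zero_less_one not_less_iff_gr_or_eq)
  then show "w + \<i> * of_int \<alpha> \<noteq> 0" by auto
  have "norm w \<le> \<bar>Re w\<bar> + \<bar>Im w\<bar>" by (rule cmod_le)
  then have "norm w \<le> 2 * (1 + K) * ?d" using w' kr re half by (simp add: algebra_simps)
  then show "norm (w / (w + \<i> * of_int \<alpha>)) \<le> 2 * (1 + K)" using d0 by (simp add: norm_divide pos_divide_le_eq)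
  have "1 \<le> 2 * (1 + K) * ?d" using half by linarith
  then show "norm (1 / (w + \<i> * of_int \<alpha>)) \<le> 2 * (1 + K)" using d0 by (simp add: norm_divide pos_divide_le_eq)
qed

lemma convex_wedge: "convex (wedge K s)"
  unfolding convex_def
proof (intro ballI allI impI)
  fix x y and u v :: real assume x: "x \<in> wedge K s" and y: "y \<in> wedge K s" and uv: "0 \<le> u" "0 \<le> v" "u + v = 1"
  have "u * (\<bar>Im x\<bar> - K * (s * Re x)) + v * (\<bar>Im y\<bar> - K * (s * Re y)) < 0"
    by (rule convex_bound_lt) (use x y uv in \<open>auto simp: wedge_def\<close>)
  moreover have "\<bar>Im (u *\<^sub>R x + v *\<^sub>R y)\<bar> \<le> u * \<bar>Im x\<bar> + v * \<bar>Im y\<bar>"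
    using abs_triangle_ineq[of "u * Im x" "v * Im y"] uv by (simp add: abs_mult)
  ultimately show "u *\<^sub>R x + v *\<^sub>R y \<in> wedge K s" by (simp add: wedge_def algebra_simps)
qed

lemma wedge_cone: "w \<in> wedge K s \<Longrightarrow> r > 0 \<Longrightarrow> of_real r * w \<in> wedge K s"
proof -
  assume "w \<in> wedge K s" "r > 0"
  then have "r * \<bar>Im w\<bar> < r * (K * (s * Re w))" by (simp add: wedge_def)
  then show ?thesis using \<open>r > 0\<close> by (simp add: wedge_def abs_mult mult_ac)
qed

lemma wedge_subset_Om: "K > 0 \<Longrightarrow> \<bar>s\<bar> = 1 \<Longrightarrow> wedge K s \<subseteq> Om K"
proof
  fix w assume K: "K > 0" and s: "\<bar>s\<bar> = 1" and w: "w \<in> wedge K s"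
  have "s * Re w \<le> \<bar>Re w\<bar>" using s abs_ge_self[of "s * Re w"] by (simp add: abs_mult)
  then have "K * (s * Re w) \<le> K * \<bar>Re w\<bar>" using K by (intro mult_left_mono) auto
  then show "w \<in> Om K" using w by (simp add: wedge_def Om_def)
qed

lemma cis_wedge:
  assumes "\<bar>\<psi>\<bar> < \<epsilon>" "\<epsilon> < pi / 2"
  shows "cis \<psi> \<in> wedge (tan \<epsilon>) 1"
proof -
  have c: "cos \<psi> > 0" using assms by (intro cos_gt_zero_pi) auto
  have "tan \<psi> < tan \<epsilon>" by (rule tan_monotone) (use assms in auto)
  moreover have "tan (- \<epsilon>) < tan \<psi>" by (rule tan_monotone) (use assms in auto)
  ultimately have "\<bar>tan \<psi>\<bar> < tan \<epsilon>" by auto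
  then have "\<bar>sin \<psi>\<bar> / cos \<psi> < tan \<epsilon>" using c by (simp add: tan_def)
  then show ?thesis using c by (simp add: wedge_def pos_divide_less_eq)
qed

lemma ray_sector_subset:
  assumes "\<And>\<psi>. \<bar>\<psi> - \<phi>\<bar> < \<epsilon> \<Longrightarrow> cis \<psi> \<in> W" "\<And>w r. w \<in> W \<Longrightarrow> r > 0 \<Longrightarrow> of_real r * w \<in> W"
  shows "ray_sector \<phi> \<epsilon> \<subseteq> W"
proof
  fix w assume w: "w \<in> ray_sector \<phi> \<epsilon>"
  let ?u = "w * cis (- \<phi>)"
  have u: "?u \<noteq> 0" "\<bar>Arg ?u\<bar> < \<epsilon>" "norm w > 0" using w by (auto simp: ray_sector_def)
  have "?u = of_real (norm ?u) * cis (Arg ?u)" using rcis_cmod_Arg[of ?u] by (simp add: rcis_def)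
  then have "w * cis (- \<phi>) * cis \<phi> = of_real (norm w) * (cis (Arg ?u) * cis \<phi>)" by (simp add: norm_mult mult.assoc)
  then have "w = of_real (norm w) * cis (Arg ?u + \<phi>)" by (simp add: cis_mult mult.assoc)
  moreover have "cis (Arg ?u + \<phi>) \<in> W" using u by (intro assms(1)) simp
  ultimately show "w \<in> W" using assms(2)[OF _ u(3)] by metis
qed

lemma open_sector_plus: "chi < pi \<Longrightarrow> open (sector_plus \<delta> chi)"
proof -
  assume chi: "chi < pi"
  have "open ((- \<real>\<^sub>\<le>\<^sub>0) \<inter> Arg -` {- ((pi + chi) / 2)<..<(pi + chi) / 2})"
    by (intro continuous_open_preimage continuous_on_Arg) (auto simp: closed_nonpos_Reals_complex open_Compl)
  then have "open (((- \<real>\<^sub>\<le>\<^sub>0) \<inter> Arg -` {- ((pi + chi) / 2)<..<(pi + chi) / 2}) \<inter> ball 0 \<delta>)" by auto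
  moreover have "((- \<real>\<^sub>\<le>\<^sub>0) \<inter> Arg -` {- ((pi + chi) / 2)<..<(pi + chi) / 2}) \<inter> ball 0 \<delta> = sector_plus \<delta> chi"
  proof (intro equalityI subsetI)
    fix x assume "x \<in> sector_plus \<delta> chi"
    then have x: "x \<noteq> 0" "norm x < \<delta>" "\<bar>Arg x\<bar> < (pi + chi) / 2" by (auto simp: sector_plus_def)
    have "x \<notin> \<real>\<^sub>\<le>\<^sub>0"
    proof
      assume "x \<in> \<real>\<^sub>\<le>\<^sub>0"
      then have "Arg x = pi" using x(1) by (auto simp: Arg_eq_pi complex_nonpos_Reals_iff complex_eq_iff)
      then show False using x(3) chi by simp
    qed
    then show "x \<in> ((- \<real>\<^sub>\<le>\<^sub>0) \<inter> Arg -` {- ((pi + chi) / 2)<..<(pi + chi) / 2}) \<inter> ball 0 \<delta>"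
    proof -
      have "- ((pi + chi) / 2) < Arg x" "Arg x < (pi + chi) / 2" using x(3) by linarith+
      then show ?thesis using x \<open>x \<notin> \<real>\<^sub>\<le>\<^sub>0\<close> by simp
    qed
  next
    fix x assume "x \<in> ((- \<real>\<^sub>\<le>\<^sub>0) \<inter> Arg -` {- ((pi + chi) / 2)<..<(pi + chi) / 2}) \<inter> ball 0 \<delta>"
    then have x: "x \<notin> \<real>\<^sub>\<le>\<^sub>0" "- ((pi + chi) / 2) < Arg x" "Arg x < (pi + chi) / 2" "norm x < \<delta>" by auto
    then have "x \<noteq> 0" by auto
    moreover have "\<bar>Arg x\<bar> < (pi + chi) / 2" using x(2,3) by linarith
    ultimately show "x \<in> sector_plus \<delta> chi" using x(4) by (simp add: sector_plus_def)
  qed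
  ultimately show ?thesis by simp
qed

lemma sector_minus_eq: "sector_minus \<delta> chi = uminus ` sector_plus \<delta> chi"
proof (intro equalityI subsetI)
  fix x assume "x \<in> sector_minus \<delta> chi"
  then have "- x \<in> sector_plus \<delta> chi" by (simp add: sector_minus_def sector_plus_def)
  then show "x \<in> uminus ` sector_plus \<delta> chi" by (rule rev_image_eqI) simp
qed (auto simp: sector_minus_def sector_plus_def)

text \<open>The direction is \<open>Arg x\<close> clamped to the interval from
  \<open>- \<epsilon>'\<close> to \<open>\<epsilon>'\<close>. As
  \<open>\<bar>Arg x\<bar> < (pi + chi) / 2\<close>, the remaining angle is at most
  \<open>pi / 2 - (\<epsilon>' - chi / 2)\<close>, whose cosine is the stated sine.\<close>

lemma sector_direction:
  assumes chi: "0 < chi" "chi / 2 < \<epsilon>'" "\<epsilon>' < pi / 2" and x: "x \<in> sector_plus \<delta> chi"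
  shows "\<exists>\<psi>. \<bar>\<psi>\<bar> \<le> \<epsilon>' \<and> Re (cis \<psi> / x) \<ge> sin (\<epsilon>' - chi / 2) / norm x"
proof -
  define a where "a = Arg x"
  define \<psi> where "\<psi> = max (- \<epsilon>') (min \<epsilon>' a)"
  have a: "\<bar>a\<bar> < (pi + chi) / 2" and n: "norm x > 0" using x by (auto simp: sector_plus_def a_def)
  have e': "\<epsilon>' > 0" using chi by simp
  have p: "\<bar>\<psi>\<bar> \<le> \<epsilon>'" using e' by (auto simp: \<psi>_def)
  have d: "\<bar>\<psi> - a\<bar> \<le> pi / 2 - (\<epsilon>' - chi / 2)" using a e' chi by (auto simp: \<psi>_def max_def min_def abs_if field_simps split: if_splits)
  have "x = of_real (norm x) * cis a" using rcis_cmod_Arg[of x] by (simp add: rcis_def a_def)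
  then have "cis \<psi> / x = cis (\<psi> - a) / of_real (norm x)"
    by (metis (no_types, lifting) cis_divide divide_divide_eq_left mult.commute)
  then have "Re (cis \<psi> / x) = cos \<bar>\<psi> - a\<bar> / norm x" by (simp add: Re_divide_of_real)
  moreover have "cos (pi / 2 - (\<epsilon>' - chi / 2)) \<le> cos \<bar>\<psi> - a\<bar>"
    using d chi by (intro cos_monotone_0_pi_le) auto
  then have "sin (\<epsilon>' - chi / 2) \<le> cos \<bar>\<psi> - a\<bar>" by (simp add: cos_diff)
  ultimately show ?thesis using p n by (intro exI[of _ \<psi>]) (auto intro: divide_right_mono)
qed

text \<open>The coefficient of \<open>x^(k+1)\<close> must be the \<open>k\<close>-th derivative of
  \<open>h\<close> at \<open>0\<close>. Cauchy's inequality on a disc of radius \<open>r\<close>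
  bounds it by a constant times \<open>k! / r^k\<close>, which is the Gevrey-1 estimate.\<close>

lemma gevrey_of_borel:
  assumes S: "open S" "0 \<in> S" and h: "h holomorphic_on S"
  obtains V where "gevrey1 V" "borel_transform V = fps_expansion h 0"
proof -
  obtain r where r: "r > 0" "cball 0 r \<subseteq> S" using S open_contains_cball[of S] by blast
  have hc: "continuous_on (cball 0 r) h" "h holomorphic_on ball 0 r"
    using r(2) ball_subset_cball[of 0 r] holomorphic_on_imp_continuous_on[OF h]
    by (blast intro: continuous_on_subset holomorphic_on_subset[OF h])+
  have "bounded (h ` cball 0 r)" by (intro compact_imp_bounded compact_continuous_image hc compact_cball)
  then obtain M where "\<forall>x\<in>cball 0 r. norm (h x) \<le> M" by (auto simp: bounded_iff simp del: mem_cball)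
  then have M: "norm (h x) \<le> max 1 M" if "x \<in> cball 0 r" for x using that by fastforce
  define V where "V = Abs_fps (\<lambda>n. if n = 0 then 0 else (deriv ^^ (n - 1)) h 0)"
  have "borel_transform V = fps_expansion h 0"
    by (simp add: borel_transform_def V_def fps_expansion_def)
  moreover have "norm (fps_nth V \<beta>) \<le> (max 1 M * r) * (1 / r) ^ \<beta> * fact (\<beta> - 1)" if b: "\<beta> \<ge> 1" for \<beta>
  proof -
    obtain k where k: "\<beta> = Suc k" using b by (cases \<beta>) auto
    have "norm ((deriv ^^ k) h 0) \<le> fact k * max 1 M / r ^ k"
      by (rule Cauchy_inequality[OF hc(2,1) r(1)]) (use M in auto)
    also have "\<dots> = (max 1 M * r) * (1 / r) ^ \<beta> * fact (\<beta> - 1)" using r by (simp add: k power_divide)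
    finally show ?thesis by (simp add: V_def k)
  qed
  then have "gevrey1 V" unfolding gevrey1_def using r
    by (intro conjI exI[of _ "max 1 M * r"] exI[of _ "1 / r"]) (auto simp: V_def)
  ultimately show ?thesis using that by blast
qed

text \<open>One half of the exponential decay becomes the power of
  \<open>\<sigma> = exp (- \<xi>)\<close>; the other half pays for the polynomial weight
  \<open>hw\<close>, at the cost of the factor \<open>E\<close>.\<close>

lemma laurent_coeff_bound:
  assumes c: "\<And>\<alpha>. norm (c \<alpha>) \<le> B * exp (- (2 * \<xi>) * \<bar>real_of_int \<alpha>\<bar>)" and E: "\<And>n. (1 + real n)\<^sup>2 * exp (- \<xi>) ^ n \<le> E" and B: "B \<ge> 0"
  shows "norm (laurent_coeff c p q) \<le> (B * E) * (exp (- \<xi>) ^ p * hw p) * (exp (- \<xi>) ^ q * hw q)"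
proof -
  let ?s = "exp (- \<xi>)"
  have E0: "E \<ge> 0" using E[of 0] by simp
  have key: "exp (- (2 * \<xi>) * real n) \<le> E * (?s ^ n * hw n)" for n
  proof -
    have "?s ^ n \<le> E * hw n" using E[of n] by (simp add: hw_def field_simps)
    then have "?s ^ n * ?s ^ n \<le> ?s ^ n * (E * hw n)" by (intro mult_left_mono) auto
    moreover have "?s ^ n * ?s ^ n = exp (- (2 * \<xi>) * real n)" by (simp add: exp_of_nat_mult[symmetric] exp_add[symmetric] algebra_simps)
    ultimately show ?thesis by (simp add: mult_ac)
  qed
  have k2: "norm (c \<alpha>) \<le> B * (E * (?s ^ n * hw n))" if "\<bar>real_of_int \<alpha>\<bar> = real n" for \<alpha> n
    by (rule order_trans[OF c]) (use key[of n] that B in \<open>auto intro: mult_left_mono\<close>)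
  show ?thesis
  proof (cases "p = 0 \<or> q = 0")
    case True
    then show ?thesis using k2[of "int p" p] k2[of "- int q" q] by (auto simp: laurent_coeff_def mult_ac)
  next
    case False
    then show ?thesis using B E0 hw_pos by (simp add: laurent_coeff_def less_imp_le)
  qed
qed

lemma quadratic_exp_bounded:
  assumes "\<xi> > 0"
  shows "\<exists>E\<ge>1. \<forall>n. (1 + real n)\<^sup>2 * exp (- \<xi>) ^ n \<le> E"
proof -
  have "(\<lambda>n. (1 + real n)\<^sup>2 * exp (- (\<xi> * real n))) \<longlonglongrightarrow> 0" using assms by real_asymp
  then have "Bseq (\<lambda>n. (1 + real n)\<^sup>2 * exp (- (\<xi> * real n)))" by (intro convergent_imp_Bseq convergentI)
  then obtain E where E: "\<And>n. norm ((1 + real n)\<^sup>2 * exp (- (\<xi> * real n))) \<le> E" by (auto simp: Bseq_def)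
  moreover have "exp (- \<xi>) ^ n = exp (- (\<xi> * real n))" for n by (simp add: exp_of_nat_mult[symmetric] mult.commute)
  ultimately have "(1 + real n)\<^sup>2 * exp (- \<xi>) ^ n \<le> max 1 E" for n
    by (metis abs_ge_self max.coboundedI2 order_trans real_norm_def)
  then show ?thesis by (intro exI[of _ "max 1 E"]) auto
qed

text \<open>Here \<open>e\<close> plays the role of \<open>4 / \<tau>\<close> and
  \<open>256 * B * e\<close> that of \<open>A\<close>. The leading term \<open>128 * B * e\<close>
  uses half of \<open>A\<close>, and the two remaining terms are each held to a quarter. The number
  \<open>X\<close> adds up all lower bounds imposed on \<open>1 / e\<close>, and the final 1 ensures
  \<open>e \<le> 1\<close>.\<close>

lemma small_parameter:
  fixes B D f N \<rho> H r :: real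
  assumes "B \<ge> 1" "D \<ge> 1" "f \<ge> 0" "N \<ge> 1" "\<rho> > 0" "H \<ge> 0" "r > 0"
  obtains e where "e > 0" "N * (512 * (256 * B * e) / \<rho>) \<le> 1 / 2"
    "128 * B * (e + 512 * (D * e * (256 * B * e)) * e) + f * (D * e * (256 * B * e)) \<le> 256 * B * e"
    "D * e \<le> 1" "256 * B * e * H \<le> r"
proof -
  define X where "X = 262144 * B * D + 4 * f * D + D + 262144 * N * B / \<rho> + 256 * B * H / r + 1"
  define e where "e = 1 / X"
  have nn: "262144 * B * D \<ge> 0" "4 * f * D \<ge> 0" "D \<ge> 0" "262144 * N * B / \<rho> \<ge> 0" "256 * B * H / r \<ge> 0"
    using assms by auto
  have X: "X \<ge> 1" "262144 * B * D \<le> X" "4 * f * D \<le> X" "D \<le> X" "262144 * N * B / \<rho> \<le> X" "256 * B * H / r \<le> X"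
    using nn unfolding X_def by linarith+
  have e: "e > 0" "e \<le> 1" using X(1) by (auto simp: e_def)
  have le: "Z * e \<le> 1" if "Z \<le> X" for Z using that X(1) by (simp add: e_def)
  have A: "256 * B * e > 0" using assms(1) e by simp
  show ?thesis
  proof
    show "e > 0" by (rule e)
    show "D * e \<le> 1" by (rule le[OF X(4)])
    have "N * (512 * (256 * B * e) / \<rho>) = (262144 * N * B / \<rho> * e) / 2" using assms(5) by (simp add: field_simps)
    also have "\<dots> \<le> 1 / 2" by (rule divide_right_mono[OF le[OF X(5)]]) simp
    finally show "N * (512 * (256 * B * e) / \<rho>) \<le> 1 / 2" .
    have "256 * B * e * H = (256 * B * H / r * e) * r" using assms(7) by simp
    also have "\<dots> \<le> 1 * r" using le[OF X(6)] assms(7) by (intro mult_right_mono) auto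
    finally show "256 * B * e * H \<le> r" by simp
    have 1: "(262144 * B * D * e) * e * (256 * B * e) \<le> 1 * 1 * (256 * B * e)"
      using le[OF X(2)] e A assms by (intro mult_mono) auto
    have 2: "(4 * f * D * e) * (256 * B * e) \<le> 1 * (256 * B * e)"
      using le[OF X(3)] A by (intro mult_right_mono) auto
    have "128 * B * (e + 512 * (D * e * (256 * B * e)) * e) + f * (D * e * (256 * B * e)) =
      128 * B * e + ((262144 * B * D * e) * e * (256 * B * e)) / 4 + ((4 * f * D * e) * (256 * B * e)) / 4"
      by algebra
    also have "\<dots> \<le> 256 * B * e" using 1 2 by simp
    finally show "128 * B * (e + 512 * (D * e * (256 * B * e)) * e) + f * (D * e * (256 * B * e)) \<le> 256 * B * e" .
  qed
qed

section \<open>Choice of constants and construction of the two solutions\<close>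

theorem theorem1p1:
  fixes F0 :: complex
    and lam :: "real ^ 'n"
    and F1 :: "complex \<Rightarrow> complex ^ 'n \<Rightarrow> complex \<Rightarrow> complex"
    and G1 :: "complex \<Rightarrow> complex ^ 'n \<Rightarrow> complex \<Rightarrow> complex ^ 'n"
    and \<kappa> \<zeta> chi :: real
  assumes "\<kappa> > 0" and "\<zeta> > 0"
    and "\<And>j. lam $ j > 0"
    and "analytic_coefficient \<kappa> \<zeta> F1"
    and "\<And>j. analytic_coefficient \<kappa> \<zeta> (\<lambda>x y \<theta>. G1 x y \<theta> $ j)"
    and "0 < chi" and "chi < pi"
  shows "\<exists>\<delta>0>0. \<exists>\<xi>0>0. \<forall>\<delta> \<xi>. 0 < \<delta> \<and> \<delta> < \<delta>0 \<and> 0 < \<xi> \<and> \<xi> < \<xi>0 \<longrightarrow>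
    (\<exists>yp ym :: complex \<Rightarrow> complex \<Rightarrow> complex ^ 'n.
       analytic_solution \<kappa> \<zeta> F0 F1 lam G1 (sector_plus \<delta> chi) \<xi> yp \<and>
       analytic_solution \<kappa> \<zeta> F0 F1 lam G1 (sector_minus \<delta> chi) \<xi> ym \<and>
       (\<forall>x\<in>sector_plus \<delta> chi. \<forall>\<theta>\<in>strip \<xi>.
          ((\<lambda>\<alpha>. exp (\<i> * of_int \<alpha> * \<theta>) *s fourier_coeff yp \<alpha> x) has_sum yp x \<theta>) UNIV) \<and>
       (\<forall>x\<in>sector_minus \<delta> chi. \<forall>\<theta>\<in>strip \<xi>.
          ((\<lambda>\<alpha>. exp (\<i> * of_int \<alpha> * \<theta>) *s fourier_coeff ym \<alpha> x) has_sum ym x \<theta>) UNIV) \<and>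
       (\<exists>C. \<forall>\<alpha>. \<forall>x\<in>sector_plus \<delta> chi.
          norm (fourier_coeff yp \<alpha> x) \<le> C * (norm x * exp (- \<bar>real_of_int \<alpha>\<bar> * \<xi>))) \<and>
       (\<exists>C. \<forall>\<alpha>. \<forall>x\<in>sector_minus \<delta> chi.
          norm (fourier_coeff ym \<alpha> x) \<le> C * (norm x * exp (- \<bar>real_of_int \<alpha>\<bar> * \<xi>))) \<and>
       (\<forall>\<alpha>. \<exists>W :: complex fps ^ 'n. \<forall>j.
          gevrey1 (W $ j) \<and>
          is_one_sum (W $ j) 0 (sector_plus \<delta> chi) (\<lambda>x. fourier_coeff yp \<alpha> x $ j) \<and>
          is_one_sum (W $ j) pi (sector_minus \<delta> chi) (\<lambda>x. fourier_coeff ym \<alpha> x $ j)))"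
proof -
  define N where "N = real (CARD('n) + 1)"
  \<comment> \<open>The coefficient functions decay like
    \<open>exp (- (\<zeta> / 4) \<bar>\<alpha>\<bar>)\<close>, that is
    \<open>exp (- 2 \<xi>0 \<bar>\<alpha>\<bar>)\<close>, as \<open>laurent_coeff_bound\<close>
    requires.\<close>
  define \<xi>0 where "\<xi>0 = \<zeta> / 8"
  define \<rho> where "\<rho> = \<kappa> / (4 * N)"
  define r0 where "r0 = \<kappa> / (8 * N\<^sup>2)"
  have N: "N \<ge> 1" by (simp add: N_def)
  have xi0: "\<xi>0 > 0" using assms(2) by (simp add: \<xi>0_def)
  have rho: "\<rho> > 0" and r0: "r0 > 0" using assms(1) N by (auto simp: \<rho>_def r0_def)
  have exp_ex: "\<exists>B\<ge>1. \<exists>c :: 'n option list \<Rightarrow> int \<Rightarrow> complex.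
     (\<forall>l \<alpha>. norm (c l \<alpha>) \<le> B / \<rho> ^ length l * exp (- (2 * \<xi>0) * \<bar>real_of_int \<alpha>\<bar>)) \<and>
     (\<forall>z \<theta>. (\<forall>v. norm (z v) \<le> r0) \<and> \<bar>Im \<theta>\<bar> < \<xi>0 \<longrightarrow>
       ((\<lambda>(l, \<alpha>). c l \<alpha> * prod_list (map z l) * exp (\<i> * of_int \<alpha> * \<theta>)) has_sum f (z None) (\<chi> j. z (Some j)) \<theta>) UNIV)"
    if "analytic_coefficient \<kappa> \<zeta> f" for f :: "complex \<Rightarrow> complex ^ 'n \<Rightarrow> complex \<Rightarrow> complex"
  proof -
    have xz: "\<xi>0 < \<zeta> / 4" "- (2 * \<xi>0) = - (\<zeta> / 4)" using assms(2) by (auto simp: \<xi>0_def)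
    from analytic_coefficient_expansion[OF that assms(1,2), folded N_def, folded \<rho>_def r0_def]
    obtain B c where B: "B \<ge> 1"
      and c: "\<forall>l \<alpha>. norm (c l \<alpha>) \<le> B / \<rho> ^ length l * exp (- (\<zeta> / 4) * \<bar>real_of_int \<alpha>\<bar>)"
        "\<forall>z \<theta>. (\<forall>v. norm (z v) \<le> r0) \<and> \<bar>Im \<theta>\<bar> < \<zeta> / 4 \<longrightarrow>
       ((\<lambda>(l, \<alpha>). c l \<alpha> * prod_list (map z l) * exp (\<i> * of_int \<alpha> * \<theta>)) has_sum f (z None) (\<chi> j. z (Some j)) \<theta>) UNIV"
      by (elim exE conjE) (rule that)
    show ?thesis
      unfolding xz(2)
    proof (intro exI[of _ B] exI[of _ c] conjI B c allI impI)
      fix z :: "'n option \<Rightarrow> complex" and \<theta> :: complex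
      assume "(\<forall>v. norm (z v) \<le> r0) \<and> \<bar>Im \<theta>\<bar> < \<xi>0"
      then have "(\<forall>v. norm (z v) \<le> r0) \<and> \<bar>Im \<theta>\<bar> < \<zeta> / 4" using xz(1) by simp
      then show "((\<lambda>(l, \<alpha>). c l \<alpha> * prod_list (map z l) * exp (\<i> * of_int \<alpha> * \<theta>)) has_sum f (z None) (\<chi> j. z (Some j)) \<theta>) UNIV"
        by (rule c(2)[rule_format])
    qed
  qed
  obtain BF cF where BF: "BF \<ge> 1"
    and cF: "\<And>l \<alpha>. norm (cF l \<alpha>) \<le> BF / \<rho> ^ length l * exp (- (2 * \<xi>0) * \<bar>real_of_int \<alpha>\<bar>)"
    and eF: "\<And>z \<theta>. (\<And>v. norm (z v) \<le> r0) \<Longrightarrow> \<bar>Im \<theta>\<bar> < \<xi>0 \<Longrightarrow>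
       ((\<lambda>(l, \<alpha>). cF l \<alpha> * prod_list (map z l) * exp (\<i> * of_int \<alpha> * \<theta>)) has_sum F1 (z None) (\<chi> j. z (Some j)) \<theta>) UNIV"
    using exp_ex[OF assms(4)] by blast
  have "\<forall>j. \<exists>B c. B \<ge> 1 \<and>
     (\<forall>l \<alpha>. norm (c l \<alpha>) \<le> B / \<rho> ^ length l * exp (- (2 * \<xi>0) * \<bar>real_of_int \<alpha>\<bar>)) \<and>
     (\<forall>z \<theta>. (\<forall>v. norm (z v) \<le> r0) \<and> \<bar>Im \<theta>\<bar> < \<xi>0 \<longrightarrow>
       ((\<lambda>(l, \<alpha>). c l \<alpha> * prod_list (map z l) * exp (\<i> * of_int \<alpha> * \<theta>)) has_sum G1 (z None) (\<chi> j. z (Some j)) \<theta> $ j) UNIV)"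
    using exp_ex[OF assms(5)] by blast
  from choice[OF this] obtain BG where "\<forall>j. \<exists>c. BG j \<ge> 1 \<and>
     (\<forall>l \<alpha>. norm (c l \<alpha>) \<le> BG j / \<rho> ^ length l * exp (- (2 * \<xi>0) * \<bar>real_of_int \<alpha>\<bar>)) \<and>
     (\<forall>z \<theta>. (\<forall>v. norm (z v) \<le> r0) \<and> \<bar>Im \<theta>\<bar> < \<xi>0 \<longrightarrow>
       ((\<lambda>(l, \<alpha>). c l \<alpha> * prod_list (map z l) * exp (\<i> * of_int \<alpha> * \<theta>)) has_sum G1 (z None) (\<chi> j. z (Some j)) \<theta> $ j) UNIV)" ..
  from choice[OF this] obtain cG where G: "\<forall>j. BG j \<ge> 1 \<and>
     (\<forall>l \<alpha>. norm (cG j l \<alpha>) \<le> BG j / \<rho> ^ length l * exp (- (2 * \<xi>0) * \<bar>real_of_int \<alpha>\<bar>)) \<and>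
     (\<forall>z \<theta>. (\<forall>v. norm (z v) \<le> r0) \<and> \<bar>Im \<theta>\<bar> < \<xi>0 \<longrightarrow>
       ((\<lambda>(l, \<alpha>). cG j l \<alpha> * prod_list (map z l) * exp (\<i> * of_int \<alpha> * \<theta>)) has_sum G1 (z None) (\<chi> j. z (Some j)) \<theta> $ j) UNIV)" ..
  have eG: "((\<lambda>(l, \<alpha>). cG j l \<alpha> * prod_list (map z l) * exp (\<i> * of_int \<alpha> * \<theta>)) has_sum G1 (z None) (\<chi> j. z (Some j)) \<theta> $ j) UNIV"
    if "\<And>v. norm (z v) \<le> r0" "\<bar>Im \<theta>\<bar> < \<xi>0" for j z \<theta>
    using G that by blast
  define B1 where "B1 = BF + (\<Sum>j\<in>UNIV. BG j)"
  have BG: "BG j \<ge> 1" for j using G by blast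
  have B1: "BF \<le> B1" "BG j \<le> B1" "B1 \<ge> 1" for j
  proof -
    have "0 \<le> (\<Sum>j\<in>UNIV. BG j)" using BG by (intro sum_nonneg) (meson order_trans zero_le_one)
    then show "BF \<le> B1" "B1 \<ge> 1" using BF by (auto simp: B1_def)
    have "BG j \<le> (\<Sum>j\<in>UNIV. BG j)" by (rule member_le_sum) (use BG in \<open>auto intro: order_trans[OF zero_le_one]\<close>)
    then show "BG j \<le> B1" using BF by (simp add: B1_def)
  qed
  have cF1: "norm (cF l \<alpha>) \<le> B1 / \<rho> ^ length l * exp (- (2 * \<xi>0) * \<bar>real_of_int \<alpha>\<bar>)" for l \<alpha>
    by (rule order_trans[OF cF]) (use B1(1) rho in \<open>auto intro!: mult_right_mono divide_right_mono\<close>)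
  have cG1: "norm (cG j l \<alpha>) \<le> B1 / \<rho> ^ length l * exp (- (2 * \<xi>0) * \<bar>real_of_int \<alpha>\<bar>)" for j l \<alpha>
  proof -
    have "norm (cG j l \<alpha>) \<le> BG j / \<rho> ^ length l * exp (- (2 * \<xi>0) * \<bar>real_of_int \<alpha>\<bar>)" using G by blast
    also have "\<dots> \<le> B1 / \<rho> ^ length l * exp (- (2 * \<xi>0) * \<bar>real_of_int \<alpha>\<bar>)"
      using B1(2)[of j] rho by (intro mult_right_mono divide_right_mono) auto
    finally show ?thesis .
  qed
  have coeff_summable: "(\<lambda>\<alpha>. c \<alpha> * exp (\<i> * of_int \<alpha> * \<theta>)) summable_on UNIV"
    if c: "\<And>\<alpha>. norm (c \<alpha>) \<le> b * exp (- (2 * \<xi>0) * \<bar>real_of_int \<alpha>\<bar>)" and b: "b \<ge> 0" and t: "\<bar>Im \<theta>\<bar> < \<xi>0" for c b \<theta>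
  proof (rule norm_summable_on[OF summable_on_cmult_right[OF int_symmetric_exp_summable[OF xi0]]])
    fix \<alpha> :: int
    have "norm (exp (\<i> * of_int \<alpha> * \<theta>)) \<le> exp (\<bar>Im \<theta>\<bar> * \<bar>real_of_int \<alpha>\<bar>)" by (simp add: abs_mult[symmetric] mult.commute)
    also have "\<dots> \<le> exp (\<xi>0 * \<bar>real_of_int \<alpha>\<bar>)" using t by (simp add: mult_right_mono)
    finally have "norm (c \<alpha> * exp (\<i> * of_int \<alpha> * \<theta>)) \<le> (b * exp (- (2 * \<xi>0) * \<bar>real_of_int \<alpha>\<bar>)) * exp (\<xi>0 * \<bar>real_of_int \<alpha>\<bar>)"
      unfolding norm_mult using c b by (intro mult_mono) auto
    also have "\<dots> = b * exp (- \<xi>0 * \<bar>real_of_int \<alpha>\<bar>)" by (simp add: exp_add[symmetric] algebra_simps)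
    finally show "norm (c \<alpha> * exp (\<i> * of_int \<alpha> * \<theta>)) \<le> b * exp (- \<xi>0 * \<bar>real_of_int \<alpha>\<bar>)" .
  qed
  have bl: "B1 / \<rho> ^ length l \<ge> 0" for l :: "'n option list" using B1(3) rho by simp
  obtain E where E: "E \<ge> 1" "\<And>n. (1 + real n)\<^sup>2 * exp (- \<xi>0) ^ n \<le> E" using quadratic_exp_bounded[OF xi0] by blast
  define B where "B = B1 * E"
  have B: "B \<ge> 1" using mult_mono[of 1 B1 1 E] B1(3) E(1) by (simp add: B_def)
  \<comment> \<open>Halfway between \<open>chi / 2\<close> and \<open>pi / 2\<close>; then
    \<open>\<epsilon>'\<close> lies halfway between \<open>chi / 2\<close> and
    \<open>\<epsilon>\<close>. Directions up to \<open>\<epsilon>'\<close> reach the whole sector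
    with the margin \<open>c0 > 0\<close> and stay strictly inside the opening
    \<open>\<epsilon>\<close>.\<close>
  define \<epsilon> where "\<epsilon> = (chi + pi) / 4"
  define \<epsilon>' where "\<epsilon>' = (chi / 2 + \<epsilon>) / 2"
  have eps: "0 < \<epsilon>" "\<epsilon> < pi / 2" "chi / 2 < \<epsilon>'" "\<epsilon>' < \<epsilon>" using assms(6,7) by (auto simp: \<epsilon>_def \<epsilon>'_def field_simps)
  \<comment> \<open>With this slope the wedges have half-opening exactly
    \<open>\<epsilon>\<close>.\<close>
  define K where "K = tan \<epsilon>"
  have K: "K > 0" using tan_gt_zero[of \<epsilon>] eps by (simp add: K_def)
  define k0 where "k0 = 2 * (1 + K)"
  define Lam where "Lam = (\<Sum>j\<in>UNIV. lam $ j)"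
  have lam_le: "lam $ j \<le> Lam" for j unfolding Lam_def by (rule member_le_sum) (use assms(3) in \<open>auto intro: less_imp_le\<close>)
  have Lam: "Lam \<ge> 0" unfolding Lam_def using assms(3) by (intro sum_nonneg) (simp add: less_imp_le)
  define D where "D = k0 * 512 * (1 + Lam)"
  have D: "D \<ge> 1"
  proof -
    have "1 * 1 \<le> (k0 * 512) * (1 + Lam)" using K Lam by (intro mult_mono) (auto simp: k0_def)
    then show ?thesis by (simp add: D_def)
  qed
  define H where "H = infsum hw3 UNIV"
  have H: "H \<ge> 0" unfolding H_def by (rule infsum_nonneg) (simp add: less_imp_le[OF hw3_pos])
  \<comment> \<open>The size of \<open>\<tau>\<close> is fixed only now. The last condition keeps
    the solution within \<open>r0\<close>, where the expansions of the coefficients over words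
    converge.\<close>
  obtain e where e: "e > 0" "N * (512 * (256 * B * e) / \<rho>) \<le> 1 / 2"
    "128 * B * (e + 512 * (D * e * (256 * B * e)) * e) + norm F0 * (D * e * (256 * B * e)) \<le> 256 * B * e"
    "D * e \<le> 1" "256 * B * e * H \<le> r0"
    using small_parameter[OF B D norm_ge_zero[of F0] N rho H r0] by blast
  define \<tau> where "\<tau> = 4 / e"
  define A where "A = 256 * B * e"
  have tau: "\<tau> > 0" "4 / \<tau> = e" using e(1) by (auto simp: \<tau>_def)
  have A: "A > 0" using e(1) B by (simp add: A_def)
  have laurent: "norm (laurent_coeff c p q) \<le> B / \<rho> ^ length l * (exp (- \<xi>0) ^ p * hw p) * (exp (- \<xi>0) ^ q * hw q)"
    if "\<And>\<alpha>. norm (c \<alpha>) \<le> B1 / \<rho> ^ length l * exp (- (2 * \<xi>0) * \<bar>real_of_int \<alpha>\<bar>)" for c p q and l :: "'n option list"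
    using laurent_coeff_bound[OF that E(2) bl, of p q] by (simp add: B_def)
  have sys: "borel_system (Om K) \<tau> (exp (- \<xi>0)) k0 (($) lam) F0 cG cF A B \<rho> Lam"
  proof (unfold_locales)
    show "star0 (Om K)" by (rule star0_Om[OF K])
    show "real (card (UNIV :: 'n option set)) * (512 * A / \<rho>) \<le> 1 / 2"
      using e(2) by (simp add: card_UNIV_option A_def N_def)
    show "128 * B * (4 / \<tau> + 512 * (k0 * 512 * (1 + Lam) * (4 / \<tau>) * A) * (4 / \<tau>)) + norm F0 * (k0 * 512 * (1 + Lam) * (4 / \<tau>) * A) \<le> A"
      using e(3) unfolding tau(2) A_def D_def by (simp only: mult.assoc)
    show "k0 * 512 * (1 + Lam) * (4 / \<tau>) \<le> 1" using e(4) unfolding tau(2) D_def .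
    show "4 / \<tau> \<le> A" unfolding tau(2) A_def using mult_right_mono[of 1 "256 * B" e] B e(1) by simp
    show "norm (laurent_coeff (cG j l) p q) \<le> B / \<rho> ^ length l * (exp (- \<xi>0) ^ p * hw p) * (exp (- \<xi>0) ^ q * hw q)" for j l p q
      by (rule laurent[OF cG1])
    show "norm (laurent_coeff (cF l) p q) \<le> B / \<rho> ^ length l * (exp (- \<xi>0) ^ p * hw p) * (exp (- \<xi>0) ^ q * hw q)" for l p q
      by (rule laurent[OF cF1])
    show "w + \<i> * of_int \<alpha> \<noteq> 0" "norm (w / (w + \<i> * of_int \<alpha>)) \<le> k0" "norm (1 / (w + \<i> * of_int \<alpha>)) \<le> k0"
      if "w \<in> Om K" "\<alpha> \<noteq> 0" for w \<alpha>
      using Om_resonance[OF K that] by (simp_all add: k0_def)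
  qed (use tau A B rho K assms(3) lam_le in \<open>auto simp: k0_def\<close>)
  interpret bs: borel_system "Om K" \<tau> "exp (- \<xi>0)" k0 "($) lam" F0 cG cF A B \<rho> Lam by (rule sys)
  obtain Q Y where QY: "\<And>j i. Q j i = bs.gQ Q Y j i" "\<And>j i. Y j i = bs.gY (Q j i) Q Y j i"
    "\<And>M j. bs.nrm M A (Q j)" "\<And>M j. bs.nrm M A (Y j)"
    using bs.system_solution by blast
  interpret sol: borel_solution "Om K" \<tau> "exp (- \<xi>0)" k0 "($) lam" F0 cG cF A B \<rho> Lam Q Y
    by unfold_locales (use xi0 QY in auto)
  define c0 where "c0 = sin (\<epsilon>' - chi / 2)"
  have c0: "c0 > 0" unfolding c0_def by (rule sin_gt_zero) (use eps assms(6) in auto)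
  \<comment> \<open>The first bound gives \<open>Re (e / x) > 2 \<tau>\<close> for a suitable
    direction \<open>e\<close>; the second keeps \<open>x\<close> in the region of convergence of
    the word expansions.\<close>
  define \<delta>0 where "\<delta>0 = min (c0 / (2 * \<tau>)) r0"
  have d0: "\<delta>0 > 0" using c0 tau r0 by (simp add: \<delta>0_def)
  have small_x: "norm x * (2 * \<tau>) < c0" "norm x \<le> r0" if "norm x < \<delta>0" for x :: complex
    using that tau by (auto simp: \<delta>0_def pos_less_divide_eq)
  have e'2: "\<epsilon>' < pi / 2" using eps by simp
  have minus_dir: "cis \<psi> \<in> wedge K (- 1)" if "\<bar>\<psi> - pi\<bar> < \<epsilon>" for \<psi>
    using cis_wedge[OF that eps(2)] by (simp add: wedge_def K_def cos_diff sin_diff)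
  \<comment> \<open>Both signs are served by the same \<open>Q\<close> and \<open>Y\<close> on
    \<open>Om K\<close>; only the cone, the sector and the central direction change.\<close>
  interpret P: sum_region "Om K" \<tau> "exp (- \<xi>0)" k0 "($) lam" F0 cG cF A B \<rho> Lam Q Y
    "wedge K 1" "sector_plus \<delta>0 chi" 0 \<epsilon> c0 \<xi>0
  proof (unfold_locales)
    show "ray_sector 0 \<epsilon> \<subseteq> wedge K 1"
      by (rule ray_sector_subset) (use cis_wedge[OF _ eps(2)] wedge_cone in \<open>auto simp: K_def\<close>)
    show "\<exists>\<psi>. \<bar>\<psi> - 0\<bar> < \<epsilon> \<and> c0 / norm x \<le> Re (cis \<psi> / x)" if "x \<in> sector_plus \<delta>0 chi" for x
      using sector_direction[OF assms(6) eps(3) e'2 that] eps(4) unfolding c0_def diff_zero by (meson le_less_trans)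
  qed (use convex_wedge wedge_subset_Om[OF K, of 1] wedge_cone eps(1) cis_wedge[OF _ eps(2)] open_sector_plus[OF assms(7)] small_x c0 xi0
      in \<open>auto simp: K_def sector_plus_def\<close>)
  interpret M: sum_region "Om K" \<tau> "exp (- \<xi>0)" k0 "($) lam" F0 cG cF A B \<rho> Lam Q Y
    "wedge K (- 1)" "sector_minus \<delta>0 chi" pi \<epsilon> c0 \<xi>0
  proof (unfold_locales)
    show "ray_sector pi \<epsilon> \<subseteq> wedge K (- 1)"
      by (rule ray_sector_subset[OF minus_dir wedge_cone])
    show "open (sector_minus \<delta>0 chi)"
      unfolding sector_minus_eq by (rule open_negations[OF open_sector_plus[OF assms(7)]])
    show "\<exists>\<psi>. \<bar>\<psi> - pi\<bar> < \<epsilon> \<and> c0 / norm x \<le> Re (cis \<psi> / x)" if "x \<in> sector_minus \<delta>0 chi" for x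
    proof -
      have "- x \<in> sector_plus \<delta>0 chi" using that by (simp add: sector_minus_def sector_plus_def)
      from sector_direction[OF assms(6) eps(3) e'2 this] obtain \<psi>
        where p: "\<bar>\<psi>\<bar> \<le> \<epsilon>'" "c0 / norm x \<le> Re (cis \<psi> / (- x))" unfolding c0_def by auto
      \<comment> \<open>The negative sector is treated as the reflection of the positive one:
        turning the direction by \<open>pi\<close> undoes the change of sign of
        \<open>x\<close>.\<close>
      have "cis (\<psi> + pi) / x = cis \<psi> / (- x)" by (simp add: cis_mult[symmetric])
      then show ?thesis using p eps(4) by (intro exI[of _ "\<psi> + pi"]) simp
    qed
  qed (use convex_wedge wedge_subset_Om[OF K, of "- 1"] wedge_cone eps(1) minus_dir small_x c0 xi0
      in \<open>auto simp: sector_minus_def\<close>)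
  have AH: "A * sol.H3 \<le> r0" using e(5) by (simp add: sol.H3_def H_def A_def)
  have r0k: "real (CARD('n) + 1) * r0 < \<kappa>"
  proof -
    have "N * r0 = \<kappa> / (8 * N)" using N by (simp add: r0_def power2_eq_square)
    also have "\<dots> < \<kappa>" using N assms(1) by (simp add: pos_divide_less_eq)
    finally show ?thesis by (simp add: N_def)
  qed
  have xz: "\<xi>0 \<le> \<zeta>" using assms(2) by (simp add: \<xi>0_def)
  \<comment> \<open>For each mode both solutions are Laplace transforms of the one function
    \<open>sol.hat (Y j) \<alpha>\<close>, so its expansion at \<open>0\<close> yields a single
    series for the two directions.\<close>
  have one_sums: "\<exists>W :: complex fps ^ 'n. \<forall>j. gevrey1 (W $ j) \<and>
      is_one_sum (W $ j) 0 R1 (\<lambda>x. fourier_coeff P.ysol \<alpha> x $ j) \<and> is_one_sum (W $ j) pi R2 (\<lambda>x. fourier_coeff M.ysol \<alpha> x $ j)"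
    if "R1 \<subseteq> sector_plus \<delta>0 chi" "R2 \<subseteq> sector_minus \<delta>0 chi" for \<alpha> R1 R2
  proof -
    have "\<exists>V. gevrey1 V \<and> borel_transform V = fps_expansion (sol.hat (Y j) \<alpha>) 0" for j
    proof (rule gevrey_of_borel)
      show "open (Om K)" by (rule star0_open[OF star0_Om[OF K]])
      show "sol.hat (Y j) \<alpha> holomorphic_on Om K" by (rule sol.hat_holomorphic[OF sol.good_Y sol.good_nonneg(1)])
    qed (auto simp: Om_def)
    then obtain V where V: "\<And>j. gevrey1 (V j)" "\<And>j. borel_transform (V j) = fps_expansion (sol.hat (Y j) \<alpha>) 0"
      by metis
    show ?thesis
      by (rule exI[of _ "\<chi> j. V j"]) (use V(1) P.ysol_one_sum[OF V(2) that(1)] M.ysol_one_sum[OF V(2) that(2)] in auto)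
  qed
  show ?thesis
  proof (rule exI[of _ \<delta>0], rule conjI[OF d0], rule exI[of _ \<xi>0], rule conjI[OF xi0], intro allI impI)
    fix \<delta> \<xi> :: real assume dx: "0 < \<delta> \<and> \<delta> < \<delta>0 \<and> 0 < \<xi> \<and> \<xi> < \<xi>0"
    then have sub: "sector_plus \<delta> chi \<subseteq> sector_plus \<delta>0 chi" "sector_minus \<delta> chi \<subseteq> sector_minus \<delta>0 chi"
      and xi: "\<xi> < \<xi>0" "\<xi> \<le> \<xi>0" by (auto simp: sector_plus_def sector_minus_def)
    have st: "\<bar>Im \<theta>\<bar> < \<xi>0" if "\<theta> \<in> strip \<xi>" for \<theta> using that xi by (simp add: strip_def)
    note sums = coeff_summable[OF cF1 bl] coeff_summable[OF cG1 bl]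
    have aP: "analytic_solution \<kappa> \<zeta> F0 F1 lam G1 (sector_plus \<delta> chi) \<xi> P.ysol"
      by (rule P.ysol_analytic_solution[OF refl eF eG sums AH _ r0k xi(1) xz sub(1)])
        (use small_x(2) in \<open>auto simp: sector_plus_def\<close>)
    have aM: "analytic_solution \<kappa> \<zeta> F0 F1 lam G1 (sector_minus \<delta> chi) \<xi> M.ysol"
      by (rule M.ysol_analytic_solution[OF refl eF eG sums AH _ r0k xi(1) xz sub(2)])
        (use small_x(2) in \<open>auto simp: sector_minus_def\<close>)
    have fP: "\<forall>x\<in>sector_plus \<delta> chi. \<forall>\<theta>\<in>strip \<xi>.
        ((\<lambda>\<alpha>. exp (\<i> * of_int \<alpha> * \<theta>) *s fourier_coeff P.ysol \<alpha> x) has_sum P.ysol x \<theta>) UNIV"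
      using P.ysol_fourier_has_sum[OF _ st] sub(1) by blast
    have fM: "\<forall>x\<in>sector_minus \<delta> chi. \<forall>\<theta>\<in>strip \<xi>.
        ((\<lambda>\<alpha>. exp (\<i> * of_int \<alpha> * \<theta>) *s fourier_coeff M.ysol \<alpha> x) has_sum M.ysol x \<theta>) UNIV"
      using M.ysol_fourier_has_sum[OF _ st] sub(2) by blast
    have bP: "\<exists>C. \<forall>\<alpha>. \<forall>x\<in>sector_plus \<delta> chi. norm (fourier_coeff P.ysol \<alpha> x) \<le> C * (norm x * exp (- \<bar>real_of_int \<alpha>\<bar> * \<xi>))"
      using P.ysol_fourier_bound[OF _ xi(2)] sub(1) by blast
    have bM: "\<exists>C. \<forall>\<alpha>. \<forall>x\<in>sector_minus \<delta> chi. norm (fourier_coeff M.ysol \<alpha> x) \<le> C * (norm x * exp (- \<bar>real_of_int \<alpha>\<bar> * \<xi>))"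
      using M.ysol_fourier_bound[OF _ xi(2)] sub(2) by blast
    show "\<exists>yp ym :: complex \<Rightarrow> complex \<Rightarrow> complex ^ 'n.
       analytic_solution \<kappa> \<zeta> F0 F1 lam G1 (sector_plus \<delta> chi) \<xi> yp \<and>
       analytic_solution \<kappa> \<zeta> F0 F1 lam G1 (sector_minus \<delta> chi) \<xi> ym \<and>
       (\<forall>x\<in>sector_plus \<delta> chi. \<forall>\<theta>\<in>strip \<xi>.
          ((\<lambda>\<alpha>. exp (\<i> * of_int \<alpha> * \<theta>) *s fourier_coeff yp \<alpha> x) has_sum yp x \<theta>) UNIV) \<and>
       (\<forall>x\<in>sector_minus \<delta> chi. \<forall>\<theta>\<in>strip \<xi>.
          ((\<lambda>\<alpha>. exp (\<i> * of_int \<alpha> * \<theta>) *s fourier_coeff ym \<alpha> x) has_sum ym x \<theta>) UNIV) \<and>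
       (\<exists>C. \<forall>\<alpha>. \<forall>x\<in>sector_plus \<delta> chi.
          norm (fourier_coeff yp \<alpha> x) \<le> C * (norm x * exp (- \<bar>real_of_int \<alpha>\<bar> * \<xi>))) \<and>
       (\<exists>C. \<forall>\<alpha>. \<forall>x\<in>sector_minus \<delta> chi.
          norm (fourier_coeff ym \<alpha> x) \<le> C * (norm x * exp (- \<bar>real_of_int \<alpha>\<bar> * \<xi>))) \<and>
       (\<forall>\<alpha>. \<exists>W :: complex fps ^ 'n. \<forall>j.
          gevrey1 (W $ j) \<and>
          is_one_sum (W $ j) 0 (sector_plus \<delta> chi) (\<lambda>x. fourier_coeff yp \<alpha> x $ j) \<and>
          is_one_sum (W $ j) pi (sector_minus \<delta> chi) (\<lambda>x. fourier_coeff ym \<alpha> x $ j))"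
      by (intro exI[of _ P.ysol] exI[of _ M.ysol] conjI allI aP aM fP fM bP bM one_sums[OF sub])
  qed
qed

end
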